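(* Let $0<\Delta<1$. There exists a constant $C=C(\Delta)$ such that for all sufficiently small $h>0$, $$2\pi\Delta^2h^2\left(|\log h|-\tfrac32\log|\log h|-C\right)\;\leq\; \min_{y\in W^{2,2}(B_1;\mathbb{R}^3)}I_{h,\Delta}(y)\;\leq\; 2\pi\Delta^2h^2\left(|\log h|+C\right).$$
   Context: $B_1:=\{x\in\mathbb{R}^2:|x|<1\}$. For $x\in\mathbb{R}^2\setminus\{0\}$ write $\hat x=x/|x|$ and $\hat x^\bot=(-x_2,x_1)/|x|$. The reference metric is $g_\Delta(x)=\mathrm{Id}_{2\times2}-\Delta^2\,\hat x^\bot\otimes\hat x^\bot$ for $x\in B_1\setminus\{0\}$ (it equals $Dy^\Delta(x)^TDy^\Delta(x)$ for the cone $y^\Delta(x)=\sqrt{1-\Delta^2}\,x+\Delta|x|e_3$, where $x\in\mathbb{R}^2$ is identified with $(x,0)\in\mathbb{R}^3$). The induced metric of $y\in W^{2,2}(B_1;\mathbb{R}^3)$ is $g_y=Dy^TDy$. The energy $I_{h,\Delta}:W^{2,2}(B_1;\mathbb{R}^3)\to\mathbb{R}$ is $$I_{h,\Delta}(y)=\int_{B_1}\left(|g_y-g_\Delta|^2+h^2|D^2y|^2\right)\,d\mathcal{L}^2,$$ where $\mathcal{L}^2$ is Lebesgue measure and $|\cdot|$ is the Euclidean (Frobenius) norm of matrices and tensors. *)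

theory Defs
  imports "HOL-Analysis.Analysis"
begin

section \<open>Test functions\<close>

definition partial_deriv ::
    "'n::finite \<Rightarrow> (real^'n \<Rightarrow> real) \<Rightarrow> real^'n \<Rightarrow> real" where
  "partial_deriv i \<phi> x = frechet_derivative \<phi> (at x) (axis i 1)"

primrec Ck :: "nat \<Rightarrow> (real^'n::finite \<Rightarrow> real) \<Rightarrow> bool" where
  "Ck 0 \<phi> \<longleftrightarrow> continuous_on UNIV \<phi>"
| "Ck (Suc k) \<phi> \<longleftrightarrow> (\<forall>x. \<phi> differentiable (at x)) \<and> (\<forall>i. Ck k (partial_deriv i \<phi>))"

definition test_function :: "(real^'n::finite) set \<Rightarrow> (real^'n \<Rightarrow> real) \<Rightarrow> bool" where
  "test_function U \<phi> \<longleftrightarrow> (\<forall>k. Ck k \<phi>) \<and>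
     compact (closure {x. \<phi> x \<noteq> 0}) \<and> closure {x. \<phi> x \<noteq> 0} \<subseteq> U"

section \<open>Weak derivatives and the Sobolev space\<close>

text \<open>Elements of Lebesgue and Sobolev spaces on \<open>U\<close> are represented by total functions; all
  notions below depend only on the values on \<open>U\<close>, up to null sets.\<close>

definition locally_integrable_on ::
    "(real^'n::finite) set \<Rightarrow> (real^'n \<Rightarrow> real^'m::finite) \<Rightarrow> bool" where
  "locally_integrable_on U f \<longleftrightarrow> (\<forall>K. compact K \<and> K \<subseteq> U \<longrightarrow> f absolutely_integrable_on K)"

definition L2_on :: "(real^'n::finite) set \<Rightarrow> (real^'n \<Rightarrow> real^'m::finite) \<Rightarrow> bool" where
  "L2_on U f \<longleftrightarrow> f \<in> borel_measurable (lebesgue_on U) \<and>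
     integrable (lebesgue_on U) (\<lambda>x. (norm (f x))\<^sup>2)"

definition has_weak_partial ::
    "(real^'n::finite) set \<Rightarrow> 'n \<Rightarrow> (real^'n \<Rightarrow> real^'m::finite) \<Rightarrow> (real^'n \<Rightarrow> real^'m) \<Rightarrow> bool" where
  "has_weak_partial U i f g \<longleftrightarrow> locally_integrable_on U f \<and> locally_integrable_on U g \<and>
     (\<forall>\<phi>. test_function U \<phi> \<longrightarrow>
        (LINT x|lebesgue_on U. partial_deriv i \<phi> x *\<^sub>R f x) =
          - (LINT x|lebesgue_on U. \<phi> x *\<^sub>R g x))"

definition W22 :: "(real^'n::finite) set \<Rightarrow> (real^'n \<Rightarrow> real^'m::finite) set" where
  "W22 U = {y. L2_on U y \<and>
     (\<forall>i. \<exists>v. has_weak_partial U i y v \<and> L2_on U v \<and>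
       (\<forall>j. \<exists>w. has_weak_partial U j v w \<and> L2_on U w))}"

text \<open>A weak partial derivative on an open set is unique up to a null set, so the choice of
  representative below does not affect integrals.\<close>

definition weak_partial ::
    "(real^'n::finite) set \<Rightarrow> 'n \<Rightarrow> (real^'n \<Rightarrow> real^'m::finite) \<Rightarrow> (real^'n \<Rightarrow> real^'m)" where
  "weak_partial U i f = (SOME g. has_weak_partial U i f g)"

definition weak_D ::
    "(real^'n::finite) set \<Rightarrow> (real^'n \<Rightarrow> real^'m::finite) \<Rightarrow> real^'n \<Rightarrow> real^'n^'m" where
  "weak_D U y x = (\<chi> k i. weak_partial U i y x $ k)"

definition weak_D2 ::
    "(real^'n::finite) set \<Rightarrow> (real^'n \<Rightarrow> real^'m::finite) \<Rightarrow> real^'n \<Rightarrow> real^'n^'n^'m" where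
  "weak_D2 U y x = (\<chi> k i j. weak_partial U j (weak_partial U i y) x $ k)"

section \<open>Metrics and energy\<close>

definition induced_metric ::
    "(real^'n::finite) set \<Rightarrow> (real^'n \<Rightarrow> real^'m::finite) \<Rightarrow> real^'n \<Rightarrow> real^'n^'n" where
  "induced_metric U y x = transpose (weak_D U y x) ** weak_D U y x"

definition outer :: "real^'m::finite \<Rightarrow> real^'n::finite \<Rightarrow> real^'n^'m" where
  "outer u v = (\<chi> i j. u $ i * v $ j)"

definition perp_hat :: "real^2 \<Rightarrow> real^2" where
  "perp_hat x = (1 / norm x) *\<^sub>R vector [- x $ 2, x $ 1]"

text \<open>Only meaningful for \<open>x \<noteq> 0\<close>; the value at the origin is irrelevant for the energy.\<close>

definition ref_metric :: "real \<Rightarrow> real^2 \<Rightarrow> real^2^2" where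
  "ref_metric \<Delta> x = mat 1 - \<Delta>\<^sup>2 *\<^sub>R outer (perp_hat x) (perp_hat x)"

abbreviation B1 :: "(real^2) set" where
  "B1 \<equiv> ball 0 1"

text \<open>The library norm on iterated vector types is the Frobenius norm. The integrand is
  nonnegative, so the integral is taken in \<^typ>\<open>ennreal\<close>; it is finite on \<open>W22 B1\<close> because
  first weak derivatives of such maps lie in \<open>L\<^sup>4\<close> by the Sobolev embedding.\<close>

definition energy :: "real \<Rightarrow> real \<Rightarrow> (real^2 \<Rightarrow> real^3) \<Rightarrow> ennreal" where
  "energy h \<Delta> y = (\<integral>\<^sup>+ x. ennreal ((norm (induced_metric B1 y x - ref_metric \<Delta> x))\<^sup>2
      + h\<^sup>2 * (norm (weak_D2 B1 y x))\<^sup>2) \<partial>lebesgue_on B1)"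

end

theory Submission
  imports Defs "HOL-Real_Asymp.Real_Asymp" "HOL-Complex_Analysis.Great_Picard"
begin

text \<open>
  The energy balances a metric term, which asks \<open>y\<close> to be the cone, against the bending term
  \<open>h\<^sup>2 |D\<^sup>2 y|\<^sup>2\<close>, which is infinite on the cone because \<open>|D\<^sup>2 y|\<^sup>2 = \<Delta>\<^sup>2 / |x|\<^sup>2\<close> there. Cutting this
  singularity off at \<open>|x| = h\<close> gives \<open>2 \<pi> \<Delta>\<^sup>2 h\<^sup>2 |ln h|\<close>, and the theorem says that nothing cheaper
  exists up to terms of lower order.

  Upper bound. In the vertical component \<open>\<Delta> |x|\<close> of the cone, \<open>|x|\<close> is replaced by \<open>sqrt (|x|\<^sup>2 + h\<^sup>2)\<close>.
  Both energy densities are then explicit rational functions of \<open>|x|\<^sup>2\<close>, and \<open>|x|\<^sup>2\<close> maps Lebesgue measure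
  on the disc to \<open>\<pi>\<close> times Lebesgue measure on \<open>[0,1]\<close> (\<open>radial_distr\<close>), so \<open>cone_energy\<close> reduces to
  elementary integrals.

  Lower bound. The curvature of a metric is seen by a functional that is linear in the metric: for
  smooth \<open>y\<close> and compactly supported \<open>\<psi>\<close>,
  \<open>\<integral> \<psi>_12 g_12 - \<psi>_22 g_11 / 2 - \<psi>_11 g_22 / 2 = \<integral> \<psi> (y_11 \<bullet> y_22 - |y_12|\<^sup>2)\<close> for \<open>g = g_y\<close>.
  The left-hand side makes sense for every metric, and it sees the curvature which \<open>g_\<Delta>\<close>
  concentrates at the apex. Take \<open>\<psi>\<close> radial with \<open>\<nabla>\<psi> = - m(|x|\<^sup>2) x\<close>, where \<open>m(s)\<close> is \<open>1 / (s + h\<^sup>2)\<close> times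
  a cutoff, so that \<open>\<psi>\<close> behaves like \<open>- ln |x|\<close> outside the disc of radius \<open>h\<close>. Three estimates are compared.

  \<^item> At \<open>g_\<Delta>\<close> the functional is at least \<open>\<pi> \<Delta>\<^sup>2 (|ln h| - 4)\<close>
    (\<open>pairing_ref_metric_integral\<close>).

  \<^item> At \<open>g_y\<close> it is at most half of \<open>\<integral> |D\<^sup>2 y|\<^sup>2\<close> (\<open>weak_estimate\<close>). One integration by parts leaves
    \<open>- \<integral> m y_2 \<bullet> \<partial>_\<theta> y_1\<close>. On each circle around the origin the isoperimetric inequality
    (\<open>isoperimetric_vector\<close>, which rests on \<open>wirtinger\<close>) bounds this by half of the squared angular derivatives of \<open>y_1\<close>
    and \<open>y_2\<close>, which carry a factor \<open>|x|\<^sup>2\<close>, and \<open>m(|x|\<^sup>2) |x|\<^sup>2 \<le> 1\<close>.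

  \<^item> The two values differ by at most \<open>c / h\<close> times the \<open>L\<^sup>2\<close> norm of \<open>g_y - g_\<Delta>\<close>, because \<open>D\<^sup>2 \<psi>\<close> has \<open>L\<^sup>2\<close> norm of
    order \<open>1 / h\<close> (\<open>dual_weight_L2\<close>).

  Young's inequality absorbs the last contribution into the metric term and costs a multiple of \<open>h\<^sup>2\<close>
  (\<open>energy_lower_bound\<close>). The result implies the stated lower bound, since \<open>ln |ln h| \<ge> 0\<close> for \<open>h < 1 / e\<close>.

  Existence of a minimiser (\<open>minimizer_exists\<close>) is the direct method. A minimising sequence has bounded second derivatives, and bounded
  first derivatives because \<open>|y_i|\<^sup>2\<close> is a diagonal entry of \<open>g_y\<close>. By Rellich compactness (\<open>rellich\<close>, from the
  Poincare inequality on small convex cells) the gradients converge almost everywhere along a subsequence,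
  and Fatou's lemma handles the metric term. The bending term is a squared Hilbert norm, for which
  iterated midpoints of tails of the sequence converge strongly by the parallelogram law
  (\<open>almost_minimizers_Cauchy\<close>). These midpoints keep the pointwise limit of the
  gradients.

  Smooth approximation enters through mollification. Elements of \<open>W22 B1\<close> are first replaced by
  triples \<open>(Y, V, W)\<close> of Borel fields vanishing outside the disc, a map with its first and second weak
  derivatives (\<open>weak_jet\<close>), on which the energy has the form \<open>field_energy\<close>.
\<close>

section \<open>Smooth test functions on the plane\<close>

text \<open>The one-dimensional building blocks of test functions: on the line, being \<open>k\<close> times continuously differentiable
  is closed under products, affine substitutions and composition with \<open>exp\<close> by short inductions, and products \<open>a(z_1) b(z_2)\<close> then give
  functions in the sense of \<open>Ck\<close> on the plane.\<close>
primrec Ck_real :: "nat \<Rightarrow> (real \<Rightarrow> real) \<Rightarrow> bool" where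
  "Ck_real 0 f \<longleftrightarrow> continuous_on UNIV f"
| "Ck_real (Suc k) f \<longleftrightarrow> (\<exists>f'. (\<forall>x. (f has_real_derivative f' x) (at x)) \<and> Ck_real k f')"

lemma Ck_real_continuous: "Ck_real k f \<Longrightarrow> continuous_on UNIV f"
  by (cases k) (auto intro!: continuous_at_imp_continuous_on intro: DERIV_isCont)

lemma Ck_real_Suc_imp: "Ck_real (Suc k) f \<Longrightarrow> Ck_real k f"
proof (induction k arbitrary: f)
  case 0 then show ?case by (metis Ck_real_continuous Ck_real.simps(1))
next
  case (Suc k) then show ?case by (metis Ck_real.simps(2))
qed

lemma Ck_real_const: "Ck_real k (\<lambda>_. c)"
proof (induction k arbitrary: c)
  case (Suc k)
  have "\<forall>x. ((\<lambda>_. c) has_real_derivative (\<lambda>_. 0) x) (at x)" by simp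
  with Suc show ?case by (metis Ck_real.simps(2))
qed simp

lemma Ck_real_add: "Ck_real k f \<Longrightarrow> Ck_real k g \<Longrightarrow> Ck_real k (\<lambda>x. f x + g x)"
proof (induction k arbitrary: f g)
  case 0 then show ?case by (simp add: continuous_on_add)
next
  case (Suc k)
  then obtain f' g' where "\<forall>x. (f has_real_derivative f' x) (at x)" "Ck_real k f'"
    "\<forall>x. (g has_real_derivative g' x) (at x)" "Ck_real k g'" by auto
  with Suc.IH[of f' g'] show ?case
    by (auto intro!: exI[of _ "\<lambda>x. f' x + g' x"] DERIV_add)
qed

lemma Ck_real_mult: "Ck_real k f \<Longrightarrow> Ck_real k g \<Longrightarrow> Ck_real k (\<lambda>x. f x * g x)"
proof (induction k arbitrary: f g)
  case 0 then show ?case by (simp add: continuous_on_mult)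
next
  case (Suc k)
  then obtain f' g' where d: "\<forall>x. (f has_real_derivative f' x) (at x)" "Ck_real k f'"
    "\<forall>x. (g has_real_derivative g' x) (at x)" "Ck_real k g'" by auto
  have "Ck_real k (\<lambda>x. f' x * g x + g' x * f x)"
    using Suc d Ck_real_Suc_imp by (intro Ck_real_add) blast+
  with d show ?case
    by (auto intro!: exI[of _ "\<lambda>x. f' x * g x + g' x * f x"] DERIV_mult)
qed

lemma Ck_real_compose_affine: "Ck_real k f \<Longrightarrow> Ck_real k (\<lambda>x. f (c * x + d))"
proof (induction k arbitrary: f)
  case 0 then show ?case
    by (auto intro!: continuous_on_compose2[of UNIV f] continuous_intros)
next
  case (Suc k)
  then obtain f' where d: "\<forall>x. (f has_real_derivative f' x) (at x)" "Ck_real k f'" by auto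
  have "((\<lambda>x. f (c * x + d)) has_real_derivative c * f' (c * x + d)) (at x)" for x
    by (rule DERIV_cong[OF DERIV_chain2[of f "f' (c*x+d)" "\<lambda>x. c*x+d" x c]])
      (use d in \<open>auto intro!: derivative_eq_intros\<close>)
  moreover have "Ck_real k (\<lambda>x. c * f' (c * x + d))"
    using Suc.IH[OF d(2)] by (intro Ck_real_mult Ck_real_const)
  ultimately show ?case unfolding Ck_real.simps by (intro exI[of _ "\<lambda>x. c * f' (c * x + d)"]) blast
qed

lemma Ck_real_exp_compose: "Ck_real k f \<Longrightarrow> Ck_real k (\<lambda>x. exp (f x))"
proof (induction k arbitrary: f)
  case 0 then show ?case by (simp add: continuous_on_exp)
next
  case (Suc k)
  then obtain f' where d: "\<forall>x. (f has_real_derivative f' x) (at x)" "Ck_real k f'" by auto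
  have "Ck_real k (\<lambda>x. exp (f x) * f' x)" using Suc d Ck_real_Suc_imp by (intro Ck_real_mult) blast+
  with d show ?case by (auto intro!: exI[of _ "\<lambda>x. exp (f x) * f' x"] DERIV_fun_exp)
qed

text \<open>The family is closed under differentiation up to linear combinations, which makes smoothness at \<open>0\<close> an
  induction on the order.\<close>
definition flat :: "nat \<Rightarrow> real \<Rightarrow> real" where
  "flat n t = (if t > 0 then (1 / t) ^ n * exp (- 1 / t) else 0)"

lemma flat_lim: "((\<lambda>t. (1 / t) ^ n * exp (- 1 / t)) \<longlongrightarrow> (0::real)) (at_right 0)"
  by real_asymp

text \<open>The only delicate point is \<open>t = 0\<close>, where the difference quotient from the right is \<open>flat (Suc n)\<close> and
  tends to \<open>0\<close> because the exponential beats every power.\<close>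
lemma flat_deriv: "(flat n has_real_derivative - real n * flat (Suc n) t + flat (Suc (Suc n)) t) (at t)"
proof -
  consider "t > 0" | "t < 0" | "t = 0" by linarith
  then show ?thesis
  proof cases
    case 1
    have "((\<lambda>t. (1 / t) ^ n * exp (- 1 / t)) has_real_derivative
       - real n * flat (Suc n) t + flat (Suc (Suc n)) t) (at t)"
      using 1
      apply (auto intro!: derivative_eq_intros simp: flat_def)
      apply (cases n)
       apply (auto simp: field_simps power2_eq_square)
      done
    then show ?thesis
      by (rule has_field_derivative_transform_within_open[of _ _ _ "{0<..}"])
        (use 1 in \<open>auto simp: flat_def\<close>)
  next
    case 2
    have "((\<lambda>t. 0) has_real_derivative - real n * flat (Suc n) t + flat (Suc (Suc n)) t) (at t)"
      using 2 by (simp add: flat_def)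
    then show ?thesis
      by (rule has_field_derivative_transform_within_open[of _ _ _ "{..<0}"])
        (use 2 in \<open>auto simp: flat_def\<close>)
  next
    case 3
    have r: "((\<lambda>h. flat n h / h) \<longlongrightarrow> 0) (at_right 0)"
    proof (rule Lim_transform_eventually[OF flat_lim[of "Suc n"]])
      show "\<forall>\<^sub>F t in at_right 0. (1 / t) ^ Suc n * exp (- 1 / t) = flat n t / t"
        by (auto simp: eventually_at_right_less flat_def eventually_at_filter)
    qed
    have l: "((\<lambda>h. flat n h / h) \<longlongrightarrow> 0) (at_left 0)"
      by (rule Lim_transform_eventually[OF tendsto_const])
        (auto simp: eventually_at_filter flat_def)
    from r l have "((\<lambda>h. flat n h / h) \<longlongrightarrow> 0) (at 0)"
      by (simp add: filterlim_split_at)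
    then show ?thesis using 3 by (simp add: DERIV_def flat_def)
  qed
qed

lemma flat_Ck_real: "Ck_real k (flat n)"
proof (induction k arbitrary: n)
  case 0
  show ?case using flat_deriv by (auto intro!: continuous_at_imp_continuous_on intro: DERIV_isCont)
next
  case (Suc k)
  have "Ck_real k (\<lambda>t. - real n * flat (Suc n) t + flat (Suc (Suc n)) t)"
    by (intro Ck_real_add Ck_real_mult Ck_real_const Suc)
  with flat_deriv show ?case unfolding Ck_real.simps
    by (intro exI[of _ "\<lambda>t. - real n * flat (Suc n) t + flat (Suc (Suc n)) t"]) blast
qed

text \<open>Smooth and supported in \<open>[l,u]\<close>; as \<open>n\<close> grows the exponent is driven to minus infinity exactly on the
  open interval, so the bumps approximate its indicator.\<close>
definition bump :: "real \<Rightarrow> real \<Rightarrow> nat \<Rightarrow> real \<Rightarrow> real" where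
  "bump l u n t = 1 - exp (- real n * (flat 0 (t - l) * flat 0 (u - t)))"

lemma bump_Ck_real: "Ck_real k (bump l u n)"
proof -
  have a: "Ck_real k (\<lambda>t. flat 0 (1 * t + (- l)))" "Ck_real k (\<lambda>t. flat 0 ((-1) * t + u))"
    by (intro Ck_real_compose_affine flat_Ck_real)+
  have "Ck_real k (\<lambda>t. 1 + (-1) * exp ((- real n) * (flat 0 (1 * t + (- l)) * flat 0 ((-1) * t + u))))"
    by (intro Ck_real_add Ck_real_mult Ck_real_const Ck_real_exp_compose a)
  moreover have "bump l u n = (\<lambda>t. 1 + (-1) * exp ((- real n) * (flat 0 (1 * t + (- l)) * flat 0 ((-1) * t + u))))"
    by (auto simp: bump_def algebra_simps)
  ultimately show ?thesis by simp
qed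

lemma flat_nonneg: "flat n t \<ge> 0" by (simp add: flat_def)

lemma bump_bounds: "0 \<le> bump l u n t" "bump l u n t \<le> 1"
  by (auto simp: bump_def flat_nonneg)

lemma bump_outside: "t \<notin> {l<..<u} \<Longrightarrow> bump l u n t = 0"
  by (auto simp: bump_def flat_def)

lemma bump_tendsto: "(\<lambda>n. bump l u n t) \<longlonglongrightarrow> indicator {l<..<u} t"
proof (cases "t \<in> {l<..<u}")
  case True
  define c where "c = flat 0 (t - l) * flat 0 (u - t)"
  have "c > 0" using True by (auto simp: c_def flat_def)
  then have "(\<lambda>n. 1 - exp (- real n * c)) \<longlonglongrightarrow> 1" by real_asymp
  with True show ?thesis by (simp add: bump_def c_def)
next
  case False
  then show ?thesis by (simp add: bump_outside)
qed

definition tensor :: "(real \<Rightarrow> real) \<Rightarrow> (real \<Rightarrow> real) \<Rightarrow> real^2 \<Rightarrow> real" where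
  "tensor a b z = a (z $ 1) * b (z $ 2)"

lemma tensor_has_derivative:
  assumes "(a has_real_derivative a') (at (z $ 1))" "(b has_real_derivative b') (at (z $ 2))"
  shows "(tensor a b has_derivative (\<lambda>d. d $ 1 * (a' * b (z $ 2)) + d $ 2 * (a (z $ 1) * b'))) (at z)"
proof -
  have 1: "((\<lambda>z. a (z $ 1)) has_derivative (\<lambda>d. a' * d $ 1)) (at z)"
    by (rule has_derivative_compose[of "\<lambda>z. z $ 1" "\<lambda>d. d $ 1" z UNIV a "(*) a'"])
      (use assms(1) in \<open>auto simp: has_field_derivative_def intro!: bounded_linear_imp_has_derivative bounded_linear_vec_nth\<close>)
  have 2: "((\<lambda>z. b (z $ 2)) has_derivative (\<lambda>d. b' * d $ 2)) (at z)"
    by (rule has_derivative_compose[of "\<lambda>z. z $ 2" "\<lambda>d. d $ 2" z UNIV b "(*) b'"])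
      (use assms(2) in \<open>auto simp: has_field_derivative_def intro!: bounded_linear_imp_has_derivative bounded_linear_vec_nth\<close>)
  show ?thesis unfolding tensor_def
    by (rule has_derivative_eq_rhs[OF has_derivative_mult[OF 1 2]]) (auto simp: algebra_simps)
qed

lemma tensor_partial:
  assumes "\<And>x. (a has_real_derivative a' x) (at x)" "\<And>x. (b has_real_derivative b' x) (at x)"
  shows "partial_deriv 1 (tensor a b) = tensor a' b" "partial_deriv 2 (tensor a b) = tensor a b'"
proof -
  have "frechet_derivative (tensor a b) (at z) =
    (\<lambda>d. d $ 1 * (a' (z $ 1) * b (z $ 2)) + d $ 2 * (a (z $ 1) * b' (z $ 2)))" for z
    using frechet_derivative_at[OF tensor_has_derivative[of a "a' (z$1)" z b "b' (z$2)"]] assms by simp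
  then show "partial_deriv 1 (tensor a b) = tensor a' b" "partial_deriv 2 (tensor a b) = tensor a b'"
    by (auto simp: partial_deriv_def tensor_def fun_eq_iff axis_def)
qed

lemma Ck_tensor: "Ck_real k a \<Longrightarrow> Ck_real k b \<Longrightarrow> Ck k (tensor a b)"
proof (induction k arbitrary: a b)
  case 0
  have "continuous_on UNIV (\<lambda>z::real^2. a (z $ 1))"
    by (rule continuous_on_compose2[of UNIV a]) (use 0 in \<open>auto intro!: continuous_intros\<close>)
  moreover have "continuous_on UNIV (\<lambda>z::real^2. b (z $ 2))"
    by (rule continuous_on_compose2[of UNIV b]) (use 0 in \<open>auto intro!: continuous_intros\<close>)
  ultimately have "continuous_on UNIV (\<lambda>z::real^2. a (z $ 1) * b (z $ 2))" by (rule continuous_on_mult)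
  then show ?case by (simp add: tensor_def[abs_def])
next
  case (Suc k)
  from Suc.prems obtain a' b' where d: "\<And>x. (a has_real_derivative a' x) (at x)" "Ck_real k a'"
    "\<And>x. (b has_real_derivative b' x) (at x)" "Ck_real k b'" by auto
  have "tensor a b differentiable (at z)" for z
    by (rule differentiableI[OF tensor_has_derivative[OF d(1) d(3)]])
  moreover have "Ck k (partial_deriv i (tensor a b))" for i
  proof -
    consider "i = 1" | "i = 2" using exhaust_2[of i] by blast
    then show ?thesis
    proof cases
      case 1
      show ?thesis unfolding 1 tensor_partial(1)[OF d(1,3)]
        by (rule Suc.IH[OF d(2) Ck_real_Suc_imp[OF Suc.prems(2)]])
    next
      case 2
      show ?thesis unfolding 2 tensor_partial(2)[OF d(1,3)]
        by (rule Suc.IH[OF Ck_real_Suc_imp[OF Suc.prems(1)] d(4)])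
    qed
  qed
  ultimately show ?case by simp
qed

lemma test_function_tensor:
  assumes "\<And>k. Ck_real k a" "\<And>k. Ck_real k b"
    and "\<And>t. t \<notin> {x$1..y$1} \<Longrightarrow> a t = 0" "\<And>t. t \<notin> {x$2..y$2} \<Longrightarrow> b t = 0" "cbox x y \<subseteq> U"
  shows "test_function U (tensor a b)"
proof -
  have "{z. tensor a b z \<noteq> 0} \<subseteq> cbox x y"
  proof
    fix z assume "z \<in> {z. tensor a b z \<noteq> 0}"
    then have "a (z$1) \<noteq> 0" "b (z$2) \<noteq> 0" by (auto simp: tensor_def)
    with assms(3,4) have "z$1 \<in> {x$1..y$1}" "z$2 \<in> {x$2..y$2}" by blast+
    then show "z \<in> cbox x y" by (simp add: mem_box_cart forall_2)
  qed
  then have "closure {z. tensor a b z \<noteq> 0} \<subseteq> cbox x y" by (intro closure_minimal closed_cbox)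
  moreover from this have "compact (closure {z. tensor a b z \<noteq> 0})"
    by (meson bounded_cbox bounded_subset closed_closure compact_eq_bounded_closed)
  ultimately show ?thesis
    using assms Ck_tensor unfolding test_function_def by blast
qed

lemma Ck_Suc_continuous: "Ck (Suc k) f \<Longrightarrow> continuous_on UNIV f"
  by (auto intro!: differentiable_imp_continuous_on simp: differentiable_on_def differentiable_at_withinI)

lemma partial_deriv_has_derivative:
  fixes f :: "real^'n::finite \<Rightarrow> real"
  assumes "f differentiable (at x)"
  shows "(f has_derivative (\<lambda>d. \<Sum>i\<in>UNIV. d $ i * partial_deriv i f x)) (at x)"
proof -
  let ?L = "frechet_derivative f (at x)"
  have L: "(f has_derivative ?L) (at x)" using assms frechet_derivative_works by blast
  then have "linear ?L" by (rule has_derivative_linear)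
  have "?L d = (\<Sum>i\<in>UNIV. d $ i * partial_deriv i f x)" for d
  proof -
    have "?L d = ?L (\<Sum>i\<in>UNIV. d $ i *\<^sub>R axis i 1)" by (simp add: basis_expansion flip: scalar_mult_eq_scaleR)
    also have "\<dots> = (\<Sum>i\<in>UNIV. d $ i *\<^sub>R ?L (axis i 1))"
      using \<open>linear ?L\<close> by (simp add: linear_sum linear_scale)
    finally show ?thesis by (simp add: partial_deriv_def)
  qed
  then have "?L = (\<lambda>d. \<Sum>i\<in>UNIV. d $ i * partial_deriv i f x)" by auto
  with L show ?thesis by simp
qed

text \<open>All that integration theory needs of a test function; the support is used through a
  compact set outside which the function and its partial derivatives vanish.\<close>
lemma test_functionD:
  fixes \<phi> :: "real^'n::finite \<Rightarrow> real"
  assumes "test_function U \<phi>"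
  shows "(\<phi> has_derivative (\<lambda>d. \<Sum>i\<in>UNIV. d $ i * partial_deriv i \<phi> x)) (at x)"
    and "continuous_on UNIV \<phi>" "continuous_on UNIV (partial_deriv i \<phi>)"
    and "\<exists>K. compact K \<and> K \<subseteq> U \<and> (\<forall>x. x \<notin> K \<longrightarrow> \<phi> x = 0 \<and> partial_deriv i \<phi> x = 0)"
proof -
  have c: "Ck (Suc 0) \<phi>" "Ck (Suc (Suc 0)) \<phi>" using assms unfolding test_function_def by blast+
  then have d: "\<phi> differentiable (at x)" for x by simp
  then show "(\<phi> has_derivative (\<lambda>d. \<Sum>i\<in>UNIV. d $ i * partial_deriv i \<phi> x)) (at x)"
    by (rule partial_deriv_has_derivative)
  show "continuous_on UNIV \<phi>" by (rule Ck_Suc_continuous[OF c(1)])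
  have "Ck (Suc 0) (partial_deriv i \<phi>)" using c(2) by simp
  then show "continuous_on UNIV (partial_deriv i \<phi>)" by (rule Ck_Suc_continuous)
  define K where "K = closure {x. \<phi> x \<noteq> 0}"
  have "partial_deriv i \<phi> x = 0" if "x \<notin> K" for x
  proof -
    have "open (-K)" "x \<in> -K" using that by (auto simp: K_def)
    have z: "\<phi> y = 0" if "y \<in> -K" for y using that closure_subset[of "{x. \<phi> x \<noteq> 0}"] by (auto simp: K_def)
    have "((\<lambda>_. 0) has_derivative (\<lambda>_. 0)) (at x)" by simp
    then have "(\<phi> has_derivative (\<lambda>_. 0)) (at x)"
      by (rule has_derivative_transform_within_open[OF _ \<open>open (-K)\<close> \<open>x \<in> -K\<close>]) (use z in auto)
    then show ?thesis by (simp add: partial_deriv_def flip: frechet_derivative_at)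
  qed
  moreover have "\<phi> x = 0" if "x \<notin> K" for x using that closure_subset[of "{x. \<phi> x \<noteq> 0}"] by (auto simp: K_def)
  ultimately show "\<exists>K. compact K \<and> K \<subseteq> U \<and> (\<forall>x. x \<notin> K \<longrightarrow> \<phi> x = 0 \<and> partial_deriv i \<phi> x = 0)"
    using assms unfolding test_function_def K_def by blast
qed

section \<open>Square-integrable functions\<close>

definition L2 :: "('a::euclidean_space \<Rightarrow> 'b::euclidean_space) \<Rightarrow> bool" where
  "L2 f \<longleftrightarrow> f \<in> borel_measurable borel \<and> integrable lborel (\<lambda>x. (norm (f x))\<^sup>2)"

text \<open>The squared norm rather than the norm: the arguments below are quadratic (parallelogram law, energy),
  and no square roots appear.\<close>
definition n2 :: "('a::euclidean_space \<Rightarrow> 'b::euclidean_space) \<Rightarrow> real" where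
  "n2 f = (\<integral>x. (norm (f x))\<^sup>2 \<partial>lborel)"

definition ip :: "('a::euclidean_space \<Rightarrow> 'b::euclidean_space) \<Rightarrow> ('a \<Rightarrow> 'b) \<Rightarrow> real" where
  "ip f g = (\<integral>x. f x \<bullet> g x \<partial>lborel)"

lemma L2_measurable [measurable_dest]: "L2 f \<Longrightarrow> f \<in> borel_measurable borel"
  and L2_integrable: "L2 f \<Longrightarrow> integrable lborel (\<lambda>x. (norm (f x))\<^sup>2)"
  by (auto simp: L2_def)

lemma n2_nonneg [simp]: "n2 f \<ge> 0" by (simp add: n2_def)

lemma nn_integral_norm_sq: "L2 f \<Longrightarrow> (\<integral>\<^sup>+x. ennreal ((norm (f x))\<^sup>2) \<partial>lborel) = ennreal (n2 f)"
  unfolding n2_def by (rule nn_integral_eq_integral) (auto simp: L2_def)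

text \<open>Turns bounds for integrals in \<^typ>\<open>ennreal\<close>, as produced by Fatou and Tonelli, into membership in \<open>L\<^sup>2\<close>.\<close>
lemma L2_if_nn_integral_le:
  assumes "f \<in> borel_measurable borel" "(\<integral>\<^sup>+x. ennreal ((norm (f x))\<^sup>2) \<partial>lborel) \<le> ennreal c" "c \<ge> 0"
  shows "L2 f" "n2 f \<le> c"
proof -
  have "(\<integral>\<^sup>+x. ennreal ((norm (f x))\<^sup>2) \<partial>lborel) < \<infinity>"
    using assms(2) by (simp add: order_le_less_trans)
  then show L: "L2 f" using assms(1) unfolding L2_def
    by (auto intro!: integrableI_bounded)
  show "n2 f \<le> c" using assms nn_integral_norm_sq[OF L] by (simp add: ennreal_le_iff)
qed

lemma L2_bound:
  assumes "L2 g" "f \<in> borel_measurable borel" "\<And>x. norm (f x) \<le> c * norm (g x)" "c \<ge> 0"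
  shows "L2 f" "n2 f \<le> c\<^sup>2 * n2 g"
proof -
  have le: "(norm (f x))\<^sup>2 \<le> c\<^sup>2 * (norm (g x))\<^sup>2" for x
    using power_mono[OF assms(3)[of x], of 2] by (simp add: power_mult_distrib)
  have i: "integrable lborel (\<lambda>x. c\<^sup>2 * (norm (g x))\<^sup>2)" using assms(1) by (simp add: L2_def)
  show L: "L2 f" unfolding L2_def
    using assms(2) by (intro conjI Bochner_Integration.integrable_bound[OF i]) (auto simp: le)
  show "n2 f \<le> c\<^sup>2 * n2 g"
    using integral_mono[OF L2_integrable[OF L] i] le by (simp add: n2_def)
qed

lemma L2_zero [simp]: "L2 (\<lambda>x. 0)" "n2 (\<lambda>x. 0) = 0"
  by (auto simp: L2_def n2_def)

lemma norm_add_sq_le: "(norm (a + b))\<^sup>2 \<le> 2 * (norm a)\<^sup>2 + 2 * (norm (b::'b::real_inner))\<^sup>2"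
proof -
  have "(norm (a + b))\<^sup>2 + (norm (a - b))\<^sup>2 = 2 * (norm a)\<^sup>2 + 2 * (norm b)\<^sup>2"
    by (simp add: power2_norm_eq_inner algebra_simps)
  then show ?thesis by (smt (verit) zero_le_power2)
qed

lemma L2_add:
  assumes "L2 f" "L2 g"
  shows "L2 (\<lambda>x. f x + g x)" "n2 (\<lambda>x. f x + g x) \<le> 2 * n2 f + 2 * n2 g"
proof -
  have i: "integrable lborel (\<lambda>x. 2 * (norm (f x))\<^sup>2 + 2 * (norm (g x))\<^sup>2)" using assms by (simp add: L2_def)
  show L: "L2 (\<lambda>x. f x + g x)" unfolding L2_def
    using assms by (intro conjI Bochner_Integration.integrable_bound[OF i])
     (auto simp: norm_add_sq_le intro!: borel_measurable_add L2_measurable)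
  show "n2 (\<lambda>x. f x + g x) \<le> 2 * n2 f + 2 * n2 g"
    using integral_mono[OF L2_integrable[OF L] i norm_add_sq_le] assms by (simp add: n2_def L2_def)
qed

lemma L2_scale:
  assumes "L2 f" shows "L2 (\<lambda>x. c *\<^sub>R f x)" "n2 (\<lambda>x. c *\<^sub>R f x) = c\<^sup>2 * n2 f"
  using assms by (auto simp: L2_def n2_def power_mult_distrib)

lemma L2_diff:
  assumes "L2 f" "L2 g"
  shows "L2 (\<lambda>x. f x - g x)" "n2 (\<lambda>x. f x - g x) \<le> 2 * n2 f + 2 * n2 g"
  using L2_add[OF assms(1) L2_scale(1)[OF assms(2), of "-1"]] L2_scale(2)[OF assms(2), of "-1"] by auto

text \<open>The form in which uniform convexity of the norm is used for minimising sequences.\<close>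
lemma n2_parallelogram:
  assumes "L2 f" "L2 g"
  shows "n2 (\<lambda>x. (1/2) *\<^sub>R (f x + g x)) = n2 f / 2 + n2 g / 2 - n2 (\<lambda>x. f x - g x) / 4"
proof -
  have "(norm ((1/2) *\<^sub>R (f x + g x)))\<^sup>2 = (norm (f x))\<^sup>2 / 2 + (norm (g x))\<^sup>2 / 2 - (norm (f x - g x))\<^sup>2 / 4" for x
    unfolding power2_norm_eq_inner by (simp add: inner_simps inner_commute field_simps)
  then show ?thesis using assms L2_diff[OF assms] by (simp add: n2_def L2_def)
qed

lemma L2_inner_integrable:
  assumes "L2 f" "L2 g"
  shows "integrable lborel (\<lambda>x. f x \<bullet> g x)"
proof (rule Bochner_Integration.integrable_bound)
  show "integrable lborel (\<lambda>x. (norm (f x))\<^sup>2 + (norm (g x))\<^sup>2)" using assms by (simp add: L2_def)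
  show "(\<lambda>x. f x \<bullet> g x) \<in> borel_measurable lborel" using assms by (auto intro!: borel_measurable_inner L2_measurable)
  show "AE x in lborel. norm (f x \<bullet> g x) \<le> norm ((norm (f x))\<^sup>2 + (norm (g x))\<^sup>2)"
  proof (rule AE_I2)
    fix x
    have "\<bar>f x \<bullet> g x\<bar> \<le> norm (f x) * norm (g x)" by (rule Cauchy_Schwarz_ineq2)
    also have "\<dots> \<le> (norm (f x))\<^sup>2 + (norm (g x))\<^sup>2"
      using sum_squares_bound[of "norm (f x)" "norm (g x)"]
        mult_nonneg_nonneg[OF norm_ge_zero[of "f x"] norm_ge_zero[of "g x"]] by linarith
    finally show "norm (f x \<bullet> g x) \<le> norm ((norm (f x))\<^sup>2 + (norm (g x))\<^sup>2)" by simp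
  qed
qed

lemma L2_norm: "L2 f \<Longrightarrow> L2 (\<lambda>x. norm (f x))" "n2 (\<lambda>x. norm (f x)) = n2 f"
  by (auto simp: L2_def n2_def)

lemma discriminant_from_nonneg:
  fixes a b c :: real
  assumes "\<And>t. a + 2 * t * b + t\<^sup>2 * c \<ge> 0" "c \<ge> 0"
  shows "b\<^sup>2 \<le> a * c"
proof (cases "c = 0")
  case True
  have "b = 0"
  proof (rule ccontr)
    assume "b \<noteq> 0"
    then show False using assms(1)[of "- (a + 1) / (2 * b)"] True by (simp add: field_simps)
  qed
  with True show ?thesis by simp
next
  case False
  then have "c > 0" using assms by simp
  have "a - b\<^sup>2 / c \<ge> 0" using assms(1)[of "- b / c"] \<open>c > 0\<close>
    by (simp add: field_simps power2_eq_square)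
  then show ?thesis using \<open>c > 0\<close> by (simp add: field_simps)
qed

lemma n2_add_expand:
  assumes "L2 f" "L2 g"
  shows "n2 (\<lambda>x. f x + t *\<^sub>R g x) = n2 f + 2 * t * ip f g + t\<^sup>2 * n2 g"
proof -
  have "(norm (f x + t *\<^sub>R g x))\<^sup>2 = (norm (f x))\<^sup>2 + 2 * t * (f x \<bullet> g x) + t\<^sup>2 * (norm (g x))\<^sup>2" for x
    unfolding power2_norm_eq_inner by (simp add: algebra_simps inner_commute power2_eq_square)
  then show ?thesis using assms L2_inner_integrable[OF assms] by (simp add: n2_def ip_def L2_def)
qed

lemma ip_CS: assumes "L2 f" "L2 g" shows "(ip f g)\<^sup>2 \<le> n2 f * n2 g"
proof (rule discriminant_from_nonneg)
  show "0 \<le> n2 f + 2 * t * ip f g + t\<^sup>2 * n2 g" for t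
    using n2_add_expand[OF assms, of t] n2_nonneg[of "\<lambda>x. f x + t *\<^sub>R g x"] by linarith
qed simp

lemma ip_CS_abs: assumes "L2 f" "L2 g" shows "\<bar>ip f g\<bar> \<le> sqrt (n2 f) * sqrt (n2 g)"
  using ip_CS[OF assms] by (metis real_sqrt_abs real_sqrt_le_mono real_sqrt_mult)

lemma ip_self: "ip f f = n2 f" by (simp add: ip_def n2_def power2_norm_eq_inner)

lemma ip_tendsto:
  assumes f: "\<And>n. L2 (f n)" "L2 F" "(\<lambda>n. n2 (\<lambda>x. f n x - F x)) \<longlonglongrightarrow> 0"
      and g: "\<And>n. L2 (g n)" "L2 G" "(\<lambda>n. n2 (\<lambda>x. g n x - G x)) \<longlonglongrightarrow> 0"
  shows "(\<lambda>n. ip (f n) (g n)) \<longlonglongrightarrow> ip F G"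
proof -
  note fd = L2_diff(1)[OF f(1) f(2)] and gd = L2_diff(1)[OF g(1) g(2)]
  have eq: "ip (f n) (g n) - ip F G = ip (\<lambda>x. f n x - F x) (\<lambda>x. g n x - G x) + ip F (\<lambda>x. g n x - G x)
     + ip (\<lambda>x. f n x - F x) G" for n
  proof -
    have "ip (f n) (g n) = (\<integral>x. (f n x - F x) \<bullet> (g n x - G x) + F x \<bullet> (g n x - G x) + (f n x - F x) \<bullet> G x + F x \<bullet> G x \<partial>lborel)"
      unfolding ip_def by (intro Bochner_Integration.integral_cong) (auto simp: algebra_simps)
    also have "\<dots> = ip (\<lambda>x. f n x - F x) (\<lambda>x. g n x - G x) + ip F (\<lambda>x. g n x - G x)
       + ip (\<lambda>x. f n x - F x) G + ip F G"
      unfolding ip_def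
      using L2_inner_integrable[OF fd gd, of n n] L2_inner_integrable[OF f(2) gd, of n]
        L2_inner_integrable[OF fd g(2), of n] L2_inner_integrable[OF f(2) g(2)] by simp
    finally show ?thesis by simp
  qed
  let ?a = "\<lambda>n. sqrt (n2 (\<lambda>x. f n x - F x))" and ?b = "\<lambda>n. sqrt (n2 (\<lambda>x. g n x - G x))"
  have "(\<lambda>n. ip (f n) (g n) - ip F G) \<longlonglongrightarrow> 0"
  proof (rule Lim_null_comparison)
    show "\<forall>\<^sub>F n in sequentially. norm (ip (f n) (g n) - ip F G)
       \<le> ?a n * ?b n + sqrt (n2 F) * ?b n + ?a n * sqrt (n2 G)"
    proof (rule always_eventually, rule allI)
      fix n
      show "norm (ip (f n) (g n) - ip F G) \<le> ?a n * ?b n + sqrt (n2 F) * ?b n + ?a n * sqrt (n2 G)"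
        unfolding eq real_norm_def
        using ip_CS_abs[OF fd[of n] gd[of n]] ip_CS_abs[OF f(2) gd[of n]] ip_CS_abs[OF fd[of n] g(2)]
        by linarith
    qed
    have "?a \<longlonglongrightarrow> sqrt 0" "?b \<longlonglongrightarrow> sqrt 0"
      by (intro tendsto_real_sqrt f(3) g(3))+
    then have "(\<lambda>n. ?a n * ?b n + sqrt (n2 F) * ?b n + ?a n * sqrt (n2 G)) \<longlonglongrightarrow>
       sqrt 0 * sqrt 0 + sqrt (n2 F) * sqrt 0 + sqrt 0 * sqrt (n2 G)"
      by (intro tendsto_add tendsto_mult tendsto_const)
    then show "(\<lambda>n. ?a n * ?b n + sqrt (n2 F) * ?b n + ?a n * sqrt (n2 G)) \<longlonglongrightarrow> 0" by simp
  qed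
  then show ?thesis using LIM_zero_iff by blast
qed

lemma n2_tendsto:
  assumes "\<And>n. L2 (f n)" "L2 F" "(\<lambda>n. n2 (\<lambda>x. f n x - F x)) \<longlonglongrightarrow> 0"
  shows "(\<lambda>n. n2 (f n)) \<longlonglongrightarrow> n2 F"
  using ip_tendsto[OF assms assms] by (simp add: ip_self)

lemma L2_AE_zero: assumes "L2 f" "n2 f = 0" shows "AE x in lborel. f x = 0"
proof -
  have "AE x in lborel. (norm (f x))\<^sup>2 = 0"
    using assms integral_nonneg_eq_0_iff_AE[OF L2_integrable[OF assms(1)]] by (simp add: n2_def)
  then show ?thesis by simp
qed

lemma liminf_le_frequently:
  fixes f :: "nat \<Rightarrow> ennreal"
  assumes "\<exists>\<^sub>F n in sequentially. f n \<le> c"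
  shows "liminf f \<le> c"
proof (rule ccontr)
  assume "\<not> liminf f \<le> c"
  then have "\<forall>\<^sub>F n in sequentially. c < f n" by (intro less_LiminfD) simp
  then have "\<forall>\<^sub>F n in sequentially. \<not> f n \<le> c" by eventually_elim simp
  with assms show False by (simp add: frequently_def)
qed

text \<open>Fatou's lemma for the nonnegative functions \<open>2|f_n|\<^sup>2 + 2|F|\<^sup>2 - |f_n - F|\<^sup>2\<close>: norms that do not
  exceed the norm of the limit leave no room for mass to escape, so pointwise convergence becomes convergence in mean
  square.\<close>
lemma n2_tendsto_of_AE_le:
  assumes L: "\<And>n. L2 (f n)" "L2 F" and ae: "AE x in lborel. (\<lambda>n. f n x) \<longlonglongrightarrow> F x"
    and le: "\<And>n. n2 (f n) \<le> n2 F"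
  shows "(\<lambda>n. n2 (\<lambda>x. f n x - F x)) \<longlonglongrightarrow> 0"
proof (rule ccontr)
  let ?a = "\<lambda>n. n2 (\<lambda>x. f n x - F x)"
  assume "\<not> ?a \<longlonglongrightarrow> 0"
  then obtain e where e: "e > 0" "\<exists>\<^sub>F n in sequentially. \<not> dist (?a n) 0 < e"
    unfolding tendsto_iff not_eventually[symmetric] by auto
  have [measurable]: "\<And>n. f n \<in> borel_measurable borel" "F \<in> borel_measurable borel"
    using L by (auto simp: L2_def)
  define H where "H n x = 2 * (norm (f n x))\<^sup>2 + 2 * (norm (F x))\<^sup>2 - (norm (f n x - F x))\<^sup>2" for n x
  have Hn: "H n x \<ge> 0" for n x
    using norm_add_sq_le[of "f n x" "- F x"] by (simp add: H_def)
  have Hi: "integrable lborel (H n)" for n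
    unfolding H_def using L L2_diff(1)[OF L(1)[of n] L(2)] by (auto simp: L2_def)
  have Hint: "(\<integral>x. H n x \<partial>lborel) = 2 * n2 (f n) + 2 * n2 F - ?a n" for n
    unfolding H_def n2_def using L L2_diff(1)[OF L(1)[of n] L(2)] by (auto simp: L2_def)
  have nnH: "(\<integral>\<^sup>+x. ennreal (H n x) \<partial>lborel) = ennreal (2 * n2 (f n) + 2 * n2 F - ?a n)" for n
    using nn_integral_eq_integral[OF Hi] Hn Hint by simp
  have "(\<integral>\<^sup>+x. ennreal (4 * (norm (F x))\<^sup>2) \<partial>lborel) = (\<integral>\<^sup>+x. liminf (\<lambda>n. ennreal (H n x)) \<partial>lborel)"
  proof (rule nn_integral_cong_AE)
    show "AE x in lborel. ennreal (4 * (norm (F x))\<^sup>2) = liminf (\<lambda>n. ennreal (H n x))"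
      using ae
    proof eventually_elim
      case (elim x)
      have "(\<lambda>n. H n x) \<longlonglongrightarrow> 2 * (norm (F x))\<^sup>2 + 2 * (norm (F x))\<^sup>2 - (norm (F x - F x))\<^sup>2"
        unfolding H_def by (intro tendsto_intros elim)
      then have "(\<lambda>n. H n x) \<longlonglongrightarrow> 4 * (norm (F x))\<^sup>2" by simp
      then have "(\<lambda>n. ennreal (H n x)) \<longlonglongrightarrow> ennreal (4 * (norm (F x))\<^sup>2)" by (intro tendsto_ennrealI)
      then show ?case by (simp add: lim_imp_Liminf)
    qed
  qed
  also have "\<dots> \<le> liminf (\<lambda>n. \<integral>\<^sup>+x. ennreal (H n x) \<partial>lborel)"
    by (rule nn_integral_liminf) (simp add: H_def)
  also have "\<dots> \<le> ennreal (4 * n2 F - e)"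
  proof (rule liminf_le_frequently)
    show "\<exists>\<^sub>F n in sequentially. (\<integral>\<^sup>+x. ennreal (H n x) \<partial>lborel) \<le> ennreal (4 * n2 F - e)"
      using e(2)
    proof (rule frequently_elim1)
      fix n assume "\<not> dist (?a n) 0 < e"
      then have "?a n \<ge> e" by simp
      then show "(\<integral>\<^sup>+x. ennreal (H n x) \<partial>lborel) \<le> ennreal (4 * n2 F - e)"
        unfolding nnH using le[of n] by (intro ennreal_leI) linarith
    qed
  qed
  finally have "(\<integral>\<^sup>+x. ennreal (4 * (norm (F x))\<^sup>2) \<partial>lborel) \<le> ennreal (4 * n2 F - e)" .
  moreover have "(\<integral>\<^sup>+x. ennreal (4 * (norm (F x))\<^sup>2) \<partial>lborel) = ennreal (4 * n2 F)"
    using nn_integral_eq_integral[of lborel "\<lambda>x. 4 * (norm (F x))\<^sup>2"] L(2) by (simp add: L2_def n2_def)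
  ultimately have "ennreal (4 * n2 F) \<le> ennreal (4 * n2 F - e)" by simp
  then have "4 * n2 F \<le> 4 * n2 F - e \<or> 4 * n2 F \<le> 0"
    by (metis ennreal_eq_0_iff ennreal_le_iff ennreal_neg le_zero_eq linorder_linear)
  then have z: "n2 F = 0" using e(1) n2_nonneg[of F] by linarith
  then have "n2 (f n) = 0" for n using le[of n] n2_nonneg[of "f n"] by linarith
  then have "?a n \<le> 0" for n using L2_diff(2)[OF L(1)[of n] L(2)] z by simp
  then have "?a n = 0" for n using n2_nonneg by (metis antisym)
  with \<open>\<not> ?a \<longlonglongrightarrow> 0\<close> show False by simp
qed

text \<open>The Riesz-Fischer theorem. The subsequence that converges almost everywhere and the last
  conclusion, that common zeros survive, are used later: the former identifies limits, the latter keeps supports inside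
  the disc.\<close>
lemma L2_complete:
  assumes L: "\<And>n. L2 (f n)"
    and C: "\<And>e. e > 0 \<Longrightarrow> \<exists>N. \<forall>m\<ge>N. \<forall>n\<ge>N. n2 (\<lambda>x. f m x - f n x) < e"
  obtains r g where "strict_mono r" "L2 g" "AE x in lborel. (\<lambda>n. f (r n) x) \<longlonglongrightarrow> g x"
    "(\<lambda>n. n2 (\<lambda>x. f n x - g x)) \<longlonglongrightarrow> 0"
    "\<forall>x. (\<forall>n. f n x = 0) \<longrightarrow> g x = 0"
proof -
  have "\<exists>N. \<forall>m\<ge>N. \<forall>n\<ge>N. n2 (\<lambda>x. f m x - f n x) < (1/4)^k" for k :: nat by (rule C) simp
  then obtain N where N: "\<And>k m n. m \<ge> N k \<Longrightarrow> n \<ge> N k \<Longrightarrow> n2 (\<lambda>x. f m x - f n x) < (1/4)^k" by metis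
  (* Partial sums make the indices strictly increasing and at least N k. *)
  define r where "r k = (\<Sum>j\<le>k. Suc (N j))" for k
  have r: "strict_mono r" by (auto simp: strict_mono_Suc_iff r_def)
  have rN: "r k \<ge> N k" for k
    unfolding r_def using member_le_sum[of k "{..k}" "\<lambda>j. Suc (N j)"] by simp
  have rSN: "r (Suc k) \<ge> N k" for k using rN[of k] strict_monoD[OF r, of k "Suc k"] by simp
  have [measurable]: "\<And>n. f n \<in> borel_measurable borel" using L by (auto simp: L2_def)
  define d where "d k x = f (r (Suc k)) x - f (r k) x" for k x
  have dL: "L2 (d k)" and dn: "n2 (d k) \<le> (1/4)^k" for k
    unfolding d_def using L2_diff(1)[OF L L] N[OF rSN rN, of k] by (auto simp: less_imp_le)
  have [measurable]: "\<And>n. d n \<in> borel_measurable borel" using dL by (auto simp: L2_def)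
  have "(\<integral>\<^sup>+x. (\<Sum>k. ennreal (2^k * (norm (d k x))\<^sup>2)) \<partial>lborel) = (\<Sum>k. \<integral>\<^sup>+x. ennreal (2^k * (norm (d k x))\<^sup>2) \<partial>lborel)"
    by (rule nn_integral_suminf) simp
  also have "\<dots> \<le> (\<Sum>k. ennreal ((1/2)^k))"
  proof (rule suminf_le)
    fix k
    have "(\<integral>\<^sup>+x. ennreal (2^k * (norm (d k x))\<^sup>2) \<partial>lborel) = ennreal (2^k * n2 (d k))"
      using nn_integral_eq_integral[of lborel "\<lambda>x. 2^k * (norm (d k x))\<^sup>2"] dL[of k] by (simp add: L2_def n2_def)
    also have "\<dots> \<le> ennreal (2^k * (1/4)^k)" using dn[of k] by (intro ennreal_leI mult_left_mono) auto
    also have "2^k * (1/4)^k = (1/2::real)^k" by (simp flip: power_mult_distrib)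
    finally show "(\<integral>\<^sup>+x. ennreal (2^k * (norm (d k x))\<^sup>2) \<partial>lborel) \<le> ennreal ((1/2)^k)" .
  qed auto
  also have "\<dots> = ennreal (\<Sum>k. (1/2)^k)" by (rule suminf_ennreal2) (auto simp: summable_geometric)
  also have "\<dots> < \<infinity>" by simp
  finally have fin: "(\<integral>\<^sup>+x. (\<Sum>k. ennreal (2^k * (norm (d k x))\<^sup>2)) \<partial>lborel) \<noteq> \<infinity>" by simp
  have "AE x in lborel. (\<Sum>k. ennreal (2^k * (norm (d k x))\<^sup>2)) \<noteq> \<infinity>"
    by (rule nn_integral_PInf_AE[OF _ fin]) simp
  then have conv: "AE x in lborel. convergent (\<lambda>n. f (r n) x)"
  proof eventually_elim
    case (elim x)
    have s1: "summable (\<lambda>k. 2^k * (norm (d k x))\<^sup>2)"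
      by (rule summable_suminf_not_top) (use elim in auto)
    have s2: "summable (\<lambda>k. (1/2::real)^k)" by (simp add: summable_geometric)
    have "summable (\<lambda>k. norm (d k x))"
    proof (rule summable_comparison_test[OF _ summable_add[OF s1 s2]], intro exI allI impI)
      fix k :: nat
      (* Geometric weights: 2 |d| <= 2^k |d|^2 + 2^(-k), so finiteness of the weighted sum of squares gives absolute convergence. *)
      have "0 \<le> (2^k * norm (d k x) - 1)\<^sup>2" by simp
      then have "2 * (2^k * norm (d k x)) \<le> (2^k)\<^sup>2 * (norm (d k x))\<^sup>2 + 1" by (simp add: power2_diff power_mult_distrib)
      also have "\<dots> = 2^k * (2^k * (norm (d k x))\<^sup>2 + (1/2)^k)"
        by (simp add: distrib_left power2_eq_square flip: power_mult_distrib)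
      finally have "2^k * (2 * norm (d k x)) \<le> 2^k * (2^k * (norm (d k x))\<^sup>2 + (1/2)^k)"
        by (simp add: mult.left_commute)
      then have "2 * norm (d k x) \<le> 2^k * (norm (d k x))\<^sup>2 + (1/2)^k" by simp
      then show "norm (norm (d k x)) \<le> 2^k * (norm (d k x))\<^sup>2 + (1/2)^k"
        using norm_ge_zero[of "d k x"] unfolding real_norm_def abs_norm_cancel by linarith
    qed
    then have "summable (\<lambda>k. d k x)" by (rule summable_norm_cancel)
    then have "convergent (\<lambda>n. \<Sum>k<n. d k x)" by (simp add: summable_iff_convergent)
    moreover have "(\<Sum>k<n. d k x) = f (r n) x - f (r 0) x" for n
      unfolding d_def by (rule sum_lessThan_telescope)
    ultimately have "convergent (\<lambda>n. (f (r n) x - f (r 0) x) + f (r 0) x)"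
      by (intro convergent_add convergent_const) simp
    then show ?case by simp
  qed
  define g where "g x = lim (\<lambda>n. f (r n) x)" for x
  have g[measurable]: "g \<in> borel_measurable borel"
    unfolding g_def by (rule borel_measurable_lim_metric) simp
  have ae: "AE x in lborel. (\<lambda>n. f (r n) x) \<longlonglongrightarrow> g x"
    using conv by eventually_elim (simp add: g_def convergent_LIMSEQ_iff)
  have key: "L2 (\<lambda>x. f m x - g x) \<and> n2 (\<lambda>x. f m x - g x) \<le> e"
    if "e > 0" "\<And>n. n \<ge> m \<Longrightarrow> n2 (\<lambda>x. f m x - f n x) \<le> e" for m e
  proof -
    have "(\<integral>\<^sup>+x. ennreal ((norm (f m x - g x))\<^sup>2) \<partial>lborel)
      = (\<integral>\<^sup>+x. liminf (\<lambda>n. ennreal ((norm (f m x - f (r n) x))\<^sup>2)) \<partial>lborel)"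
    proof (rule nn_integral_cong_AE)
      show "AE x in lborel. ennreal ((norm (f m x - g x))\<^sup>2) = liminf (\<lambda>n. ennreal ((norm (f m x - f (r n) x))\<^sup>2))"
        using ae
      proof eventually_elim
        case (elim x)
        then have "(\<lambda>n. ennreal ((norm (f m x - f (r n) x))\<^sup>2)) \<longlonglongrightarrow> ennreal ((norm (f m x - g x))\<^sup>2)"
          by (intro tendsto_intros tendsto_ennrealI)
        from lim_imp_Liminf[OF _ this] show ?case by simp
      qed
    qed
    also have "\<dots> \<le> liminf (\<lambda>n. \<integral>\<^sup>+x. ennreal ((norm (f m x - f (r n) x))\<^sup>2) \<partial>lborel)"
      by (rule nn_integral_liminf) simp
    also have "\<dots> \<le> ennreal e"
    proof (rule liminf_le_frequently, rule eventually_frequently[OF sequentially_bot])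
      show "\<forall>\<^sub>F n in sequentially. (\<integral>\<^sup>+x. ennreal ((norm (f m x - f (r n) x))\<^sup>2) \<partial>lborel) \<le> ennreal e"
        using eventually_ge_at_top[of m]
      proof eventually_elim
        case (elim n)
        then have "r n \<ge> m" using seq_suble[OF r, of n] by simp
        then show ?case using nn_integral_norm_sq[OF L2_diff(1)[OF L[of m] L[of "r n"]]] that(2)[of "r n"]
          by (simp add: ennreal_leI)
      qed
    qed
    finally show ?thesis using L2_if_nn_integral_le[of "\<lambda>x. f m x - g x" e] \<open>e > 0\<close> by (simp add: less_imp_le)
  qed
  have ev: "\<exists>M. \<forall>m\<ge>M. L2 (\<lambda>x. f m x - g x) \<and> n2 (\<lambda>x. f m x - g x) \<le> e" if e: "e > 0" for e
  proof -
    obtain M where M: "\<forall>m\<ge>M. \<forall>n\<ge>M. n2 (\<lambda>x. f m x - f n x) < e" using C[OF e] by blast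
    show ?thesis
    proof (intro exI allI impI)
      fix m assume "m \<ge> M"
      then show "L2 (\<lambda>x. f m x - g x) \<and> n2 (\<lambda>x. f m x - g x) \<le> e"
        using M e by (intro key) (auto simp: less_imp_le)
    qed
  qed
  obtain M where "L2 (\<lambda>x. f M x - g x)" using ev[of 1] by auto
  from L2_diff(1)[OF L[of M] this] have Lg: "L2 g" by simp
  have lim: "(\<lambda>n. n2 (\<lambda>x. f n x - g x)) \<longlonglongrightarrow> 0"
  proof (rule LIMSEQ_I)
    fix e :: real assume "e > 0"
    then obtain M where "\<forall>m\<ge>M. n2 (\<lambda>x. f m x - g x) \<le> e / 2" using ev[of "e/2"] by auto
    then show "\<exists>M. \<forall>m\<ge>M. norm (n2 (\<lambda>x. f m x - g x) - 0) < e"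
      using \<open>e > 0\<close> by (intro exI[of _ M]) fastforce
  qed
  have "\<forall>x. (\<forall>n. f n x = 0) \<longrightarrow> g x = 0" by (simp add: g_def)
  from that[OF r Lg ae lim this] show thesis by blast
qed

lemma L2_AE_subseq:
  assumes "\<And>n. L2 (f n)" "L2 F" "(\<lambda>n. n2 (\<lambda>x. f n x - F x)) \<longlonglongrightarrow> 0"
  obtains r where "strict_mono r" "AE x in lborel. (\<lambda>n. f (r n) x) \<longlonglongrightarrow> F x"
proof -
  have C: "\<exists>N. \<forall>m\<ge>N. \<forall>n\<ge>N. n2 (\<lambda>x. f m x - f n x) < e" if e: "e > 0" for e
  proof -
    obtain N where N: "\<And>n. n \<ge> N \<Longrightarrow> n2 (\<lambda>x. f n x - F x) < e / 4"
      using LIMSEQ_D[OF assms(3), of "e/4"] e by auto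
    have "n2 (\<lambda>x. f m x - f n x) < e" if "m \<ge> N" "n \<ge> N" for m n
      using L2_diff(2)[OF L2_diff(1)[OF assms(1)[of m] assms(2)] L2_diff(1)[OF assms(1)[of n] assms(2)]]
        N[OF that(1)] N[OF that(2)] by simp
    then show ?thesis by blast
  qed
  obtain r g where g: "strict_mono r" "L2 g" "AE x in lborel. (\<lambda>n. f (r n) x) \<longlonglongrightarrow> g x"
    "(\<lambda>n. n2 (\<lambda>x. f n x - g x)) \<longlonglongrightarrow> 0"
    "\<forall>x. (\<forall>n. f n x = 0) \<longrightarrow> g x = 0" by (rule L2_complete[OF assms(1) C])
  have "n2 (\<lambda>x. g x - F x) \<le> 0"
  proof (rule LIMSEQ_le_const)
    have "(\<lambda>n. 2 * n2 (\<lambda>x. f n x - F x) + 2 * n2 (\<lambda>x. f n x - g x)) \<longlonglongrightarrow> 2 * 0 + 2 * 0"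
      by (intro tendsto_intros assms g)
    then show "(\<lambda>n. 2 * n2 (\<lambda>x. f n x - F x) + 2 * n2 (\<lambda>x. f n x - g x)) \<longlonglongrightarrow> 0" by simp
    show "\<exists>N. \<forall>n\<ge>N. n2 (\<lambda>x. g x - F x) \<le> 2 * n2 (\<lambda>x. f n x - F x) + 2 * n2 (\<lambda>x. f n x - g x)"
    proof (intro exI allI impI)
      fix n
      show "n2 (\<lambda>x. g x - F x) \<le> 2 * n2 (\<lambda>x. f n x - F x) + 2 * n2 (\<lambda>x. f n x - g x)"
        using L2_diff(2)[OF L2_diff(1)[OF assms(1)[of n] assms(2)] L2_diff(1)[OF assms(1)[of n] g(2)]] by simp
    qed
  qed
  then have "n2 (\<lambda>x. g x - F x) = 0" using n2_nonneg by (metis antisym)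
  from L2_AE_zero[OF L2_diff(1)[OF g(2) assms(2)] this]
  have "AE x in lborel. (\<lambda>n. f (r n) x) \<longlonglongrightarrow> F x" using g(3) by eventually_elim simp
  with g(1) that show thesis by blast
qed

section \<open>Mollification in mean square\<close>

text \<open>Bounded and of bounded support, hence in every \<open>L\<^sup>p\<close>; this covers smooth kernels and averages over squares
  alike.\<close>
definition bounded_kernel :: "(real^2 \<Rightarrow> real) \<Rightarrow> bool" where
  "bounded_kernel k \<longleftrightarrow> k \<in> borel_measurable borel \<and> (\<exists>B. \<forall>x. \<bar>k x\<bar> \<le> B) \<and> (\<exists>R. \<forall>x. norm x > R \<longrightarrow> k x = 0)"

text \<open>The kernel is evaluated at \<open>z - x\<close>, not \<open>x - z\<close>, so that for fixed \<open>x\<close> it is a test function in \<open>z\<close> without reflection;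
  this is why derivatives falling on the kernel carry a minus sign below.\<close>
definition mollify :: "(real^2 \<Rightarrow> real) \<Rightarrow> (real^2 \<Rightarrow> 'b::euclidean_space) \<Rightarrow> real^2 \<Rightarrow> 'b" where
  "mollify k f x = (\<integral>z. k (z - x) *\<^sub>R f z \<partial>lborel)"

lemma kernel_measurable [measurable_dest]: "bounded_kernel k \<Longrightarrow> k \<in> borel_measurable borel"
  by (simp add: bounded_kernel_def)

lemma L2_indicator_bounded:
  assumes "bounded A" "A \<in> sets borel"
  shows "L2 (indicator A :: 'a::euclidean_space \<Rightarrow> real)" "n2 (indicator A :: 'a \<Rightarrow> real) = measure lborel A"
proof -
  have "emeasure lborel A < \<infinity>" using assms(1) by (rule emeasure_bounded_finite)
  then have "integrable lborel (indicator A :: 'a \<Rightarrow> real)" using assms(2) by (simp add: integrable_real_indicator)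
  moreover have "(\<lambda>x. (norm (indicator A x :: real))\<^sup>2) = indicator A" by (auto simp: indicator_def)
  ultimately show "L2 (indicator A :: 'a \<Rightarrow> real)" "n2 (indicator A :: 'a \<Rightarrow> real) = measure lborel A"
    using assms(2) by (auto simp: L2_def n2_def)
qed

lemma L2_integrable_bounded_support:
  fixes f :: "'a::euclidean_space \<Rightarrow> 'b::euclidean_space"
  assumes "L2 f" "bounded A" "A \<in> sets borel" "\<And>x. x \<notin> A \<Longrightarrow> f x = 0"
  shows "integrable lborel f"
proof (rule Bochner_Integration.integrable_bound)
  show "integrable lborel (\<lambda>x. norm (f x) \<bullet> indicat_real A x)"
    by (intro L2_inner_integrable L2_norm assms L2_indicator_bounded)
  show "f \<in> borel_measurable lborel" using assms by (simp add: L2_def)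
  show "AE x in lborel. norm (f x) \<le> norm (norm (f x) \<bullet> indicat_real A x)"
    using assms(4) by (auto simp: indicator_def)
qed

lemma kernel_L2: assumes "bounded_kernel k" shows "L2 k" "integrable lborel k" "integrable lborel (\<lambda>x. \<bar>k x\<bar>)"
proof -
  obtain B R where B: "\<And>x. \<bar>k x\<bar> \<le> B" and R: "\<And>x. norm x > R \<Longrightarrow> k x = 0"
    using assms by (auto simp: bounded_kernel_def)
  have b: "\<bar>k x\<bar> \<le> \<bar>B\<bar> * norm (indicat_real (cball 0 R) x)" for x
    using B[of x] R[of x] by (auto simp: indicator_def)
  show L: "L2 k"
    by (rule L2_bound(1)[OF L2_indicator_bounded(1), of "cball 0 R" _ "\<bar>B\<bar>"])
      (use assms b in \<open>auto simp: bounded_kernel_def\<close>)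
  show "integrable lborel k"
    by (rule L2_integrable_bounded_support[OF L, of "cball 0 R"]) (use R in auto)
  then show "integrable lborel (\<lambda>x. \<bar>k x\<bar>)" by simp
qed

lemma kernel_shift: assumes "bounded_kernel k" shows "bounded_kernel (\<lambda>z. k (z - x))"
proof -
  obtain B R where B: "\<And>x. \<bar>k x\<bar> \<le> B" and R: "\<And>x. norm x > R \<Longrightarrow> k x = 0"
    using assms by (auto simp: bounded_kernel_def)
  have "k (z - x) = 0" if "norm z > R + norm x" for z
    using R[of "z - x"] norm_triangle_ineq2[of z x] that by simp
  moreover have [measurable]: "k \<in> borel_measurable borel" using assms by (simp add: bounded_kernel_def)
  have "(\<lambda>z. k (z - x)) \<in> borel_measurable borel" by measurable
  ultimately show ?thesis using B unfolding bounded_kernel_def by blast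
qed

lemma kernel_diff: assumes "bounded_kernel k" "bounded_kernel l" shows "bounded_kernel (\<lambda>z. k z - l z)"
proof -
  obtain B R where B: "\<And>x. \<bar>k x\<bar> \<le> B" and R: "\<And>x. norm x > R \<Longrightarrow> k x = 0"
    using assms by (auto simp: bounded_kernel_def)
  obtain B' R' where B': "\<And>x. \<bar>l x\<bar> \<le> B'" and R': "\<And>x. norm x > R' \<Longrightarrow> l x = 0"
    using assms by (auto simp: bounded_kernel_def)
  have "\<bar>k x - l x\<bar> \<le> B + B'" for x using B[of x] B'[of x] by linarith
  moreover have "k x - l x = 0" if "norm x > max R R'" for x using R[of x] R'[of x] that by simp
  moreover have "(\<lambda>z. k z - l z) \<in> borel_measurable borel"
    using assms by (intro borel_measurable_diff) (auto simp: bounded_kernel_def)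
  ultimately show ?thesis unfolding bounded_kernel_def by blast
qed

lemma mollify_integrable:
  fixes f :: "real^2 \<Rightarrow> 'b::euclidean_space"
  assumes "bounded_kernel k" "L2 f"
  shows "integrable lborel (\<lambda>z. k (z - x) *\<^sub>R f z)"
proof (rule Bochner_Integration.integrable_bound)
  have k: "bounded_kernel (\<lambda>z. k (z - x))" by (rule kernel_shift[OF assms(1)])
  show "integrable lborel (\<lambda>z. norm (k (z - x)) \<bullet> norm (f z))"
    by (rule L2_inner_integrable[OF L2_norm(1)[OF kernel_L2(1)[OF k]] L2_norm(1)[OF assms(2)]])
  have "(\<lambda>z. k (z - x)) \<in> borel_measurable borel" "f \<in> borel_measurable borel"
    using k assms by (auto simp: bounded_kernel_def L2_def)
  then show "(\<lambda>z. k (z - x) *\<^sub>R f z) \<in> borel_measurable lborel" by simp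
qed simp

lemma nn_integral_reflect:
  fixes f :: "real^2 \<Rightarrow> ennreal"
  assumes [measurable]: "f \<in> borel_measurable borel"
  shows "(\<integral>\<^sup>+x. f (z - x) \<partial>lborel) = (\<integral>\<^sup>+x. f x \<partial>lborel)"
proof -
  have "(\<integral>\<^sup>+x. f x \<partial>lborel) = (\<integral>\<^sup>+x. f x \<partial>(density (distr lborel borel (\<lambda>x. z + (-1) *\<^sub>R x)) (\<lambda>_. 1)))"
    using lborel_affine[of "-1" z] by simp
  also have "\<dots> = (\<integral>\<^sup>+x. f (z + (-1) *\<^sub>R x) \<partial>lborel)"
    by (simp add: nn_integral_density nn_integral_distr)
  finally show ?thesis by simp
qed

lemma integral_shift:
  fixes f :: "'a::euclidean_space \<Rightarrow> 'b::euclidean_space"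
  assumes [measurable]: "f \<in> borel_measurable borel"
  shows "(\<integral>x. f (c + x) \<partial>lborel) = (\<integral>x. f x \<partial>lborel)"
  by (subst lborel_distr_plus[of c, symmetric]) (simp add: integral_distr)

lemma mollify_measurable:
  assumes "bounded_kernel k" "L2 f" shows "mollify k f \<in> borel_measurable borel"
proof -
  have [measurable]: "k \<in> borel_measurable borel" "f \<in> borel_measurable borel"
    using assms by (auto simp: bounded_kernel_def L2_def)
  have "(\<lambda>x. \<integral>z. k (z - x) *\<^sub>R f z \<partial>lborel) \<in> borel_measurable lborel"
    by (rule lborel.borel_measurable_lebesgue_integral) measurable
  then show ?thesis by (simp add: mollify_def[abs_def])
qed

text \<open>Young's inequality: Cauchy-Schwarz with the weight \<open>|k|\<close> splits off one factor \<open>K\<close>, and Tonelli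
  produces the other.\<close>
lemma mollify_young:
  fixes f :: "real^2 \<Rightarrow> 'b::euclidean_space"
  assumes k: "bounded_kernel k" and f: "L2 f" and K: "(\<integral>x. \<bar>k x\<bar> \<partial>lborel) \<le> K"
  shows "L2 (mollify k f)" "n2 (mollify k f) \<le> K\<^sup>2 * n2 f"
proof -
  have [measurable]: "k \<in> borel_measurable borel" "f \<in> borel_measurable borel"
    using assms by (auto simp: bounded_kernel_def L2_def)
  have "0 \<le> (\<integral>x. \<bar>k x\<bar> \<partial>lborel)" by (rule integral_nonneg_AE) simp
  with K have K0: "K \<ge> 0" by linarith
  have nnk: "(\<integral>\<^sup>+x. ennreal \<bar>k (z - x)\<bar> \<partial>lborel) \<le> ennreal K" for z
  proof -
    have "(\<integral>\<^sup>+x. ennreal \<bar>k (z - x)\<bar> \<partial>lborel) = (\<integral>\<^sup>+x. ennreal \<bar>k x\<bar> \<partial>lborel)"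
      by (rule nn_integral_reflect) measurable
    also have "\<dots> = ennreal (\<integral>x. \<bar>k x\<bar> \<partial>lborel)"
      by (rule nn_integral_eq_integral[OF kernel_L2(3)[OF k]]) simp
    finally show ?thesis using K by (simp add: ennreal_leI)
  qed
  have pt: "ennreal ((norm (mollify k f x))\<^sup>2) \<le> ennreal K * (\<integral>\<^sup>+z. ennreal (\<bar>k (z - x)\<bar> * (norm (f z))\<^sup>2) \<partial>lborel)" for x
  proof -
    define A where "A = (\<lambda>z. sqrt \<bar>k (z - x)\<bar>)"
    define B where "B = (\<lambda>z. sqrt \<bar>k (z - x)\<bar> * norm (f z))"
    have ks: "bounded_kernel (\<lambda>z. k (z - x))" by (rule kernel_shift[OF k])
    obtain b where b: "\<And>z. \<bar>k z\<bar> \<le> b" using k by (auto simp: bounded_kernel_def)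
    have A: "L2 A" using kernel_L2(3)[OF ks] by (simp add: L2_def A_def)
    have nA: "n2 A \<le> K"
    proof -
      have "n2 A = (\<integral>z. \<bar>k (z - x)\<bar> \<partial>lborel)" by (simp add: n2_def A_def)
      also have "\<dots> = (\<integral>z. \<bar>k z\<bar> \<partial>lborel)"
        using integral_shift[of "\<lambda>z. \<bar>k z\<bar>" "- x"] by simp
      finally show ?thesis using K by simp
    qed
    have B: "L2 B"
    proof (rule L2_bound(1)[OF L2_norm(1)[OF f]])
      show "B \<in> borel_measurable borel" unfolding B_def by measurable
      show "norm (B z) \<le> sqrt b * norm (norm (f z))" for z
        using b[of "z - x"] by (auto simp: B_def abs_mult intro!: mult_right_mono)
      show "sqrt b \<ge> 0" using b[of 0] by simp
    qed
    have "norm (mollify k f x) \<le> (\<integral>z. norm (k (z - x) *\<^sub>R f z) \<partial>lborel)"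
      unfolding mollify_def by (rule integral_norm_bound)
    also have "\<dots> = ip A B"
      unfolding ip_def A_def B_def by (intro Bochner_Integration.integral_cong) (auto simp: mult.assoc[symmetric])
    finally have "(norm (mollify k f x))\<^sup>2 \<le> (ip A B)\<^sup>2" by (intro power_mono) auto
    also have "\<dots> \<le> n2 A * n2 B" by (rule ip_CS[OF A B])
    also have "\<dots> \<le> K * n2 B" by (intro mult_right_mono nA) simp
    finally have "ennreal ((norm (mollify k f x))\<^sup>2) \<le> ennreal (K * n2 B)" by (rule ennreal_leI)
    also have "\<dots> = ennreal K * ennreal (n2 B)" by (rule ennreal_mult[OF K0]) simp
    also have "ennreal (n2 B) = (\<integral>\<^sup>+z. ennreal (\<bar>k (z - x)\<bar> * (norm (f z))\<^sup>2) \<partial>lborel)"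
      unfolding nn_integral_norm_sq[OF B, symmetric] by (simp add: B_def power_mult_distrib abs_mult)
    finally show ?thesis .
  qed
  have "(\<integral>\<^sup>+x. ennreal ((norm (mollify k f x))\<^sup>2) \<partial>lborel)
      \<le> (\<integral>\<^sup>+x. ennreal K * (\<integral>\<^sup>+z. ennreal (\<bar>k (z - x)\<bar> * (norm (f z))\<^sup>2) \<partial>lborel) \<partial>lborel)"
    by (rule nn_integral_mono) (use pt in simp)
  also have "\<dots> = ennreal K * (\<integral>\<^sup>+x. \<integral>\<^sup>+z. ennreal (\<bar>k (z - x)\<bar> * (norm (f z))\<^sup>2) \<partial>lborel \<partial>lborel)"
    by (rule nn_integral_cmult) measurable
  finally have le1: "(\<integral>\<^sup>+x. ennreal ((norm (mollify k f x))\<^sup>2) \<partial>lborel) \<le>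
     ennreal K * (\<integral>\<^sup>+x. \<integral>\<^sup>+z. ennreal (\<bar>k (z - x)\<bar> * (norm (f z))\<^sup>2) \<partial>lborel \<partial>lborel)" .
  have "(\<integral>\<^sup>+x. \<integral>\<^sup>+z. ennreal (\<bar>k (z - x)\<bar> * (norm (f z))\<^sup>2) \<partial>lborel \<partial>lborel)
     = (\<integral>\<^sup>+z. \<integral>\<^sup>+x. ennreal (\<bar>k (z - x)\<bar> * (norm (f z))\<^sup>2) \<partial>lborel \<partial>lborel)"
    by (rule lborel_pair.Fubini') measurable
  also have "\<dots> = (\<integral>\<^sup>+z. ennreal ((norm (f z))\<^sup>2) * (\<integral>\<^sup>+x. ennreal \<bar>k (z - x)\<bar> \<partial>lborel) \<partial>lborel)"
  proof (intro nn_integral_cong)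
    fix z
    have "(\<integral>\<^sup>+x. ennreal (\<bar>k (z - x)\<bar> * (norm (f z))\<^sup>2) \<partial>lborel)
       = (\<integral>\<^sup>+x. ennreal ((norm (f z))\<^sup>2) * ennreal \<bar>k (z - x)\<bar> \<partial>lborel)"
      by (simp add: ennreal_mult mult.commute)
    then show "(\<integral>\<^sup>+x. ennreal (\<bar>k (z - x)\<bar> * (norm (f z))\<^sup>2) \<partial>lborel)
       = ennreal ((norm (f z))\<^sup>2) * (\<integral>\<^sup>+x. ennreal \<bar>k (z - x)\<bar> \<partial>lborel)"
      by (simp add: nn_integral_cmult)
  qed
  also have "\<dots> \<le> (\<integral>\<^sup>+z. ennreal ((norm (f z))\<^sup>2) * ennreal K \<partial>lborel)"
    by (intro nn_integral_mono mult_left_mono nnk) simp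
  also have "\<dots> = ennreal (n2 f) * ennreal K"
    by (simp add: nn_integral_multc nn_integral_norm_sq[OF f])
  finally have "ennreal K * (\<integral>\<^sup>+x. \<integral>\<^sup>+z. ennreal (\<bar>k (z - x)\<bar> * (norm (f z))\<^sup>2) \<partial>lborel \<partial>lborel)
     \<le> ennreal K * (ennreal (n2 f) * ennreal K)"
    by (rule mult_left_mono) simp
  with le1 have "(\<integral>\<^sup>+x. ennreal ((norm (mollify k f x))\<^sup>2) \<partial>lborel) \<le> ennreal K * (ennreal (n2 f) * ennreal K)"
    by (rule order_trans)
  also have "\<dots> = ennreal (K * (n2 f * K))"
    using K0 by (simp only: ennreal_mult[OF n2_nonneg K0] ennreal_mult[OF K0 mult_nonneg_nonneg[OF n2_nonneg K0]])
  also have "K * (n2 f * K) = K\<^sup>2 * n2 f" by (simp add: power2_eq_square)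
  finally have "(\<integral>\<^sup>+x. ennreal ((norm (mollify k f x))\<^sup>2) \<partial>lborel) \<le> ennreal (K\<^sup>2 * n2 f)" .
  note le = this
  have "K\<^sup>2 * n2 f \<ge> 0" by simp
  from L2_if_nn_integral_le[OF mollify_measurable[OF k f] le this]
  show "L2 (mollify k f)" "n2 (mollify k f) \<le> K\<^sup>2 * n2 f" by auto
qed

lemma mollify_diff_kernel:
  assumes "bounded_kernel k" "bounded_kernel l" "L2 f"
  shows "mollify k f x - mollify l f x = mollify (\<lambda>z. k z - l z) f x"
  using mollify_integrable[OF assms(1,3)] mollify_integrable[OF assms(2,3)]
  by (simp add: mollify_def scaleR_diff_left)

lemma One_cart [simp]: "(One :: real^'n::finite) $ i = 1"
proof -
  have "(\<Sum>i\<in>Basis. i) \<bullet> b = (1::real)" if "b \<in> Basis" for b :: "real^'n"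
    using that by (simp add: inner_sum_left_Basis)
  from this[of "axis i 1"] have "One \<bullet> axis i (1::real) = (1::real)" by (simp add: axis_in_Basis_iff)
  then show ?thesis by (simp add: inner_axis)
qed

text \<open>Averages over squares with lower left corner \<open>x\<close> and side \<open>h\<close>. For them Lebesgue's differentiation theorem is available, so they
  are the reference kernel against which smooth kernels are compared in \<open>L\<^sup>1\<close>.\<close>
definition square_kernel :: "real \<Rightarrow> real^2 \<Rightarrow> real" where
  "square_kernel h z = indicator (cbox 0 (h *\<^sub>R One)) z / h\<^sup>2"

lemma kernel_square_kernel: "bounded_kernel (square_kernel h)"
proof -
  obtain R where R: "\<And>x::real^2. x \<in> cbox 0 (h *\<^sub>R One) \<Longrightarrow> norm x \<le> R"
    using bounded_cbox[of "0::real^2" "h *\<^sub>R One"] by (auto simp: bounded_iff)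
  have "\<forall>x. \<bar>square_kernel h x\<bar> \<le> 1 / h\<^sup>2" by (auto simp: square_kernel_def indicator_def)
  moreover have "\<forall>x. norm x > R \<longrightarrow> square_kernel h x = 0" using R by (auto simp: square_kernel_def indicator_def not_less[symmetric])
  moreover have "square_kernel h \<in> borel_measurable borel" unfolding square_kernel_def by measurable
  ultimately show ?thesis unfolding bounded_kernel_def by blast
qed

lemma square_kernel_integral: assumes "h > 0" shows "(\<integral>x. \<bar>square_kernel h x\<bar> \<partial>lborel) = 1"
proof -
  have "(\<Sum>i\<in>Basis. i) \<bullet> b = (1::real)" if "b \<in> Basis" for b :: "real^2"
    using that by (simp add: inner_sum_left_Basis)
  then have "measure lborel (cbox 0 (h *\<^sub>R One) :: (real^2) set) = h ^ DIM(real^2)"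
    using assms by (subst measure_lborel_cbox) (auto simp: less_imp_le)
  then have "measure lborel (cbox 0 (h *\<^sub>R One) :: (real^2) set) = h\<^sup>2" by simp
  moreover have "(\<lambda>x. \<bar>square_kernel h x\<bar>) = (\<lambda>x. indicator (cbox 0 (h *\<^sub>R One)) x / h\<^sup>2)"
    using assms by (auto simp: square_kernel_def)
  ultimately show ?thesis using assms by simp
qed

lemma mollify_square_kernel:
  fixes f :: "real^2 \<Rightarrow> 'b::euclidean_space"
  assumes "L2 f"
  shows "f integrable_on cbox a b" "mollify (square_kernel h) f x = integral (cbox x (x + h *\<^sub>R One)) f /\<^sub>R h ^ DIM(real^2)"
proof -
  have [measurable]: "f \<in> borel_measurable borel" using assms by (simp add: L2_def)
  have int: "integrable lborel (\<lambda>z. indicator (cbox a b) z *\<^sub>R f z)" for a b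
    by (rule L2_integrable_bounded_support[where A="cbox a b"], rule L2_bound(1)[OF assms, of _ 1])
      (auto simp: indicator_def)
  have hi: "(f has_integral (\<integral>z. indicator (cbox a b) z *\<^sub>R f z \<partial>lborel)) (cbox a b)" for a b
  proof -
    have "((\<lambda>z. indicator (cbox a b) z *\<^sub>R f z) has_integral (\<integral>z. indicator (cbox a b) z *\<^sub>R f z \<partial>lborel)) UNIV"
      by (rule has_integral_integral_lborel[OF int])
    moreover have "(\<lambda>z. indicator (cbox a b) z *\<^sub>R f z) = (\<lambda>z. if z \<in> cbox a b then f z else 0)"
      by (auto simp: indicator_def)
    ultimately show ?thesis by (simp only: has_integral_restrict_UNIV)
  qed
  then show "f integrable_on cbox a b" by blast
  have "indicat_real (cbox 0 (h *\<^sub>R One)) (z - x) = indicator (cbox x (x + h *\<^sub>R One)) z" for z :: "real^2"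
    by (auto simp: indicator_def mem_box algebra_simps)
  then have "mollify (square_kernel h) f x = (\<integral>z. (1 / h\<^sup>2) *\<^sub>R (indicator (cbox x (x + h *\<^sub>R One)) z *\<^sub>R f z) \<partial>lborel)"
    unfolding mollify_def square_kernel_def by (intro Bochner_Integration.integral_cong) auto
  also have "\<dots> = (1 / h\<^sup>2) *\<^sub>R (\<integral>z. indicator (cbox x (x + h *\<^sub>R One)) z *\<^sub>R f z \<partial>lborel)"
    by (rule integral_scaleR_right)
  also have "(\<integral>z. indicator (cbox x (x + h *\<^sub>R One)) z *\<^sub>R f z \<partial>lborel) = integral (cbox x (x + h *\<^sub>R One)) f"
    by (rule integral_unique[OF hi, symmetric])
  finally show "mollify (square_kernel h) f x = integral (cbox x (x + h *\<^sub>R One)) f /\<^sub>R h ^ DIM(real^2)"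
    by (simp add: divide_inverse)
qed

lemma AE_lborel_negligible: "negligible N \<Longrightarrow> AE x in lborel. x \<notin> N"
  using AE_not_in[of N "completion lborel"] by (simp add: AE_completion_iff negligible_iff_null_sets)

text \<open>Averages over squares do not increase the norm and converge almost everywhere, so
  \<open>n2_tendsto_of_AE_le\<close> applies.\<close>
lemma square_kernel_tendsto:
  fixes f :: "real^2 \<Rightarrow> 'b::euclidean_space"
  assumes f: "L2 f"
  shows "(\<lambda>n. n2 (\<lambda>x. mollify (square_kernel (1 / real (Suc n))) f x - f x)) \<longlonglongrightarrow> 0"
proof (rule n2_tendsto_of_AE_le)
  show "L2 (mollify (square_kernel (1 / real (Suc n))) f)" "n2 (mollify (square_kernel (1 / real (Suc n))) f) \<le> n2 f" for n
    using mollify_young[OF kernel_square_kernel f, of "1 / real (Suc n)" 1] square_kernel_integral[of "1 / real (Suc n)"] by auto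
  obtain N where N: "negligible N" "\<And>x e. \<lbrakk>x \<notin> N; 0 < e\<rbrakk> \<Longrightarrow> \<exists>d>0. \<forall>h. 0 < h \<and> h < d \<longrightarrow>
       norm (integral (cbox x (x + h *\<^sub>R One)) f /\<^sub>R h ^ DIM(real^2) - f x) < e"
    using integrable_ccontinuous_explicit[OF mollify_square_kernel(1)[OF f]] by blast
  show "AE x in lborel. (\<lambda>n. mollify (square_kernel (1 / real (Suc n))) f x) \<longlonglongrightarrow> f x"
    using AE_lborel_negligible[OF N(1)]
  proof eventually_elim
    case (elim x)
    show ?case
    proof (rule LIMSEQ_I)
      fix e :: real assume "e > 0"
      then obtain d where d: "d > 0" "\<And>h. 0 < h \<Longrightarrow> h < d \<Longrightarrow>
       norm (integral (cbox x (x + h *\<^sub>R One)) f /\<^sub>R h ^ DIM(real^2) - f x) < e" using N(2)[OF elim] by blast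
      have "(\<lambda>n. 1 / real (Suc n)) \<longlonglongrightarrow> 0" by (rule LIMSEQ_Suc[OF lim_1_over_n])
      from LIMSEQ_D[OF this d(1)] obtain M where M: "\<And>n. n \<ge> M \<Longrightarrow> 1 / real (Suc n) < d" by fastforce
      show "\<exists>no. \<forall>n\<ge>no. norm (mollify (square_kernel (1 / real (Suc n))) f x - f x) < e"
        unfolding mollify_square_kernel(2)[OF f] using M d(2) by (intro exI[of _ M]) auto
    qed
  qed
qed (rule f)

lemma Ck_real_scale: "Ck_real k f \<Longrightarrow> Ck_real k (\<lambda>x. c * f x)"
  by (intro Ck_real_mult Ck_real_const)

lemma kernel_tensor:
  assumes "Ck_real 0 a" "Ck_real 0 b" "\<And>t. t \<notin> {l..u} \<Longrightarrow> a t = 0" "\<And>t. t \<notin> {l..u} \<Longrightarrow> b t = 0"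
  shows "bounded_kernel (tensor a b)"
proof -
  have c: "continuous_on UNIV (tensor a b)" using Ck_tensor[OF assms(1,2)] by simp
  have out: "tensor a b z = 0" if "z \<notin> cbox (\<chi> i. l) (\<chi> i. u)" for z
    using that assms(3,4) by (force simp: tensor_def mem_box_cart forall_2)
  have "compact (tensor a b ` cbox (\<chi> i. l) (\<chi> i. u))"
    by (intro compact_continuous_image continuous_on_subset[OF c] compact_cbox) auto
  then have "bounded (tensor a b ` cbox (\<chi> i. l) (\<chi> i. u))" by (rule compact_imp_bounded)
  then obtain B where "\<forall>y\<in>tensor a b ` cbox (\<chi> i. l) (\<chi> i. u). \<bar>y\<bar> \<le> B" unfolding bounded_iff real_norm_def ..
  then have B: "\<And>z. z \<in> cbox (\<chi> i. l) (\<chi> i. u) \<Longrightarrow> \<bar>tensor a b z\<bar> \<le> B" by blast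
  obtain R where R: "\<And>x::real^2. x \<in> cbox (\<chi> i. l) (\<chi> i. u) \<Longrightarrow> norm x \<le> R"
    using bounded_cbox[of "(\<chi> i. l)::real^2" "(\<chi> i. u)"] by (auto simp: bounded_iff)
  have "\<bar>tensor a b z\<bar> \<le> max B 0" for z using B[of z] out[of z] by (cases "z \<in> cbox (\<chi> i. l) (\<chi> i. u)") auto
  moreover have "tensor a b z = 0" if "norm z > R" for z using R[of z] out[of z] that by force
  moreover have "tensor a b \<in> borel_measurable borel" using c by (rule borel_measurable_continuous_onI)
  ultimately show ?thesis unfolding bounded_kernel_def by blast
qed

lemma box_bump_tendsto:
  "(\<lambda>n. tensor (bump (l$1) (u$1) n) (bump (l$2) (u$2) n) z) \<longlonglongrightarrow> indicator (box l u) z"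
proof -
  have "(\<lambda>n. tensor (bump (l$1) (u$1) n) (bump (l$2) (u$2) n) z) \<longlonglongrightarrow>
    indicator {l$1<..<u$1} (z$1) * indicator {l$2<..<u$2} (z$2)"
    unfolding tensor_def by (intro tendsto_mult bump_tendsto)
  moreover have "indicator {l$1<..<u$1} (z$1) * indicator {l$2<..<u$2} (z$2) = indicat_real (box l u) z"
    by (auto simp: indicator_def mem_box_cart forall_2)
  ultimately show ?thesis by simp
qed

lemma box_bump_bound:
  "norm (tensor (bump (l$1) (u$1) n) (bump (l$2) (u$2) n) z) \<le> indicator (cbox l u) z"
proof (cases "z \<in> cbox l u")
  case True
  then show ?thesis using bump_bounds by (simp add: tensor_def abs_mult mult_le_one)
next
  case False
  then have "z $ 1 \<notin> {l$1<..<u$1} \<or> z $ 2 \<notin> {l$2<..<u$2}" by (auto simp: mem_box_cart forall_2)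
  then show ?thesis using bump_outside False by (auto simp: tensor_def)
qed

text \<open>Products of bumps converge to the indicator of the square boundedly and almost everywhere, hence
  in \<open>L\<^sup>1\<close>.\<close>
lemma ex_smooth_kernel:
  assumes h: "h > (0::real)"
  shows "\<exists>a. (\<forall>k. Ck_real k a) \<and> (\<forall>t. t \<notin> {0..h} \<longrightarrow> a t = 0) \<and>
    (\<integral>z. \<bar>tensor a a z - square_kernel h z\<bar> \<partial>lborel) \<le> h"
proof -
  define u :: "real^2" where "u = h *\<^sub>R One"
  have u: "u $ i = h" for i unfolding u_def vector_scaleR_component One_cart by simp
  define T where "T n = tensor (bump 0 h n) (bump 0 h n)" for n
  have Tt: "(\<lambda>n. T n z) \<longlonglongrightarrow> indicator (box 0 u) z" and Tb: "norm (T n z) \<le> indicator (cbox 0 u) z" for z n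
    using box_bump_tendsto[of 0 u z] box_bump_bound[of 0 u n z] by (auto simp: u T_def)
  have [measurable]: "T n \<in> borel_measurable borel" for n
    unfolding T_def using Ck_tensor[of 0 "bump 0 h n" "bump 0 h n"] bump_Ck_real
    by (intro borel_measurable_continuous_onI) simp
  have [measurable]: "square_kernel h \<in> borel_measurable borel" using kernel_square_kernel by (simp add: bounded_kernel_def)
  have i: "integrable lborel (\<lambda>z. 2 / h\<^sup>2 * indicat_real (cbox 0 u) z)"
    by (intro integrable_mult_right L2_integrable_bounded_support[OF L2_indicator_bounded(1)[of "cbox 0 u"], of "cbox 0 u"]) auto
  have "(\<lambda>n. \<integral>z. \<bar>T n z / h\<^sup>2 - square_kernel h z\<bar> \<partial>lborel) \<longlonglongrightarrow> (\<integral>z. 0 \<partial>(lborel :: (real^2) measure))"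
  proof (rule integral_dominated_convergence[OF _ _ i])
    have "AE z in lborel. z \<notin> (cbox 0 u - box 0 u)"
      by (rule AE_lborel_negligible) (metis negligible_frontier_interval)
    then show "AE z in lborel. (\<lambda>n. \<bar>T n z / h\<^sup>2 - square_kernel h z\<bar>) \<longlonglongrightarrow> 0"
    proof eventually_elim
      case (elim z)
      then have "indicat_real (cbox 0 u) z = indicator (box 0 u) z"
        using box_subset_cbox[of 0 u] by (auto simp: indicator_def)
      then have "(\<lambda>n. \<bar>T n z / h\<^sup>2 - square_kernel h z\<bar>) \<longlonglongrightarrow> \<bar>indicator (box 0 u) z / h\<^sup>2 - indicator (box 0 u) z / h\<^sup>2\<bar>"
        unfolding square_kernel_def u_def[symmetric] using h by (intro tendsto_intros Tt) auto
      then show ?case by simp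
    qed
    show "AE z in lborel. norm \<bar>T n z / h\<^sup>2 - square_kernel h z\<bar> \<le> 2 / h\<^sup>2 * indicat_real (cbox 0 u) z" for n
    proof (rule AE_I2)
      fix z
      have "\<bar>T n z / h\<^sup>2 - square_kernel h z\<bar> \<le> \<bar>T n z\<bar> / h\<^sup>2 + \<bar>square_kernel h z\<bar>"
        by (rule order_trans[OF abs_triangle_ineq4]) simp
      also have "\<dots> \<le> indicat_real (cbox 0 u) z / h\<^sup>2 + indicat_real (cbox 0 u) z / h\<^sup>2"
        using Tb[of n z] h by (intro add_mono divide_right_mono) (auto simp: square_kernel_def u_def)
      finally show "norm \<bar>T n z / h\<^sup>2 - square_kernel h z\<bar> \<le> 2 / h\<^sup>2 * indicat_real (cbox 0 u) z" by simp
    qed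
  qed measurable
  from LIMSEQ_D[OF this h] obtain n where n: "\<bar>\<integral>z. \<bar>T n z / h\<^sup>2 - square_kernel h z\<bar> \<partial>lborel\<bar> < h" by auto
  have "tensor (\<lambda>t. 1 / h * bump 0 h n t) (\<lambda>t. 1 / h * bump 0 h n t) z = T n z / h\<^sup>2" for z
    by (simp add: tensor_def T_def power2_eq_square)
  then have "(\<integral>z. \<bar>tensor (\<lambda>t. 1 / h * bump 0 h n t) (\<lambda>t. 1 / h * bump 0 h n t) z - square_kernel h z\<bar> \<partial>lborel) \<le> h"
    using n by simp
  moreover have "\<forall>k. Ck_real k (\<lambda>t. 1 / h * bump 0 h n t)" using Ck_real_scale bump_Ck_real by blast
  moreover have "\<forall>t. t \<notin> {0..h} \<longrightarrow> 1 / h * bump 0 h n t = 0" using bump_outside by force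
  ultimately show ?thesis by blast
qed

text \<open>A smooth product kernel within \<open>L\<^sup>1\<close> distance \<open>h\<close> of the average over a square of side \<open>h\<close>. Its integral
  is only close to \<open>1\<close>, which suffices for convergence.\<close>
definition profile :: "real \<Rightarrow> real \<Rightarrow> real" where
  "profile h = (SOME a. (\<forall>k. Ck_real k a) \<and> (\<forall>t. t \<notin> {0..h} \<longrightarrow> a t = 0) \<and>
    (\<integral>z. \<bar>tensor a a z - square_kernel h z\<bar> \<partial>lborel) \<le> h)"

lemma profile:
  assumes "h > 0"
  shows "Ck_real k (profile h)" "t \<notin> {0..h} \<Longrightarrow> profile h t = 0"
    "(\<integral>z. \<bar>tensor (profile h) (profile h) z - square_kernel h z\<bar> \<partial>lborel) \<le> h"
  using someI_ex[OF ex_smooth_kernel[OF assms], folded profile_def] by blast+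

definition eta :: "nat \<Rightarrow> real^2 \<Rightarrow> real" where
  "eta n = tensor (profile (1 / real (Suc n))) (profile (1 / real (Suc n)))"

lemma kernel_eta: "bounded_kernel (eta n)"
proof -
  have "1 / real (Suc n) > 0" by simp
  note p = profile[OF this]
  show ?thesis unfolding eta_def by (rule kernel_tensor[OF p(1) p(1) p(2) p(2)])
qed

text \<open>Young's inequality for the difference of the two kernels transfers convergence from averages over
  squares to smooth kernels.\<close>
lemma eta_tendsto:
  fixes f :: "real^2 \<Rightarrow> 'b::euclidean_space"
  assumes f: "L2 f"
  shows "L2 (mollify (eta n) f)" "(\<lambda>n. n2 (\<lambda>x. mollify (eta n) f x - f x)) \<longlonglongrightarrow> 0"
proof -
  show L: "L2 (mollify (eta n) f)" for n by (rule mollify_young(1)[OF kernel_eta f order_refl])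
  let ?s = "\<lambda>n. square_kernel (1 / real (Suc n))"
  have Ls: "L2 (mollify (?s n) f)" for n by (rule mollify_young(1)[OF kernel_square_kernel f order_refl])
  have 1: "n2 (\<lambda>x. mollify (eta n) f x - mollify (?s n) f x) \<le> (1 / real (Suc n))\<^sup>2 * n2 f" for n
    unfolding mollify_diff_kernel[OF kernel_eta kernel_square_kernel f]
    by (rule mollify_young(2)[OF kernel_diff[OF kernel_eta kernel_square_kernel] f]) (use profile(3)[of "1 / real (Suc n)"] in \<open>simp add: eta_def\<close>)
  have 2: "n2 (\<lambda>x. mollify (eta n) f x - f x) \<le> 2 * ((1 / real (Suc n))\<^sup>2 * n2 f) + 2 * n2 (\<lambda>x. mollify (?s n) f x - f x)" for n
    using L2_add(2)[OF L2_diff(1)[OF L[of n] Ls[of n]] L2_diff(1)[OF Ls[of n] f]] 1[of n] by (simp del: of_nat_Suc)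
  show "(\<lambda>n. n2 (\<lambda>x. mollify (eta n) f x - f x)) \<longlonglongrightarrow> 0"
  proof (rule tendsto_sandwich[OF _ _ tendsto_const])
    show "\<forall>\<^sub>F n in sequentially. 0 \<le> n2 (\<lambda>x. mollify (eta n) f x - f x)" by simp
    show "\<forall>\<^sub>F n in sequentially. n2 (\<lambda>x. mollify (eta n) f x - f x)
       \<le> 2 * ((1 / real (Suc n))\<^sup>2 * n2 f) + 2 * n2 (\<lambda>x. mollify (?s n) f x - f x)"
      using 2 by (intro always_eventually allI)
    have "(\<lambda>n. 2 * ((1 / real (Suc n))\<^sup>2 * n2 f) + 2 * n2 (\<lambda>x. mollify (?s n) f x - f x)) \<longlonglongrightarrow> 2 * (0\<^sup>2 * n2 f) + 2 * 0"
      by (intro tendsto_intros square_kernel_tendsto[OF f] LIMSEQ_Suc[OF lim_1_over_n])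
    then show "(\<lambda>n. 2 * ((1 / real (Suc n))\<^sup>2 * n2 f) + 2 * n2 (\<lambda>x. mollify (?s n) f x - f x)) \<longlonglongrightarrow> 0" by simp
  qed
qed

section \<open>The fundamental lemma of the calculus of variations\<close>

text \<open>Testing with products of bumps and dominated convergence gives zero integrals over all boxes
  in the disc; Lebesgue's differentiation theorem concludes.\<close>
lemma fundamental_lemma:
  fixes w :: "real^2 \<Rightarrow> real^'m::finite"
  assumes w: "locally_integrable_on B1 w"
    and 0: "\<And>\<phi>. test_function B1 \<phi> \<Longrightarrow> (LINT x|lebesgue_on B1. \<phi> x *\<^sub>R w x) = 0"
  shows "AE x in lborel. x \<in> B1 \<longrightarrow> w x = 0"
proof -
  have B: "B1 \<in> sets lebesgue" by simp
  have box0: "integral (cbox l u) w = 0" if sub: "cbox l u \<subseteq> B1" for l u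
  proof -
    have i: "integrable lebesgue (\<lambda>z. indicator (cbox l u) z *\<^sub>R w z)"
      using w sub by (auto simp: locally_integrable_on_def set_integrable_def)
    define T where "T n = tensor (bump (l$1) (u$1) n) (bump (l$2) (u$2) n)" for n
    have T: "test_function B1 (T n)" for n
      unfolding T_def by (rule test_function_tensor[of _ _ l u]) (use sub in \<open>auto intro!: bump_Ck_real bump_outside\<close>)
    have [measurable]: "T n \<in> borel_measurable lebesgue" for n
      using borel_measurable_continuous_onI[OF test_functionD(2)[OF T[of n]]] by (simp add: measurable_completion)
    have eq: "(LINT z|lebesgue. T n z *\<^sub>R (indicator (cbox l u) z *\<^sub>R w z)) = 0" for n
    proof -
      have "T n z *\<^sub>R (indicator (cbox l u) z *\<^sub>R w z) = indicator B1 z *\<^sub>R (T n z *\<^sub>R w z)" for z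
        using sub box_bump_bound[of l u n z] by (cases "z \<in> cbox l u") (auto simp: T_def)
      then have "(LINT z|lebesgue. T n z *\<^sub>R (indicator (cbox l u) z *\<^sub>R w z)) = (LINT z|lebesgue. indicator B1 z *\<^sub>R (T n z *\<^sub>R w z))"
        by (rule Bochner_Integration.integral_cong[OF refl])
      also have "\<dots> = (LINT z|lebesgue_on B1. T n z *\<^sub>R w z)" by (rule integral_restrict_space[symmetric]) simp
      finally show ?thesis using 0[OF T[of n]] by simp
    qed
    have "(\<lambda>n. LINT z|lebesgue. T n z *\<^sub>R (indicator (cbox l u) z *\<^sub>R w z)) \<longlonglongrightarrow> (LINT z|lebesgue. indicator (cbox l u) z *\<^sub>R w z)"
    proof (rule integral_dominated_convergence[OF _ _ integrable_norm[OF i]])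
      show "(\<lambda>z. indicator (cbox l u) z *\<^sub>R w z) \<in> borel_measurable lebesgue" using i by simp
      then show "(\<lambda>z. T n z *\<^sub>R (indicator (cbox l u) z *\<^sub>R w z)) \<in> borel_measurable lebesgue" for n
        by (rule borel_measurable_scaleR[rotated]) simp
      have "AE z in lebesgue. z \<notin> (cbox l u - box l u)"
        using AE_not_in[of "cbox l u - box l u" lebesgue] negligible_frontier_interval[of l u] by (simp add: negligible_iff_null_sets)
      then show "AE z in lebesgue. (\<lambda>n. T n z *\<^sub>R (indicator (cbox l u) z *\<^sub>R w z)) \<longlonglongrightarrow> indicator (cbox l u) z *\<^sub>R w z"
      proof eventually_elim
        case (elim z)
        have "(\<lambda>n. T n z *\<^sub>R (indicator (cbox l u) z *\<^sub>R w z)) \<longlonglongrightarrow> indicat_real (box l u) z *\<^sub>R (indicator (cbox l u) z *\<^sub>R w z)"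
          unfolding T_def by (intro tendsto_intros box_bump_tendsto)
        moreover have "indicat_real (box l u) z *\<^sub>R (indicator (cbox l u) z *\<^sub>R w z) = indicator (cbox l u) z *\<^sub>R w z"
          using elim box_subset_cbox[of l u] by (auto simp: indicator_def)
        ultimately show ?case by (simp only:)
      qed
      show "AE z in lebesgue. norm (T n z *\<^sub>R (indicator (cbox l u) z *\<^sub>R w z)) \<le> norm (indicator (cbox l u) z *\<^sub>R w z)" for n
      proof (rule AE_I2)
        fix z
        have "\<bar>T n z\<bar> \<le> 1" using box_bump_bound[of l u n z] by (cases "z \<in> cbox l u") (auto simp: T_def)
        then show "norm (T n z *\<^sub>R (indicator (cbox l u) z *\<^sub>R w z)) \<le> norm (indicator (cbox l u) z *\<^sub>R w z)"
          unfolding norm_scaleR[of "T n z"] by (intro mult_left_le_one_le) auto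
      qed
    qed
    then have "(LINT z|lebesgue. indicator (cbox l u) z *\<^sub>R w z) = 0" unfolding eq by (simp add: LIMSEQ_const_iff)
    then show ?thesis using i set_lebesgue_integral_eq_integral(2)[of "cbox l u" w]
      by (simp add: set_integrable_def set_lebesgue_integral_def)
  qed
  have ball: "AE x in lborel. norm x < r \<longrightarrow> w x = 0" if r: "r < 1" for r
  proof -
    define v where "v x = (if x \<in> cball 0 r then w x else 0)" for x
    have "cball 0 r \<subseteq> B1" using r by auto
    then have "w absolutely_integrable_on cball 0 r"
      using w by (auto simp: locally_integrable_on_def)
    then have "v absolutely_integrable_on UNIV"
      unfolding v_def by (simp only: absolutely_integrable_restrict_UNIV)
    then have v: "v integrable_on cbox a b" for a b
      by (meson set_lebesgue_integral_eq_integral(1) integrable_on_subcbox subset_UNIV)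
    obtain N where N: "negligible N" "\<And>x e. \<lbrakk>x \<notin> N; 0 < e\<rbrakk> \<Longrightarrow> \<exists>d>0. \<forall>h. 0 < h \<and> h < d \<longrightarrow>
       norm (integral (cbox x (x + h *\<^sub>R One)) v /\<^sub>R h ^ DIM(real^2) - v x) < e"
      using integrable_ccontinuous_explicit[OF v] by blast
    show ?thesis using AE_lborel_negligible[OF N(1)]
    proof eventually_elim
      case (elim x)
      show ?case
      proof (intro impI, rule ccontr)
        assume x: "norm x < r" and nz: "w x \<noteq> 0"
        then obtain d where d: "d > 0" "\<And>h. 0 < h \<Longrightarrow> h < d \<Longrightarrow>
           norm (integral (cbox x (x + h *\<^sub>R One)) v /\<^sub>R h ^ DIM(real^2) - v x) < norm (w x)"
          using N(2)[OF elim, of "norm (w x)"] by auto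
        define h where "h = min (d / 2) ((r - norm x) / 2)"
        have h1: "h \<le> d / 2" unfolding h_def by (rule min.cobounded1)
        have h2: "h \<le> (r - norm x) / 2" unfolding h_def by (rule min.cobounded2)
        have "0 < h" using d(1) x by (simp add: h_def)
        with h1 h2 d(1) have h: "0 < h" "h < d" "2 * h \<le> r - norm x" by auto
        have sub: "cbox x (x + h *\<^sub>R One) \<subseteq> cball 0 r"
        proof
          fix z assume "z \<in> cbox x (x + h *\<^sub>R One)"
          then have "x $ i \<le> z $ i \<and> z $ i \<le> x $ i + h * (One :: real^2) $ i" for i
            unfolding mem_box_cart vector_add_component vector_scaleR_component real_scaleR_def by blast
          then have "\<bar>(z - x) $ i\<bar> \<le> h" for i using h(1) unfolding One_cart by (simp add: abs_le_iff algebra_simps)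
          then have "norm (z - x) \<le> (\<Sum>i\<in>(UNIV::2 set). h)"
            by (intro order_trans[OF norm_le_l1_cart] sum_mono)
          then have "norm (z - x) \<le> 2 * h" by simp
          then have "norm z \<le> norm x + 2 * h" using norm_triangle_sub[of z x] by linarith
          then show "z \<in> cball 0 r" using h by simp
        qed
        have "integral (cbox x (x + h *\<^sub>R One)) v = integral (cbox x (x + h *\<^sub>R One)) w"
          by (intro integral_cong) (use sub in \<open>auto simp: v_def\<close>)
        also have "\<dots> = 0" by (rule box0) (use sub r in auto)
        finally have "norm (v x) < norm (w x)" using d(2)[OF h(1,2)] by simp
        then show False using x by (simp add: v_def)
      qed
    qed
  qed
  have "AE x in lborel. \<forall>n::nat. norm x < 1 - 1 / real (Suc n) \<longrightarrow> w x = 0"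
    unfolding AE_all_countable by (intro allI ball) simp
  then show ?thesis
  proof eventually_elim
    case (elim x)
    show ?case
    proof
      assume "x \<in> B1"
      then have "1 - norm x > 0" by simp
      then obtain n where "1 / real (Suc n) < 1 - norm x" using nat_approx_posE by blast
      then have "norm x < 1 - 1 / real (Suc n)" by linarith
      then show "w x = 0" using elim by blast
    qed
  qed
qed

section \<open>Weak derivatives and mollification\<close>

text \<open>Functions on the disc are extended by zero, so that all integrals run over the whole plane.\<close>
definition L2B :: "(real^2 \<Rightarrow> 'b::euclidean_space) \<Rightarrow> bool" where
  "L2B f \<longleftrightarrow> L2 f \<and> (\<forall>x. x \<notin> B1 \<longrightarrow> f x = 0)"

text \<open>The weak derivative on the disc in the form which \<open>has_weak_partial\<close> takes for elements of \<open>L2B\<close>, without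
  restricted Lebesgue measure.\<close>
definition weak_deriv :: "2 \<Rightarrow> (real^2 \<Rightarrow> 'b::euclidean_space) \<Rightarrow> (real^2 \<Rightarrow> 'b) \<Rightarrow> bool" where
  "weak_deriv i u v \<longleftrightarrow> (\<forall>\<phi>. test_function B1 \<phi> \<longrightarrow>
     (\<integral>x. partial_deriv i \<phi> x *\<^sub>R u x \<partial>lborel) = - (\<integral>x. \<phi> x *\<^sub>R v x \<partial>lborel))"

lemma L2B_L2: "L2B f \<Longrightarrow> L2 f" by (simp add: L2B_def)

lemma L2B_integrable: "L2B f \<Longrightarrow> integrable lborel f"
  by (rule L2_integrable_bounded_support[where A=B1]) (auto simp: L2B_def)

lemma integrable_indicator_bounded:
  fixes A :: "'a::euclidean_space set"
  assumes "bounded A" "A \<in> sets borel"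
  shows "integrable lborel (indicator A :: 'a \<Rightarrow> real)"
  by (rule L2_integrable_bounded_support[OF L2_indicator_bounded(1)[OF assms] assms]) simp

lemma uniformly_continuous_compact_support:
  fixes p :: "'a::euclidean_space \<Rightarrow> 'b::real_normed_vector"
  assumes c: "continuous_on UNIV p" and R: "\<And>x. norm x > R \<Longrightarrow> p x = 0" and e: "e > 0"
  obtains d where "d > 0" "\<And>x y. dist x y < d \<Longrightarrow> norm (p x - p y) < e"
proof -
  have "uniformly_continuous_on (cball 0 (\<bar>R\<bar> + 2)) p"
    by (intro compact_uniformly_continuous continuous_on_subset[OF c]) auto
  then obtain d where d: "d > 0" "\<And>x y. x \<in> cball 0 (\<bar>R\<bar> + 2) \<Longrightarrow> y \<in> cball 0 (\<bar>R\<bar> + 2) \<Longrightarrow> dist y x < d \<Longrightarrow> dist (p y) (p x) < e"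
    unfolding uniformly_continuous_on_def using e by blast
  show thesis
  proof (rule that[of "min d 1"])
    show "min d 1 > 0" using d(1) by simp
    fix x y :: 'a assume xy: "dist x y < min d 1"
    have n: "norm x \<le> norm y + 1" "norm y \<le> norm x + 1"
      using xy norm_triangle_ineq2[of x y] norm_triangle_ineq2[of y x] by (auto simp: dist_norm norm_minus_commute)
    show "norm (p x - p y) < e"
    proof (cases "norm y \<le> \<bar>R\<bar> + 1")
      case True
      then show ?thesis using d(2)[of y x] n xy by (auto simp: dist_norm norm_minus_commute)
    next
      case False
      then have "p x = 0" "p y = 0" using n R[of x] R[of y] by auto
      then show ?thesis using e by simp
    qed
  qed
qed

lemma linear_combination_bounded:
  fixes q :: "2 \<Rightarrow> 'b::real_normed_vector"
  shows "bounded_linear (\<lambda>d::real^2. \<Sum>i\<in>UNIV. d $ i *\<^sub>R q i)"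
  by (intro bounded_linear_sum bounded_linear_scaleR_left bounded_linear_compose[OF bounded_linear_scaleR_left bounded_linear_vec_nth])

lemma onorm_linear_combination:
  fixes q :: "2 \<Rightarrow> 'b::real_normed_vector"
  shows "onorm (\<lambda>d::real^2. \<Sum>i\<in>UNIV. d $ i *\<^sub>R q i) \<le> (\<Sum>i\<in>UNIV. norm (q i))"
proof (rule onorm_bound)
  show "0 \<le> (\<Sum>i\<in>UNIV. norm (q i))" by (intro sum_nonneg) auto
  fix d :: "real^2"
  have "norm (\<Sum>i\<in>UNIV. d $ i *\<^sub>R q i) \<le> (\<Sum>i\<in>UNIV. norm d * norm (q i))"
    by (intro sum_norm_le) (auto intro!: mult_right_mono component_le_norm_cart)
  then show "norm (\<Sum>i\<in>UNIV. d $ i *\<^sub>R q i) \<le> (\<Sum>i\<in>UNIV. norm (q i)) * norm d"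
    by (simp add: sum_distrib_left mult.commute)
qed

text \<open>The partial derivatives of the kernel are uniformly continuous, so its first-order Taylor
  remainder is uniformly small, and integrating it against \<open>u\<close> keeps it so.\<close>
lemma mollify_kernel_has_derivative:
  fixes u :: "real^2 \<Rightarrow> 'b::euclidean_space" and p :: "2 \<Rightarrow> real^2 \<Rightarrow> real"
  assumes k: "bounded_kernel k" "\<And>i. bounded_kernel (p i)"
    and der: "\<And>y. (k has_derivative (\<lambda>d. \<Sum>i\<in>UNIV. d $ i *\<^sub>R p i y)) (at y)"
    and pc: "\<And>i. continuous_on UNIV (p i)" and u: "L2B u"
  shows "(mollify k u has_derivative (\<lambda>d. \<Sum>i\<in>UNIV. d $ i *\<^sub>R (- mollify (p i) u x))) (at x)"
  unfolding has_derivative_at_alt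
proof (intro conjI allI impI linear_combination_bounded)
  fix e :: real assume e: "e > 0"
  define C where "C = (\<integral>z. norm (u z) \<partial>lborel)"
  have C: "C \<ge> 0" by (simp add: C_def)
  have iu: "integrable lborel (\<lambda>z. norm (u z))" using L2B_integrable[OF u] by simp
  (* The factor 2 counts the partial derivatives, and C + 1 avoids division by zero. *)
  define e' where "e' = e / (2 * (C + 1))"
  have e': "e' > 0" "2 * e' * C \<le> e" using e C by (auto simp: e'_def field_simps)
  have "\<exists>d>0. \<forall>x y. dist x y < d \<longrightarrow> norm (p i x - p i y) < e'" for i
  proof -
    obtain R where "\<And>x. norm x > R \<Longrightarrow> p i x = 0" using k(2)[of i] by (auto simp: bounded_kernel_def)
    from uniformly_continuous_compact_support[OF pc this e'(1)] show ?thesis by metis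
  qed
  then obtain \<delta> where \<delta>: "\<And>i. \<delta> i > 0" "\<And>i x y. dist x y < \<delta> i \<Longrightarrow> norm (p i x - p i y) < e'" by metis
  define D where "D = min (\<delta> 1) (\<delta> 2)"
  have D: "D > 0" "dist x y < D \<Longrightarrow> norm (p i x - p i y) < e'" for i x y
    using \<delta> exhaust_2[of i] by (auto simp: D_def)
  have lin: "\<bar>k (w - d) - k w + (\<Sum>i\<in>UNIV. d $ i *\<^sub>R p i w)\<bar> \<le> 2 * e' * norm d" if d: "norm d < D" for w d
  proof -
    have "norm ((\<lambda>y. k y - (\<Sum>i\<in>UNIV. y $ i *\<^sub>R p i w)) (w - d) - (\<lambda>y. k y - (\<Sum>i\<in>UNIV. y $ i *\<^sub>R p i w)) w) \<le> 2 * e' * norm ((w - d) - w)"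
    proof (rule differentiable_bound[of "ball w D" _ "\<lambda>y d. \<Sum>i\<in>UNIV. d $ i *\<^sub>R (p i y - p i w)"])
      fix y assume y: "y \<in> ball w D"
      have "((\<lambda>y. k y - (\<Sum>i\<in>UNIV. y $ i *\<^sub>R p i w)) has_derivative
        (\<lambda>d. (\<Sum>i\<in>UNIV. d $ i *\<^sub>R p i y) - (\<Sum>i\<in>UNIV. d $ i *\<^sub>R p i w))) (at y within ball w D)"
        by (intro has_derivative_diff has_derivative_at_withinI[OF der] bounded_linear_imp_has_derivative linear_combination_bounded)
      then show "((\<lambda>y. k y - (\<Sum>i\<in>UNIV. y $ i *\<^sub>R p i w)) has_derivative
        (\<lambda>d. \<Sum>i\<in>UNIV. d $ i *\<^sub>R (p i y - p i w))) (at y within ball w D)"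
        by (simp add: sum_subtractf scaleR_diff_right right_diff_distrib)
      have "onorm (\<lambda>d::real^2. \<Sum>i\<in>UNIV. d $ i *\<^sub>R (p i y - p i w)) \<le> (\<Sum>i\<in>(UNIV::2 set). norm (p i y - p i w))"
        by (rule onorm_linear_combination)
      also have "\<dots> \<le> (\<Sum>i\<in>(UNIV::2 set). e')"
        by (intro sum_mono less_imp_le D(2)) (use y in \<open>simp add: dist_commute\<close>)
      finally show "onorm (\<lambda>d::real^2. \<Sum>i\<in>UNIV. d $ i *\<^sub>R (p i y - p i w)) \<le> 2 * e'" by simp
    qed (use D d in \<open>auto simp: dist_norm\<close>)
    moreover have "(\<Sum>i\<in>UNIV. (w - d) $ i *\<^sub>R p i w) = (\<Sum>i\<in>UNIV. w $ i *\<^sub>R p i w) - (\<Sum>i\<in>UNIV. d $ i *\<^sub>R p i w)"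
      by (simp add: sum_subtractf left_diff_distrib)
    ultimately show ?thesis by simp
  qed
  show "\<exists>d>0. \<forall>y. norm (y - x) < d \<longrightarrow>
     norm (mollify k u y - mollify k u x - (\<Sum>i\<in>UNIV. (y - x) $ i *\<^sub>R (- mollify (p i) u x))) \<le> e * norm (y - x)"
  proof (intro exI[of _ D] conjI allI impI D(1))
    fix y assume y: "norm (y - x) < D"
    note ik = mollify_integrable[OF k(1) L2B_L2[OF u]] and ip = mollify_integrable[OF k(2) L2B_L2[OF u]]
    define F where "F z = (k (z - y) - k (z - x) + (\<Sum>i\<in>UNIV. (y - x) $ i *\<^sub>R p i (z - x))) *\<^sub>R u z" for z
    have Fe: "F z = k (z - y) *\<^sub>R u z - k (z - x) *\<^sub>R u z + (\<Sum>i\<in>UNIV. (y - x) $ i *\<^sub>R (p i (z - x) *\<^sub>R u z))" for z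
      by (simp add: F_def algebra_simps scaleR_sum_left)
    have "mollify k u y - mollify k u x - (\<Sum>i\<in>UNIV. (y - x) $ i *\<^sub>R (- mollify (p i) u x)) = (\<integral>z. F z \<partial>lborel)"
      unfolding Fe using ik[of y] ik[of x] ip[of _ x]
      by (simp add: mollify_def sum_negf del: scaleR_scaleR)
    also have "norm \<dots> \<le> (\<integral>z. norm (F z) \<partial>lborel)" by (rule integral_norm_bound)
    also have "\<dots> \<le> (\<integral>z. (2 * e' * norm (y - x)) * norm (u z) \<partial>lborel)"
    proof (rule integral_mono')
      show "norm (F z) \<le> 2 * e' * norm (y - x) * norm (u z)" for z
        using lin[OF y, of "z - x"] unfolding F_def norm_scaleR real_norm_def by (intro mult_right_mono) auto
    qed (use iu e'(1) in \<open>auto intro!: integrable_mult_right\<close>)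
    also have "\<dots> = (2 * e' * C) * norm (y - x)" using iu by (simp add: C_def)
    also have "\<dots> \<le> e * norm (y - x)" using e'(2) by (intro mult_right_mono) auto
    finally show "norm (mollify k u y - mollify k u x - (\<Sum>i\<in>UNIV. (y - x) $ i *\<^sub>R (- mollify (p i) u x))) \<le> e * norm (y - x)" .
  qed
qed

lemma sum_UNIV_2: "(\<Sum>i\<in>(UNIV::2 set). f i) = f 1 + f 2"
  by (simp add: UNIV_2)

definition eta_partial :: "nat \<Rightarrow> 2 \<Rightarrow> real^2 \<Rightarrow> real" where
  "eta_partial n i = partial_deriv i (eta n)"

lemma Ck_real_shift: "Ck_real k f \<Longrightarrow> Ck_real k (\<lambda>t. f (t - c))"
  using Ck_real_compose_affine[of k f 1 "- c"] by simp

lemma smooth_derivative: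
  assumes "\<And>k. Ck_real k a" and z: "\<And>t. t \<notin> {l..u} \<Longrightarrow> a t = 0"
  obtains a' where "\<And>t. (a has_real_derivative a' t) (at t)" "\<And>k. Ck_real k a'" "\<And>t. t \<notin> {l..u} \<Longrightarrow> a' t = 0"
proof -
  define a' where "a' = deriv a"
  have d: "(a has_real_derivative a' t) (at t)" for t
  proof -
    obtain f' where f': "\<forall>x. (a has_real_derivative f' x) (at x)" using assms(1)[of "Suc 0"] by auto
    then have "deriv a t = f' t" using DERIV_imp_deriv by blast
    then show ?thesis using f' by (simp add: a'_def)
  qed
  have "Ck_real k a'" for k
  proof -
    obtain f' where f': "\<forall>x. (a has_real_derivative f' x) (at x)" "Ck_real k f'" using assms(1)[of "Suc k"] by auto
    then have "f' = a'" using d DERIV_unique by blast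
    with f' show ?thesis by simp
  qed
  moreover have "a' t = 0" if "t \<notin> {l..u}" for t
  proof -
    have "open (- {l..u})" "t \<in> - {l..u}" using that by auto
    have "((\<lambda>_. 0) has_real_derivative 0) (at t)" by simp
    then have "(a has_real_derivative 0) (at t)"
      by (rule has_field_derivative_transform_within_open[OF _ \<open>open (- {l..u})\<close> \<open>t \<in> - {l..u}\<close>]) (use z in auto)
    then show ?thesis using d DERIV_unique by blast
  qed
  ultimately show thesis using d that by blast
qed

text \<open>Exhibits the kernel and its partial derivatives as products with the same one-dimensional
  profile and its derivative, all supported in the small interval; shifts of such products are test functions.\<close>
lemma eta_structure:
  obtains a a' where "eta n = tensor a a" "eta_partial n 1 = tensor a' a" "eta_partial n 2 = tensor a a'"
    "\<forall>k. Ck_real k a" "\<forall>k. Ck_real k a'" "\<forall>t. t \<notin> {0..1 / real (Suc n)} \<longrightarrow> a t = 0"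
    "\<forall>t. t \<notin> {0..1 / real (Suc n)} \<longrightarrow> a' t = 0" "\<forall>t. (a has_real_derivative a' t) (at t)"
proof -
  define a where "a = profile (1 / real (Suc n))"
  have "1 / real (Suc n) > 0" by simp
  note p = profile(1,2)[OF this, folded a_def]
  obtain a' where a': "\<And>t. (a has_real_derivative a' t) (at t)" "\<And>k. Ck_real k a'" "\<And>t. t \<notin> {0..1 / real (Suc n)} \<Longrightarrow> a' t = 0"
    using smooth_derivative[OF p] by metis
  have e: "eta n = tensor a a" by (simp add: eta_def a_def)
  show thesis
  proof (rule that[OF e])
    show "\<forall>k. Ck_real k a" "\<forall>k. Ck_real k a'" "\<forall>t. t \<notin> {0..1 / real (Suc n)} \<longrightarrow> a t = 0"
      "\<forall>t. t \<notin> {0..1 / real (Suc n)} \<longrightarrow> a' t = 0" "\<forall>t. (a has_real_derivative a' t) (at t)"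
      using p a' by blast+
    show "eta_partial n 1 = tensor a' a" "eta_partial n 2 = tensor a a'"
      unfolding eta_partial_def e using tensor_partial[OF a'(1) a'(1)] by auto
  qed
qed

lemma eta_props:
  shows "bounded_kernel (eta_partial n i)" "continuous_on UNIV (eta_partial n i)"
    "(eta n has_derivative (\<lambda>d. \<Sum>i\<in>UNIV. d $ i *\<^sub>R eta_partial n i y)) (at y)"
proof -
  obtain a a' where a0: "eta n = tensor a a" "eta_partial n 1 = tensor a' a" "eta_partial n 2 = tensor a a'"
    "\<forall>k. Ck_real k a" "\<forall>k. Ck_real k a'" "\<forall>t. t \<notin> {0..1 / real (Suc n)} \<longrightarrow> a t = 0"
    "\<forall>t. t \<notin> {0..1 / real (Suc n)} \<longrightarrow> a' t = 0" "\<forall>t. (a has_real_derivative a' t) (at t)"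
    by (rule eta_structure[of n])
  note a = a0(1,2,3) a0(4-8)[rule_format]
  have "bounded_kernel (tensor a' a)" by (rule kernel_tensor[OF a(5) a(4) a(7) a(6)])
  moreover have "bounded_kernel (tensor a a')" by (rule kernel_tensor[OF a(4) a(5) a(6) a(7)])
  moreover have "continuous_on UNIV (tensor a' a)" "continuous_on UNIV (tensor a a')"
    using Ck_tensor[OF a(5) a(4), of 0] Ck_tensor[OF a(4) a(5), of 0] by auto
  moreover have "i = 1 \<or> i = 2" by (rule exhaust_2)
  ultimately show "bounded_kernel (eta_partial n i)" "continuous_on UNIV (eta_partial n i)" using a by auto
  show "(eta n has_derivative (\<lambda>d. \<Sum>i\<in>UNIV. d $ i *\<^sub>R eta_partial n i y)) (at y)"
    using tensor_has_derivative[OF a(8) a(8), of y] by (simp add: sum_UNIV_2 a tensor_def)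
qed

lemma mollify_eta_derivative_kernel:
  fixes u :: "real^2 \<Rightarrow> 'b::euclidean_space"
  assumes "L2B u"
  shows "(mollify (eta n) u has_derivative (\<lambda>d. \<Sum>i\<in>UNIV. d $ i *\<^sub>R (- mollify (eta_partial n i) u x))) (at x)"
  by (rule mollify_kernel_has_derivative[OF kernel_eta eta_props(1) eta_props(3) eta_props(2) assms])

lemma mollify_eta_continuous: "L2B u \<Longrightarrow> continuous_on UNIV (mollify (eta n) u)"
  by (rule has_derivative_continuous_on[of UNIV "mollify (eta n) u"]) (rule mollify_eta_derivative_kernel)

text \<open>The distance condition \<open>norm x + 2 h < 1\<close> recurs below: it guarantees that the shifted kernel is supported
  in the disc.\<close>
lemma cube_in_B1:
  assumes "norm x + 2 * h < 1"
  shows "cbox x (\<chi> i. x $ i + h) \<subseteq> (B1 :: (real^2) set)"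
proof
  fix z :: "real^2" assume z: "z \<in> cbox x (\<chi> i. x $ i + h)"
  then have "\<bar>(z - x) $ i\<bar> \<le> h" for i by (auto simp: mem_box_cart abs_le_iff algebra_simps)
  then have "norm (z - x) \<le> (\<Sum>i\<in>(UNIV::2 set). h)"
    by (intro order_trans[OF norm_le_l1_cart] sum_mono)
  then have "norm z \<le> norm x + 2 * h" using norm_triangle_sub[of z x] by simp
  then show "z \<in> B1" using assms by simp
qed

lemma test_function_tensor_shift:
  fixes x :: "real^2"
  assumes "\<And>k. Ck_real k a" "\<And>k. Ck_real k b" "\<And>t. t \<notin> {0..h} \<Longrightarrow> a t = 0" "\<And>t. t \<notin> {0..h} \<Longrightarrow> b t = 0"
    and "norm x + 2 * h < 1"
  shows "test_function B1 (tensor (\<lambda>t. a (t - x $ 1)) (\<lambda>t. b (t - x $ 2)))"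
proof (rule test_function_tensor[of _ _ x "\<chi> i. x $ i + h"])
  show "cbox x (\<chi> i. x $ i + h) \<subseteq> B1" by (rule cube_in_B1[OF assms(5)])
qed (use assms(3,4) in \<open>auto intro!: Ck_real_shift assms(1,2)\<close>)

lemma DERIV_shift_minus:
  "(f has_real_derivative y) (at (t - c)) \<Longrightarrow> ((\<lambda>t. f (t - c)) has_real_derivative y) (at t)"
  using DERIV_shift[of f y t "- c"] by simp

text \<open>For fixed \<open>x\<close> the shifted kernel is an admissible test function, so the weak derivative moves from
  the kernel to \<open>u\<close>.\<close>
lemma mollify_weak_deriv:
  fixes u :: "real^2 \<Rightarrow> 'b::euclidean_space"
  assumes w: "weak_deriv i u v" and x: "norm x + 2 / real (Suc n) < 1"
  shows "mollify (eta_partial n i) u x = - mollify (eta n) v x"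
proof -
  obtain a a' where a0: "eta n = tensor a a" "eta_partial n 1 = tensor a' a" "eta_partial n 2 = tensor a a'"
    "\<forall>k. Ck_real k a" "\<forall>k. Ck_real k a'" "\<forall>t. t \<notin> {0..1 / real (Suc n)} \<longrightarrow> a t = 0"
    "\<forall>t. t \<notin> {0..1 / real (Suc n)} \<longrightarrow> a' t = 0" "\<forall>t. (a has_real_derivative a' t) (at t)"
    by (rule eta_structure[of n])
  note a = a0(1,2,3) a0(4-8)[rule_format]
  have x': "norm x + 2 * (1 / real (Suc n)) < 1" using x by simp
  define A1 where "A1 = (\<lambda>t. a (t - x $ 1))"
  define A2 where "A2 = (\<lambda>t. a (t - x $ 2))"
  have T: "test_function B1 (tensor A1 A2)"
    unfolding A1_def A2_def by (rule test_function_tensor_shift[OF a(4) a(4) a(6) a(6) x'])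
  have d: "(A1 has_real_derivative a' (t - x $ 1)) (at t)" "(A2 has_real_derivative a' (t - x $ 2)) (at t)" for t
    unfolding A1_def A2_def by (rule DERIV_shift_minus[OF a(8)])+
  have "partial_deriv i (tensor A1 A2) z = eta_partial n i (z - x)" for z
    using tensor_partial[OF d] exhaust_2[of i] by (auto simp: a tensor_def A1_def A2_def)
  moreover have "tensor A1 A2 z = eta n (z - x)" for z by (simp add: a tensor_def A1_def A2_def)
  ultimately show ?thesis using w[unfolded weak_deriv_def, rule_format, OF T] by (simp add: mollify_def)
qed

lemma mollify_weak_deriv_has_derivative:
  fixes u :: "real^2 \<Rightarrow> 'b::euclidean_space"
  assumes "L2B u" "\<And>i. weak_deriv i u (v i)" "norm x + 2 / real (Suc n) < 1"
  shows "(mollify (eta n) u has_derivative (\<lambda>d. \<Sum>i\<in>UNIV. d $ i *\<^sub>R mollify (eta n) (v i) x)) (at x)"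
  using mollify_eta_derivative_kernel[OF assms(1), of n x] mollify_weak_deriv[OF assms(2) assms(3)] by simp

text \<open>Both sides equal \<open>u\<close> tested with the mixed second derivative of the kernel, which is a product
  and hence visibly symmetric.\<close>
lemma mollify_weak_deriv_symmetric:
  fixes u :: "real^2 \<Rightarrow> 'b::euclidean_space"
  assumes w: "\<And>i. weak_deriv i u (v i)" "\<And>i j. weak_deriv j (v i) (w i j)" and x: "norm x + 2 / real (Suc n) < 1"
  shows "mollify (eta n) (w 1 2) x = mollify (eta n) (w 2 1) x"
proof -
  obtain a a' where a0: "eta n = tensor a a" "eta_partial n 1 = tensor a' a" "eta_partial n 2 = tensor a a'"
    "\<forall>k. Ck_real k a" "\<forall>k. Ck_real k a'" "\<forall>t. t \<notin> {0..1 / real (Suc n)} \<longrightarrow> a t = 0"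
    "\<forall>t. t \<notin> {0..1 / real (Suc n)} \<longrightarrow> a' t = 0" "\<forall>t. (a has_real_derivative a' t) (at t)"
    by (rule eta_structure[of n])
  note a = a0(1,2,3) a0(4-8)[rule_format]
  obtain a'' where a'': "\<And>t. (a' has_real_derivative a'' t) (at t)" using a(5)[of "Suc 0"] by auto
  define A where "A c = (\<lambda>t. a (t - c))" for c
  define A' where "A' c = (\<lambda>t. a' (t - c))" for c
  have d: "(A c has_real_derivative A' c t) (at t)" "(A' c has_real_derivative a'' (t - c)) (at t)" for t c
    unfolding A_def A'_def by (rule DERIV_shift_minus[OF a(8)], rule DERIV_shift_minus[OF a''])
  have x': "norm x + 2 * (1 / real (Suc n)) < 1" using x by simp
  have T1: "test_function B1 (tensor (A' (x$1)) (A (x$2)))"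
    unfolding A_def A'_def by (rule test_function_tensor_shift[OF a(5) a(4) a(7) a(6) x'])
  have T2: "test_function B1 (tensor (A (x$1)) (A' (x$2)))"
    unfolding A_def A'_def by (rule test_function_tensor_shift[OF a(4) a(5) a(6) a(7) x'])
  have p: "partial_deriv 2 (tensor (A' (x$1)) (A (x$2))) = tensor (A' (x$1)) (A' (x$2))"
          "partial_deriv 1 (tensor (A (x$1)) (A' (x$2))) = tensor (A' (x$1)) (A' (x$2))"
    using tensor_partial[OF d(2) d(1)] tensor_partial[OF d(1) d(2)] by auto
  have m1: "mollify (eta_partial n 1) (v 2) x = (\<integral>z. tensor (A' (x$1)) (A (x$2)) z *\<^sub>R v 2 z \<partial>lborel)"
   and m2: "mollify (eta_partial n 2) (v 1) x = (\<integral>z. tensor (A (x$1)) (A' (x$2)) z *\<^sub>R v 1 z \<partial>lborel)"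
    by (auto simp: mollify_def a tensor_def A_def A'_def)
  have "- mollify (eta n) (w 1 2) x = (\<integral>z. tensor (A (x$1)) (A' (x$2)) z *\<^sub>R v 1 z \<partial>lborel)"
    using mollify_weak_deriv[OF w(2)[of 2 1] x] m2 by simp
  also have "\<dots> = - (\<integral>z. tensor (A' (x$1)) (A' (x$2)) z *\<^sub>R u z \<partial>lborel)"
    using w(1)[of 1, unfolded weak_deriv_def, rule_format, OF T2] unfolding p(2) by simp
  also have "\<dots> = (\<integral>z. tensor (A' (x$1)) (A (x$2)) z *\<^sub>R v 2 z \<partial>lborel)"
    using w(1)[of 2, unfolded weak_deriv_def, rule_format, OF T1] unfolding p(1) by simp
  also have "\<dots> = - mollify (eta n) (w 2 1) x"
    using mollify_weak_deriv[OF w(2)[of 1 2] x] m1 by simp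
  finally show ?thesis by simp
qed

section \<open>Integration by parts\<close>

text \<open>Translation invariance makes the integral of every difference quotient vanish; the quotients
  converge boundedly on a fixed ball.\<close>
lemma integral_partial_zero:
  fixes F :: "real^2 \<Rightarrow> 'b::euclidean_space"
  assumes der: "\<And>x. (F has_derivative (\<lambda>d. \<Sum>i\<in>UNIV. d $ i *\<^sub>R F' i x)) (at x)"
    and c: "\<And>i. continuous_on UNIV (F' i)" and R: "\<And>x. norm x > R \<Longrightarrow> F x = 0"
  shows "(\<integral>x. F' i x \<partial>lborel) = 0"
proof -
  have Fc: "continuous_on UNIV F" by (rule has_derivative_continuous_on[OF der])
  have [measurable]: "F \<in> borel_measurable borel" "F' i \<in> borel_measurable borel"
    using Fc c by (auto intro: borel_measurable_continuous_onI)
  have "\<exists>M. \<forall>x\<in>cball 0 (\<bar>R\<bar> + 2). (\<Sum>i\<in>UNIV. norm (F' i x)) \<le> M"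
  proof -
    have "compact ((\<lambda>x. \<Sum>i\<in>UNIV. norm (F' i x)) ` cball 0 (\<bar>R\<bar> + 2))"
      by (intro compact_continuous_image continuous_on_sum continuous_on_norm continuous_on_subset[OF c]) auto
    then have "bounded ((\<lambda>x. \<Sum>i\<in>UNIV. norm (F' i x)) ` cball 0 (\<bar>R\<bar> + 2))" by (rule compact_imp_bounded)
    then obtain M where "\<forall>y\<in>(\<lambda>x. \<Sum>i\<in>UNIV. norm (F' i x)) ` cball 0 (\<bar>R\<bar> + 2). norm y \<le> M" unfolding bounded_iff ..
    then have "\<And>x. x \<in> cball 0 (\<bar>R\<bar> + 2) \<Longrightarrow> norm (\<Sum>i\<in>UNIV. norm (F' i x)) \<le> M" by blast
    then show ?thesis unfolding real_norm_def by (meson abs_ge_self order_trans)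
  qed
  then obtain M where M: "\<And>x. x \<in> cball 0 (\<bar>R\<bar> + 2) \<Longrightarrow> (\<Sum>i\<in>UNIV. norm (F' i x)) \<le> M" by blast
  have M0: "M \<ge> 0" using M[of 0] sum_nonneg[of UNIV "\<lambda>i. norm (F' i 0)"] by simp
  define t where "t n = 1 / real (Suc n)" for n
  have t: "t n > 0" "t n \<le> 1" for n by (auto simp: t_def)
  have tl: "t \<longlonglongrightarrow> 0" unfolding t_def by (rule LIMSEQ_Suc[OF lim_1_over_n])
  define Q where "Q n x = (1 / t n) *\<^sub>R (F (t n *\<^sub>R axis i 1 + x) - F x)" for n x
  have Fi: "integrable lborel F"
  proof -
    have "bounded (F ` cball 0 \<bar>R\<bar>)"
      by (intro compact_imp_bounded compact_continuous_image continuous_on_subset[OF Fc] compact_cball) simp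
    then obtain B where "\<forall>y\<in>F ` cball 0 \<bar>R\<bar>. norm y \<le> B" unfolding bounded_iff ..
    then have B: "\<And>x. x \<in> cball 0 \<bar>R\<bar> \<Longrightarrow> norm (F x) \<le> B" by blast
    have "L2 F"
    proof (rule L2_bound(1)[OF L2_indicator_bounded(1), of "cball 0 \<bar>R\<bar>" _ "\<bar>B\<bar>"])
      show "norm (F x) \<le> \<bar>B\<bar> * norm (indicat_real (cball 0 \<bar>R\<bar>) x)" for x
        using B[of x] R[of x] by (cases "x \<in> cball 0 \<bar>R\<bar>") auto
    qed auto
    then show ?thesis by (rule L2_integrable_bounded_support[of _ "cball 0 \<bar>R\<bar>"]) (auto intro: R)
  qed
  have Fi': "integrable lborel (\<lambda>x. F (c + x))" for c
    using Fi lborel_distr_plus[of c] integrable_distr_eq[of "(+) c" lborel borel F] by simp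
  have Q0: "(\<integral>x. Q n x \<partial>lborel) = 0" for n
    unfolding Q_def using Fi Fi' by (simp add: integral_shift)
  have "(\<lambda>n. \<integral>x. Q n x \<partial>lborel) \<longlonglongrightarrow> (\<integral>x. F' i x \<partial>lborel)"
  proof (rule integral_dominated_convergence)
    show "integrable lborel (\<lambda>x::real^2. M * indicator (cball 0 (\<bar>R\<bar> + 1)) x)"
      by (intro integrable_mult_right integrable_indicator_bounded) auto
    show "AE x in lborel. (\<lambda>n. Q n x) \<longlonglongrightarrow> F' i x"
    proof (rule AE_I2)
      fix x
      have "((\<lambda>s. F (x + s *\<^sub>R axis i 1)) has_derivative (\<lambda>s. \<Sum>j\<in>UNIV. (s *\<^sub>R axis i 1) $ j *\<^sub>R F' j x)) (at 0)"
        by (rule has_derivative_compose[of "\<lambda>s. x + s *\<^sub>R axis i 1" "\<lambda>s. s *\<^sub>R axis i 1" 0 UNIV F, simplified])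
          (auto intro!: derivative_eq_intros der)
      moreover have "(\<lambda>s. \<Sum>j\<in>UNIV. (s *\<^sub>R axis i (1::real)) $ j *\<^sub>R F' j x) = (\<lambda>s. s *\<^sub>R F' i x)"
      proof
        fix s :: real
        have "(\<Sum>j\<in>UNIV. (s *\<^sub>R axis i (1::real)) $ j *\<^sub>R F' j x) = (\<Sum>j\<in>UNIV. if j = i then s *\<^sub>R F' j x else 0)"
          by (intro sum.cong) (auto simp: axis_def)
        then show "(\<Sum>j\<in>UNIV. (s *\<^sub>R axis i (1::real)) $ j *\<^sub>R F' j x) = s *\<^sub>R F' i x" by simp
      qed
      ultimately have "((\<lambda>s. F (x + s *\<^sub>R axis i 1)) has_vector_derivative F' i x) (at 0)"
        by (simp add: has_vector_derivative_def)
      then have "((\<lambda>s. norm (F (x + s *\<^sub>R axis i 1) - F x - s *\<^sub>R F' i x) / norm s) \<longlongrightarrow> 0) (at 0)"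
        by (simp add: has_vector_derivative_def has_derivative_at)
      moreover have "filterlim t (at 0) sequentially"
        unfolding filterlim_at using tl t(1) by (auto intro!: always_eventually simp: less_imp_neq[symmetric] dest: less_imp_neq)
      ultimately have "(\<lambda>n. norm (F (x + t n *\<^sub>R axis i 1) - F x - t n *\<^sub>R F' i x) / norm (t n)) \<longlonglongrightarrow> 0"
        by (rule filterlim_compose)
      moreover have "norm (F (x + t n *\<^sub>R axis i 1) - F x - t n *\<^sub>R F' i x) / norm (t n) = norm (Q n x - F' i x)" for n
      proof -
        have "Q n x - F' i x = (1 / t n) *\<^sub>R (F (x + t n *\<^sub>R axis i 1) - F x - t n *\<^sub>R F' i x)"
          using t(1)[of n] by (simp add: Q_def scaleR_diff_right add.commute)
        then show ?thesis using t(1)[of n] by simp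
      qed
      ultimately have "(\<lambda>n. norm (Q n x - F' i x)) \<longlonglongrightarrow> 0" by simp
      then show "(\<lambda>n. Q n x) \<longlonglongrightarrow> F' i x" by (rule LIM_zero_cancel[OF tendsto_norm_zero_cancel])
    qed
    show "AE x in lborel. norm (Q n x) \<le> M * indicator (cball 0 (\<bar>R\<bar> + 1)) x" for n
    proof (rule AE_I2)
      fix x
      show "norm (Q n x) \<le> M * indicator (cball 0 (\<bar>R\<bar> + 1)) x"
      proof (cases "x \<in> cball 0 (\<bar>R\<bar> + 1)")
        case True
        let ?y = "t n *\<^sub>R axis i 1 + x"
        have y: "?y \<in> cball 0 (\<bar>R\<bar> + 2)"
          using norm_triangle_ineq[of "t n *\<^sub>R axis i (1::real)" x] t[of n] True by simp
        have "norm (F ?y - F x) \<le> M * norm (?y - x)"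
        proof (rule differentiable_bound[of "cball 0 (\<bar>R\<bar> + 2)"])
          fix z :: "real^2" assume "z \<in> cball 0 (\<bar>R\<bar> + 2)"
          then show "onorm (\<lambda>d::real^2. \<Sum>i\<in>UNIV. d $ i *\<^sub>R F' i z) \<le> M"
            using onorm_linear_combination[of "\<lambda>i. F' i z"] M by (meson order_trans)
        qed (use True y in \<open>auto intro!: has_derivative_at_withinI der\<close>)
        moreover have "norm (Q n x) = norm (F ?y - F x) / t n" unfolding Q_def norm_scaleR using t[of n] by simp
        ultimately show ?thesis using True t[of n] by (simp add: pos_divide_le_eq)
      next
        case False
        have "norm x \<le> norm (t n *\<^sub>R axis i 1 + x) + norm (t n *\<^sub>R axis i (1::real) :: real^2)"
          using norm_triangle_ineq4[of "t n *\<^sub>R axis i 1 + x" "t n *\<^sub>R axis i 1"] by simp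
        then have "norm (t n *\<^sub>R axis i 1 + x) > \<bar>R\<bar>" using False t[of n] by simp
        then show ?thesis using False R[of x] R[of "t n *\<^sub>R axis i 1 + x"] by (simp add: Q_def)
      qed
    qed
    show "Q n \<in> borel_measurable lborel" for n unfolding Q_def by measurable
  qed measurable
  then show ?thesis unfolding Q0 by (simp add: LIMSEQ_const_iff)
qed

text \<open>The second factor is differentiable only near the support of the first, as happens for
  mollified fields, which are controlled inside the disc only.\<close>
lemma integration_by_parts:
  fixes P :: "real^2 \<Rightarrow> 'b::euclidean_space"
  assumes q: "\<And>x. (q has_derivative (\<lambda>d. \<Sum>i\<in>UNIV. d $ i *\<^sub>R q' i x)) (at x)"
    and qc: "\<And>i. continuous_on UNIV (q' i)"
    and K: "compact K" "K \<subseteq> U" "open U" "\<And>x. x \<notin> K \<Longrightarrow> q x = 0" "\<And>x i. x \<notin> K \<Longrightarrow> q' i x = 0"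
    and P: "\<And>x. x \<in> U \<Longrightarrow> (P has_derivative (\<lambda>d. \<Sum>i\<in>UNIV. d $ i *\<^sub>R P' i x)) (at x)"
    and Pc: "\<And>i. continuous_on U (P' i)"
  shows "(\<integral>x. q' i x *\<^sub>R P x + q x *\<^sub>R P' i x \<partial>lborel) = 0"
proof -
  define F where "F x = q x *\<^sub>R P x" for x
  define F' where "F' i x = q' i x *\<^sub>R P x + q x *\<^sub>R P' i x" for i x
  have cov: "U \<union> - K = UNIV" using K(2) by auto
  have oK: "open (- K)" using K(1) by (simp add: compact_imp_closed open_Compl)
  have qcont: "continuous_on UNIV q" by (rule has_derivative_continuous_on[OF q])
  have Pcont: "continuous_on U P" by (rule has_derivative_continuous_on[of U P]) (auto intro: has_derivative_at_withinI P)
  have "(F has_derivative (\<lambda>d. \<Sum>i\<in>UNIV. d $ i *\<^sub>R F' i x)) (at x)" for x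
  proof (cases "x \<in> U")
    case True
    show ?thesis unfolding F_def F'_def
      by (rule has_derivative_eq_rhs[OF has_derivative_scaleR[OF q P[OF True]]])
        (auto simp: fun_eq_iff sum.distrib scaleR_right_distrib scaleR_sum_left scaleR_sum_right ac_simps)
  next
    case False
    then have x: "x \<in> - K" using cov by blast
    have "((\<lambda>_. 0) has_derivative (\<lambda>d. 0)) (at x)" by simp
    then have "(F has_derivative (\<lambda>d. 0)) (at x)"
      by (rule has_derivative_transform_within_open[OF _ oK x]) (simp add: F_def K)
    moreover have "F' i x = 0" for i using x K by (simp add: F'_def)
    ultimately show ?thesis by simp
  qed
  moreover have "continuous_on UNIV (F' i)" for i
  proof -
    have "continuous_on U (F' i)" unfolding F'_def
      by (intro continuous_on_add continuous_on_scaleR Pcont Pc continuous_on_subset[OF qc] continuous_on_subset[OF qcont]) auto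
    moreover have "continuous_on (- K) (F' i)"
      using continuous_on_cong[of "-K" "-K" "F' i" "\<lambda>_. 0"] K by (auto simp: F'_def)
    ultimately show ?thesis using continuous_on_open_Un[OF K(3) oK] cov by metis
  qed
  moreover obtain R where "\<And>x. x \<in> K \<Longrightarrow> norm x \<le> R" using compact_imp_bounded[OF K(1)] by (auto simp: bounded_iff)
  then have "F x = 0" if "norm x > R" for x using that K(4)[of x] by (force simp: F_def)
  ultimately have "(\<integral>x. F' i x \<partial>lborel) = 0" by (rule integral_partial_zero)
  then show ?thesis by (simp add: F'_def)
qed

section \<open>The Poincare inequality\<close>

lemma interval_Jensen:
  fixes f :: "real \<Rightarrow> 'b::euclidean_space"
  assumes c: "continuous_on {0..1} f"
  shows "L2 (\<lambda>t. indicator {0..1} t *\<^sub>R f t)"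
    "(norm (\<integral>t. indicator {0..1} t *\<^sub>R f t \<partial>lborel))\<^sup>2 \<le> n2 (\<lambda>t. indicator {0..1} t *\<^sub>R f t)"
proof -
  let ?g = "\<lambda>t. indicator {0..1} t *\<^sub>R f t"
  have "bounded (f ` {0..1})" by (intro compact_imp_bounded compact_continuous_image c) simp
  then obtain B where "\<forall>y\<in>f ` {0..1}. norm y \<le> B" unfolding bounded_iff ..
  then have B: "\<And>x. x \<in> {0..1} \<Longrightarrow> norm (f x) \<le> B" by blast
  have I: "L2 (indicator {0..1::real} :: real \<Rightarrow> real)" "n2 (indicator {0..1::real} :: real \<Rightarrow> real) = 1"
    using L2_indicator_bounded[of "{0..1::real}"] by auto
  show L: "L2 ?g"
  proof (rule L2_bound(1)[OF I(1), of _ "\<bar>B\<bar>"])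
    show "?g \<in> borel_measurable borel" by (rule borel_measurable_continuous_on_indicator[OF _ c]) simp
    show "norm (?g t) \<le> \<bar>B\<bar> * norm (indicat_real {0..1} t)" for t
      using B[of t] by (cases "t \<in> {0..1}") auto
  qed simp
  have "norm (\<integral>t. ?g t \<partial>lborel) \<le> (\<integral>t. norm (?g t) \<partial>lborel)" by (rule integral_norm_bound)
  also have "\<dots> = ip (indicator {0..1}) (\<lambda>t. norm (?g t))"
    unfolding ip_def by (intro Bochner_Integration.integral_cong) (auto simp: indicator_def)
  finally have "(norm (\<integral>t. ?g t \<partial>lborel))\<^sup>2 \<le> (ip (indicator {0..1}) (\<lambda>t. norm (?g t)))\<^sup>2"
    by (intro power_mono) auto
  also have "\<dots> \<le> n2 (indicator {0..1::real} :: real \<Rightarrow> real) * n2 (\<lambda>t. norm (?g t))"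
    by (rule ip_CS[OF I(1) L2_norm(1)[OF L]])
  also have "\<dots> = n2 ?g" unfolding I(2) L2_norm(2) by simp
  finally show "(norm (\<integral>t. ?g t \<partial>lborel))\<^sup>2 \<le> n2 ?g" .
qed

lemma norm_vec2_sq: "(norm (d::real^2))\<^sup>2 = (d $ 1)\<^sup>2 + (d $ 2)\<^sup>2"
  by (simp add: norm_vec_def L2_set_def UNIV_2)

lemma norm_directional_sq_le:
  fixes q :: "2 \<Rightarrow> 'b::real_normed_vector" and d :: "real^2"
  shows "(norm (\<Sum>i\<in>UNIV. d $ i *\<^sub>R q i))\<^sup>2 \<le> (norm d)\<^sup>2 * (\<Sum>i\<in>UNIV. (norm (q i))\<^sup>2)"
proof -
  define a b s t where "a = \<bar>d $ 1\<bar>" "b = \<bar>d $ 2\<bar>" "s = norm (q 1)" "t = norm (q 2)"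
  have "norm (\<Sum>i\<in>UNIV. d $ i *\<^sub>R q i) \<le> a * s + b * t"
    unfolding sum_UNIV_2 a_b_s_t_def by (rule order_trans[OF norm_triangle_ineq]) simp
  then have "(norm (\<Sum>i\<in>UNIV. d $ i *\<^sub>R q i))\<^sup>2 \<le> (a * s + b * t)\<^sup>2" by (intro power_mono) auto
  also have "\<dots> \<le> (a\<^sup>2 + b\<^sup>2) * (s\<^sup>2 + t\<^sup>2)"
    using zero_le_power2[of "a * t - b * s"] by (simp add: power2_eq_square algebra_simps)
  also have "\<dots> = (norm d)\<^sup>2 * (\<Sum>i\<in>UNIV. (norm (q i))\<^sup>2)"
    by (simp add: norm_vec2_sq sum_UNIV_2 a_b_s_t_def)
  finally show ?thesis .
qed

text \<open>Fundamental theorem of calculus along the first half of the segment from \<open>x\<close> to \<open>z\<close>. On that half the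
  factor \<open>1 - t/2\<close> in front of \<open>x\<close> stays above \<open>1/2\<close>, which makes \<open>x \<mapsto> (1 - t/2) x + (t/2) z\<close> a change of variables with
  bounded Jacobian.\<close>
lemma half_segment_bound:
  fixes u :: "real^2 \<Rightarrow> 'b::euclidean_space"
  assumes \<Omega>: "convex \<Omega>" "x \<in> \<Omega>" "z \<in> \<Omega>" "norm (x - z) \<le> d"
    and der: "\<And>y. y \<in> \<Omega> \<Longrightarrow> (u has_derivative (\<lambda>d. \<Sum>i\<in>UNIV. d $ i *\<^sub>R p i y)) (at y)"
    and pc: "\<And>i. continuous_on UNIV (p i)"
  shows "ennreal ((norm (u x - u ((1/2) *\<^sub>R (x + z))))\<^sup>2) \<le>
    ennreal (d\<^sup>2 / 4) * (\<integral>\<^sup>+t. indicator {0..1} t * (indicator \<Omega> ((1 - t/2) *\<^sub>R x + (t/2) *\<^sub>R z)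
       * ennreal (\<Sum>i\<in>UNIV. (norm (p i ((1 - t/2) *\<^sub>R x + (t/2) *\<^sub>R z)))\<^sup>2)) \<partial>lborel)"
proof -
  define \<gamma> where "\<gamma> t = (1 - t/2) *\<^sub>R x + (t/2) *\<^sub>R z" for t
  define e where "e = (1/2) *\<^sub>R (z - x)"
  have \<gamma>e: "\<gamma> t = x + t *\<^sub>R e" for t by (simp add: \<gamma>_def e_def algebra_simps)
  have \<gamma>\<Omega>: "\<gamma> t \<in> \<Omega>" if "t \<in> {0..1}" for t
    unfolding \<gamma>_def using that by (intro convexD[OF \<Omega>(1-3)]) auto
  define f where "f t = (\<Sum>i\<in>UNIV. e $ i *\<^sub>R p i (\<gamma> t))" for t
  have fc: "continuous_on {0..1} f" unfolding f_def \<gamma>e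
    by (intro continuous_on_sum continuous_on_scaleR continuous_on_const continuous_on_compose2[OF pc]) (auto intro!: continuous_intros)
  have FT: "(\<integral>t. indicator {0..1} t *\<^sub>R f t \<partial>lborel) = u (\<gamma> 1) - u (\<gamma> 0)"
  proof (rule integral_FTC_atLeastAtMost[OF _ _ fc])
    fix t :: real assume "0 \<le> t" "t \<le> 1"
    then have t: "\<gamma> t \<in> \<Omega>" using \<gamma>\<Omega> by simp
    have "((\<lambda>t. u (\<gamma> t)) has_derivative (\<lambda>s. \<Sum>i\<in>UNIV. (s *\<^sub>R e) $ i *\<^sub>R p i (\<gamma> t))) (at t within {0..1})"
      by (rule has_derivative_compose[of \<gamma> "\<lambda>s. s *\<^sub>R e" t "{0..1}" u "\<lambda>d. \<Sum>i\<in>UNIV. d $ i *\<^sub>R p i (\<gamma> t)", OF _ der[OF t]])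
        (auto simp: \<gamma>e[abs_def] intro!: derivative_eq_intros)
    then show "((\<lambda>t. u (\<gamma> t)) has_vector_derivative f t) (at t within {0..1})"
      by (simp add: has_vector_derivative_def f_def scaleR_sum_right)
  qed simp
  let ?G = "\<lambda>t. \<Sum>i\<in>UNIV. (norm (p i (\<gamma> t)))\<^sup>2"
  have ne: "(norm e)\<^sup>2 \<le> d\<^sup>2 / 4"
  proof -
    have "norm e \<le> d / 2" using \<Omega>(4) by (simp add: e_def norm_minus_commute)
    then have "(norm e)\<^sup>2 \<le> (d / 2)\<^sup>2" by (intro power_mono) auto
    then show ?thesis by (simp add: power_divide)
  qed
  have "ennreal ((norm (u x - u ((1/2) *\<^sub>R (x + z))))\<^sup>2) = ennreal ((norm (\<integral>t. indicator {0..1} t *\<^sub>R f t \<partial>lborel))\<^sup>2)"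
    unfolding FT by (simp add: \<gamma>_def norm_minus_commute scaleR_add_right)
  also have "\<dots> \<le> ennreal (n2 (\<lambda>t. indicator {0..1} t *\<^sub>R f t))"
    by (rule ennreal_leI[OF interval_Jensen(2)[OF fc]])
  also have "\<dots> = (\<integral>\<^sup>+t. ennreal ((norm (indicator {0..1} t *\<^sub>R f t))\<^sup>2) \<partial>lborel)"
    by (rule nn_integral_norm_sq[OF interval_Jensen(1)[OF fc], symmetric])
  also have "\<dots> \<le> (\<integral>\<^sup>+t. ennreal (d\<^sup>2 / 4) * (indicator {0..1} t * (indicator \<Omega> (\<gamma> t) * ennreal (?G t))) \<partial>lborel)"
  proof (rule nn_integral_mono)
    fix t :: real
    show "ennreal ((norm (indicator {0..1} t *\<^sub>R f t))\<^sup>2) \<le> ennreal (d\<^sup>2 / 4) * (indicator {0..1} t * (indicator \<Omega> (\<gamma> t) * ennreal (?G t)))"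
    proof (cases "t \<in> {0..1}")
      case True
      have "(norm (f t))\<^sup>2 \<le> (norm e)\<^sup>2 * ?G t" unfolding f_def by (rule norm_directional_sq_le)
      also have "\<dots> \<le> d\<^sup>2 / 4 * ?G t" by (intro mult_right_mono ne sum_nonneg) simp
      finally have "ennreal ((norm (f t))\<^sup>2) \<le> ennreal (d\<^sup>2 / 4 * ?G t)" by (rule ennreal_leI)
      also have "\<dots> = ennreal (d\<^sup>2 / 4) * ennreal (?G t)" by (rule ennreal_mult) (auto intro: sum_nonneg)
      finally show ?thesis using True \<gamma>\<Omega>[OF True] by simp
    qed simp
  qed
  also have "\<dots> = ennreal (d\<^sup>2 / 4) * (\<integral>\<^sup>+t. indicator {0..1} t * (indicator \<Omega> (\<gamma> t) * ennreal (?G t)) \<partial>lborel)"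
  proof (rule nn_integral_cmult)
    have "(\<lambda>t. ?G t) \<in> borel_measurable borel"
      by (intro borel_measurable_continuous_onI continuous_on_sum continuous_on_power continuous_on_norm continuous_on_compose2[OF pc])
        (auto simp: \<gamma>e intro!: continuous_intros)
    moreover have "(\<lambda>t. indicator {0..1} t * (indicator \<Omega> (\<gamma> t) * ennreal (?G t))) = (\<lambda>t. indicator {0..1} t * ennreal (?G t))"
      using \<gamma>\<Omega> by (auto simp: indicator_def fun_eq_iff)
    ultimately show "(\<lambda>t. indicator {0..1} t * (indicator \<Omega> (\<gamma> t) * ennreal (?G t))) \<in> borel_measurable lborel"
      by simp
  qed
  finally show ?thesis by (simp add: \<gamma>_def)
qed

lemma nn_integral_scale:
  fixes f :: "real^2 \<Rightarrow> ennreal"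
  assumes [measurable]: "f \<in> borel_measurable borel" and s: "s > 0"
  shows "(\<integral>\<^sup>+x. f (s *\<^sub>R x + c) \<partial>lborel) = ennreal (1 / s\<^sup>2) * (\<integral>\<^sup>+x. f x \<partial>lborel)"
proof -
  have "(\<integral>\<^sup>+x. f x \<partial>lborel) = (\<integral>\<^sup>+x. f x \<partial>(density (distr lborel borel (\<lambda>x. c + s *\<^sub>R x)) (\<lambda>_. ennreal (\<bar>s\<bar>^DIM(real^2)))))"
    using lborel_affine[of s c] s by simp
  also have "\<dots> = ennreal (s\<^sup>2) * (\<integral>\<^sup>+x. f (s *\<^sub>R x + c) \<partial>lborel)"
    using s by (simp add: nn_integral_density nn_integral_distr nn_integral_cmult add.commute power2_eq_square)
  finally have "ennreal (1 / s\<^sup>2) * (\<integral>\<^sup>+x. f x \<partial>lborel) = (ennreal (1 / s\<^sup>2) * ennreal (s\<^sup>2)) * (\<integral>\<^sup>+x. f (s *\<^sub>R x + c) \<partial>lborel)"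
    by (simp add: mult.assoc)
  also have "ennreal (1 / s\<^sup>2) * ennreal (s\<^sup>2) = 1" using s by (simp flip: ennreal_mult)
  finally show ?thesis by simp
qed

text \<open>Compare \<open>u(x)\<close> and \<open>u(z)\<close> with the value at the midpoint. Each half of the segment is covered by
  \<open>half_segment_bound\<close>, and the substitution costs at most a factor \<open>4\<close>.\<close>
lemma poincare_C1:
  fixes u :: "real^2 \<Rightarrow> 'b::euclidean_space"
  assumes \<Omega>: "convex \<Omega>" and [measurable]: "\<Omega> \<in> sets borel"
    and d: "\<And>x z. x \<in> \<Omega> \<Longrightarrow> z \<in> \<Omega> \<Longrightarrow> norm (x - z) \<le> d"
    and der: "\<And>y. y \<in> \<Omega> \<Longrightarrow> (u has_derivative (\<lambda>d. \<Sum>i\<in>UNIV. d $ i *\<^sub>R p i y)) (at y)"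
    and pc: "\<And>i. continuous_on UNIV (p i)" and [measurable]: "u \<in> borel_measurable borel"
  shows "(\<integral>\<^sup>+z. \<integral>\<^sup>+x. indicator \<Omega> z * (indicator \<Omega> x * ennreal ((norm (u x - u z))\<^sup>2)) \<partial>lborel \<partial>lborel)
    \<le> ennreal (4 * d\<^sup>2) * (emeasure lborel \<Omega> * (\<integral>\<^sup>+x. indicator \<Omega> x * ennreal (\<Sum>i\<in>UNIV. (norm (p i x))\<^sup>2) \<partial>lborel))"
proof -
  have [measurable]: "p i \<in> borel_measurable borel" for i by (rule borel_measurable_continuous_onI[OF pc])
  define G where "G y = (indicator \<Omega> y * ennreal (\<Sum>i\<in>UNIV. (norm (p i y))\<^sup>2) :: ennreal)" for y
  have [measurable]: "G \<in> borel_measurable borel" unfolding G_def by measurable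
  define h where "h z x = (indicator \<Omega> z * (indicator \<Omega> x * ennreal ((norm (u x - u ((1/2) *\<^sub>R (x + z))))\<^sup>2)) :: ennreal)" for z x
  have hm[measurable]: "(\<lambda>(z, x). h z x) \<in> borel_measurable (lborel \<Otimes>\<^sub>M lborel)" unfolding h_def by measurable
  have hz: "(\<integral>\<^sup>+x. h z x \<partial>lborel) \<le> indicator \<Omega> z * (ennreal (d\<^sup>2) * (\<integral>\<^sup>+y. G y \<partial>lborel))" for z
  proof (cases "z \<in> \<Omega>")
    case True
    have "(\<integral>\<^sup>+x. h z x \<partial>lborel) \<le> (\<integral>\<^sup>+x. ennreal (d\<^sup>2 / 4) * (\<integral>\<^sup>+t. indicator {0..1} t * G ((1 - t/2) *\<^sub>R x + (t/2) *\<^sub>R z) \<partial>lborel) \<partial>lborel)"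
    proof (rule nn_integral_mono)
      fix x
      show "h z x \<le> ennreal (d\<^sup>2 / 4) * (\<integral>\<^sup>+t. indicator {0..1} t * G ((1 - t/2) *\<^sub>R x + (t/2) *\<^sub>R z) \<partial>lborel)"
        using half_segment_bound[OF \<Omega> _ True d der pc, of x] True
        by (cases "x \<in> \<Omega>") (auto simp: h_def G_def)
    qed
    also have "\<dots> = ennreal (d\<^sup>2 / 4) * (\<integral>\<^sup>+x. \<integral>\<^sup>+t. indicator {0..1} t * G ((1 - t/2) *\<^sub>R x + (t/2) *\<^sub>R z) \<partial>lborel \<partial>lborel)"
      by (rule nn_integral_cmult) measurable
    also have "(\<integral>\<^sup>+x. \<integral>\<^sup>+t. indicator {0..1} t * G ((1 - t/2) *\<^sub>R x + (t/2) *\<^sub>R z) \<partial>lborel \<partial>lborel)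
       = (\<integral>\<^sup>+t. \<integral>\<^sup>+x. indicator {0..1} t * G ((1 - t/2) *\<^sub>R x + (t/2) *\<^sub>R z) \<partial>lborel \<partial>lborel)"
      by (rule lborel_pair.Fubini') measurable
    also have "\<dots> \<le> (\<integral>\<^sup>+t. indicator {0..1::real} t * (4 * (\<integral>\<^sup>+y. G y \<partial>lborel)) \<partial>lborel)"
    proof (rule nn_integral_mono)
      fix t :: real
      show "(\<integral>\<^sup>+x. indicator {0..1} t * G ((1 - t/2) *\<^sub>R x + (t/2) *\<^sub>R z) \<partial>lborel) \<le> indicator {0..1} t * (4 * (\<integral>\<^sup>+y. G y \<partial>lborel))"
      proof (cases "t \<in> {0..1}")
        case True
        then have s: "1 - t/2 \<ge> 1/2" by simp
        have "(1/2)\<^sup>2 \<le> (1 - t/2)\<^sup>2" using s by (intro power_mono) auto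
        then have "1 / (1 - t/2)\<^sup>2 \<le> 1 / (1/2)\<^sup>2" using s by (intro divide_left_mono) auto
        then have "ennreal (1 / (1 - t/2)\<^sup>2) \<le> 4" using ennreal_leI[of "1 / (1 - t/2)\<^sup>2" 4] by (simp add: power2_eq_square)
        then show ?thesis using True nn_integral_scale[of G "1 - t/2" "(t/2) *\<^sub>R z"] s by (auto intro: mult_right_mono)
      qed simp
    qed
    also have "\<dots> = 4 * (\<integral>\<^sup>+y. G y \<partial>lborel)" by (simp add: nn_integral_multc)
    finally have "(\<integral>\<^sup>+x. h z x \<partial>lborel) \<le> ennreal (d\<^sup>2 / 4) * (4 * (\<integral>\<^sup>+y. G y \<partial>lborel))"
      by (simp add: mult_left_mono)
    also have "\<dots> = ennreal (d\<^sup>2 / 4 * 4) * (\<integral>\<^sup>+y. G y \<partial>lborel)"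
      by (subst ennreal_mult) (auto simp: mult.assoc)
    finally show ?thesis using True by simp
  qed (simp add: h_def)
  have I: "(\<integral>\<^sup>+z. \<integral>\<^sup>+x. h z x \<partial>lborel \<partial>lborel) \<le> emeasure lborel \<Omega> * (ennreal (d\<^sup>2) * (\<integral>\<^sup>+y. G y \<partial>lborel))"
  proof -
    have "(\<integral>\<^sup>+z. \<integral>\<^sup>+x. h z x \<partial>lborel \<partial>lborel) \<le> (\<integral>\<^sup>+z. indicator \<Omega> z * (ennreal (d\<^sup>2) * (\<integral>\<^sup>+y. G y \<partial>lborel)) \<partial>lborel)"
      by (intro nn_integral_mono hz)
    then show ?thesis by (simp add: nn_integral_multc)
  qed
  have sw: "(\<integral>\<^sup>+z. \<integral>\<^sup>+x. h x z \<partial>lborel \<partial>lborel) = (\<integral>\<^sup>+z. \<integral>\<^sup>+x. h z x \<partial>lborel \<partial>lborel)"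
    by (rule lborel_pair.Fubini') (use hm in \<open>simp add: h_def add.commute\<close>)
  have pt: "indicator \<Omega> z * (indicator \<Omega> x * ennreal ((norm (u x - u z))\<^sup>2)) \<le> 2 * h z x + 2 * h x z" for x z
  proof (cases "x \<in> \<Omega> \<and> z \<in> \<Omega>")
    case True
    let ?m = "(1/2) *\<^sub>R (x + z)"
    have "(norm (u x - u z))\<^sup>2 \<le> 2 * (norm (u x - u ?m))\<^sup>2 + 2 * (norm (u z - u ?m))\<^sup>2"
      using norm_add_sq_le[of "u x - u ?m" "u ?m - u z"] by (simp add: norm_minus_commute)
    then have "ennreal ((norm (u x - u z))\<^sup>2) \<le> ennreal (2 * (norm (u x - u ?m))\<^sup>2 + 2 * (norm (u z - u ?m))\<^sup>2)"
      by (rule ennreal_leI)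
    then show ?thesis using True by (simp add: h_def ennreal_mult add.commute ennreal_plus)
  qed (auto simp: indicator_def)
  have "(\<integral>\<^sup>+z. \<integral>\<^sup>+x. indicator \<Omega> z * (indicator \<Omega> x * ennreal ((norm (u x - u z))\<^sup>2)) \<partial>lborel \<partial>lborel)
     \<le> (\<integral>\<^sup>+z. \<integral>\<^sup>+x. 2 * h z x + 2 * h x z \<partial>lborel \<partial>lborel)"
    by (intro nn_integral_mono pt)
  also have "\<dots> = 2 * (\<integral>\<^sup>+z. \<integral>\<^sup>+x. h z x \<partial>lborel \<partial>lborel) + 2 * (\<integral>\<^sup>+z. \<integral>\<^sup>+x. h x z \<partial>lborel \<partial>lborel)"
  proof -
    have [measurable]: "(\<lambda>x. h z x) \<in> borel_measurable lborel" "(\<lambda>x. h x z) \<in> borel_measurable lborel" for z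
      unfolding h_def by measurable
    have [measurable]: "(\<lambda>z. \<integral>\<^sup>+x. h z x \<partial>lborel) \<in> borel_measurable lborel" "(\<lambda>z. \<integral>\<^sup>+x. h x z \<partial>lborel) \<in> borel_measurable lborel"
      unfolding h_def by measurable
    show ?thesis by (simp add: nn_integral_add nn_integral_cmult)
  qed
  also have "\<dots> = 4 * (\<integral>\<^sup>+z. \<integral>\<^sup>+x. h z x \<partial>lborel \<partial>lborel)" unfolding sw by (simp flip: distrib_right)
  also have "\<dots> \<le> 4 * (emeasure lborel \<Omega> * (ennreal (d\<^sup>2) * (\<integral>\<^sup>+y. G y \<partial>lborel)))"
    by (intro mult_left_mono I) simp
  also have "\<dots> = ennreal (4 * d\<^sup>2) * (emeasure lborel \<Omega> * (\<integral>\<^sup>+y. G y \<partial>lborel))"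
    by (simp add: ennreal_mult ac_simps)
  finally show ?thesis by (simp add: G_def)
qed

lemma L2_restrict:
  assumes "L2 f" "\<Omega> \<in> sets borel"
  shows "L2 (\<lambda>x. indicator \<Omega> x *\<^sub>R f x)" "n2 (\<lambda>x. indicator \<Omega> x *\<^sub>R f x) \<le> n2 f"
proof -
  have "L2 (\<lambda>x. indicator \<Omega> x *\<^sub>R f x) \<and> n2 (\<lambda>x. indicator \<Omega> x *\<^sub>R f x) \<le> 1\<^sup>2 * n2 f"
    using assms by (intro conjI L2_bound[OF assms(1), of _ 1]) (auto simp: indicator_def intro!: borel_measurable_scaleR L2_measurable)
  then show "L2 (\<lambda>x. indicator \<Omega> x *\<^sub>R f x)" "n2 (\<lambda>x. indicator \<Omega> x *\<^sub>R f x) \<le> n2 f" by auto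
qed

lemma restrict_tendsto:
  assumes "\<And>n. L2 (f n)" "L2 g" "(\<lambda>n. n2 (\<lambda>x. f n x - g x)) \<longlonglongrightarrow> 0" "\<Omega> \<in> sets borel"
  shows "(\<lambda>n. n2 (\<lambda>x. indicator \<Omega> x *\<^sub>R f n x - indicator \<Omega> x *\<^sub>R g x)) \<longlonglongrightarrow> 0"
proof (rule tendsto_sandwich[OF _ _ tendsto_const assms(3)])
  have "n2 (\<lambda>x. indicator \<Omega> x *\<^sub>R f n x - indicator \<Omega> x *\<^sub>R g x) \<le> n2 (\<lambda>x. f n x - g x)" for n
    using L2_restrict(2)[OF L2_diff(1)[OF assms(1)[of n] assms(2)] assms(4)] by (simp add: scaleR_diff_right)
  then show "\<forall>\<^sub>F n in sequentially. n2 (\<lambda>x. indicator \<Omega> x *\<^sub>R f n x - indicator \<Omega> x *\<^sub>R g x) \<le> n2 (\<lambda>x. f n x - g x)"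
    by (intro always_eventually allI)
qed simp

lemma nn_gradient:
  assumes "\<And>i. L2 (p i :: real^2 \<Rightarrow> 'b::euclidean_space)" "\<Omega> \<in> sets borel"
  shows "(\<integral>\<^sup>+x. indicator \<Omega> x * ennreal (\<Sum>i\<in>(UNIV::2 set). (norm (p i x))\<^sup>2) \<partial>lborel)
     = ennreal (\<Sum>i\<in>UNIV. n2 (\<lambda>x. indicator \<Omega> x *\<^sub>R p i x))"
proof -
  have "(\<integral>\<^sup>+x. indicator \<Omega> x * ennreal (\<Sum>i\<in>UNIV. (norm (p i x))\<^sup>2) \<partial>lborel)
    = (\<integral>\<^sup>+x. ennreal (\<Sum>i\<in>UNIV. (norm (indicator \<Omega> x *\<^sub>R p i x))\<^sup>2) \<partial>lborel)"
    by (intro nn_integral_cong) (auto simp: indicator_def)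
  also have "\<dots> = ennreal (\<integral>x. (\<Sum>i\<in>UNIV. (norm (indicator \<Omega> x *\<^sub>R p i x))\<^sup>2) \<partial>lborel)"
    using L2_integrable[OF L2_restrict(1)[OF assms]] by (intro nn_integral_eq_integral) (auto intro!: sum_nonneg)
  also have "(\<integral>x. (\<Sum>i\<in>UNIV. (norm (indicator \<Omega> x *\<^sub>R p i x))\<^sup>2) \<partial>lborel) = (\<Sum>i\<in>UNIV. n2 (\<lambda>x. indicator \<Omega> x *\<^sub>R p i x))"
    unfolding n2_def by (rule Bochner_Integration.integral_sum) (rule L2_integrable[OF L2_restrict(1)[OF assms]])
  finally show ?thesis .
qed

text \<open>Mollification and Fatou's lemma, on the sets obtained by intersecting \<open>\<Omega>\<close> with slightly smaller discs, where the
  mollified gradient is the gradient of the mollified map.\<close>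
lemma poincare_weak_deriv:
  fixes u :: "real^2 \<Rightarrow> 'b::euclidean_space"
  assumes \<Omega>: "convex \<Omega>" and \<Omega>m[measurable]: "\<Omega> \<in> sets borel" and sub: "\<Omega> \<subseteq> B1"
    and d: "\<And>x z. x \<in> \<Omega> \<Longrightarrow> z \<in> \<Omega> \<Longrightarrow> norm (x - z) \<le> d"
    and u: "L2B u" and v: "\<And>i. L2B (v i)" and w: "\<And>i. weak_deriv i u (v i)"
  shows "(\<integral>\<^sup>+z. \<integral>\<^sup>+x. indicator \<Omega> z * (indicator \<Omega> x * ennreal ((norm (u x - u z))\<^sup>2)) \<partial>lborel \<partial>lborel)
    \<le> ennreal (4 * d\<^sup>2) * (emeasure lborel \<Omega> * ennreal (\<Sum>i\<in>UNIV. n2 (\<lambda>x. indicator \<Omega> x *\<^sub>R v i x)))"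
proof -
  note uL = L2B_L2[OF u] and vL = L2B_L2[OF v]
  obtain r where r: "strict_mono r" "AE x in lborel. (\<lambda>n. mollify (eta (r n)) u x) \<longlonglongrightarrow> u x"
    by (rule L2_AE_subseq[OF eta_tendsto(1)[OF uL] uL eta_tendsto(2)[OF uL]])
  define U where "U n = mollify (eta (r n)) u" for n
  define V where "V n i = mollify (eta (r n)) (v i)" for n i
  have Um[measurable]: "U n \<in> borel_measurable borel" for n
    unfolding U_def by (rule borel_measurable_continuous_onI[OF mollify_eta_continuous[OF u]])
  have um[measurable]: "u \<in> borel_measurable borel" using uL by (simp add: L2_def)
  (* On this part of Omega the n-th kernel, of side at most 1 / Suc (r n), does not leave the disc. *)
  define O' where "O' n = \<Omega> \<inter> ball 0 (1 - 2 / real (Suc (r n)))" for n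
  have O'm[measurable]: "O' n \<in> sets borel" for n unfolding O'_def by measurable
  have O'lim: "(\<lambda>n. indicator (O' n) x :: ennreal) \<longlonglongrightarrow> indicator \<Omega> x" for x
  proof (cases "x \<in> \<Omega>")
    case True
    then have "norm x < 1" using sub by auto
    have "(\<lambda>n. 1 - 2 * (1 / real (Suc (r n)))) \<longlonglongrightarrow> 1 - 2 * 0"
      using LIMSEQ_subseq_LIMSEQ[OF LIMSEQ_Suc[OF lim_1_over_n] r(1)] by (intro tendsto_intros) (simp add: o_def)
    then have "\<forall>\<^sub>F n in sequentially. norm x < 1 - 2 * (1 / real (Suc (r n)))"
      using \<open>norm x < 1\<close> by (intro order_tendstoD(1)) auto
    then have "\<forall>\<^sub>F n in sequentially. indicator \<Omega> x = (indicator (O' n) x :: ennreal)"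
      by eventually_elim (use True in \<open>simp add: O'_def\<close>)
    then show ?thesis by (rule Lim_transform_eventually[OF tendsto_const])
  qed (simp add: O'_def)
  define I where "I n z x = (indicator (O' n) z * (indicator (O' n) x * ennreal ((norm (U n x - U n z))\<^sup>2)) :: ennreal)" for n z x
  have Im[measurable]: "(\<lambda>(z, x). I n z x) \<in> borel_measurable (lborel \<Otimes>\<^sub>M lborel)" for n unfolding I_def by measurable
  have Im2[measurable]: "I n z \<in> borel_measurable lborel" for n z unfolding I_def by measurable
  have Im3[measurable]: "(\<lambda>z. \<integral>\<^sup>+x. I n z x \<partial>lborel) \<in> borel_measurable lborel" for n by measurable
  have step: "(\<integral>\<^sup>+z. \<integral>\<^sup>+x. I n z x \<partial>lborel \<partial>lborel) \<le>
     ennreal (4 * d\<^sup>2) * (emeasure lborel \<Omega> * ennreal (\<Sum>i\<in>UNIV. n2 (\<lambda>x. indicator \<Omega> x *\<^sub>R V n i x)))" for n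
  proof -
    have "(\<integral>\<^sup>+z. \<integral>\<^sup>+x. I n z x \<partial>lborel \<partial>lborel) \<le>
      ennreal (4 * d\<^sup>2) * (emeasure lborel (O' n) * (\<integral>\<^sup>+x. indicator (O' n) x * ennreal (\<Sum>i\<in>UNIV. (norm (V n i x))\<^sup>2) \<partial>lborel))"
      unfolding I_def
    proof (rule poincare_C1)
      show "convex (O' n)" unfolding O'_def using \<Omega> by (intro convex_Int) auto
      show "(U n has_derivative (\<lambda>d. \<Sum>i\<in>UNIV. d $ i *\<^sub>R V n i y)) (at y)" if "y \<in> O' n" for y
        unfolding U_def V_def by (rule mollify_weak_deriv_has_derivative[OF u w]) (use that in \<open>simp add: O'_def\<close>)
      show "continuous_on UNIV (V n i)" for i unfolding V_def by (rule mollify_eta_continuous[OF v])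
    qed (use d in \<open>auto simp: O'_def\<close>)
    also have "\<dots> \<le> ennreal (4 * d\<^sup>2) * (emeasure lborel \<Omega> * (\<integral>\<^sup>+x. indicator \<Omega> x * ennreal (\<Sum>i\<in>UNIV. (norm (V n i x))\<^sup>2) \<partial>lborel))"
      by (intro mult_left_mono mult_mono emeasure_mono nn_integral_mono mult_right_mono) (auto simp: O'_def indicator_def)
    also have "(\<integral>\<^sup>+x. indicator \<Omega> x * ennreal (\<Sum>i\<in>UNIV. (norm (V n i x))\<^sup>2) \<partial>lborel) = ennreal (\<Sum>i\<in>UNIV. n2 (\<lambda>x. indicator \<Omega> x *\<^sub>R V n i x))"
      by (rule nn_gradient) (auto simp: V_def intro!: eta_tendsto(1) vL)
    finally show ?thesis .
  qed
  have pt: "AE z in lborel. (\<integral>\<^sup>+x. indicator \<Omega> z * (indicator \<Omega> x * ennreal ((norm (u x - u z))\<^sup>2)) \<partial>lborel)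
     \<le> liminf (\<lambda>n. \<integral>\<^sup>+x. I n z x \<partial>lborel)"
    using r(2)
  proof eventually_elim
    case (elim z)
    have "(\<integral>\<^sup>+x. indicator \<Omega> z * (indicator \<Omega> x * ennreal ((norm (u x - u z))\<^sup>2)) \<partial>lborel) = (\<integral>\<^sup>+x. liminf (\<lambda>n. I n z x) \<partial>lborel)"
    proof (rule nn_integral_cong_AE)
      show "AE x in lborel. indicator \<Omega> z * (indicator \<Omega> x * ennreal ((norm (u x - u z))\<^sup>2)) = liminf (\<lambda>n. I n z x)"
        using r(2)
      proof eventually_elim
        fix x assume x: "(\<lambda>n. mollify (eta (r n)) u x) \<longlonglongrightarrow> u x"
        have e: "(\<lambda>n. ennreal ((norm (U n x - U n z))\<^sup>2)) \<longlonglongrightarrow> ennreal ((norm (u x - u z))\<^sup>2)"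
          unfolding U_def by (intro tendsto_ennrealI tendsto_intros x elim)
        show "indicator \<Omega> z * (indicator \<Omega> x * ennreal ((norm (u x - u z))\<^sup>2)) = liminf (\<lambda>n. I n z x)"
        proof (cases "x \<in> \<Omega> \<and> z \<in> \<Omega>")
          case True
          have "\<forall>\<^sub>F n in sequentially. (indicator (O' n) z :: ennreal) > 0" "\<forall>\<^sub>F n in sequentially. (indicator (O' n) x :: ennreal) > 0"
            using order_tendstoD(1)[OF O'lim[of z], of 0] order_tendstoD(1)[OF O'lim[of x], of 0] True by auto
          then have "\<forall>\<^sub>F n in sequentially. ennreal ((norm (U n x - U n z))\<^sup>2) = I n z x"
            by eventually_elim (auto simp: I_def indicator_def split: if_splits)
          with e have "(\<lambda>n. I n z x) \<longlonglongrightarrow> ennreal ((norm (u x - u z))\<^sup>2)" by (rule Lim_transform_eventually)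
          then show ?thesis using True by (simp add: lim_imp_Liminf)
        next
          case False
          then have "I n z x = 0" for n by (auto simp: I_def O'_def indicator_def)
          then show ?thesis using False by (auto simp: Liminf_const)
        qed
      qed
    qed
    also have "\<dots> \<le> liminf (\<lambda>n. \<integral>\<^sup>+x. I n z x \<partial>lborel)" by (rule nn_integral_liminf) measurable
    finally show ?case .
  qed
  have "(\<integral>\<^sup>+z. \<integral>\<^sup>+x. indicator \<Omega> z * (indicator \<Omega> x * ennreal ((norm (u x - u z))\<^sup>2)) \<partial>lborel \<partial>lborel)
     \<le> (\<integral>\<^sup>+z. liminf (\<lambda>n. \<integral>\<^sup>+x. I n z x \<partial>lborel) \<partial>lborel)"
    by (rule nn_integral_mono_AE[OF pt])
  also have "\<dots> \<le> liminf (\<lambda>n. \<integral>\<^sup>+z. \<integral>\<^sup>+x. I n z x \<partial>lborel \<partial>lborel)"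
    by (rule nn_integral_liminf) measurable
  also have "\<dots> \<le> liminf (\<lambda>n. ennreal (4 * d\<^sup>2) * (emeasure lborel \<Omega> * ennreal (\<Sum>i\<in>UNIV. n2 (\<lambda>x. indicator \<Omega> x *\<^sub>R V n i x))))"
    by (intro Liminf_mono always_eventually allI step)
  also have "\<dots> = ennreal (4 * d\<^sup>2) * (emeasure lborel \<Omega> * ennreal (\<Sum>i\<in>UNIV. n2 (\<lambda>x. indicator \<Omega> x *\<^sub>R v i x)))"
  proof (rule lim_imp_Liminf)
    have VL: "L2 (V n i)" for n i unfolding V_def by (rule eta_tendsto(1)[OF vL])
    have "(\<lambda>n. n2 (\<lambda>x. V n i x - v i x)) \<longlonglongrightarrow> 0" for i
      using LIMSEQ_subseq_LIMSEQ[OF eta_tendsto(2)[OF vL] r(1)] by (simp add: V_def o_def)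
    from restrict_tendsto[OF VL vL this \<Omega>m]
    have "(\<lambda>n. n2 (\<lambda>x. indicator \<Omega> x *\<^sub>R V n i x)) \<longlonglongrightarrow> n2 (\<lambda>x. indicator \<Omega> x *\<^sub>R v i x)" for i
      by (intro n2_tendsto L2_restrict(1) VL vL \<Omega>m)
    then have "(\<lambda>n. ennreal (\<Sum>i\<in>UNIV. n2 (\<lambda>x. indicator \<Omega> x *\<^sub>R V n i x))) \<longlonglongrightarrow> ennreal (\<Sum>i\<in>UNIV. n2 (\<lambda>x. indicator \<Omega> x *\<^sub>R v i x))"
      by (intro tendsto_ennrealI tendsto_sum)
    moreover have "emeasure lborel \<Omega> < top"
      using emeasure_bounded_finite[of \<Omega>] bounded_subset[OF bounded_ball sub] by (simp add: less_top)
    ultimately show "(\<lambda>n. ennreal (4 * d\<^sup>2) * (emeasure lborel \<Omega> * ennreal (\<Sum>i\<in>UNIV. n2 (\<lambda>x. indicator \<Omega> x *\<^sub>R V n i x))))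
       \<longlonglongrightarrow> ennreal (4 * d\<^sup>2) * (emeasure lborel \<Omega> * ennreal (\<Sum>i\<in>UNIV. n2 (\<lambda>x. indicator \<Omega> x *\<^sub>R v i x)))"
      by (intro ennreal_tendsto_cmult) auto
  qed simp
  finally show ?thesis .
qed

text \<open>Expanding the square in the double integral of \<open>|u(x) - u(z)|\<^sup>2\<close> gives twice the measure times the
  squared norm minus twice the squared integral. Nothing is divided by the measure, so null sets are harmless.\<close>
lemma poincare_mean:
  fixes u :: "real^2 \<Rightarrow> 'b::euclidean_space"
  assumes \<Omega>: "convex \<Omega>" and \<Omega>m[measurable]: "\<Omega> \<in> sets borel" and sub: "\<Omega> \<subseteq> B1"
    and d: "\<And>x z. x \<in> \<Omega> \<Longrightarrow> z \<in> \<Omega> \<Longrightarrow> norm (x - z) \<le> d"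
    and u: "L2B u" and v: "\<And>i. L2B (v i)" and w: "\<And>i. weak_deriv i u (v i)"
  shows "measure lborel \<Omega> * n2 (\<lambda>x. indicator \<Omega> x *\<^sub>R u x)
    \<le> 2 * d\<^sup>2 * measure lborel \<Omega> * (\<Sum>i\<in>UNIV. n2 (\<lambda>x. indicator \<Omega> x *\<^sub>R v i x))
      + (norm (\<integral>x. indicator \<Omega> x *\<^sub>R u x \<partial>lborel))\<^sup>2"
proof -
  define U where "U x = indicator \<Omega> x *\<^sub>R u x" for x
  define S where "S = (\<integral>x. U x \<partial>lborel)"
  define m where "m = measure lborel \<Omega>"
  have bd: "bounded \<Omega>" using bounded_subset[OF bounded_ball sub] .
  have em: "emeasure lborel \<Omega> = ennreal m"
    unfolding m_def using emeasure_bounded_finite[OF bd] by (simp add: emeasure_eq_ennreal_measure less_top)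
  have UL: "L2 U" unfolding U_def by (rule L2_restrict(1)[OF L2B_L2[OF u] \<Omega>m])
  have Ui: "integrable lborel U" by (rule L2_integrable_bounded_support[OF UL bd \<Omega>m]) (simp add: U_def)
  have ii: "integrable lborel (indicator \<Omega> :: _ \<Rightarrow> real)" by (rule integrable_indicator_bounded[OF bd \<Omega>m])
  have UN: "integrable lborel (\<lambda>x. (norm (U x))\<^sup>2)" by (rule L2_integrable[OF UL])
  (* The inner integral over x, expanded in powers of u z. *)
  define J where "J z = n2 U - 2 * (S \<bullet> u z) + m * (norm (u z))\<^sup>2" for z
  have e1: "indicator \<Omega> x * (norm (u x - u z))\<^sup>2 = (norm (U x))\<^sup>2 - 2 * (U x \<bullet> u z) + indicator \<Omega> x * (norm (u z))\<^sup>2" for x z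
    by (cases "x \<in> \<Omega>") (simp_all add: U_def power2_norm_eq_inner algebra_simps inner_commute)
  have i1: "integrable lborel (\<lambda>x. indicator \<Omega> x * (norm (u x - u z))\<^sup>2)"
   and J: "(\<integral>x. indicator \<Omega> x * (norm (u x - u z))\<^sup>2 \<partial>lborel) = J z" for z
  proof -
    have a: "integrable lborel (\<lambda>x. 2 * (U x \<bullet> u z))" "integrable lborel (\<lambda>x. indicator \<Omega> x * (norm (u z))\<^sup>2)"
      using Ui ii by auto
    show "integrable lborel (\<lambda>x. indicator \<Omega> x * (norm (u x - u z))\<^sup>2)" unfolding e1
      by (intro Bochner_Integration.integrable_add Bochner_Integration.integrable_diff UN a)
    have "(\<integral>x. indicator \<Omega> x * (norm (u x - u z))\<^sup>2 \<partial>lborel) = (\<integral>x. (norm (U x))\<^sup>2 \<partial>lborel) - (\<integral>x. 2 * (U x \<bullet> u z) \<partial>lborel)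
       + (\<integral>x. indicator \<Omega> x * (norm (u z))\<^sup>2 \<partial>lborel)"
      unfolding e1 by (simp only: Bochner_Integration.integral_add[OF Bochner_Integration.integrable_diff[OF UN a(1)] a(2)] Bochner_Integration.integral_diff[OF UN a(1)])
    also have "\<dots> = J z" using Ui ii by (simp add: J_def n2_def S_def m_def)
    finally show "(\<integral>x. indicator \<Omega> x * (norm (u x - u z))\<^sup>2 \<partial>lborel) = J z" .
  qed
  have J0: "J z \<ge> 0" for z unfolding J[symmetric] by (rule integral_nonneg_AE) simp
  have e2: "indicator \<Omega> z * J z = n2 U * indicator \<Omega> z - 2 * (S \<bullet> U z) + m * (norm (U z))\<^sup>2" for z
    by (cases "z \<in> \<Omega>") (simp_all add: U_def J_def)
  have a: "integrable lborel (\<lambda>z. n2 U * indicator \<Omega> z)" "integrable lborel (\<lambda>z. 2 * (S \<bullet> U z))" "integrable lborel (\<lambda>z. m * (norm (U z))\<^sup>2)"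
    using ii Ui UN by auto
  have i2: "integrable lborel (\<lambda>z. indicator \<Omega> z * J z)" unfolding e2
    by (intro Bochner_Integration.integrable_add Bochner_Integration.integrable_diff a)
  have "(\<integral>z. indicator \<Omega> z * J z \<partial>lborel) = (\<integral>z. n2 U * indicator \<Omega> z \<partial>lborel) - (\<integral>z. 2 * (S \<bullet> U z) \<partial>lborel) + (\<integral>z. m * (norm (U z))\<^sup>2 \<partial>lborel)"
    unfolding e2 by (simp only: Bochner_Integration.integral_add[OF Bochner_Integration.integrable_diff[OF a(1,2)] a(3)] Bochner_Integration.integral_diff[OF a(1,2)])
  also have "\<dots> = 2 * m * n2 U - 2 * (norm S)\<^sup>2"
    using Ui ii UN by (simp add: n2_def S_def m_def power2_norm_eq_inner)
  finally have tot: "(\<integral>z. indicator \<Omega> z * J z \<partial>lborel) = 2 * m * n2 U - 2 * (norm S)\<^sup>2" .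
  have in1: "(\<integral>\<^sup>+x. indicator \<Omega> z * (indicator \<Omega> x * ennreal ((norm (u x - u z))\<^sup>2)) \<partial>lborel) = ennreal (indicator \<Omega> z * J z)" for z
  proof -
    have "(\<integral>\<^sup>+x. indicator \<Omega> z * (indicator \<Omega> x * ennreal ((norm (u x - u z))\<^sup>2)) \<partial>lborel)
       = (\<integral>\<^sup>+x. ennreal (indicator \<Omega> z * (indicator \<Omega> x * (norm (u x - u z))\<^sup>2)) \<partial>lborel)"
      by (intro nn_integral_cong) (auto simp: indicator_def)
    also have "\<dots> = ennreal (\<integral>x. indicator \<Omega> z * (indicator \<Omega> x * (norm (u x - u z))\<^sup>2) \<partial>lborel)"
      by (rule nn_integral_eq_integral) (use i1 in auto)
    finally show ?thesis using i1 J by simp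
  qed
  let ?D = "\<Sum>i\<in>UNIV. n2 (\<lambda>x. indicator \<Omega> x *\<^sub>R v i x)"
  have D0: "?D \<ge> 0" by (intro sum_nonneg) simp
  have m0: "m \<ge> 0" by (simp add: m_def)
  have "ennreal (2 * m * n2 U - 2 * (norm S)\<^sup>2) = (\<integral>\<^sup>+z. ennreal (indicator \<Omega> z * J z) \<partial>lborel)"
    unfolding tot[symmetric] by (rule nn_integral_eq_integral[OF i2, symmetric]) (simp add: J0)
  also have "\<dots> \<le> ennreal (4 * d\<^sup>2) * (ennreal m * ennreal ?D)"
    using poincare_weak_deriv[OF \<Omega> \<Omega>m sub d u v w] unfolding in1 em .
  also have "\<dots> = ennreal (4 * d\<^sup>2 * (m * ?D))"
    using D0 m0 by (simp add: ennreal_mult)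
  finally have "2 * m * n2 U - 2 * (norm S)\<^sup>2 \<le> 4 * d\<^sup>2 * (m * ?D)"
    using D0 m0 by (simp add: ennreal_le_iff)
  then show ?thesis by (simp add: U_def[symmetric] S_def[symmetric] m_def[symmetric] algebra_simps)
qed

section \<open>Rellich compactness\<close>

text \<open>Half-open grid squares of side \<open>1/N\<close>, clipped to the disc. They are convex and small, as the Poincare
  inequality asks.\<close>
definition cell :: "nat \<Rightarrow> int \<times> int \<Rightarrow> (real^2) set" where
  "cell N c = {x \<in> B1. \<lfloor>real N * x $ 1\<rfloor> = fst c \<and> \<lfloor>real N * x $ 2\<rfloor> = snd c}"

lemma cell_props:
  assumes "N > 0"
  shows "convex (cell N c)" "cell N c \<in> sets borel" "cell N c \<subseteq> B1"
    "x \<in> cell N c \<Longrightarrow> z \<in> cell N c \<Longrightarrow> norm (x - z) \<le> 2 / real N"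
proof -
  have eq: "cell N c = B1 \<inter> ({x. axis 1 (real N) \<bullet> x \<ge> of_int (fst c)} \<inter> {x. axis 1 (real N) \<bullet> x < of_int (fst c) + 1}
     \<inter> ({x. axis 2 (real N) \<bullet> x \<ge> of_int (snd c)} \<inter> {x. axis 2 (real N) \<bullet> x < of_int (snd c) + 1}))"
    by (auto simp: cell_def inner_axis inner_commute[of "axis i a" for i a] floor_eq_iff mult.commute)
  show "convex (cell N c)" unfolding eq
    by (intro convex_Int convex_halfspace_ge convex_halfspace_lt convex_ball)
  show "cell N c \<in> sets borel" unfolding cell_def by measurable
  show "cell N c \<subseteq> B1" by (auto simp: cell_def)
  assume x: "x \<in> cell N c" and z: "z \<in> cell N c"
  have "\<bar>(x - z) $ i\<bar> \<le> 1 / real N" for i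
  proof -
    have "\<lfloor>real N * x $ i\<rfloor> = \<lfloor>real N * z $ i\<rfloor>" using x z exhaust_2[of i] by (auto simp: cell_def)
    then have "\<bar>real N * x $ i - real N * z $ i\<bar> \<le> 1" by linarith
    then have "real N * \<bar>(x - z) $ i\<bar> \<le> 1" by (simp add: abs_mult flip: right_diff_distrib)
    then show ?thesis using assms by (simp add: field_simps)
  qed
  then have "norm (x - z) \<le> (\<Sum>i\<in>(UNIV::2 set). 1 / real N)"
    by (intro order_trans[OF norm_le_l1_cart] sum_mono)
  then show "norm (x - z) \<le> 2 / real N" by simp
qed

lemma sum_cells:
  assumes "x \<in> B1"
  shows "(\<Sum>c\<in>{- int N..int N} \<times> {- int N..int N}. indicator (cell N c) x) = (1::real)"
proof -
  define c0 where "c0 = (\<lfloor>real N * x $ 1\<rfloor>, \<lfloor>real N * x $ 2\<rfloor>)"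
  have "\<lfloor>real N * x $ i\<rfloor> \<in> {- int N..int N}" for i
  proof -
    have "\<bar>x $ i\<bar> \<le> 1" using component_le_norm_cart[of x i] assms by simp
    then have "\<bar>real N * x $ i\<bar> \<le> real N" using mult_left_mono[of "\<bar>x $ i\<bar>" 1 "real N"] by (simp add: abs_mult)
    then have "- real N \<le> real N * x $ i" "real N * x $ i \<le> real N" by auto
    then show ?thesis by (simp add: le_floor_iff floor_le_iff)
  qed
  then have c0: "c0 \<in> {- int N..int N} \<times> {- int N..int N}" by (simp add: c0_def)
  have "indicator (cell N c) x = (if c = c0 then 1 else (0::real))" for c
    using assms by (auto simp: cell_def c0_def indicator_def prod_eq_iff)
  then show ?thesis using c0 by simp
qed

lemma n2_cells:
  assumes "L2B (f :: real^2 \<Rightarrow> 'b::euclidean_space)" "N > 0"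
  shows "n2 f = (\<Sum>c\<in>{- int N..int N} \<times> {- int N..int N}. n2 (\<lambda>x. indicator (cell N c) x *\<^sub>R f x))"
proof -
  let ?C = "{- int N..int N} \<times> {- int N..int N}"
  have L: "L2 (\<lambda>x. indicator (cell N c) x *\<^sub>R f x)" for c
    by (rule L2_restrict(1)[OF L2B_L2[OF assms(1)] cell_props(2)[OF assms(2)]])
  have "(norm (f x))\<^sup>2 = (\<Sum>c\<in>?C. (norm (indicator (cell N c) x *\<^sub>R f x))\<^sup>2)" for x
  proof (cases "x \<in> B1")
    case True
    have "(\<Sum>c\<in>?C. (norm (indicator (cell N c) x *\<^sub>R f x))\<^sup>2) = (\<Sum>c\<in>?C. indicator (cell N c) x * (norm (f x))\<^sup>2)"
      by (intro sum.cong) (auto simp: indicator_def)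
    then show ?thesis using sum_cells[OF True, of N] by (simp flip: sum_distrib_right)
  next
    case False
    then show ?thesis using assms(1) by (simp add: L2B_def)
  qed
  then show ?thesis unfolding n2_def
    using Bochner_Integration.integral_sum[of ?C lborel "\<lambda>c x. (norm (indicator (cell N c) x *\<^sub>R f x))\<^sup>2"] L2_integrable[OF L] by simp
qed

text \<open>Applies the mean value form of the Poincare inequality on each cell: up to a small multiple of the
  gradient norm, \<open>u\<close> is controlled by finitely many averages.\<close>
lemma poincare_cells:
  fixes u :: "real^2 \<Rightarrow> 'b::euclidean_space"
  assumes u: "L2B u" and v: "\<And>i. L2B (v i)" and w: "\<And>i. weak_deriv i u (v i)" and N: "N > 0"
  shows "n2 u \<le> 8 / (real N)\<^sup>2 * (\<Sum>i\<in>UNIV. n2 (v i))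
    + (\<Sum>c\<in>{- int N..int N} \<times> {- int N..int N}. (norm (\<integral>x. indicator (cell N c) x *\<^sub>R u x \<partial>lborel))\<^sup>2 / measure lborel (cell N c))"
proof -
  let ?C = "{- int N..int N} \<times> {- int N..int N}"
  have one: "n2 (\<lambda>x. indicator (cell N c) x *\<^sub>R u x) \<le> 8 / (real N)\<^sup>2 * (\<Sum>i\<in>UNIV. n2 (\<lambda>x. indicator (cell N c) x *\<^sub>R v i x))
     + (norm (\<integral>x. indicator (cell N c) x *\<^sub>R u x \<partial>lborel))\<^sup>2 / measure lborel (cell N c)" for c
  proof (cases "measure lborel (cell N c) = 0")
    case True
    have cm: "cell N c \<in> sets borel" by (rule cell_props(2)[OF N])
    have "emeasure lborel (cell N c) < \<infinity>"
      using emeasure_bounded_finite[of "cell N c"] bounded_subset[OF bounded_ball cell_props(3)[OF N]] by blast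
    then have "emeasure lborel (cell N c) = 0" using True by (simp add: emeasure_eq_ennreal_measure less_top)
    then have "AE x in lborel. x \<notin> cell N c" using cm by (intro AE_not_in) (simp add: null_sets_def)
    then have "AE x in lborel. (norm (indicator (cell N c) x *\<^sub>R u x))\<^sup>2 = 0" by eventually_elim simp
    then have "n2 (\<lambda>x. indicator (cell N c) x *\<^sub>R u x) = 0" unfolding n2_def by (rule integral_eq_zero_AE)
    moreover have "0 \<le> 8 / (real N)\<^sup>2 * (\<Sum>i\<in>UNIV. n2 (\<lambda>x. indicator (cell N c) x *\<^sub>R v i x))"
      by (intro mult_nonneg_nonneg sum_nonneg) auto
    ultimately show ?thesis by (simp add: add_nonneg_nonneg)
  next
    case False
    then have m: "measure lborel (cell N c) > 0" using measure_nonneg[of lborel "cell N c"] by linarith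
    have "measure lborel (cell N c) * n2 (\<lambda>x. indicator (cell N c) x *\<^sub>R u x)
      \<le> 2 * (2 / real N)\<^sup>2 * measure lborel (cell N c) * (\<Sum>i\<in>UNIV. n2 (\<lambda>x. indicator (cell N c) x *\<^sub>R v i x))
      + (norm (\<integral>x. indicator (cell N c) x *\<^sub>R u x \<partial>lborel))\<^sup>2"
      by (rule poincare_mean[OF cell_props(1-3)[OF N] cell_props(4)[OF N] u v w])
    also have "2 * (2 / real N)\<^sup>2 = 8 / (real N)\<^sup>2" by (simp add: power_divide)
    finally show ?thesis using m by (simp add: field_simps)
  qed
  have "n2 u = (\<Sum>c\<in>?C. n2 (\<lambda>x. indicator (cell N c) x *\<^sub>R u x))" by (rule n2_cells[OF u N])
  also have "\<dots> \<le> (\<Sum>c\<in>?C. 8 / (real N)\<^sup>2 * (\<Sum>i\<in>UNIV. n2 (\<lambda>x. indicator (cell N c) x *\<^sub>R v i x))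
     + (norm (\<integral>x. indicator (cell N c) x *\<^sub>R u x \<partial>lborel))\<^sup>2 / measure lborel (cell N c))"
    by (intro sum_mono one)
  also have "\<dots> = 8 / (real N)\<^sup>2 * (\<Sum>i\<in>UNIV. \<Sum>c\<in>?C. n2 (\<lambda>x. indicator (cell N c) x *\<^sub>R v i x))
     + (\<Sum>c\<in>?C. (norm (\<integral>x. indicator (cell N c) x *\<^sub>R u x \<partial>lborel))\<^sup>2 / measure lborel (cell N c))"
    by (subst sum.swap) (simp add: sum.distrib sum_distrib_left)
  also have "(\<Sum>i\<in>UNIV. \<Sum>c\<in>?C. n2 (\<lambda>x. indicator (cell N c) x *\<^sub>R v i x)) = (\<Sum>i\<in>UNIV. n2 (v i))"
    by (intro sum.cong refl n2_cells[OF v N, symmetric])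
  finally show ?thesis .
qed

lemma weak_deriv_diff:
  assumes u: "L2B u" "L2B u'" and v: "L2B v" "L2B v'" and w: "weak_deriv i u v" "weak_deriv i u' v'"
  shows "weak_deriv i (\<lambda>x. u x - u' x) (\<lambda>x. v x - v' x)"
proof -
  have int: "integrable lborel (\<lambda>x. g x *\<^sub>R f x)" if f: "L2B f" and g: "continuous_on UNIV g"
      "\<exists>K. compact K \<and> K \<subseteq> B1 \<and> (\<forall>x. x \<notin> K \<longrightarrow> g x = 0)" for f :: "real^2 \<Rightarrow> 'a" and g :: "real^2 \<Rightarrow> real"
  proof -
    obtain K where K: "compact K" "\<And>x. x \<notin> K \<Longrightarrow> g x = 0" using g(2) by blast
    have "bounded (g ` K)" by (intro compact_imp_bounded compact_continuous_image continuous_on_subset[OF g(1)] K(1)) simp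
    then obtain B where "\<forall>y\<in>g ` K. norm y \<le> B" unfolding bounded_iff ..
    then have B: "norm (g x) \<le> \<bar>B\<bar>" for x using K(2)[of x] by (cases "x \<in> K") force+
    have [measurable]: "g \<in> borel_measurable borel" "f \<in> borel_measurable borel"
      using borel_measurable_continuous_onI[OF g(1)] f by (auto simp: L2B_def L2_def)
    have "L2B (\<lambda>x. g x *\<^sub>R f x)" unfolding L2B_def
      using f B by (intro conjI L2_bound(1)[OF L2B_L2[OF f], of _ "\<bar>B\<bar>"]) (auto simp: L2B_def intro!: mult_right_mono)
    then show ?thesis by (rule L2B_integrable)
  qed
  show ?thesis unfolding weak_deriv_def
  proof (intro allI impI)
    fix \<phi> assume \<phi>: "test_function B1 \<phi>"
    have p: "integrable lborel (\<lambda>x. partial_deriv i \<phi> x *\<^sub>R f x)" "integrable lborel (\<lambda>x. \<phi> x *\<^sub>R f x)" if "L2B f" for f :: "real^2 \<Rightarrow> 'a"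
    proof -
      obtain K where K: "compact K" "K \<subseteq> B1" "\<forall>x. x \<notin> K \<longrightarrow> \<phi> x = 0 \<and> partial_deriv i \<phi> x = 0"
        using test_functionD(4)[OF \<phi>, of i] by blast
      show "integrable lborel (\<lambda>x. partial_deriv i \<phi> x *\<^sub>R f x)" by (rule int[OF that test_functionD(3)[OF \<phi>]]) (use K in blast)
      show "integrable lborel (\<lambda>x. \<phi> x *\<^sub>R f x)" by (rule int[OF that test_functionD(2)[OF \<phi>]]) (use K in blast)
    qed
    show "(\<integral>x. partial_deriv i \<phi> x *\<^sub>R (u x - u' x) \<partial>lborel) = - (\<integral>x. \<phi> x *\<^sub>R (v x - v' x) \<partial>lborel)"
      using w[unfolded weak_deriv_def, rule_format, OF \<phi>] p[OF u(1)] p[OF u(2)] p[OF v(1)] p[OF v(2)]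
      by (simp add: scaleR_diff_right)
  qed
qed

lemma L2B_diff: "L2B u \<Longrightarrow> L2B v \<Longrightarrow> L2B (\<lambda>x. u x - v x)"
  by (simp add: L2B_def L2_diff(1))

text \<open>A diagonal subsequence makes the averages over all cells of all grids converge; by \<open>poincare_cells\<close>
  it is Cauchy.\<close>
lemma rellich:
  fixes u :: "nat \<Rightarrow> real^2 \<Rightarrow> 'b::euclidean_space"
  assumes u: "\<And>n. L2B (u n)" and v: "\<And>n i. L2B (v n i)" and w: "\<And>n i. weak_deriv i (u n) (v n i)"
    and bu: "\<And>n. n2 (u n) \<le> M" and bv: "\<And>n i. n2 (v n i) \<le> M"
  obtains r where "strict_mono (r :: nat \<Rightarrow> nat)"
    "\<And>e. e > 0 \<Longrightarrow> \<exists>N. \<forall>m\<ge>N. \<forall>n\<ge>N. n2 (\<lambda>x. u (r m) x - u (r n) x) < e"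
proof -
  define A where "A n q = (\<integral>x. indicator (cell (Suc (fst q)) (snd q)) x *\<^sub>R u n x \<partial>lborel)" for n and q :: "nat \<times> int \<times> int"
  have cm: "cell (Suc N) c \<in> sets borel" for N c by (rule cell_props(2)) simp
  have "norm (A n q) \<le> sqrt (measure lborel B1) * sqrt M" for n q
  proof -
    have "norm (A n q) \<le> (\<integral>x. norm (indicator (cell (Suc (fst q)) (snd q)) x *\<^sub>R u n x) \<partial>lborel)"
      unfolding A_def by (rule integral_norm_bound)
    also have "\<dots> = ip (indicator (cell (Suc (fst q)) (snd q))) (\<lambda>x. norm (u n x))"
      unfolding ip_def by (intro Bochner_Integration.integral_cong) (auto simp: indicator_def)
    also have "\<dots> \<le> sqrt (n2 (indicator (cell (Suc (fst q)) (snd q)) :: _ \<Rightarrow> real)) * sqrt (n2 (\<lambda>x. norm (u n x)))"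
      using ip_CS_abs[OF L2_indicator_bounded(1)[OF bounded_subset[OF bounded_ball cell_props(3)] cm] L2_norm(1)[OF L2B_L2[OF u]], of "fst q" "snd q" n]
      by (smt (verit) zero_less_Suc)
    also have "\<dots> \<le> sqrt (measure lborel B1) * sqrt M"
    proof (intro mult_mono real_sqrt_le_mono)
      have b: "bounded (cell (Suc (fst q)) (snd q))" by (rule bounded_subset[OF bounded_ball cell_props(3)]) simp
      show "n2 (indicator (cell (Suc (fst q)) (snd q)) :: _ \<Rightarrow> real) \<le> measure lborel B1"
        unfolding L2_indicator_bounded(2)[OF b cm]
        using emeasure_bounded_finite[OF bounded_ball, of "0::real^2" 1]
        by (intro measure_mono_fmeasurable cell_props(3) fmeasurableI) (auto simp: cm)
      show "n2 (\<lambda>x. norm (u n x)) \<le> M" using bu by (simp add: L2_norm(2))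
    qed auto
    finally show ?thesis .
  qed
  then obtain r where r: "strict_mono (r :: nat \<Rightarrow> nat)" "\<And>q. q \<in> UNIV \<Longrightarrow> \<exists>l. (\<lambda>n. A (r n) q) \<longlonglongrightarrow> l"
    using function_convergent_subsequence[of UNIV A] by blast
  show thesis
  proof (rule that[OF r(1)])
    fix e :: real assume e: "e > 0"
    have M0: "M \<ge> 0" using bu[of 0] n2_nonneg[of "u 0"] by linarith
    (* The grid is fine enough that the gradient part, at most 64 M / N^2, is below e / 2. *)
    obtain N where N: "1 / real (Suc N) < e / (128 * (M + 1))" using nat_approx_posE[of "e / (128 * (M + 1))"] e M0 by auto
    have small: "8 / (real (Suc N))\<^sup>2 * (8 * M) < e / 2"
    proof -
      have "1 / (real (Suc N))\<^sup>2 \<le> 1 / real (Suc N)" by (intro divide_left_mono) (auto simp: power2_eq_square)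
      then have "8 / (real (Suc N))\<^sup>2 * (8 * M) \<le> 64 * M * (1 / real (Suc N))"
        using mult_left_mono[of "1 / (real (Suc N))\<^sup>2" "1 / real (Suc N)" "64 * M"] M0 by simp
      also have "\<dots> \<le> 64 * (M + 1) * (1 / real (Suc N))" by (intro mult_right_mono) auto
      also have "\<dots> < 64 * (M + 1) * (e / (128 * (M + 1)))" using N M0 by (intro mult_strict_left_mono) auto
      also have "\<dots> = e / 2" using M0 by (simp add: field_simps)
      finally show ?thesis .
    qed
    let ?C = "{- int (Suc N)..int (Suc N)} \<times> {- int (Suc N)..int (Suc N)}"
    define E where "E m n = (\<Sum>c\<in>?C. (norm (A (r m) (N, c) - A (r n) (N, c)))\<^sup>2 / measure lborel (cell (Suc N) c))" for m n
    have "\<exists>K. \<forall>m\<ge>K. \<forall>n\<ge>K. E m n < e / 2"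
    proof -
      define l where "l c = lim (\<lambda>n. A (r n) (N, c))" for c
      have l: "(\<lambda>n. A (r n) (N, c)) \<longlonglongrightarrow> l c" for c
        using r(2)[of "(N, c)"] unfolding l_def by (metis UNIV_I limI)
      define F where "F n = (\<Sum>c\<in>?C. 2 * (norm (A (r n) (N, c) - l c))\<^sup>2 / measure lborel (cell (Suc N) c))" for n
      have "F \<longlonglongrightarrow> (\<Sum>c\<in>?C. 2 * (norm (l c - l c))\<^sup>2 * inverse (measure lborel (cell (Suc N) c)))"
        unfolding F_def divide_inverse by (intro tendsto_intros l)
      then have "F \<longlonglongrightarrow> 0" by simp
      from LIMSEQ_D[OF this, of "e/4"] obtain K where K: "\<And>n. n \<ge> K \<Longrightarrow> \<bar>F n\<bar> < e / 4" using e by auto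
      have EF: "E m n \<le> F m + F n" for m n
        unfolding E_def F_def sum.distrib[symmetric]
      proof (rule sum_mono)
        fix c
        have "(norm (A (r m) (N, c) - A (r n) (N, c)))\<^sup>2 \<le> 2 * (norm (A (r m) (N, c) - l c))\<^sup>2 + 2 * (norm (A (r n) (N, c) - l c))\<^sup>2"
          using norm_add_sq_le[of "A (r m) (N, c) - l c" "l c - A (r n) (N, c)"] by (simp add: norm_minus_commute)
        then show "(norm (A (r m) (N, c) - A (r n) (N, c)))\<^sup>2 / measure lborel (cell (Suc N) c)
          \<le> 2 * (norm (A (r m) (N, c) - l c))\<^sup>2 / measure lborel (cell (Suc N) c) + 2 * (norm (A (r n) (N, c) - l c))\<^sup>2 / measure lborel (cell (Suc N) c)"
          unfolding add_divide_distrib[symmetric] by (rule divide_right_mono) simp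
      qed
      show ?thesis
      proof (intro exI[of _ K] allI impI)
        fix m n assume "m \<ge> K" "n \<ge> K"
        then show "E m n < e / 2" using K[of m] K[of n] EF[of m n] by linarith
      qed
    qed
    then obtain K where K: "\<And>m n. m \<ge> K \<Longrightarrow> n \<ge> K \<Longrightarrow> E m n < e / 2" by blast
    have main: "n2 (\<lambda>x. u (r m) x - u (r n) x) \<le> 8 / (real (Suc N))\<^sup>2 * (8 * M) + E m n" for m n
    proof -
      have Aeq: "(\<integral>x. indicator (cell (Suc N) c) x *\<^sub>R (u (r m) x - u (r n) x) \<partial>lborel) = A (r m) (N, c) - A (r n) (N, c)" for c
      proof -
        have "integrable lborel (\<lambda>x. indicator (cell (Suc N) c) x *\<^sub>R u n x)" for n
          by (rule L2_integrable_bounded_support[OF L2_restrict(1)[OF L2B_L2[OF u] cm], of B1]) (use u in \<open>auto simp: L2B_def\<close>)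
        then show ?thesis by (simp add: A_def scaleR_diff_right)
      qed
      have "(\<Sum>i\<in>UNIV. n2 (\<lambda>x. v (r m) i x - v (r n) i x)) \<le> (\<Sum>i\<in>(UNIV::2 set). 4 * M)"
      proof (rule sum_mono)
        fix i
        show "n2 (\<lambda>x. v (r m) i x - v (r n) i x) \<le> 4 * M"
          using L2_diff(2)[OF L2B_L2[OF v[of "r m" i]] L2B_L2[OF v[of "r n" i]]] bv[of "r m" i] bv[of "r n" i] by linarith
      qed
      then have le8: "8 / (real (Suc N))\<^sup>2 * (\<Sum>i\<in>UNIV. n2 (\<lambda>x. v (r m) i x - v (r n) i x)) \<le> 8 / (real (Suc N))\<^sup>2 * (8 * M)"
        by (intro mult_left_mono) auto
      have "n2 (\<lambda>x. u (r m) x - u (r n) x) \<le> 8 / (real (Suc N))\<^sup>2 * (\<Sum>i\<in>UNIV. n2 (\<lambda>x. v (r m) i x - v (r n) i x))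
        + (\<Sum>c\<in>?C. (norm (\<integral>x. indicator (cell (Suc N) c) x *\<^sub>R (u (r m) x - u (r n) x) \<partial>lborel))\<^sup>2 / measure lborel (cell (Suc N) c))"
        by (rule poincare_cells[OF L2B_diff[OF u u] L2B_diff[OF v v] weak_deriv_diff[OF u u v v w w]]) simp
      then have "n2 (\<lambda>x. u (r m) x - u (r n) x) \<le> 8 / (real (Suc N))\<^sup>2 * (\<Sum>i\<in>UNIV. n2 (\<lambda>x. v (r m) i x - v (r n) i x)) + E m n"
        unfolding Aeq E_def .
      with le8 show ?thesis by linarith
    qed
    show "\<exists>N. \<forall>m\<ge>N. \<forall>n\<ge>N. n2 (\<lambda>x. u (r m) x - u (r n) x) < e"
    proof (intro exI[of _ K] allI impI)
      fix m n assume "m \<ge> K" "n \<ge> K"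
      then show "n2 (\<lambda>x. u (r m) x - u (r n) x) < e" using K[of m n] main[of m n] small by linarith
    qed
  qed
qed

section \<open>Sobolev maps as triples of Borel fields\<close>

text \<open>Its argument is the family of partial derivatives, so \<open>metric_of V\<close> is the induced metric of a map with gradient \<open>V\<close>.\<close>
definition metric_of :: "(2 \<Rightarrow> real^2 \<Rightarrow> real^3) \<Rightarrow> real^2 \<Rightarrow> real^2^2" where
  "metric_of V x = (\<chi> i j. V i x \<bullet> V j x)"

definition bending :: "(2 \<Rightarrow> 2 \<Rightarrow> real^2 \<Rightarrow> real^3) \<Rightarrow> real" where
  "bending W = (\<Sum>i\<in>UNIV. \<Sum>j\<in>UNIV. n2 (W i j))"

text \<open>The energy in terms of the first and second derivative fields. The metric term
  may be infinite a priori and stays in \<^typ>\<open>ennreal\<close>, while the bending term is a real number.\<close>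
definition field_energy :: "real \<Rightarrow> real \<Rightarrow> (2 \<Rightarrow> real^2 \<Rightarrow> real^3) \<Rightarrow> (2 \<Rightarrow> 2 \<Rightarrow> real^2 \<Rightarrow> real^3) \<Rightarrow> ennreal" where
  "field_energy h \<Delta> V W = (\<integral>\<^sup>+x. indicator B1 x * ennreal ((norm (metric_of V x - ref_metric \<Delta> x))\<^sup>2) \<partial>lborel) + ennreal (h\<^sup>2 * bending W)"

definition weak_jet :: "(real^2 \<Rightarrow> real^3) \<Rightarrow> (2 \<Rightarrow> real^2 \<Rightarrow> real^3) \<Rightarrow> (2 \<Rightarrow> 2 \<Rightarrow> real^2 \<Rightarrow> real^3) \<Rightarrow> bool" where
  "weak_jet Y V W \<longleftrightarrow> L2B Y \<and> (\<forall>i. L2B (V i)) \<and> (\<forall>i j. L2B (W i j)) \<and>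
     (\<forall>i. weak_deriv i Y (V i)) \<and> (\<forall>i j. weak_deriv j (V i) (W i j))"

abbreviation AE1 :: "(real^2 \<Rightarrow> 'b) \<Rightarrow> (real^2 \<Rightarrow> 'b) \<Rightarrow> bool" where
  "AE1 f g \<equiv> (AE x in lborel. x \<in> B1 \<longrightarrow> f x = g x)"

lemma continuous_compact_support_bounded:
  fixes g :: "'a::euclidean_space \<Rightarrow> real"
  assumes "continuous_on UNIV g" "compact K" "\<And>x. x \<notin> K \<Longrightarrow> g x = 0"
  obtains B where "\<And>x. \<bar>g x\<bar> \<le> B"
proof -
  have "bounded (g ` K)" by (intro compact_imp_bounded compact_continuous_image continuous_on_subset[OF assms(1)] assms(2)) simp
  then obtain B where "\<forall>y\<in>g ` K. norm y \<le> B" unfolding bounded_iff ..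
  then have "\<bar>g x\<bar> \<le> \<bar>B\<bar>" for x using assms(3)[of x] by (cases "x \<in> K") force+
  with that show thesis by blast
qed

lemma borel_measurable_vec_lambda:
  fixes g :: "'n::finite \<Rightarrow> 'a \<Rightarrow> 'b::euclidean_space"
  assumes "\<And>i. g i \<in> borel_measurable M"
  shows "(\<lambda>x. \<chi> i. g i x) \<in> borel_measurable M"
proof (subst borel_measurable_euclidean_space, intro ballI)
  fix b :: "'b^'n" assume "b \<in> Basis"
  then obtain i k where b: "b = axis i k" by (auto simp: Basis_vec_def)
  have "(\<lambda>x. (\<chi> i. g i x) \<bullet> b) = (\<lambda>x. g i x \<bullet> k)" by (simp add: b inner_axis)
  then show "(\<lambda>x. (\<chi> i. g i x) \<bullet> b) \<in> borel_measurable M" using assms by simp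
qed

lemma borel_measurable_vec_nth_real:
  fixes f :: "'a \<Rightarrow> real^'n::finite"
  assumes "f \<in> borel_measurable M" shows "(\<lambda>x. f x $ i) \<in> borel_measurable M"
proof -
  have "(\<lambda>x. f x \<bullet> axis i 1) \<in> borel_measurable M" using assms by simp
  then show ?thesis by (simp add: inner_axis)
qed

text \<open>A locally integrable function is integrable against every continuous function with compact support
  in the disc, and the domain of integration can be enlarged.\<close>
lemma test_integral:
  fixes f :: "real^2 \<Rightarrow> real^'m::finite"
  assumes f: "locally_integrable_on B1 f" and g: "continuous_on UNIV g"
    and K: "compact K" "K \<subseteq> B1" "\<And>x. x \<notin> K \<Longrightarrow> g x = 0"
  shows "integrable lebesgue (\<lambda>x. g x *\<^sub>R f x)"
    "(LINT x|lebesgue_on B1. g x *\<^sub>R f x) = (LINT x|lebesgue. g x *\<^sub>R f x)"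
proof -
  obtain B where B: "\<And>x. \<bar>g x\<bar> \<le> B" using continuous_compact_support_bounded[OF g K(1,3)] by blast
  have i: "integrable lebesgue (\<lambda>x. indicator K x *\<^sub>R f x)"
    using f K by (auto simp: locally_integrable_on_def set_integrable_def)
  have eq: "(\<lambda>x. g x *\<^sub>R f x) = (\<lambda>x. g x *\<^sub>R (indicator K x *\<^sub>R f x))"
    using K(3) by (force simp: indicator_def fun_eq_iff)
  have metric_of: "g \<in> borel_measurable lebesgue"
    using borel_measurable_continuous_onI[OF g] by (simp add: measurable_completion)
  show "integrable lebesgue (\<lambda>x. g x *\<^sub>R f x)" unfolding eq
  proof (rule Bochner_Integration.integrable_bound)
    show "integrable lebesgue (\<lambda>x. B *\<^sub>R norm (indicator K x *\<^sub>R f x))" using i by (intro integrable_scaleR_right integrable_norm)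
    show "(\<lambda>x. g x *\<^sub>R (indicator K x *\<^sub>R f x)) \<in> borel_measurable lebesgue"
      using metric_of i by (intro borel_measurable_scaleR[of g]) auto
    show "AE x in lebesgue. norm (g x *\<^sub>R indicat_real K x *\<^sub>R f x) \<le> norm (B *\<^sub>R norm (indicat_real K x *\<^sub>R f x))"
    proof (rule AE_I2)
      fix x
      have "B \<ge> 0" using B[of x] by linarith
      then show "norm (g x *\<^sub>R indicat_real K x *\<^sub>R f x) \<le> norm (B *\<^sub>R norm (indicat_real K x *\<^sub>R f x))"
        unfolding norm_scaleR[of "g x"] using B[of x] by (simp add: abs_mult mult_right_mono)
    qed
  qed
  have "(LINT x|lebesgue_on B1. g x *\<^sub>R f x) = (LINT x|lebesgue. indicator B1 x *\<^sub>R (g x *\<^sub>R f x))"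
    by (rule integral_restrict_space) simp
  also have "(\<lambda>x. indicator B1 x *\<^sub>R (g x *\<^sub>R f x)) = (\<lambda>x. g x *\<^sub>R f x)"
  proof
    fix x show "indicator B1 x *\<^sub>R (g x *\<^sub>R f x) = g x *\<^sub>R f x"
      using K(2,3) by (cases "x \<in> K") auto
  qed
  finally show "(LINT x|lebesgue_on B1. g x *\<^sub>R f x) = (LINT x|lebesgue. g x *\<^sub>R f x)" .
qed

lemma has_weak_partial_iff:
  assumes f: "locally_integrable_on B1 f" and g: "locally_integrable_on B1 g"
  shows "has_weak_partial B1 i f g \<longleftrightarrow> (\<forall>\<phi>. test_function B1 \<phi> \<longrightarrow>
     (LINT x|lebesgue. partial_deriv i \<phi> x *\<^sub>R f x) = - (LINT x|lebesgue. \<phi> x *\<^sub>R g x))"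
proof -
  have "(LINT x|lebesgue_on B1. partial_deriv i \<phi> x *\<^sub>R f x) = (LINT x|lebesgue. partial_deriv i \<phi> x *\<^sub>R f x)
     \<and> (LINT x|lebesgue_on B1. \<phi> x *\<^sub>R g x) = (LINT x|lebesgue. \<phi> x *\<^sub>R g x)" if \<phi>: "test_function B1 \<phi>" for \<phi>
  proof -
    obtain K where "compact K" "K \<subseteq> B1" "\<forall>x. x \<notin> K \<longrightarrow> \<phi> x = 0 \<and> partial_deriv i \<phi> x = 0"
      using test_functionD(4)[OF \<phi>, of i] by blast
    then have K: "compact K" "K \<subseteq> B1" "\<And>x. x \<notin> K \<Longrightarrow> \<phi> x = 0" "\<And>x. x \<notin> K \<Longrightarrow> partial_deriv i \<phi> x = 0" by auto
    show ?thesis using test_integral(2)[OF f test_functionD(3)[OF \<phi>] K(1,2,4)] test_integral(2)[OF g test_functionD(2)[OF \<phi>] K(1-3)] by blast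
  qed
  then have "test_function B1 \<phi> \<Longrightarrow> ((LINT x|lebesgue_on B1. partial_deriv i \<phi> x *\<^sub>R f x) = - (LINT x|lebesgue_on B1. \<phi> x *\<^sub>R g x))
     \<longleftrightarrow> ((LINT x|lebesgue. partial_deriv i \<phi> x *\<^sub>R f x) = - (LINT x|lebesgue. \<phi> x *\<^sub>R g x))" for \<phi> by simp
  then show ?thesis using f g unfolding has_weak_partial_def by blast
qed

text \<open>Makes the choice inside \<open>weak_partial\<close> harmless: any two candidates agree almost everywhere on
  the disc.\<close>
lemma has_weak_partial_unique:
  fixes f :: "real^2 \<Rightarrow> real^'m::finite"
  assumes "has_weak_partial B1 i f g" "has_weak_partial B1 i f g'"
  shows "AE1 g g'"
proof -
  have l: "locally_integrable_on B1 f" "locally_integrable_on B1 g" "locally_integrable_on B1 g'"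
    using assms by (auto simp: has_weak_partial_def)
  have ld: "locally_integrable_on B1 (\<lambda>x. g x - g' x)"
    using l unfolding locally_integrable_on_def by (auto intro!: set_integral_diff)
  have "AE x in lborel. x \<in> B1 \<longrightarrow> g x - g' x = 0"
  proof (rule fundamental_lemma[OF ld])
    fix \<phi> :: "real^2 \<Rightarrow> real" assume \<phi>: "test_function B1 \<phi>"
    obtain K where "compact K" "K \<subseteq> B1" "\<forall>x. x \<notin> K \<longrightarrow> \<phi> x = 0 \<and> partial_deriv i \<phi> x = 0"
      using test_functionD(4)[OF \<phi>, of i] by blast
    then have K: "compact K" "K \<subseteq> B1" "\<And>x. x \<notin> K \<Longrightarrow> \<phi> x = 0" by auto
    note c = test_functionD(2)[OF \<phi>]
    have "(LINT x|lebesgue. \<phi> x *\<^sub>R g x) = (LINT x|lebesgue. \<phi> x *\<^sub>R g' x)"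
      using assms \<phi> unfolding has_weak_partial_iff[OF l(1,2)] has_weak_partial_iff[OF l(1,3)] by simp
    then have "(LINT x|lebesgue. \<phi> x *\<^sub>R (g x - g' x)) = 0"
      using test_integral(1)[OF l(2) c K] test_integral(1)[OF l(3) c K] by (simp add: scaleR_diff_right)
    then show "(LINT x|lebesgue_on B1. \<phi> x *\<^sub>R (g x - g' x)) = 0"
      using test_integral(2)[OF ld c K] by simp
  qed
  then show ?thesis by simp
qed

lemma has_weak_partial_AE:
  fixes f :: "real^2 \<Rightarrow> real^'m::finite"
  assumes w: "has_weak_partial B1 i f g" and ae: "AE1 f f'" "AE1 g g'"
    and l': "locally_integrable_on B1 f'" "locally_integrable_on B1 g'"
  shows "has_weak_partial B1 i f' g'"
proof -
  have l: "locally_integrable_on B1 f" "locally_integrable_on B1 g" using w by (auto simp: has_weak_partial_def)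
  show ?thesis unfolding has_weak_partial_iff[OF l']
  proof (intro allI impI)
    fix \<phi> :: "real^2 \<Rightarrow> real" assume \<phi>: "test_function B1 \<phi>"
    obtain K where "compact K" "K \<subseteq> B1" "\<forall>x. x \<notin> K \<longrightarrow> \<phi> x = 0 \<and> partial_deriv i \<phi> x = 0"
      using test_functionD(4)[OF \<phi>, of i] by blast
    then have K: "compact K" "K \<subseteq> B1" "\<And>x. x \<notin> K \<Longrightarrow> \<phi> x = 0" "\<And>x. x \<notin> K \<Longrightarrow> partial_deriv i \<phi> x = 0" by auto
    note c = test_functionD(2)[OF \<phi>] and c' = test_functionD(3)[OF \<phi>, of i]
    have cong: "(LINT x|lebesgue. q x *\<^sub>R a x) = (LINT x|lebesgue. q x *\<^sub>R b x)"
      if "AE1 a b" "locally_integrable_on B1 a" "locally_integrable_on B1 b" "continuous_on UNIV q" "\<And>x. x \<notin> K \<Longrightarrow> q x = 0"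
      for a b :: "real^2 \<Rightarrow> real^'m" and q
    proof (rule integral_cong_AE)
      show "AE x in lebesgue. q x *\<^sub>R a x = q x *\<^sub>R b x" unfolding AE_completion_iff
        using that(1)
      proof eventually_elim
        case (elim x) then show ?case using that(5)[of x] K(2) by (cases "x \<in> K") auto
      qed
    qed (use test_integral(1)[OF that(2,4) K(1,2) that(5)] test_integral(1)[OF that(3,4) K(1,2) that(5)] in auto)
    have "(LINT x|lebesgue. partial_deriv i \<phi> x *\<^sub>R f' x) = (LINT x|lebesgue. partial_deriv i \<phi> x *\<^sub>R f x)"
      by (rule cong[OF ae(1) l(1) l'(1) c' K(4), symmetric])
    also have "\<dots> = - (LINT x|lebesgue. \<phi> x *\<^sub>R g x)"
      using w \<phi> unfolding has_weak_partial_iff[OF l] by simp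
    also have "(LINT x|lebesgue. \<phi> x *\<^sub>R g x) = (LINT x|lebesgue. \<phi> x *\<^sub>R g' x)"
      by (rule cong[OF ae(2) l(2) l'(2) c K(3)])
    finally show "(LINT x|lebesgue. partial_deriv i \<phi> x *\<^sub>R f' x) = - (LINT x|lebesgue. \<phi> x *\<^sub>R g' x)" .
  qed
qed

lemma L2B_locally_integrable:
  fixes f :: "real^2 \<Rightarrow> real^'m::finite"
  assumes "L2B f" shows "locally_integrable_on B1 f"
proof -
  have "integrable lebesgue f"
    using L2B_integrable[OF assms] by (subst integrable_completion) auto
  then show ?thesis unfolding locally_integrable_on_def set_integrable_def
    by (auto intro!: integrable_mult_indicator lmeasurable_compact fmeasurableD)
qed

lemma weak_deriv_iff_has_weak_partial:
  fixes f :: "real^2 \<Rightarrow> real^'m::finite"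
  assumes "L2B f" "L2B g"
  shows "has_weak_partial B1 i f g \<longleftrightarrow> weak_deriv i f g"
proof -
  have tr: "(LINT x|lebesgue. q x *\<^sub>R f x) = (LINT x|lborel. q x *\<^sub>R f x)" if "continuous_on UNIV q" "L2B f" for q and f :: "real^2 \<Rightarrow> real^'m"
  proof (rule integral_completion)
    have "q \<in> borel_measurable borel" "f \<in> borel_measurable borel"
      using borel_measurable_continuous_onI[OF that(1)] that(2) by (auto simp: L2B_def L2_def)
    then show "(\<lambda>x. q x *\<^sub>R f x) \<in> borel_measurable lborel" by simp
  qed
  then show ?thesis
    unfolding has_weak_partial_iff[OF L2B_locally_integrable[OF assms(1)] L2B_locally_integrable[OF assms(2)]] weak_deriv_def
    using tr[OF test_functionD(2) assms(2)] tr[OF test_functionD(3) assms(1)] by simp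
qed

text \<open>A Lebesgue measurable function agrees almost everywhere with a Borel function; outside the disc it is
  set to zero.\<close>
lemma L2_on_representative:
  fixes f :: "real^2 \<Rightarrow> real^'m::finite"
  assumes "L2_on B1 f"
  obtains F where "L2B F" "AE1 f F"
proof -
  have fm: "(\<lambda>x. if x \<in> B1 then f x else 0) \<in> borel_measurable lebesgue"
    using assms borel_measurable_if_lebesgue_on[of B1 UNIV f] by (simp add: L2_on_def lebesgue_on_UNIV_eq)
  have "\<forall>k. \<exists>g. g \<in> borel_measurable borel \<and> (AE x in lborel. (if x \<in> B1 then f x else 0) $ k = g x)"
    using completion_ex_borel_measurable_real[OF borel_measurable_vec_nth_real[OF fm]]
    unfolding measurable_lborel1 measurable_lborel2 Bex_def by blast
  from choice[OF this] obtain g where g0: "\<forall>k. g k \<in> borel_measurable borel \<and> (AE x in lborel. (if x \<in> B1 then f x else 0) $ k = g k x)" ..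
  then have g: "\<And>k. g k \<in> borel_measurable borel" "\<And>k. AE x in lborel. (if x \<in> B1 then f x else 0) $ k = g k x" by auto
  define F where "F x = indicator B1 x *\<^sub>R (\<chi> k. g k x)" for x
  have Fm[measurable]: "F \<in> borel_measurable borel"
    unfolding F_def using g(1) by (intro borel_measurable_scaleR borel_measurable_indicator) (auto intro!: borel_measurable_vec_lambda)
  have "AE x in lborel. \<forall>k. (if x \<in> B1 then f x else 0) $ k = g k x"
    using g(2) by (intro AE_finite_allI[of UNIV, simplified]) auto
  then have ae: "AE1 f F" by eventually_elim (auto simp: F_def vec_eq_iff)
  have i: "integrable (lebesgue_on B1) (\<lambda>x. (norm (f x))\<^sup>2)" using assms by (simp add: L2_on_def)
  have "(\<integral>\<^sup>+x. ennreal ((norm (F x))\<^sup>2) \<partial>lborel) = (\<integral>\<^sup>+x. ennreal ((norm (f x))\<^sup>2) * indicator B1 x \<partial>lborel)"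
    using ae by (intro nn_integral_cong_AE) (auto elim!: eventually_mono simp: F_def indicator_def)
  also have "\<dots> = (\<integral>\<^sup>+x. ennreal ((norm (f x))\<^sup>2) \<partial>lebesgue_on B1)"
    by (simp add: nn_integral_restrict_space nn_integral_completion)
  also have "\<dots> = ennreal (\<integral>x. (norm (f x))\<^sup>2 \<partial>lebesgue_on B1)" by (rule nn_integral_eq_integral[OF i]) simp
  finally have "(\<integral>\<^sup>+x. ennreal ((norm (F x))\<^sup>2) \<partial>lborel) \<le> ennreal (\<integral>x. (norm (f x))\<^sup>2 \<partial>lebesgue_on B1)" by simp
  then have "L2 F" by (rule L2_if_nn_integral_le(1)[OF Fm]) (auto intro!: integral_nonneg_AE)
  then have "L2B F" by (auto simp: L2B_def F_def)
  with ae that show thesis by blast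
qed

lemma L2B_L2_on:
  fixes f :: "real^2 \<Rightarrow> real^'m::finite"
  assumes "L2B f" shows "L2_on B1 f"
proof -
  have m[measurable]: "f \<in> borel_measurable borel" using assms by (simp add: L2B_def L2_def)
  have "f \<in> borel_measurable (lebesgue_on B1)"
    by (intro measurable_restrict_space1 measurable_completion) simp
  moreover have "integrable lebesgue (\<lambda>x. (norm (f x))\<^sup>2)"
    using L2_integrable[OF L2B_L2[OF assms]] by (subst integrable_completion) auto
  then have "integrable (lebesgue_on B1) (\<lambda>x. (norm (f x))\<^sup>2)"
    using integrable_mult_indicator[of B1 lebesgue "\<lambda>x. (norm (f x))\<^sup>2"] by (simp add: integrable_restrict_space)
  ultimately show ?thesis by (simp add: L2_on_def)
qed

lemma ref_metric_measurable [measurable]: "ref_metric \<Delta> \<in> borel_measurable borel"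
proof -
  have "(\<lambda>x. ref_metric \<Delta> x $ i $ j) \<in> borel_measurable borel" for i j
    using exhaust_2[of i] exhaust_2[of j]
    by (auto simp: ref_metric_def outer_def perp_hat_def mat_def)
  then have "(\<lambda>x. \<chi> i j. ref_metric \<Delta> x $ i $ j) \<in> borel_measurable borel"
    by (intro borel_measurable_vec_lambda)
  moreover have "(\<chi> i j. ref_metric \<Delta> x $ i $ j) = ref_metric \<Delta> x" for x by (simp add: vec_eq_iff)
  ultimately show ?thesis by simp
qed

lemma metric_of_measurable [measurable]:
  assumes "\<And>i. V i \<in> borel_measurable borel" shows "metric_of V \<in> borel_measurable borel"
  unfolding metric_of_def[abs_def] using assms by (intro borel_measurable_vec_lambda borel_measurable_inner)

lemma norm_array3_sq: "(norm (A :: real^2^2^3))\<^sup>2 = (\<Sum>k\<in>UNIV. \<Sum>i\<in>UNIV. \<Sum>j\<in>UNIV. (A $ k $ i $ j)\<^sup>2)"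
  by (simp add: norm_vec_def L2_set_def sum_nonneg)

text \<open>The derivatives chosen by \<open>weak_D\<close> and \<open>weak_D2\<close> agree almost everywhere with \<open>V\<close> and \<open>W\<close>. For the second
  derivative this uses that weak differentiation does not see null sets (\<open>has_weak_partial_AE\<close>).\<close>
lemma energy_eq:
  assumes a: "weak_jet Y V W" and y: "AE1 y Y" "locally_integrable_on B1 y"
  shows "energy h \<Delta> y = field_energy h \<Delta> V W"
proof -
  have L: "\<And>i. L2B (V i)" "\<And>i j. L2B (W i j)" "L2B Y" using a by (auto simp: weak_jet_def)
  have Lm[measurable]: "\<And>i. V i \<in> borel_measurable borel" "\<And>i j. W i j \<in> borel_measurable borel"
    using L by (auto simp: L2B_def L2_def)
  have [measurable]: "B1 \<in> sets borel" "metric_of V \<in> borel_measurable borel" by (auto intro!: metric_of_measurable)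
  note li = L2B_locally_integrable
  have sym: "AE1 f g \<Longrightarrow> AE1 g f" for f g :: "real^2 \<Rightarrow> real^3" by (auto elim!: eventually_mono)
  have 1: "has_weak_partial B1 i y (V i)" for i
  proof -
    have "has_weak_partial B1 i Y (V i)" using a unfolding weak_deriv_iff_has_weak_partial[OF L(3) L(1)] by (simp add: weak_jet_def)
    then show ?thesis by (rule has_weak_partial_AE[OF _ sym[OF y(1)] _ y(2) li[OF L(1)]]) simp
  qed
  define D where "D i = weak_partial B1 i y" for i
  have D: "has_weak_partial B1 i y (D i)" for i unfolding D_def weak_partial_def by (rule someI[of "has_weak_partial B1 i y", OF 1])
  have VD: "AE1 (V i) (D i)" for i by (rule has_weak_partial_unique[OF 1 D])
  have Dl: "locally_integrable_on B1 (D i)" for i using D by (simp add: has_weak_partial_def)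
  have 2: "has_weak_partial B1 j (D i) (W i j)" for i j
  proof -
    have "has_weak_partial B1 j (V i) (W i j)" using a unfolding weak_deriv_iff_has_weak_partial[OF L(1) L(2)] by (simp add: weak_jet_def)
    then show ?thesis by (rule has_weak_partial_AE[OF _ VD _ Dl li[OF L(2)]]) simp
  qed
  define D2 where "D2 i j = weak_partial B1 j (D i)" for i j
  have D2: "has_weak_partial B1 j (D i) (D2 i j)" for i j unfolding D2_def weak_partial_def by (rule someI[of "has_weak_partial B1 j (D i)", OF 2])
  have WD2: "AE1 (W i j) (D2 i j)" for i j by (rule has_weak_partial_unique[OF 2 D2])
  have aeall: "AE x in lborel. x \<in> B1 \<longrightarrow> (\<forall>i. V i x = D i x) \<and> (\<forall>i j. W i j x = D2 i j x)"
  proof -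
    have "AE x in lborel. \<forall>i. x \<in> B1 \<longrightarrow> V i x = D i x"
      using VD by (intro AE_finite_allI[of UNIV, simplified]) auto
    moreover have "AE x in lborel. \<forall>i. \<forall>j. x \<in> B1 \<longrightarrow> W i j x = D2 i j x"
      using WD2 by (intro AE_finite_allI[of UNIV, simplified]) auto
    ultimately show ?thesis by eventually_elim blast
  qed
  have "energy h \<Delta> y = (\<integral>\<^sup>+x. ennreal ((norm (induced_metric B1 y x - ref_metric \<Delta> x))\<^sup>2
      + h\<^sup>2 * (norm (weak_D2 B1 y x))\<^sup>2) * indicator B1 x \<partial>lborel)"
    by (simp add: energy_def nn_integral_restrict_space nn_integral_completion)
  also have "\<dots> = (\<integral>\<^sup>+x. indicator B1 x * ennreal ((norm (metric_of V x - ref_metric \<Delta> x))\<^sup>2)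
      + ennreal (h\<^sup>2 * (\<Sum>i\<in>UNIV. \<Sum>j\<in>UNIV. (norm (W i j x))\<^sup>2)) \<partial>lborel)"
  proof (rule nn_integral_cong_AE)
    show "AE x in lborel. ennreal ((norm (induced_metric B1 y x - ref_metric \<Delta> x))\<^sup>2
      + h\<^sup>2 * (norm (weak_D2 B1 y x))\<^sup>2) * indicator B1 x = indicator B1 x * ennreal ((norm (metric_of V x - ref_metric \<Delta> x))\<^sup>2)
      + ennreal (h\<^sup>2 * (\<Sum>i\<in>UNIV. \<Sum>j\<in>UNIV. (norm (W i j x))\<^sup>2))"
      using aeall
    proof eventually_elim
      case (elim x)
      show ?case
      proof (cases "x \<in> B1")
        case True
        then have V: "V i x = weak_partial B1 i y x" and W: "W i j x = weak_partial B1 j (weak_partial B1 i y) x" for i j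
          using elim by (auto simp: D_def D2_def)
        have "induced_metric B1 y x = metric_of V x"
          by (simp add: induced_metric_def metric_of_def weak_D_def vec_eq_iff matrix_matrix_mult_def transpose_def inner_vec_def V)
        moreover have "(norm (weak_D2 B1 y x))\<^sup>2 = (\<Sum>i\<in>UNIV. \<Sum>j\<in>UNIV. (norm (W i j x))\<^sup>2)"
        proof -
          have "(norm (weak_D2 B1 y x))\<^sup>2 = (\<Sum>k\<in>UNIV. \<Sum>i\<in>UNIV. \<Sum>j\<in>UNIV. (W i j x $ k)\<^sup>2)"
            by (simp add: norm_array3_sq weak_D2_def W)
          also have "\<dots> = (\<Sum>i\<in>UNIV. \<Sum>j\<in>UNIV. \<Sum>k\<in>UNIV. (W i j x $ k)\<^sup>2)"
            by (subst sum.swap) (simp add: sum.swap[of _ "UNIV :: 3 set"])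
          also have "\<dots> = (\<Sum>i\<in>UNIV. \<Sum>j\<in>UNIV. (norm (W i j x))\<^sup>2)"
            by (simp add: norm_vec_def L2_set_def sum_nonneg)
          finally show ?thesis .
        qed
        ultimately show ?thesis using True by (simp add: ennreal_plus sum_nonneg)
      next
        case False
        then show ?thesis using L by (simp add: L2B_def)
      qed
    qed
  qed
  also have "\<dots> = (\<integral>\<^sup>+x. indicator B1 x * ennreal ((norm (metric_of V x - ref_metric \<Delta> x))\<^sup>2) \<partial>lborel)
      + (\<integral>\<^sup>+x. ennreal (h\<^sup>2 * (\<Sum>i\<in>UNIV. \<Sum>j\<in>UNIV. (norm (W i j x))\<^sup>2)) \<partial>lborel)"
    by (rule nn_integral_add) measurable
  also have "(\<integral>\<^sup>+x. ennreal (h\<^sup>2 * (\<Sum>i\<in>UNIV. \<Sum>j\<in>UNIV. (norm (W i j x))\<^sup>2)) \<partial>lborel) = ennreal (h\<^sup>2 * bending W)"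
  proof -
    have i: "integrable lborel (\<lambda>x. (norm (W i j x))\<^sup>2)" for i j by (rule L2_integrable[OF L2B_L2[OF L(2)]])
    have "(\<integral>\<^sup>+x. ennreal (h\<^sup>2 * (\<Sum>i\<in>UNIV. \<Sum>j\<in>UNIV. (norm (W i j x))\<^sup>2)) \<partial>lborel)
       = ennreal (\<integral>x. h\<^sup>2 * (\<Sum>i\<in>UNIV. \<Sum>j\<in>UNIV. (norm (W i j x))\<^sup>2) \<partial>lborel)"
      using i by (intro nn_integral_eq_integral) (auto intro!: sum_nonneg mult_nonneg_nonneg)
    also have "(\<integral>x. h\<^sup>2 * (\<Sum>i\<in>UNIV. \<Sum>j\<in>UNIV. (norm (W i j x))\<^sup>2) \<partial>lborel) = h\<^sup>2 * bending W"
      using i by (simp add: bending_def n2_def)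
    finally show ?thesis .
  qed
  finally show ?thesis by (simp add: field_energy_def)
qed

text \<open>Together with \<open>weak_jet_imp_W22\<close> this moves the minimisation problem to triples of fields.\<close>
lemma W22_imp_weak_jet:
  assumes "y \<in> W22 B1"
  obtains Y V W where "weak_jet Y V W" "\<And>h \<Delta>. energy h \<Delta> y = field_energy h \<Delta> V W"
proof -
  obtain v where v: "\<And>i. has_weak_partial B1 i y (v i)" "\<And>i. L2_on B1 (v i)"
    "\<And>i j. \<exists>w. has_weak_partial B1 j (v i) w \<and> L2_on B1 w" and y: "L2_on B1 y"
    using assms unfolding W22_def by simp metis
  define w where "w i j = (SOME w. has_weak_partial B1 j (v i) w \<and> L2_on B1 w)" for i j
  have w: "has_weak_partial B1 j (v i) (w i j)" "L2_on B1 (w i j)" for i j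
    using someI_ex[OF v(3)[of j i]] by (auto simp: w_def)
  obtain Y where Y: "L2B Y" "AE1 y Y" using L2_on_representative[OF y] by blast
  have ex: "\<exists>F. L2B F \<and> AE1 f F" if "L2_on B1 f" for f :: "real^2 \<Rightarrow> real^3"
    using L2_on_representative[OF that] by blast
  define V where "V i = (SOME F. L2B F \<and> AE1 (v i) F)" for i
  define W where "W i j = (SOME F. L2B F \<and> AE1 (w i j) F)" for i j
  have V: "L2B (V i)" "AE1 (v i) (V i)" for i using someI_ex[OF ex[OF v(2)[of i]]] by (auto simp: V_def)
  have W: "L2B (W i j)" "AE1 (w i j) (W i j)" for i j using someI_ex[OF ex[OF w(2)[of i j]]] by (auto simp: W_def)
  note li = L2B_locally_integrable
  have "weak_jet Y V W" unfolding weak_jet_def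
  proof (intro conjI allI Y(1) V(1) W(1))
    show "weak_deriv i Y (V i)" for i
      using has_weak_partial_AE[OF v(1) Y(2) V(2) li[OF Y(1)] li[OF V(1)]] by (simp add: weak_deriv_iff_has_weak_partial Y V)
    show "weak_deriv j (V i) (W i j)" for i j
      using has_weak_partial_AE[OF w(1) V(2) W(2) li[OF V(1)] li[OF W(1)]] by (simp add: weak_deriv_iff_has_weak_partial V W)
  qed
  moreover have "locally_integrable_on B1 y" using v(1)[of 1] by (simp add: has_weak_partial_def)
  ultimately show thesis using that energy_eq Y(2) by blast
qed

lemma weak_jet_imp_W22:
  assumes "weak_jet Y V W"
  shows "Y \<in> W22 B1" "energy h \<Delta> Y = field_energy h \<Delta> V W"
proof -
  have L: "\<And>i. L2B (V i)" "\<And>i j. L2B (W i j)" "L2B Y" using assms by (auto simp: weak_jet_def)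
  have "\<And>i. has_weak_partial B1 i Y (V i)" "\<And>i j. has_weak_partial B1 j (V i) (W i j)"
    using assms by (auto simp: weak_jet_def weak_deriv_iff_has_weak_partial)
  then show "Y \<in> W22 B1" unfolding W22_def using L2B_L2_on L by blast
  show "energy h \<Delta> Y = field_energy h \<Delta> V W"
    by (rule energy_eq[OF assms _ L2B_locally_integrable[OF L(3)]]) simp
qed

section \<open>Existence of minimisers\<close>

text \<open>The mechanism behind Mazur's lemma, with no reference to a vector space. The infimum of \<open>N\<close> over
  \<open>K n\<close> increases with \<open>n\<close> to a finite limit. Almost minimisers with late indices have a midpoint that is still in a late
  \<open>K n\<close>, so the parallelogram law leaves no room for them to be apart.\<close>
lemma almost_minimizers_Cauchy:
  fixes K :: "nat \<Rightarrow> 'a set" and N :: "'a \<Rightarrow> real" and mid :: "'a \<Rightarrow> 'a \<Rightarrow> 'a"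
  assumes dec: "\<And>n. K (Suc n) \<subseteq> K n" and ne: "\<And>n. K n \<noteq> {}"
    and N0: "\<And>a. N a \<ge> 0" and bd: "\<And>a. a \<in> K 0 \<Longrightarrow> N a \<le> B"
    and mid: "\<And>n a b. a \<in> K n \<Longrightarrow> b \<in> K n \<Longrightarrow> mid a b \<in> K n"
    and par: "\<And>a b. a \<in> K 0 \<Longrightarrow> b \<in> K 0 \<Longrightarrow> N (mid a b) = N a / 2 + N b / 2 - D a b / 4"
  obtains g where "\<And>n. g n \<in> K n" "\<And>e. e > 0 \<Longrightarrow> \<exists>M. \<forall>m\<ge>M. \<forall>n\<ge>M. D (g m) (g n) < e"
proof -
  have mono: "m \<le> n \<Longrightarrow> K n \<subseteq> K m" for m n by (rule lift_Suc_antimono_le[of K, OF dec])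
  define c where "c n = Inf (N ` K n)" for n
  have bb: "bdd_below (N ` K n)" for n using N0 by (intro bdd_belowI[of _ 0]) auto
  have cl: "a \<in> K n \<Longrightarrow> c n \<le> N a" for a n unfolding c_def by (rule cInf_lower[OF _ bb]) auto
  have cinc: "incseq c"
    unfolding incseq_def c_def using mono ne bb by (auto intro!: cInf_superset_mono)
  have cB: "c n \<le> B" for n
  proof -
    obtain a where a: "a \<in> K n" using ne by blast
    then have "a \<in> K 0" using mono[of 0 n] by auto
    then show ?thesis using cl[OF a] bd by force
  qed
  obtain c' where c': "c \<longlonglongrightarrow> c'" "\<forall>n. c n \<le> c'"
    using incseq_convergent[OF cinc, of B] cB by auto
  have "\<exists>a\<in>K n. N a < c n + 1 / real (Suc n)" for n
    using cInf_lessD[of "N ` K n" "c n + 1 / real (Suc n)"] ne by (auto simp: c_def)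
  then obtain g where g: "\<And>n. g n \<in> K n" "\<And>n. N (g n) < c n + 1 / real (Suc n)" by metis
  show thesis
  proof (rule that[of g, OF g(1)])
    fix e :: real assume e: "e > 0"
    obtain M1 where M1: "\<And>n. n \<ge> M1 \<Longrightarrow> \<bar>c n - c'\<bar> < e / 8" using LIMSEQ_D[OF c'(1), of "e/8"] e by auto
    obtain M2 where M2: "1 / real (Suc M2) < e / 8" using nat_approx_posE[of "e/8"] e by auto
    define M where "M = max M1 M2"
    have inv: "1 / real (Suc n) < e / 8" if "n \<ge> M" for n
    proof -
      have "1 / real (Suc n) \<le> 1 / real (Suc M2)" using that by (intro divide_left_mono) (auto simp: M_def)
      then show ?thesis using M2 by linarith
    qed
    have le: "D (g m) (g n) < e" if "m \<ge> M" "n \<ge> M" for m n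
    proof -
      have k: "g m \<in> K M" "g n \<in> K M" using g(1) mono that by blast+
      then have k0: "g m \<in> K 0" "g n \<in> K 0" using mono[of 0 M] by auto
      have 1: "c M \<le> N (mid (g m) (g n))" by (rule cl[OF mid[OF k]])
      have 2: "N (mid (g m) (g n)) = N (g m) / 2 + N (g n) / 2 - D (g m) (g n) / 4" by (rule par[OF k0])
      have 3: "N (g m) < c' + e / 8" "N (g n) < c' + e / 8"
        using g(2)[of m] g(2)[of n] inv[OF that(1)] inv[OF that(2)] c'(2)[rule_format, of m] c'(2)[rule_format, of n] by linarith+
      have "M1 \<le> M" by (simp add: M_def)
      from M1[OF this] have 4: "c' - e / 8 < c M" by linarith
      show ?thesis using 1 2 3 4 by linarith
    qed
    then show "\<exists>M. \<forall>m\<ge>M. \<forall>n\<ge>M. D (g m) (g n) < e" by blast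
  qed
qed

lemma ref_metric_component: "\<bar>ref_metric \<Delta> x $ i $ i\<bar> \<le> 1 + \<Delta>\<^sup>2"
proof -
  have c: "\<bar>perp_hat x $ i\<bar> \<le> 1"
  proof (cases "x = 0")
    case False
    have "\<bar>perp_hat x $ i\<bar> = \<bar>x $ 2\<bar> / norm x \<or> \<bar>perp_hat x $ i\<bar> = \<bar>x $ 1\<bar> / norm x"
      using exhaust_2[of i] by (auto simp: perp_hat_def abs_mult)
    then obtain j where "\<bar>perp_hat x $ i\<bar> = \<bar>x $ j\<bar> / norm x" by blast
    moreover have "\<bar>x $ j\<bar> \<le> norm x" by (rule component_le_norm_cart)
    ultimately show ?thesis using False by (simp add: divide_le_eq_1)
  qed (use exhaust_2[of i] in \<open>auto simp: perp_hat_def\<close>)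
  have "ref_metric \<Delta> x $ i $ i = 1 - \<Delta>\<^sup>2 * (perp_hat x $ i)\<^sup>2"
    by (simp add: ref_metric_def outer_def mat_def power2_eq_square)
  moreover have "(perp_hat x $ i)\<^sup>2 \<le> 1" using power_mono[OF c, of 2] by simp
  then have "\<Delta>\<^sup>2 * (perp_hat x $ i)\<^sup>2 \<le> \<Delta>\<^sup>2 * 1" by (intro mult_left_mono) auto
  moreover have "0 \<le> \<Delta>\<^sup>2 * (perp_hat x $ i)\<^sup>2" by simp
  ultimately show ?thesis unfolding abs_le_iff by (smt (verit) mult.right_neutral zero_le_power2)
qed

text \<open>The squared norm of \<open>V i\<close> is a diagonal entry of the metric, and \<open>t \<le> 1 + t\<^sup>2\<close> turns the distance to the
  reference metric into its square.\<close>
lemma gradient_bound: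
  assumes a: "weak_jet Y V W" and E: "field_energy h \<Delta> V W \<le> ennreal c" and c: "c \<ge> 0"
  shows "n2 (V i) \<le> (2 + \<Delta>\<^sup>2) * measure lborel B1 + c"
proof -
  have VL: "L2B (V i)" for i using a by (auto simp: weak_jet_def)
  have [measurable]: "V i \<in> borel_measurable borel" for i using VL by (auto simp: L2B_def L2_def)
  have [measurable]: "B1 \<in> sets borel" "metric_of V \<in> borel_measurable borel" by (auto intro!: metric_of_measurable)
  have pt: "(norm (V i x))\<^sup>2 \<le> (2 + \<Delta>\<^sup>2) + (norm (metric_of V x - ref_metric \<Delta> x))\<^sup>2" for x
  proof -
    have "(norm (V i x))\<^sup>2 = metric_of V x $ i $ i" by (simp add: metric_of_def power2_norm_eq_inner)
    also have "\<dots> \<le> \<bar>(metric_of V x - ref_metric \<Delta> x) $ i $ i\<bar> + \<bar>ref_metric \<Delta> x $ i $ i\<bar>" by simp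
    also have "\<bar>(metric_of V x - ref_metric \<Delta> x) $ i $ i\<bar> \<le> norm (metric_of V x - ref_metric \<Delta> x)"
      by (rule order_trans[OF component_le_norm_cart Finite_Cartesian_Product.norm_nth_le])
    also have "norm (metric_of V x - ref_metric \<Delta> x) \<le> 1 + (norm (metric_of V x - ref_metric \<Delta> x))\<^sup>2"
      using zero_le_power2[of "norm (metric_of V x - ref_metric \<Delta> x) - 1"] norm_ge_zero[of "metric_of V x - ref_metric \<Delta> x"]
      unfolding power2_diff by (smt (verit) mult_cancel_left2 one_power2)
    finally show ?thesis using ref_metric_component[of \<Delta> x i] by linarith
  qed
  let ?k = "(2 + \<Delta>\<^sup>2) * measure lborel B1"
  have mB: "(\<integral>\<^sup>+x. indicator B1 x * ennreal (2 + \<Delta>\<^sup>2) \<partial>lborel) = ennreal ?k"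
  proof -
    have "emeasure lborel B1 = ennreal (measure lborel B1)"
      using emeasure_bounded_finite[OF bounded_ball, of "0::real^2" 1] by (simp add: emeasure_eq_ennreal_measure less_top)
    then show ?thesis by (simp add: nn_integral_multc ennreal_mult'' mult.commute flip: ennreal_mult)
  qed
  have "ennreal (n2 (V i)) = (\<integral>\<^sup>+x. indicator B1 x * ennreal ((norm (V i x))\<^sup>2) \<partial>lborel)"
    unfolding nn_integral_norm_sq[OF L2B_L2[OF VL], symmetric] using VL[of i]
    by (intro nn_integral_cong) (auto simp: indicator_def L2B_def)
  also have "\<dots> \<le> (\<integral>\<^sup>+x. indicator B1 x * ennreal (2 + \<Delta>\<^sup>2) + indicator B1 x * ennreal ((norm (metric_of V x - ref_metric \<Delta> x))\<^sup>2) \<partial>lborel)"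
  proof (rule nn_integral_mono)
    fix x
    have "ennreal ((norm (V i x))\<^sup>2) \<le> ennreal (2 + \<Delta>\<^sup>2) + ennreal ((norm (metric_of V x - ref_metric \<Delta> x))\<^sup>2)"
      using ennreal_leI[OF pt[of x]] by (subst ennreal_plus[symmetric]) auto
    then show "indicator B1 x * ennreal ((norm (V i x))\<^sup>2) \<le> indicator B1 x * ennreal (2 + \<Delta>\<^sup>2) + indicator B1 x * ennreal ((norm (metric_of V x - ref_metric \<Delta> x))\<^sup>2)"
      by (simp add: indicator_def)
  qed
  also have "\<dots> = ennreal ?k + (\<integral>\<^sup>+x. indicator B1 x * ennreal ((norm (metric_of V x - ref_metric \<Delta> x))\<^sup>2) \<partial>lborel)"
  proof (subst nn_integral_add)
    show "(\<lambda>x. indicator B1 x * ennreal (2 + \<Delta>\<^sup>2)) \<in> borel_measurable lborel" by measurable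
    show "(\<lambda>x. indicator B1 x * ennreal ((norm (metric_of V x - ref_metric \<Delta> x))\<^sup>2)) \<in> borel_measurable lborel" by measurable
  qed (simp only: mB)
  also have "\<dots> \<le> ennreal ?k + ennreal c"
  proof (rule add_left_mono)
    have "(\<integral>\<^sup>+x. indicator B1 x * ennreal ((norm (metric_of V x - ref_metric \<Delta> x))\<^sup>2) \<partial>lborel) \<le> field_energy h \<Delta> V W"
      unfolding field_energy_def by simp
    then show "(\<integral>\<^sup>+x. indicator B1 x * ennreal ((norm (metric_of V x - ref_metric \<Delta> x))\<^sup>2) \<partial>lborel) \<le> ennreal c"
      using E by (rule order_trans)
  qed
  also have "\<dots> = ennreal (?k + c)" using c by (intro ennreal_plus[symmetric]) auto
  finally show ?thesis using c by (subst (asm) ennreal_le_iff) (auto intro!: add_nonneg_nonneg)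
qed

text \<open>The map, its gradient and its second derivatives. Midpoints and distances below act on whole jets, so that
  convergence of gradients and of second derivatives is obtained from one sequence.\<close>
type_synonym jet = "(real^2 \<Rightarrow> real^3) \<times> (2 \<Rightarrow> real^2 \<Rightarrow> real^3) \<times> (2 \<Rightarrow> 2 \<Rightarrow> real^2 \<Rightarrow> real^3)"

definition jet_mid :: "jet \<Rightarrow> jet \<Rightarrow> jet" where
  "jet_mid = (\<lambda>(Y, V, W) (Y', V', W'). (\<lambda>x. (1/2) *\<^sub>R (Y x + Y' x), \<lambda>i x. (1/2) *\<^sub>R (V i x + V' i x),
     \<lambda>i j x. (1/2) *\<^sub>R (W i j x + W' i j x)))"

text \<open>Everything reachable from the tail \<open>S n, S (n + 1), ...\<close> by iterated midpoints. Dyadic convex combinations suffice and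
  avoid bookkeeping of coefficients.\<close>
inductive_set mid_hull :: "(nat \<Rightarrow> jet) \<Rightarrow> nat \<Rightarrow> jet set" for S n where
  base: "k \<ge> n \<Longrightarrow> S k \<in> mid_hull S n"
| step: "a \<in> mid_hull S n \<Longrightarrow> b \<in> mid_hull S n \<Longrightarrow> jet_mid a b \<in> mid_hull S n"

definition grad2 :: "(2 \<Rightarrow> real^2 \<Rightarrow> real^3) \<Rightarrow> real" where
  "grad2 V = (\<Sum>i\<in>UNIV. n2 (V i))"

lemma test_L2:
  assumes "continuous_on UNIV q" "compact K" "\<And>x. x \<notin> K \<Longrightarrow> q x = 0"
  shows "L2 (q :: real^2 \<Rightarrow> real)"
proof -
  obtain B where B: "\<And>x. \<bar>q x\<bar> \<le> B" using continuous_compact_support_bounded[OF assms] by blast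
  have "L2 (indicator K :: real^2 \<Rightarrow> real)"
    using assms(2) by (intro L2_indicator_bounded(1)) (auto simp: compact_imp_bounded compact_imp_closed borel_closed)
  then show ?thesis
  proof (rule L2_bound(1)[of _ _ "\<bar>B\<bar>"])
    show "norm (q x) \<le> \<bar>B\<bar> * norm (indicat_real K x)" for x
      using B[of x] assms(3)[of x] by (cases "x \<in> K") auto
  qed (use borel_measurable_continuous_onI[OF assms(1)] in auto)
qed

lemma integrable_L2_scaleR:
  fixes f :: "real^2 \<Rightarrow> 'b::euclidean_space"
  assumes "L2 q" "L2 f" shows "integrable lborel (\<lambda>x. q x *\<^sub>R f x)"
proof (rule Bochner_Integration.integrable_bound)
  show "integrable lborel (\<lambda>x. norm (q x) \<bullet> norm (f x))"
    by (rule L2_inner_integrable[OF L2_norm(1)[OF assms(1)] L2_norm(1)[OF assms(2)]])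
  show "(\<lambda>x. q x *\<^sub>R f x) \<in> borel_measurable lborel" using assms by (auto simp: L2_def)
qed simp

lemma test_function_L2:
  assumes "test_function B1 \<phi>" shows "L2 \<phi>" "L2 (partial_deriv i \<phi>)"
proof -
  obtain K where K: "compact K" "K \<subseteq> B1" "\<forall>x. x \<notin> K \<longrightarrow> \<phi> x = 0 \<and> partial_deriv i \<phi> x = 0"
    using test_functionD(4)[OF assms, of i] by blast
  show "L2 \<phi>" by (rule test_L2[OF test_functionD(2)[OF assms] K(1)]) (use K in blast)
  show "L2 (partial_deriv i \<phi>)" by (rule test_L2[OF test_functionD(3)[OF assms] K(1)]) (use K in blast)
qed

lemma weak_deriv_mid:
  assumes L: "L2 u" "L2 u'" "L2 v" "L2 v'" and w: "weak_deriv i u v" "weak_deriv i u' v'"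
  shows "weak_deriv i (\<lambda>x. (1/2) *\<^sub>R (u x + u' x)) (\<lambda>x. (1/2) *\<^sub>R (v x + v' x))"
  unfolding weak_deriv_def
proof (intro allI impI)
  fix \<phi> :: "real^2 \<Rightarrow> real" assume \<phi>: "test_function B1 \<phi>"
  note t = test_function_L2[OF \<phi>]
  have e: "(\<integral>x. q x *\<^sub>R (1/2) *\<^sub>R (a x + b x) \<partial>lborel) = (1/2) *\<^sub>R ((\<integral>x. q x *\<^sub>R a x \<partial>lborel) + (\<integral>x. q x *\<^sub>R b x \<partial>lborel))"
    if "L2 q" "L2 a" "L2 b" for q :: "real^2 \<Rightarrow> real" and a b :: "real^2 \<Rightarrow> 'a"
  proof -
    have "(\<lambda>x. q x *\<^sub>R (1/2) *\<^sub>R (a x + b x)) = (\<lambda>x. (1/2) *\<^sub>R (q x *\<^sub>R a x + q x *\<^sub>R b x))"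
      by (simp add: scaleR_add_right)
    then show ?thesis using integrable_L2_scaleR[OF that(1,2)] integrable_L2_scaleR[OF that(1,3)] by simp
  qed
  show "(\<integral>x. partial_deriv i \<phi> x *\<^sub>R (1/2) *\<^sub>R (u x + u' x) \<partial>lborel) = - (\<integral>x. \<phi> x *\<^sub>R (1/2) *\<^sub>R (v x + v' x) \<partial>lborel)"
    unfolding e[OF t(2) L(1,2)] e[OF t(1) L(3,4)]
    using w[unfolded weak_deriv_def, rule_format, OF \<phi>] by (simp add: algebra_simps)
qed

lemma weak_deriv_limit:
  assumes L: "\<And>n. L2 (u n)" "L2 U" "\<And>n. L2 (v n)" "L2 V"
    and lim: "(\<lambda>n. n2 (\<lambda>x. u n x - U x)) \<longlonglongrightarrow> 0" "(\<lambda>n. n2 (\<lambda>x. v n x - V x)) \<longlonglongrightarrow> 0"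
    and w: "\<And>n. weak_deriv i (u n) (v n)"
  shows "weak_deriv i U V"
  unfolding weak_deriv_def
proof (intro allI impI)
  fix \<phi> :: "real^2 \<Rightarrow> real" assume \<phi>: "test_function B1 \<phi>"
  note t = test_function_L2[OF \<phi>]
  have e: "(\<lambda>n. \<integral>x. q x *\<^sub>R a n x \<partial>lborel) \<longlonglongrightarrow> (\<integral>x. q x *\<^sub>R A x \<partial>lborel)"
    if q: "L2 q" and a: "\<And>n. L2 (a n)" "L2 A" "(\<lambda>n. n2 (\<lambda>x. a n x - A x)) \<longlonglongrightarrow> 0"
    for q :: "real^2 \<Rightarrow> real" and a :: "nat \<Rightarrow> real^2 \<Rightarrow> 'a" and A
  proof -
    have "(\<lambda>n. (\<integral>x. q x *\<^sub>R a n x \<partial>lborel) - (\<integral>x. q x *\<^sub>R A x \<partial>lborel)) \<longlonglongrightarrow> 0"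
    proof (rule Lim_null_comparison)
      have "norm ((\<integral>x. q x *\<^sub>R a n x \<partial>lborel) - (\<integral>x. q x *\<^sub>R A x \<partial>lborel)) \<le> sqrt (n2 q) * sqrt (n2 (\<lambda>x. a n x - A x))" for n
      proof -
        have d: "L2 (\<lambda>x. a n x - A x)" by (rule L2_diff(1)[OF a(1,2)])
        have "(\<integral>x. q x *\<^sub>R a n x \<partial>lborel) - (\<integral>x. q x *\<^sub>R A x \<partial>lborel) = (\<integral>x. q x *\<^sub>R (a n x - A x) \<partial>lborel)"
          using integrable_L2_scaleR[OF q a(1)[of n]] integrable_L2_scaleR[OF q a(2)] by (simp add: scaleR_diff_right)
        also have "norm \<dots> \<le> (\<integral>x. norm (q x *\<^sub>R (a n x - A x)) \<partial>lborel)" by (rule integral_norm_bound)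
        also have "\<dots> = ip (\<lambda>x. norm (q x)) (\<lambda>x. norm (a n x - A x))" by (simp add: ip_def)
        also have "\<dots> \<le> sqrt (n2 q) * sqrt (n2 (\<lambda>x. a n x - A x))"
          using ip_CS_abs[OF L2_norm(1)[OF q] L2_norm(1)[OF d]] by (simp only: L2_norm(2))
        finally show ?thesis .
      qed
      then show "\<forall>\<^sub>F n in sequentially. norm ((\<integral>x. q x *\<^sub>R a n x \<partial>lborel) - (\<integral>x. q x *\<^sub>R A x \<partial>lborel)) \<le> sqrt (n2 q) * sqrt (n2 (\<lambda>x. a n x - A x))"
        by (intro always_eventually allI)
      have "(\<lambda>n. sqrt (n2 q) * sqrt (n2 (\<lambda>x. a n x - A x))) \<longlonglongrightarrow> sqrt (n2 q) * sqrt 0"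
        by (intro tendsto_mult tendsto_const tendsto_real_sqrt a(3))
      then show "(\<lambda>n. sqrt (n2 q) * sqrt (n2 (\<lambda>x. a n x - A x))) \<longlonglongrightarrow> 0" by simp
    qed
    then show ?thesis by (rule LIM_zero_cancel)
  qed
  have 1: "(\<lambda>n. \<integral>x. partial_deriv i \<phi> x *\<^sub>R u n x \<partial>lborel) \<longlonglongrightarrow> (\<integral>x. partial_deriv i \<phi> x *\<^sub>R U x \<partial>lborel)"
    by (rule e[OF t(2) L(1,2) lim(1)])
  have 2: "(\<lambda>n. - (\<integral>x. \<phi> x *\<^sub>R v n x \<partial>lborel)) \<longlonglongrightarrow> - (\<integral>x. \<phi> x *\<^sub>R V x \<partial>lborel)"
    by (rule tendsto_minus[OF e[OF t(1) L(3,4) lim(2)]])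
  show "(\<integral>x. partial_deriv i \<phi> x *\<^sub>R U x \<partial>lborel) = - (\<integral>x. \<phi> x *\<^sub>R V x \<partial>lborel)"
    using LIMSEQ_unique[OF 1] 2 w[unfolded weak_deriv_def, rule_format, OF \<phi>] by simp
qed

lemma weak_deriv_const: "weak_deriv i (\<lambda>x. indicator B1 x *\<^sub>R c) (\<lambda>x. 0)"
  unfolding weak_deriv_def
proof (intro allI impI)
  fix \<phi> :: "real^2 \<Rightarrow> real" assume \<phi>: "test_function B1 \<phi>"
  obtain K where K: "compact K" "K \<subseteq> B1" "\<forall>x. x \<notin> K \<longrightarrow> \<phi> x = 0 \<and> partial_deriv i \<phi> x = 0"
    using test_functionD(4)[OF \<phi>, of i] by blast
  obtain R where R: "\<And>x. x \<in> K \<Longrightarrow> norm x \<le> R" using compact_imp_bounded[OF K(1)] by (auto simp: bounded_iff)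
  have z: "(\<integral>x. partial_deriv i \<phi> x \<partial>lborel) = 0"
  proof (rule integral_partial_zero)
    show "(\<phi> has_derivative (\<lambda>d. \<Sum>i\<in>UNIV. d $ i *\<^sub>R partial_deriv i \<phi> x)) (at x)" for x
      using test_functionD(1)[OF \<phi>] by simp
    show "\<phi> x = 0" if "norm x > R" for x using K(3) R[of x] that by force
  qed (rule test_functionD(3)[OF \<phi>])
  have "(\<integral>x. partial_deriv i \<phi> x *\<^sub>R indicator B1 x *\<^sub>R c \<partial>lborel) = (\<integral>x. partial_deriv i \<phi> x *\<^sub>R c \<partial>lborel)"
  proof (rule Bochner_Integration.integral_cong[OF refl])
    fix x show "partial_deriv i \<phi> x *\<^sub>R indicator B1 x *\<^sub>R c = partial_deriv i \<phi> x *\<^sub>R c"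
      using K by (cases "x \<in> B1") auto
  qed
  moreover have "integrable lborel (partial_deriv i \<phi>)"
    by (rule L2_integrable_bounded_support[OF test_function_L2(2)[OF \<phi>], of K])
      (use K in \<open>auto simp: compact_imp_bounded compact_imp_closed borel_closed\<close>)
  then have "(\<integral>x. partial_deriv i \<phi> x *\<^sub>R c \<partial>lborel) = 0" using z by simp
  ultimately show "(\<integral>x. partial_deriv i \<phi> x *\<^sub>R indicator B1 x *\<^sub>R c \<partial>lborel) = - (\<integral>x. \<phi> x *\<^sub>R (0::'a) \<partial>lborel)" by simp
qed

lemma L2B_mid: "L2B u \<Longrightarrow> L2B v \<Longrightarrow> L2B (\<lambda>x. (1/2) *\<^sub>R (u x + v x))"
  by (auto simp: L2B_def intro!: L2_scale(1) L2_add(1))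

definition is_jet :: "jet \<Rightarrow> bool" where "is_jet s \<longleftrightarrow> weak_jet (fst s) (fst (snd s)) (snd (snd s))"

lemma jet_mid_components:
  "fst (jet_mid a b) = (\<lambda>x. (1/2) *\<^sub>R (fst a x + fst b x))"
  "fst (snd (jet_mid a b)) = (\<lambda>i x. (1/2) *\<^sub>R (fst (snd a) i x + fst (snd b) i x))"
  "snd (snd (jet_mid a b)) = (\<lambda>i j x. (1/2) *\<^sub>R (snd (snd a) i j x + snd (snd b) i j x))"
  by (auto simp: jet_mid_def split: prod.splits)

lemma is_jet_jet_mid: assumes "is_jet a" "is_jet b" shows "is_jet (jet_mid a b)"
  unfolding is_jet_def weak_jet_def jet_mid_components
  using assms by (auto simp: is_jet_def weak_jet_def intro!: L2B_mid weak_deriv_mid L2B_L2)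

text \<open>The map itself does not enter: only derivatives are controlled by the energy, and the constant of
  integration is fixed later by subtracting the mean.\<close>
definition jet_norm2 :: "jet \<Rightarrow> real" where "jet_norm2 s = grad2 (fst (snd s)) + bending (snd (snd s))"

definition jet_dist2 :: "jet \<Rightarrow> jet \<Rightarrow> real" where
  "jet_dist2 a b = grad2 (\<lambda>i x. fst (snd a) i x - fst (snd b) i x) + bending (\<lambda>i j x. snd (snd a) i j x - snd (snd b) i j x)"

lemma grad2_par:
  assumes "\<And>i. L2 (V i)" "\<And>i. L2 (V' i)"
  shows "grad2 (\<lambda>i x. (1/2) *\<^sub>R (V i x + V' i x)) = grad2 V / 2 + grad2 V' / 2 - grad2 (\<lambda>i x. V i x - V' i x) / 4"
  unfolding grad2_def n2_parallelogram[OF assms] by (simp add: sum.distrib sum_subtractf sum_divide_distrib)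

lemma bending_par:
  assumes "\<And>i j. L2 (V i j)" "\<And>i j. L2 (V' i j)"
  shows "bending (\<lambda>i j x. (1/2) *\<^sub>R (V i j x + V' i j x)) = bending V / 2 + bending V' / 2 - bending (\<lambda>i j x. V i j x - V' i j x) / 4"
  unfolding bending_def n2_parallelogram[OF assms] by (simp add: sum.distrib sum_subtractf sum_divide_distrib)

lemma grad2_nonneg [simp]: "grad2 V \<ge> 0" and bending_nonneg [simp]: "bending W \<ge> 0"
  by (auto simp: grad2_def bending_def intro!: sum_nonneg)

lemma n2_le_grad2: "n2 (V i) \<le> grad2 V"
  unfolding grad2_def by (rule member_le_sum) auto

lemma n2_le_bending: "n2 (W i j) \<le> bending W"
proof -
  have "n2 (W i j) \<le> (\<Sum>j\<in>UNIV. n2 (W i j))" by (rule member_le_sum) auto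
  also have "\<dots> \<le> bending W" unfolding bending_def by (rule member_le_sum) (auto intro!: sum_nonneg)
  finally show ?thesis .
qed

lemma is_jet_L2:
  assumes "is_jet s" shows "L2 (fst (snd s) i)" "L2 (snd (snd s) i j)"
  using assms by (auto simp: is_jet_def weak_jet_def L2B_def)

lemma jet_norm2_par:
  assumes "is_jet a" "is_jet b" shows "jet_norm2 (jet_mid a b) = jet_norm2 a / 2 + jet_norm2 b / 2 - jet_dist2 a b / 4"
  unfolding jet_norm2_def jet_dist2_def jet_mid_components
  using grad2_par[of "fst (snd a)" "fst (snd b)", OF is_jet_L2(1)[OF assms(1)] is_jet_L2(1)[OF assms(2)]]
    bending_par[of "snd (snd a)" "snd (snd b)", OF is_jet_L2(2)[OF assms(1)] is_jet_L2(2)[OF assms(2)]]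
  by (simp add: add_divide_distrib)

lemma mid_hull_antimono: "s \<in> mid_hull S n \<Longrightarrow> m \<le> n \<Longrightarrow> s \<in> mid_hull S m"
  by (induction rule: mid_hull.induct) (auto intro: mid_hull.intros)

lemma mid_hull_is_jet: "(\<And>k. is_jet (S k)) \<Longrightarrow> s \<in> mid_hull S n \<Longrightarrow> is_jet s"
  by (rotate_tac, induction rule: mid_hull.induct) (auto intro: is_jet_jet_mid)

lemma mid_hull_jet_norm2:
  assumes "\<And>k. is_jet (S k)" "\<And>k. jet_norm2 (S k) \<le> B" "s \<in> mid_hull S n" shows "jet_norm2 s \<le> B"
  using assms(3)
proof (induction rule: mid_hull.induct)
  case (step a b)
  then have "is_jet a" "is_jet b" using mid_hull_is_jet[OF assms(1)] by auto
  moreover have "jet_dist2 a b \<ge> 0" by (simp add: jet_dist2_def)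
  ultimately show ?case using jet_norm2_par[of a b] step.IH by linarith
qed (use assms(2) in auto)

lemma mid_hull_bending:
  assumes "\<And>k. is_jet (S k)" "\<And>k. k \<ge> n \<Longrightarrow> bending (snd (snd (S k))) \<le> B" "s \<in> mid_hull S n"
  shows "bending (snd (snd s)) \<le> B"
  using assms(3)
proof (induction rule: mid_hull.induct)
  case (step a b)
  then have "is_jet a" "is_jet b" using mid_hull_is_jet[OF assms(1)] by auto
  from bending_par[of "snd (snd a)" "snd (snd b)", OF is_jet_L2(2)[OF this(1)] is_jet_L2(2)[OF this(2)]]
  show ?case using step.IH bending_nonneg[of "\<lambda>i j x. snd (snd a) i j x - snd (snd b) i j x"]
    unfolding jet_mid_components by linarith
qed (use assms(2) in auto)

text \<open>Balls are convex, so midpoints of a tail inherit the pointwise limit of the sequence. This is what ties the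
  strong limit of midpoints to the pointwise limit of the original gradients.\<close>
lemma mid_hull_pointwise:
  assumes "\<And>k. k \<ge> n \<Longrightarrow> dist (fst (snd (S k)) i x) l \<le> e" "s \<in> mid_hull S n"
  shows "dist (fst (snd s) i x) l \<le> e"
  using assms(2)
proof (induction rule: mid_hull.induct)
  case (step a b)
  have "(1/2) *\<^sub>R fst (snd a) i x + (1/2) *\<^sub>R fst (snd b) i x \<in> cball l e"
    by (rule convexD[OF convex_cball]) (use step.IH in \<open>auto simp: dist_commute\<close>)
  then show ?case unfolding jet_mid_components by (simp add: scaleR_add_right dist_commute)
qed (use assms(1) in auto)

lemma measure_B1_pos: "measure lborel (B1 :: (real^2) set) > 0"
  using content_ball_pos[of 1 "0::real^2"] by simp

text \<open>Strongly convergent midpoints replace weak convergence: the limit keeps the pointwise limit of the gradients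
  and does not increase the limiting bending energy, by convexity of \<open>bending\<close>.\<close>
lemma weak_limit_jet:
  assumes a: "\<And>n. is_jet (S n)" and b: "\<And>n. jet_norm2 (S n) \<le> B"
    and ae: "AE x in lborel. \<forall>i. (\<lambda>n. fst (snd (S n)) i x) \<longlonglongrightarrow> Vs i x"
    and bl: "(\<lambda>n. bending (snd (snd (S n)))) \<longlonglongrightarrow> \<beta>"
  obtains Y V W where "weak_jet Y V W" "AE x in lborel. \<forall>i. V i x = Vs i x" "bending W \<le> \<beta>"
proof -
  obtain g where g: "\<And>n. g n \<in> mid_hull S n"
    and gC: "\<And>e. e > 0 \<Longrightarrow> \<exists>M. \<forall>m\<ge>M. \<forall>n\<ge>M. jet_dist2 (g m) (g n) < e"
  proof (rule almost_minimizers_Cauchy[of "mid_hull S" jet_norm2 B jet_mid jet_dist2])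
    show "mid_hull S (Suc n) \<subseteq> mid_hull S n" for n using mid_hull_antimono[of _ S "Suc n" n] by auto
    show "mid_hull S n \<noteq> {}" for n using mid_hull.base[of n n S] by auto
    show "jet_norm2 s \<ge> 0" for s by (simp add: jet_norm2_def)
    show "jet_norm2 s \<le> B" if "s \<in> mid_hull S 0" for s by (rule mid_hull_jet_norm2[OF a b that])
    show "jet_mid s t \<in> mid_hull S n" if "s \<in> mid_hull S n" "t \<in> mid_hull S n" for n s t using that by (rule mid_hull.step)
    show "jet_norm2 (jet_mid s t) = jet_norm2 s / 2 + jet_norm2 t / 2 - jet_dist2 s t / 4" if "s \<in> mid_hull S 0" "t \<in> mid_hull S 0" for s t
      by (rule jet_norm2_par) (use mid_hull_is_jet[OF a] that in auto)
  qed blast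
  have ga: "is_jet (g n)" for n by (rule mid_hull_is_jet[OF a g])
  define y where "y n = fst (g n)" for n
  define v where "v n = fst (snd (g n))" for n
  define w where "w n = snd (snd (g n))" for n
  have weak_jet: "weak_jet (y n) (v n) (w n)" for n using ga[of n] by (simp add: is_jet_def y_def v_def w_def)
  have L: "L2B (y n)" "L2B (v n i)" "L2B (w n i j)" for n i j using weak_jet[of n] by (auto simp: weak_jet_def)
  have Wd: "weak_deriv i (y n) (v n i)" "weak_deriv j (v n i) (w n i j)" for n i j using weak_jet[of n] by (auto simp: weak_jet_def)
  have zero: "L2B G" if "L2 G" "\<forall>x. (\<forall>n. f n x = 0) \<longrightarrow> G x = 0" "\<And>n. L2B (f n)"
    for f :: "nat \<Rightarrow> real^2 \<Rightarrow> real^3" and G using that by (auto simp: L2B_def)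
  have sDe: "jet_dist2 (g m) (g n) = grad2 (\<lambda>i x. v m i x - v n i x) + bending (\<lambda>i j x. w m i j x - w n i j x)" for m n
    by (simp add: jet_dist2_def v_def w_def)
  have Cv: "\<exists>N. \<forall>m\<ge>N. \<forall>n\<ge>N. n2 (\<lambda>x. v m i x - v n i x) < e" if e: "e > 0" for e i
  proof -
    obtain M where M: "\<forall>m\<ge>M. \<forall>n\<ge>M. jet_dist2 (g m) (g n) < e" using gC[OF e] by blast
    have "n2 (\<lambda>x. v m i x - v n i x) \<le> jet_dist2 (g m) (g n)" for m n
      unfolding sDe using n2_le_grad2[of "\<lambda>i x. v m i x - v n i x" i] bending_nonneg[of "\<lambda>i j x. w m i j x - w n i j x"] by linarith
    then show ?thesis using M by (meson order_le_less_trans)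
  qed
  have Cw: "\<exists>N. \<forall>m\<ge>N. \<forall>n\<ge>N. n2 (\<lambda>x. w m i j x - w n i j x) < e" if e: "e > 0" for e i j
  proof -
    obtain M where M: "\<forall>m\<ge>M. \<forall>n\<ge>M. jet_dist2 (g m) (g n) < e" using gC[OF e] by blast
    have "n2 (\<lambda>x. w m i j x - w n i j x) \<le> jet_dist2 (g m) (g n)" for m n
      unfolding sDe using n2_le_bending[of "\<lambda>i j x. w m i j x - w n i j x" i j] grad2_nonneg[of "\<lambda>i x. v m i x - v n i x"] by linarith
    then show ?thesis using M by (meson order_le_less_trans)
  qed
  have exV: "\<exists>G. L2B G \<and> (\<lambda>n. n2 (\<lambda>x. v n i x - G x)) \<longlonglongrightarrow> 0" for i
  proof -
    obtain r G where "strict_mono r" "L2 G" "AE x in lborel. (\<lambda>n. v (r n) i x) \<longlonglongrightarrow> G x" "(\<lambda>n. n2 (\<lambda>x. v n i x - G x)) \<longlonglongrightarrow> 0"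
      "\<forall>x. (\<forall>n. v n i x = 0) \<longrightarrow> G x = 0" by (rule L2_complete[OF L2B_L2[OF L(2)] Cv])
    then show ?thesis using zero[of G "\<lambda>n. v n i"] L(2) by blast
  qed
  define V where "V i = (SOME G. L2B G \<and> (\<lambda>n. n2 (\<lambda>x. v n i x - G x)) \<longlonglongrightarrow> 0)" for i
  have V: "L2B (V i)" "(\<lambda>n. n2 (\<lambda>x. v n i x - V i x)) \<longlonglongrightarrow> 0" for i
    using someI_ex[OF exV[of i]] by (auto simp: V_def)
  have exW: "\<exists>G. L2B G \<and> (\<lambda>n. n2 (\<lambda>x. w n i j x - G x)) \<longlonglongrightarrow> 0" for i j
  proof -
    obtain r G where "strict_mono r" "L2 G" "AE x in lborel. (\<lambda>n. w (r n) i j x) \<longlonglongrightarrow> G x" "(\<lambda>n. n2 (\<lambda>x. w n i j x - G x)) \<longlonglongrightarrow> 0"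
      "\<forall>x. (\<forall>n. w n i j x = 0) \<longrightarrow> G x = 0" by (rule L2_complete[OF L2B_L2[OF L(3)] Cw])
    then show ?thesis using zero[of G "\<lambda>n. w n i j"] L(3) by blast
  qed
  define W where "W i j = (SOME G. L2B G \<and> (\<lambda>n. n2 (\<lambda>x. w n i j x - G x)) \<longlonglongrightarrow> 0)" for i j
  have W: "L2B (W i j)" "(\<lambda>n. n2 (\<lambda>x. w n i j x - W i j x)) \<longlonglongrightarrow> 0" for i j
    using someI_ex[OF exW[of i j]] by (auto simp: W_def)
  define m where "m = measure lborel (B1 :: (real^2) set)"
  have m: "m > 0" using measure_B1_pos by (simp add: m_def)
  define c where "c n = (1 / m) *\<^sub>R (\<integral>x. y n x \<partial>lborel)" for n
  (* Only gradients converge so far; subtracting the mean lets the Poincare inequality control the maps themselves. *)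
  define z where "z n x = y n x - indicator B1 x *\<^sub>R c n" for n x
  have Ic: "L2B (\<lambda>x. indicator B1 x *\<^sub>R c n :: real^3)" for n
  proof -
    have "L2 (\<lambda>x. indicator B1 x *\<^sub>R c n :: real^3)"
      by (rule L2_bound(1)[OF L2_indicator_bounded(1)[OF bounded_ball, of 0 1], of _ "norm (c n)"])
        (auto intro!: borel_measurable_scaleR borel_measurable_indicator)
    then show ?thesis by (simp add: L2B_def)
  qed
  have Lz: "L2B (z n)" for n unfolding z_def by (rule L2B_diff[OF L(1) Ic])
  have L0: "L2B (\<lambda>x. 0 :: real^3)" by (simp add: L2B_def)
  have Wz: "weak_deriv i (z n) (v n i)" for i n
    using weak_deriv_diff[OF L(1)[of n] Ic[of n] L(2)[of n i] L0 Wd(1)[of i n] weak_deriv_const] by (simp add: z_def[abs_def])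
  have mz: "(\<integral>x. z n x \<partial>lborel) = 0" for n
  proof -
    have "(\<integral>x. z n x \<partial>lborel) = (\<integral>x. y n x \<partial>lborel) - (\<integral>x. indicator B1 x *\<^sub>R c n \<partial>lborel)"
      unfolding z_def by (rule Bochner_Integration.integral_diff[OF L2B_integrable[OF L(1)] L2B_integrable[OF Ic]])
    also have "(\<integral>x. indicator B1 x *\<^sub>R c n \<partial>lborel) = m *\<^sub>R c n"
      using integrable_indicator_bounded[OF bounded_ball, of "0::real^2" 1] by (simp add: m_def)
    finally show ?thesis using m by (simp add: c_def)
  qed
  have zle: "n2 (\<lambda>x. z k x - z n x) \<le> 8 * jet_dist2 (g k) (g n)" for k n
  proof -
    have i: "(\<lambda>x. indicator B1 x *\<^sub>R f x) = f" if "L2B f" for f :: "real^2 \<Rightarrow> real^3"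
      using that by (auto simp: L2B_def fun_eq_iff indicator_def)
    note ld = L2B_diff[OF Lz[of k] Lz[of n]] and vd = L2B_diff[OF L(2)[of k] L(2)[of n]]
    have "norm (p - q) \<le> 2" if "p \<in> B1" "q \<in> B1" for p q :: "real^2"
      using that norm_triangle_ineq4[of p q] by simp
    from poincare_mean[OF convex_ball _ subset_refl this ld vd weak_deriv_diff[OF Lz Lz L(2) L(2) Wz Wz]]
    have "m * n2 (\<lambda>x. z k x - z n x) \<le> 2 * 2\<^sup>2 * m * (\<Sum>i\<in>UNIV. n2 (\<lambda>x. v k i x - v n i x)) + (norm (\<integral>x. z k x - z n x \<partial>lborel))\<^sup>2"
      unfolding i[OF ld] i[OF vd] m_def by simp
    also have "(\<integral>x. z k x - z n x \<partial>lborel) = 0"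
      using mz by (simp add: Bochner_Integration.integral_diff[OF L2B_integrable[OF Lz] L2B_integrable[OF Lz]])
    finally have "m * n2 (\<lambda>x. z k x - z n x) \<le> m * (8 * grad2 (\<lambda>i x. v k i x - v n i x))" by (simp add: grad2_def algebra_simps)
    then have "n2 (\<lambda>x. z k x - z n x) \<le> 8 * grad2 (\<lambda>i x. v k i x - v n i x)" using m by simp
    also have "\<dots> \<le> 8 * jet_dist2 (g k) (g n)" unfolding sDe by (intro mult_left_mono) auto
    finally show ?thesis .
  qed
  have Cz: "\<exists>N. \<forall>m\<ge>N. \<forall>n\<ge>N. n2 (\<lambda>x. z m x - z n x) < e" if e: "e > 0" for e
  proof -
    obtain M where M: "\<forall>m\<ge>M. \<forall>n\<ge>M. jet_dist2 (g m) (g n) < e / 8" using gC[of "e/8"] e by auto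
    show ?thesis
    proof (intro exI[of _ M] allI impI)
      fix k n assume "k \<ge> M" "n \<ge> M"
      then have "jet_dist2 (g k) (g n) < e / 8" using M by blast
      then show "n2 (\<lambda>x. z k x - z n x) < e" using zle[of k n] by linarith
    qed
  qed
  obtain r Y where Y: "strict_mono r" "L2 Y" "AE x in lborel. (\<lambda>n. z (r n) x) \<longlonglongrightarrow> Y x" "(\<lambda>n. n2 (\<lambda>x. z n x - Y x)) \<longlonglongrightarrow> 0"
      "\<forall>x. (\<forall>n. z n x = 0) \<longrightarrow> Y x = 0" by (rule L2_complete[OF L2B_L2[OF Lz] Cz])
  have LY: "L2B Y" by (rule zero[OF Y(2,5) Lz])
  show thesis
  proof (rule that)
    show "weak_jet Y V W" unfolding weak_jet_def
    proof (intro conjI allI LY V(1) W(1))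
      show "weak_deriv i Y (V i)" for i
        by (rule weak_deriv_limit[OF L2B_L2[OF Lz] Y(2) L2B_L2[OF L(2)] L2B_L2[OF V(1)] Y(4) V(2) Wz])
      show "weak_deriv j (V i) (W i j)" for i j
        by (rule weak_deriv_limit[OF L2B_L2[OF L(2)] L2B_L2[OF V(1)] L2B_L2[OF L(3)] L2B_L2[OF W(1)] V(2) W(2) Wd(2)])
    qed
    have "AE x in lborel. V i x = Vs i x" for i
    proof -
      obtain r where r: "strict_mono r" "AE x in lborel. (\<lambda>n. v (r n) i x) \<longlonglongrightarrow> V i x"
        by (rule L2_AE_subseq[OF L2B_L2[OF L(2)] L2B_L2[OF V(1)] V(2)])
      from r(2) ae show ?thesis
      proof eventually_elim
        case (elim x)
        have "(\<lambda>n. v n i x) \<longlonglongrightarrow> Vs i x"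
        proof (rule metric_LIMSEQ_I)
          fix e :: real assume e: "e > 0"
          from elim(2) have "(\<lambda>n. fst (snd (S n)) i x) \<longlonglongrightarrow> Vs i x" by blast
          from metric_LIMSEQ_D[OF this, of "e/2"] e obtain M where M: "\<And>n. n \<ge> M \<Longrightarrow> dist (fst (snd (S n)) i x) (Vs i x) < e / 2" by auto
          have "dist (v n i x) (Vs i x) < e" if "n \<ge> M" for n
          proof -
            have "dist (fst (snd (g n)) i x) (Vs i x) \<le> e / 2"
              by (rule mid_hull_pointwise[OF _ g[of n]]) (use M that in \<open>auto intro: less_imp_le\<close>)
            then show ?thesis using e by (simp add: v_def)
          qed
          then show "\<exists>no. \<forall>n\<ge>no. dist (v n i x) (Vs i x) < e" by blast
        qed
        from LIMSEQ_subseq_LIMSEQ[OF this r(1)] have "(\<lambda>n. v (r n) i x) \<longlonglongrightarrow> Vs i x" by (simp add: o_def)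
        then show ?case using LIMSEQ_unique elim(1) by blast
      qed
    qed
    then show "AE x in lborel. \<forall>i. V i x = Vs i x" by (intro AE_finite_allI[of UNIV, simplified]) auto
    have lim: "(\<lambda>n. bending (w n)) \<longlonglongrightarrow> bending W"
      unfolding bending_def by (intro tendsto_sum n2_tendsto L2B_L2 L(3) W)
    show "bending W \<le> \<beta>"
    proof (rule field_le_epsilon)
      fix e :: real assume e: "e > 0"
      obtain M where M: "\<And>n. n \<ge> M \<Longrightarrow> \<bar>bending (snd (snd (S n))) - \<beta>\<bar> < e" using LIMSEQ_D[OF bl e] by auto
      have "bending (w n) \<le> \<beta> + e" if n: "n \<ge> M" for n
        unfolding w_def
      proof (rule mid_hull_bending[OF a _ g])
        fix k assume "k \<ge> n"
        then show "bending (snd (snd (S k))) \<le> \<beta> + e" using M[of k] n by linarith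
      qed
      then show "bending W \<le> \<beta> + e" by (intro LIMSEQ_le_const2[OF lim]) blast
    qed
  qed
qed

text \<open>The direct method: compactness of the gradients by \<open>rellich\<close>, lower semicontinuity of the metric term
  by Fatou and of the bending term by \<open>weak_limit_jet\<close>.\<close>
lemma minimizer_exists:
  assumes h: "h > 0" and ex: "weak_jet Y0 V0 W0" "field_energy h \<Delta> V0 W0 < \<infinity>"
  shows "\<exists>Y V W. weak_jet Y V W \<and> (\<forall>Y' V' W'. weak_jet Y' V' W' \<longrightarrow> field_energy h \<Delta> V W \<le> field_energy h \<Delta> V' W')"
proof -
  define En where "En s = field_energy h \<Delta> (fst (snd s)) (snd (snd s))" for s :: jet
  define m where "m = Inf (En ` {s. is_jet s})"
  have "m \<le> field_energy h \<Delta> V0 W0"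
    unfolding m_def by (rule Inf_lower) (rule image_eqI[of _ _ "(Y0, V0, W0)"], use ex(1) in \<open>auto simp: En_def is_jet_def\<close>)
  then have mfin: "m < top" using ex(2) by (simp add: order_le_less_trans)
  then obtain m' where m': "m = ennreal m'" "m' \<ge> 0" by (cases m) auto
  have "\<exists>s. is_jet s \<and> En s < ennreal (m' + 1 / real (Suc n))" for n
  proof -
    have "m < ennreal (m' + 1 / real (Suc n))" unfolding m'(1) using m'(2) by (subst ennreal_less_iff) auto
    then show ?thesis unfolding m_def by (auto simp: Inf_less_iff)
  qed
  then obtain s where s: "\<And>n. is_jet (s n)" "\<And>n. En (s n) < ennreal (m' + 1 / real (Suc n))" by metis
  define v where "v n = fst (snd (s n))" for n
  define w where "w n = snd (snd (s n))" for n
  define a where "a n = enn2real (\<integral>\<^sup>+x. indicator B1 x * ennreal ((norm (metric_of (v n) x - ref_metric \<Delta> x))\<^sup>2) \<partial>lborel)" for n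
  have weak_jet: "weak_jet (fst (s n)) (v n) (w n)" for n using s(1)[of n] by (simp add: is_jet_def v_def w_def)
  have L: "L2B (v n i)" "L2B (w n i j)" for n i j using weak_jet[of n] by (auto simp: weak_jet_def)
  have Wd: "weak_deriv j (v n i) (w n i j)" for n i j using weak_jet[of n] by (auto simp: weak_jet_def)
  have E1: "field_energy h \<Delta> (v n) (w n) \<le> ennreal (m' + 1 / real (Suc n))" for n
    using s(2)[of n] by (simp add: En_def v_def w_def less_imp_le)
  have E2: "field_energy h \<Delta> (v n) (w n) \<le> ennreal (m' + 1)" for n
    by (rule order_trans[OF E1]) (auto intro!: ennreal_leI)
  have aE: "(\<integral>\<^sup>+x. indicator B1 x * ennreal ((norm (metric_of (v n) x - ref_metric \<Delta> x))\<^sup>2) \<partial>lborel) = ennreal (a n)" for n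
  proof -
    have "(\<integral>\<^sup>+x. indicator B1 x * ennreal ((norm (metric_of (v n) x - ref_metric \<Delta> x))\<^sup>2) \<partial>lborel) \<le> field_energy h \<Delta> (v n) (w n)"
      by (simp add: field_energy_def)
    then have "(\<integral>\<^sup>+x. indicator B1 x * ennreal ((norm (metric_of (v n) x - ref_metric \<Delta> x))\<^sup>2) \<partial>lborel) < top"
      using E2[of n] by (meson ennreal_less_top order_le_less_trans)
    then show ?thesis by (simp add: a_def)
  qed
  have a0: "a n \<ge> 0" for n by (simp add: a_def)
  have ab: "a n + h\<^sup>2 * bending (w n) \<le> m' + 1 / real (Suc n)" for n
  proof -
    have "ennreal (a n + h\<^sup>2 * bending (w n)) = field_energy h \<Delta> (v n) (w n)"
      unfolding field_energy_def aE using a0 by (intro ennreal_plus) auto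
    also have "\<dots> \<le> ennreal (m' + 1 / real (Suc n))" by (rule E1)
    finally show ?thesis using m'(2) by (subst (asm) ennreal_le_iff) auto
  qed
  have ab1: "a n + h\<^sup>2 * bending (w n) \<le> m' + 1" for n
  proof -
    have "1 / real (Suc n) \<le> 1" by simp
    then show ?thesis using ab[of n] by linarith
  qed
  have h2: "h\<^sup>2 > 0" using h by simp
  define C where "C = (m' + 1) / h\<^sup>2"
  have bw: "bending (w n) \<le> C" for n
    using ab1[of n] a0[of n] h2 by (simp add: C_def field_simps)
  have C0: "C \<ge> 0" using m'(2) by (simp add: C_def)
  define C' where "C' = (2 + \<Delta>\<^sup>2) * measure lborel (B1 :: (real^2) set) + (m' + 1)"
  have bv: "n2 (v n i) \<le> C'" for n i
    unfolding C'_def by (rule gradient_bound[OF weak_jet E2]) (use m'(2) in simp)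
  define M where "M = max C C'"
  have bv': "n2 (v n i) \<le> M" for n i using bv[of n i] by (simp add: M_def)
  have bw': "n2 (w n i j) \<le> M" for n i j
    using n2_le_bending[of "w n" i j] bw[of n] by (simp add: M_def)
  (* Stated for an arbitrary subsequence r, so that it can be applied to the two partial derivatives in turn. *)
  have sub: "\<exists>q G. strict_mono (q :: nat \<Rightarrow> nat) \<and> (AE x in lborel. (\<lambda>n. v (r (q n)) i x) \<longlonglongrightarrow> G x)" for r :: "nat \<Rightarrow> nat" and i
  proof -
    obtain q1 where q1: "strict_mono (q1 :: nat \<Rightarrow> nat)"
      "\<And>e. e > 0 \<Longrightarrow> \<exists>N. \<forall>m\<ge>N. \<forall>n\<ge>N. n2 (\<lambda>x. v (r (q1 m)) i x - v (r (q1 n)) i x) < e"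
      using rellich[of "\<lambda>n. v (r n) i" "\<lambda>n j. w (r n) i j" M, OF L(1) L(2) Wd bv' bw'] by blast
    obtain q2 G where "strict_mono q2" "L2 G" "AE x in lborel. (\<lambda>n. v (r (q1 (q2 n))) i x) \<longlonglongrightarrow> G x"
      "(\<lambda>n. n2 (\<lambda>x. v (r (q1 n)) i x - G x)) \<longlonglongrightarrow> 0" "\<forall>x. (\<forall>n. v (r (q1 n)) i x = 0) \<longrightarrow> G x = 0"
      by (rule L2_complete[of "\<lambda>n. v (r (q1 n)) i", OF L2B_L2[OF L(1)] q1(2)])
    then show ?thesis using strict_mono_o[OF q1(1), of q2] by (intro exI[of _ "q1 \<circ> q2"] exI[of _ G]) (auto simp: o_def)
  qed
  obtain r1 G1 where r1: "strict_mono r1" "AE x in lborel. (\<lambda>n. v (r1 n) 1 x) \<longlonglongrightarrow> G1 x"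
    using sub[of id 1] by auto
  obtain r2 G2 where r2: "strict_mono r2" "AE x in lborel. (\<lambda>n. v (r1 (r2 n)) 2 x) \<longlonglongrightarrow> G2 x"
    using sub[of r1 2] by auto
  (* Both bounded energy sequences are packed into one function of k to extract a common convergent subsequence. *)
  define f where "f n k = (if k = (0::nat) then a (r1 (r2 n)) else bending (w (r1 (r2 n))))" for n k
  have "norm (f n k) \<le> m' + 1 + C" for n k
  proof -
    have "a k \<le> m' + 1" for k using ab1[of k] h2 mult_nonneg_nonneg[OF less_imp_le[OF h2] bending_nonneg[of "w k"]] by linarith
    then have "f n k \<le> m' + 1 + C" using bw[of "r1 (r2 n)"] C0 m'(2) by (simp add: f_def add_increasing2)
    moreover have "f n k \<ge> 0" using a0 by (simp add: f_def)
    ultimately show ?thesis by simp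
  qed
  then obtain r3 where r3: "strict_mono (r3 :: nat \<Rightarrow> nat)" "\<And>k. k \<in> UNIV \<Longrightarrow> \<exists>l. (\<lambda>n. f (r3 n) k) \<longlonglongrightarrow> l"
    using function_convergent_subsequence[of UNIV f] by blast
  define q where "q = r1 \<circ> r2 \<circ> r3"
  have q: "strict_mono q" unfolding q_def by (intro strict_mono_o r1 r2 r3)
  obtain \<alpha> where \<alpha>: "(\<lambda>n. a (q n)) \<longlonglongrightarrow> \<alpha>" using r3(2)[of 0] by (auto simp: f_def q_def)
  obtain \<beta> where \<beta>: "(\<lambda>n. bending (w (q n))) \<longlonglongrightarrow> \<beta>" using r3(2)[of 1] by (auto simp: f_def q_def)
  define Vs where "Vs i = (if i = 1 then G1 else G2)" for i :: 2
  have ae: "AE x in lborel. \<forall>i. (\<lambda>n. v (q n) i x) \<longlonglongrightarrow> Vs i x"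
    using r1(2) r2(2)
  proof eventually_elim
    case (elim x)
    have "(\<lambda>n. v (q n) 1 x) \<longlonglongrightarrow> G1 x"
      using LIMSEQ_subseq_LIMSEQ[OF elim(1) strict_mono_o[OF r2(1) r3(1)]] by (simp add: o_def q_def)
    moreover have "(\<lambda>n. v (q n) 2 x) \<longlonglongrightarrow> G2 x"
      using LIMSEQ_subseq_LIMSEQ[OF elim(2) r3(1)] by (simp add: o_def q_def)
    ultimately show ?case by (auto simp: Vs_def forall_2)
  qed
  have \<alpha>\<beta>: "\<alpha> + h\<^sup>2 * \<beta> \<le> m'"
  proof (rule LIMSEQ_le)
    show "(\<lambda>n. a (q n) + h\<^sup>2 * bending (w (q n))) \<longlonglongrightarrow> \<alpha> + h\<^sup>2 * \<beta>" by (intro tendsto_intros \<alpha> \<beta>)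
    have "(\<lambda>n. m' + 1 / real (Suc (q n))) \<longlonglongrightarrow> m' + 0"
      using LIMSEQ_subseq_LIMSEQ[OF LIMSEQ_Suc[OF lim_1_over_n] q] by (intro tendsto_intros) (simp add: o_def)
    then show "(\<lambda>n. m' + 1 / real (Suc (q n))) \<longlonglongrightarrow> m'" by simp
  qed (use ab in blast)
  have \<alpha>0: "\<alpha> \<ge> 0" by (rule LIMSEQ_le_const[OF \<alpha>]) (use a0 in blast)
  have \<beta>0: "\<beta> \<ge> 0" by (rule LIMSEQ_le_const[OF \<beta>]) (use bending_nonneg in blast)
  obtain Y V W where YVW: "weak_jet Y V W" "AE x in lborel. \<forall>i. V i x = Vs i x" "bending W \<le> \<beta>"
  proof (rule weak_limit_jet[of "\<lambda>n. s (q n)" "2 * M + C" Vs \<beta>])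
    show "is_jet (s (q n))" for n by (rule s(1))
    show "jet_norm2 (s (q n)) \<le> 2 * M + C" for n
    proof -
      have "grad2 (v (q n)) \<le> (\<Sum>i\<in>(UNIV::2 set). M)" unfolding grad2_def by (rule sum_mono) (rule bv')
      then show ?thesis using bw[of "q n"] by (simp add: jet_norm2_def v_def w_def)
    qed
    show "AE x in lborel. \<forall>i. (\<lambda>n. fst (snd (s (q n))) i x) \<longlonglongrightarrow> Vs i x" using ae by (simp add: v_def)
    show "(\<lambda>n. bending (snd (snd (s (q n))))) \<longlonglongrightarrow> \<beta>" using \<beta> by (simp add: w_def)
  qed blast
  have low: "(\<integral>\<^sup>+x. indicator B1 x * ennreal ((norm (metric_of V x - ref_metric \<Delta> x))\<^sup>2) \<partial>lborel) \<le> ennreal \<alpha>"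
  proof -
    have [measurable]: "v n i \<in> borel_measurable borel" for n i using L(1) by (auto simp: L2B_def L2_def)
    have [measurable]: "B1 \<in> sets borel" "metric_of (v n) \<in> borel_measurable borel" for n by (auto intro!: metric_of_measurable)
    have "(\<integral>\<^sup>+x. indicator B1 x * ennreal ((norm (metric_of V x - ref_metric \<Delta> x))\<^sup>2) \<partial>lborel)
       = (\<integral>\<^sup>+x. liminf (\<lambda>n. indicator B1 x * ennreal ((norm (metric_of (v (q n)) x - ref_metric \<Delta> x))\<^sup>2)) \<partial>lborel)"
    proof (rule nn_integral_cong_AE)
      show "AE x in lborel. indicator B1 x * ennreal ((norm (metric_of V x - ref_metric \<Delta> x))\<^sup>2)
        = liminf (\<lambda>n. indicator B1 x * ennreal ((norm (metric_of (v (q n)) x - ref_metric \<Delta> x))\<^sup>2))"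
        using ae YVW(2)
      proof eventually_elim
        case (elim x)
        then have lim: "(\<lambda>n. v (q n) i x) \<longlonglongrightarrow> V i x" for i by simp
        have "(\<lambda>n. metric_of (v (q n)) x) \<longlonglongrightarrow> metric_of V x"
          unfolding metric_of_def by (intro tendsto_vec_lambda tendsto_inner lim)
        then have "(\<lambda>n. ennreal ((norm (metric_of (v (q n)) x - ref_metric \<Delta> x))\<^sup>2)) \<longlonglongrightarrow> ennreal ((norm (metric_of V x - ref_metric \<Delta> x))\<^sup>2)"
          by (intro tendsto_ennrealI tendsto_intros)
        then have "(\<lambda>n. indicator B1 x * ennreal ((norm (metric_of (v (q n)) x - ref_metric \<Delta> x))\<^sup>2)) \<longlonglongrightarrow> indicator B1 x * ennreal ((norm (metric_of V x - ref_metric \<Delta> x))\<^sup>2)"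
          by (intro ennreal_tendsto_cmult) (auto simp: indicator_def)
        then show ?case by (intro lim_imp_Liminf[symmetric]) auto
      qed
    qed
    also have "\<dots> \<le> liminf (\<lambda>n. \<integral>\<^sup>+x. indicator B1 x * ennreal ((norm (metric_of (v (q n)) x - ref_metric \<Delta> x))\<^sup>2) \<partial>lborel)"
      by (rule nn_integral_liminf) measurable
    also have "\<dots> = ennreal \<alpha>" unfolding aE by (intro lim_imp_Liminf tendsto_ennrealI \<alpha>) auto
    finally show ?thesis .
  qed
  have "field_energy h \<Delta> V W \<le> ennreal \<alpha> + ennreal (h\<^sup>2 * \<beta>)"
    unfolding field_energy_def using YVW(3) by (intro add_mono low ennreal_leI mult_left_mono) auto
  also have "\<dots> = ennreal (\<alpha> + h\<^sup>2 * \<beta>)" using \<alpha>0 \<beta>0 by (intro ennreal_plus[symmetric]) auto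
  also have "\<dots> \<le> m" unfolding m'(1) by (rule ennreal_leI[OF \<alpha>\<beta>])
  finally have le: "field_energy h \<Delta> V W \<le> m" .
  have "m \<le> field_energy h \<Delta> V' W'" if "weak_jet Y' V' W'" for Y' V' W'
    unfolding m_def by (rule Inf_lower) (rule image_eqI[of _ _ "(Y', V', W')"], use that in \<open>auto simp: En_def is_jet_def\<close>)
  then show ?thesis using YVW(1) le by (meson order_trans)
qed

section \<open>Integration of radial functions\<close>

lemma emeasure_disc: "r \<ge> 0 \<Longrightarrow> emeasure lborel (cball (0::real^2) r) = ennreal (pi * r\<^sup>2)"
  by (simp add: emeasure_cball unit_ball_vol_2)

lemma emeasure_open_disc: "r \<ge> 0 \<Longrightarrow> emeasure lborel (ball (0::real^2) r) = ennreal (pi * r\<^sup>2)"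
  by (simp add: emeasure_ball unit_ball_vol_2)

text \<open>Two finite measures on the line are compared on the rays \<open>{a<..}\<close>, where the left one is the area of an
  annulus.\<close>
lemma radial_distr:
  "distr (density lborel (indicator B1)) borel (\<lambda>x::real^2. (norm x)\<^sup>2) = density lborel (\<lambda>s. ennreal pi * indicator {0..1} s)"
  (is "?M = ?N")
proof -
  have Bm[measurable]: "B1 \<in> sets borel" by simp
  have nm[measurable]: "(\<lambda>x::real^2. (norm x)\<^sup>2) \<in> borel_measurable borel" by measurable
  have M: "emeasure ?M {a<..} = emeasure lborel {x \<in> B1. a < (norm x)\<^sup>2}" for a
  proof -
    have "emeasure ?M {a<..} = emeasure (density lborel (indicator B1)) ((\<lambda>x::real^2. (norm x)\<^sup>2) -` {a<..} \<inter> space lborel)"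
      by (subst emeasure_distr) auto
    also have "\<dots> = (\<integral>\<^sup>+x. indicator B1 x * indicator ((\<lambda>x::real^2. (norm x)\<^sup>2) -` {a<..} \<inter> space lborel) x \<partial>lborel)"
      by (rule emeasure_density) (use measurable_sets[OF nm, of "{a<..}"] in auto)
    also have "\<dots> = (\<integral>\<^sup>+x. indicator {x \<in> B1. a < (norm x)\<^sup>2} x \<partial>lborel)"
      by (intro nn_integral_cong) (auto simp: indicator_def)
    also have "\<dots> = emeasure lborel {x \<in> B1. a < (norm x)\<^sup>2}" by (rule nn_integral_indicator) measurable
    finally show ?thesis .
  qed
  have N: "emeasure ?N {a<..} = ennreal pi * emeasure lborel ({0..1} \<inter> {a<..})" for a :: real
  proof -
    have "emeasure ?N {a<..} = (\<integral>\<^sup>+x. ennreal pi * indicator {0..1} x * indicator {a<..} x \<partial>lborel)"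
      by (rule emeasure_density) auto
    also have "\<dots> = (\<integral>\<^sup>+x. ennreal pi * indicator ({0..1} \<inter> {a<..}) x \<partial>lborel)"
      by (intro nn_integral_cong) (auto simp: indicator_def)
    also have "\<dots> = ennreal pi * emeasure lborel ({0..1} \<inter> {a<..})" by (rule nn_integral_cmult_indicator) auto
    finally show ?thesis .
  qed
  have eq: "emeasure ?M {a<..} = emeasure ?N {a<..}" for a
  proof -
    consider "a < 0" | "0 \<le> a" "a < 1" | "a \<ge> 1" by linarith
    then show ?thesis
    proof cases
      case 1
      then have "{x \<in> B1. a < (norm x)\<^sup>2} = (B1 :: (real^2) set)" by (auto intro: order_less_le_trans[OF _ zero_le_power2])
      moreover have "{0..1} \<inter> {a<..} = {0..1}" using 1 by auto
      ultimately show ?thesis unfolding M N by (simp add: emeasure_open_disc)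
    next
      case 2
      have s: "{x \<in> B1. a < (norm x)\<^sup>2} = (B1 - cball 0 (sqrt a) :: (real^2) set)"
      proof -
        have iff: "a < (norm x)\<^sup>2 \<longleftrightarrow> sqrt a < norm x" for x :: "real^2"
          using real_sqrt_less_iff[of a "(norm x)\<^sup>2"] by simp
        show ?thesis unfolding iff by (auto simp: not_le)
      qed
      have sub: "cball (0::real^2) (sqrt a) \<subseteq> B1" 
      proof -
        have "sqrt a < 1" using 2 by simp
        then show ?thesis by (intro subsetI) (metis mem_ball mem_cball order_le_less_trans)
      qed
      have "emeasure lborel (B1 - cball 0 (sqrt a) :: (real^2) set) = emeasure lborel (B1 :: (real^2) set) - emeasure lborel (cball (0::real^2) (sqrt a))"
        by (rule emeasure_Diff) (use sub 2 in \<open>auto simp: emeasure_disc\<close>)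
      also have "\<dots> = ennreal (pi - pi * a)" using 2 by (simp add: emeasure_disc emeasure_open_disc ennreal_minus)
      also have "pi - pi * a = pi * (1 - a)" by (simp add: algebra_simps)
      finally have l: "emeasure lborel {x \<in> B1. a < (norm x)\<^sup>2} = ennreal (pi * (1 - a))" unfolding s .
      have "{0..1} \<inter> {a<..} = {a<..1}" using 2 by auto
      then show ?thesis unfolding M N l using 2 by (simp add: ennreal_mult)
    next
      case 3
      have "{x \<in> B1. a < (norm x)\<^sup>2} = ({} :: (real^2) set)"
      proof -
        have "(norm x)\<^sup>2 \<le> a" if "x \<in> B1" for x :: "real^2"
          using that 3 power_mono[of "norm x" 1 2] by simp
        then show ?thesis by (auto simp: not_less[symmetric])
      qed
      moreover have "{0..1} \<inter> {a<..} = {}" using 3 by auto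
      ultimately show ?thesis unfolding M N by (simp only: emeasure_empty mult_zero_right)
    qed
  qed
  have fin: "emeasure ?M {a<..} < \<infinity>" for a
    unfolding M by (intro emeasure_bounded_finite bounded_subset[OF bounded_ball[of 0 1]]) auto
  show ?thesis
  proof (rule measure_eqI_lessThan)
    show "emeasure ?M {a<..} < \<infinity>" for a by (rule fin)
    show "emeasure ?M {a<..} = emeasure ?N {a<..}" for a by (rule eq)
  qed simp_all
qed

lemma radial_nn_integral:
  assumes [measurable]: "G \<in> borel_measurable borel"
  shows "(\<integral>\<^sup>+x. indicator B1 x * G ((norm (x::real^2))\<^sup>2) \<partial>lborel) = ennreal pi * (\<integral>\<^sup>+s. indicator {0..1} s * G s \<partial>lborel)"
proof -
  have Bm[measurable]: "B1 \<in> sets borel" by simp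
  have "(\<integral>\<^sup>+x. indicator B1 x * G ((norm (x::real^2))\<^sup>2) \<partial>lborel) = (\<integral>\<^sup>+x. G ((norm x)\<^sup>2) \<partial>density lborel (indicator B1))"
    by (rule nn_integral_density[symmetric]) auto
  also have "\<dots> = (\<integral>\<^sup>+s. G s \<partial>distr (density lborel (indicator B1)) borel (\<lambda>x::real^2. (norm x)\<^sup>2))"
    by (rule nn_integral_distr[symmetric]) auto
  also have "\<dots> = (\<integral>\<^sup>+s. ennreal pi * indicator {0..1} s * G s \<partial>lborel)"
    unfolding radial_distr by (rule nn_integral_density) auto
  also have "\<dots> = ennreal pi * (\<integral>\<^sup>+s. indicator {0..1} s * G s \<partial>lborel)"
    by (simp add: mult.assoc nn_integral_cmult)
  finally show ?thesis .
qed

lemma radial_integral: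
  fixes G :: "real \<Rightarrow> real"
  assumes [measurable]: "G \<in> borel_measurable borel"
  shows "(\<integral>x. indicator B1 x * G ((norm (x::real^2))\<^sup>2) \<partial>lborel) = pi * (\<integral>s. indicator {0..1} s * G s \<partial>lborel)"
proof -
  have Bm[measurable]: "B1 \<in> sets borel" by simp
  have d1: "density lborel (indicator B1 :: real^2 \<Rightarrow> ennreal) = density lborel (\<lambda>x. ennreal (indicator B1 x))"
    by (simp add: ennreal_indicator)
  have d2: "density lborel (\<lambda>s. ennreal pi * indicator {0..1} s) = density lborel (\<lambda>s. ennreal (pi * indicator {0..1::real} s))"
    by (intro arg_cong[of _ _ "density lborel"]) (auto simp: fun_eq_iff indicator_def)
  have "(\<integral>x. indicator B1 x * G ((norm (x::real^2))\<^sup>2) \<partial>lborel) = (\<integral>x. G ((norm x)\<^sup>2) \<partial>density lborel (indicator B1))"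
    unfolding d1 by (subst integral_density) auto
  also have "\<dots> = (\<integral>s. G s \<partial>distr (density lborel (indicator B1)) borel (\<lambda>x::real^2. (norm x)\<^sup>2))"
    by (rule integral_distr[symmetric]) auto
  also have "\<dots> = (\<integral>s. (pi * indicator {0..1} s) * G s \<partial>lborel)"
    unfolding radial_distr d2 by (subst integral_density) auto
  also have "\<dots> = pi * (\<integral>s. indicator {0..1} s * G s \<partial>lborel)" by (simp add: mult.assoc)
  finally show ?thesis .
qed

lemma nn_integral_inverse_square:
  assumes "h > (0::real)"
  shows "(\<integral>\<^sup>+s. indicator {0..1} s * ennreal (1 / (s + h\<^sup>2)\<^sup>2) \<partial>lborel) \<le> ennreal (1 / h\<^sup>2)"
proof -
  have pos: "s + h\<^sup>2 > 0" if "s \<ge> 0" for s using that assms by (simp add: add_nonneg_pos)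
  have "(\<integral>\<^sup>+s. indicator {0..1} s * ennreal (1 / (s + h\<^sup>2)\<^sup>2) \<partial>lborel) = (\<integral>\<^sup>+s. ennreal (1 / (s + h\<^sup>2)\<^sup>2) * indicator {0..1} s \<partial>lborel)"
    by (simp add: mult.commute)
  also have "\<dots> = ennreal (- 1 / (1 + h\<^sup>2) - (- 1 / (0 + h\<^sup>2)))"
  proof (rule nn_integral_FTC_Icc)
    show "((\<lambda>s. - 1 / (s + h\<^sup>2)) has_real_derivative 1 / (s + h\<^sup>2)\<^sup>2) (at s)" if "s \<in> {0..1}" for s
      using pos[of s] that by (auto intro!: derivative_eq_intros simp: power2_eq_square)
  qed auto
  also have "\<dots> \<le> ennreal (1 / h\<^sup>2)" by (intro ennreal_leI) simp
  finally show ?thesis .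
qed

lemma nn_integral_inverse:
  assumes "h > (0::real)"
  shows "(\<integral>\<^sup>+s. indicator {0..1} s * ennreal (1 / (s + h\<^sup>2)) \<partial>lborel) = ennreal (ln (1 + h\<^sup>2) - ln (h\<^sup>2))"
proof -
  have pos: "s + h\<^sup>2 > 0" if "s \<ge> 0" for s using that assms by (simp add: add_nonneg_pos)
  have "(\<integral>\<^sup>+s. indicator {0..1} s * ennreal (1 / (s + h\<^sup>2)) \<partial>lborel) = (\<integral>\<^sup>+s. ennreal (1 / (s + h\<^sup>2)) * indicator {0..1} s \<partial>lborel)"
    by (simp add: mult.commute)
  also have "\<dots> = ennreal (ln (1 + h\<^sup>2) - ln (0 + h\<^sup>2))"
  proof (rule nn_integral_FTC_Icc)
    show "((\<lambda>s. ln (s + h\<^sup>2)) has_real_derivative 1 / (s + h\<^sup>2)) (at s)" if "s \<in> {0..1}" for s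
      using pos[of s] that by (auto intro!: derivative_eq_intros)
    show "0 \<le> 1 / (s + h\<^sup>2)" if "s \<in> {0..1}" for s using pos[of s] that by simp
  qed auto
  finally show ?thesis by simp
qed

section \<open>The smoothed cone and the upper bound\<close>

lemma L2B_restrict_continuous:
  fixes P :: "real^2 \<Rightarrow> 'b::euclidean_space"
  assumes c: "continuous_on UNIV P" shows "L2B (\<lambda>x. indicator B1 x *\<^sub>R P x)"
proof -
  have "bounded (P ` cball 0 1)" by (intro compact_imp_bounded compact_continuous_image continuous_on_subset[OF c]) auto
  then obtain B where "\<forall>y\<in>P ` cball 0 1. norm y \<le> B" unfolding bounded_iff ..
  then have B: "norm (P x) \<le> B" if "x \<in> B1" for x using that by auto
  have "P \<in> borel_measurable borel" by (rule borel_measurable_continuous_onI[OF c])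
  then have "L2 (\<lambda>x. indicator B1 x *\<^sub>R P x)"
    by (intro L2_bound(1)[OF L2_indicator_bounded(1)[OF bounded_ball, of 0 1], of _ "\<bar>B\<bar>"])
      (auto simp: indicator_def intro!: borel_measurable_scaleR borel_measurable_indicator intro: order_trans[OF B])
  then show ?thesis by (simp add: L2B_def)
qed

text \<open>Integration by parts against test functions; \<open>P\<close> is continuously differentiable on the whole plane
  and is cut off by the indicator of the disc afterwards.\<close>
lemma classical_weak_deriv:
  fixes P :: "real^2 \<Rightarrow> 'b::euclidean_space"
  assumes d: "\<And>x. (P has_derivative (\<lambda>d. \<Sum>i\<in>UNIV. d $ i *\<^sub>R P' i x)) (at x)" and c: "\<And>i. continuous_on UNIV (P' i)"
  shows "weak_deriv i (\<lambda>x. indicator B1 x *\<^sub>R P x) (\<lambda>x. indicator B1 x *\<^sub>R P' i x)"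
  unfolding weak_deriv_def
proof (intro allI impI)
  fix \<phi> :: "real^2 \<Rightarrow> real" assume \<phi>: "test_function B1 \<phi>"
  have Pc: "continuous_on UNIV P" by (rule has_derivative_continuous_on[OF d])
  obtain K where K: "compact K" "K \<subseteq> B1" "\<forall>x. x \<notin> K \<longrightarrow> \<phi> x = 0 \<and> (\<forall>i. partial_deriv i \<phi> x = 0)"
  proof -
    obtain K1 where K1: "compact K1" "K1 \<subseteq> B1" "\<forall>x. x \<notin> K1 \<longrightarrow> \<phi> x = 0 \<and> partial_deriv 1 \<phi> x = 0"
      using test_functionD(4)[OF \<phi>, of 1] by blast
    obtain K2 where K2: "compact K2" "K2 \<subseteq> B1" "\<forall>x. x \<notin> K2 \<longrightarrow> \<phi> x = 0 \<and> partial_deriv 2 \<phi> x = 0"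
      using test_functionD(4)[OF \<phi>, of 2] by blast
    show thesis by (rule that[of "K1 \<union> K2"]) (use K1 K2 in \<open>auto simp: forall_2 compact_Un\<close>)
  qed
  have "(\<integral>x. partial_deriv i \<phi> x *\<^sub>R P x + \<phi> x *\<^sub>R P' i x \<partial>lborel) = 0"
    by (rule integration_by_parts[of \<phi> "\<lambda>i. partial_deriv i \<phi>" K UNIV])
      (use K d c test_functionD(1)[OF \<phi>] test_functionD(3)[OF \<phi>] in auto)
  also have "(\<lambda>x. partial_deriv i \<phi> x *\<^sub>R P x + \<phi> x *\<^sub>R P' i x)
     = (\<lambda>x. partial_deriv i \<phi> x *\<^sub>R indicator B1 x *\<^sub>R P x + \<phi> x *\<^sub>R indicator B1 x *\<^sub>R P' i x)"
  proof
    fix x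
    show "partial_deriv i \<phi> x *\<^sub>R P x + \<phi> x *\<^sub>R P' i x = partial_deriv i \<phi> x *\<^sub>R indicator B1 x *\<^sub>R P x + \<phi> x *\<^sub>R indicator B1 x *\<^sub>R P' i x"
    proof (cases "x \<in> K")
      case True
      then have "x \<in> B1" using K(2) by blast
      then show ?thesis by simp
    next
      case False
      then show ?thesis using K(3) by simp
    qed
  qed
  finally show "(\<integral>x. partial_deriv i \<phi> x *\<^sub>R indicator B1 x *\<^sub>R P x \<partial>lborel) = - (\<integral>x. \<phi> x *\<^sub>R indicator B1 x *\<^sub>R P' i x \<partial>lborel)"
    using integrable_L2_scaleR[OF test_function_L2(2)[OF \<phi>] L2B_L2[OF L2B_restrict_continuous[OF Pc]], of i]
      integrable_L2_scaleR[OF test_function_L2(1)[OF \<phi>] L2B_L2[OF L2B_restrict_continuous[OF c[of i]]]]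
    by (simp add: eq_neg_iff_add_eq_0)
qed

text \<open>The regularised distance to the apex.\<close>
definition smooth_radius :: "real \<Rightarrow> real^2 \<Rightarrow> real" where "smooth_radius h x = sqrt ((norm x)\<^sup>2 + h\<^sup>2)"

definition unit3 :: "2 \<Rightarrow> real^3" where "unit3 i = axis (if i = 1 then 1 else 2) 1"

text \<open>The embedding of the plane is written as a linear combination of \<open>unit3 1\<close> and \<open>unit3 2\<close>, whose derivative is
  read off from \<open>linear_combination_bounded\<close>. Its first and second partial derivatives are \<open>cone_deriv\<close> and \<open>cone_deriv2\<close>.\<close>
definition cone :: "real \<Rightarrow> real \<Rightarrow> real^2 \<Rightarrow> real^3" where
  "cone h \<Delta> x = (\<Sum>i\<in>UNIV. x $ i *\<^sub>R (sqrt (1 - \<Delta>\<^sup>2) *\<^sub>R unit3 i)) + (\<Delta> * smooth_radius h x) *\<^sub>R axis 3 1"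

definition cone_deriv :: "real \<Rightarrow> real \<Rightarrow> 2 \<Rightarrow> real^2 \<Rightarrow> real^3" where
  "cone_deriv h \<Delta> i x = sqrt (1 - \<Delta>\<^sup>2) *\<^sub>R unit3 i + (\<Delta> * (x $ i / smooth_radius h x)) *\<^sub>R axis 3 1"

definition kronecker :: "2 \<Rightarrow> 2 \<Rightarrow> real" where "kronecker i j = (if i = j then 1 else 0)"

definition cone_deriv2 :: "real \<Rightarrow> real \<Rightarrow> 2 \<Rightarrow> 2 \<Rightarrow> real^2 \<Rightarrow> real^3" where
  "cone_deriv2 h \<Delta> i j x = (\<Delta> * (kronecker i j / smooth_radius h x - x $ i * x $ j / (smooth_radius h x)^3)) *\<^sub>R axis 3 1"

lemma smooth_radius_pos: "h > 0 \<Longrightarrow> smooth_radius h x > 0" and smooth_radius_sq: "(smooth_radius h x)\<^sup>2 = (norm x)\<^sup>2 + h\<^sup>2"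
  by (auto simp: smooth_radius_def intro!: add_nonneg_pos)

lemma smooth_radius_has_derivative:
  assumes "h > 0" shows "(smooth_radius h has_derivative (\<lambda>d. (x \<bullet> d) / smooth_radius h x)) (at x)"
proof -
  have p: "x \<bullet> x + h\<^sup>2 > 0" using assms by (intro add_nonneg_pos) auto
  have "((\<lambda>x. x \<bullet> x + h\<^sup>2) has_derivative (\<lambda>d. 2 * (x \<bullet> d))) (at x)"
    by (auto intro!: derivative_eq_intros simp: inner_commute)
  from has_derivative_real_sqrt[OF p this]
  have "((\<lambda>x. sqrt (x \<bullet> x + h\<^sup>2)) has_derivative (\<lambda>d. (2 * (x \<bullet> d)) * (inverse (sqrt (x \<bullet> x + h\<^sup>2)) / 2))) (at x)" .
  then have "((\<lambda>x. sqrt (x \<bullet> x + h\<^sup>2)) has_derivative (\<lambda>d. (x \<bullet> d) / sqrt (x \<bullet> x + h\<^sup>2))) (at x)"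
    by (rule has_derivative_eq_rhs) (simp add: inverse_eq_divide)
  then show ?thesis unfolding smooth_radius_def[abs_def] power2_norm_eq_inner .
qed

lemma smooth_radius_continuous: "h > 0 \<Longrightarrow> continuous_on UNIV (smooth_radius h)"
  by (rule has_derivative_continuous_on) (rule smooth_radius_has_derivative)

lemma inner2: "(x::real^2) \<bullet> y = x $ 1 * y $ 1 + x $ 2 * y $ 2"
  by (simp add: inner_vec_def UNIV_2)

lemma cone_derivative:
  assumes "h > 0"
  shows "(cone h \<Delta> has_derivative (\<lambda>d. \<Sum>i\<in>UNIV. d $ i *\<^sub>R cone_deriv h \<Delta> i x)) (at x)"
proof -
  have "((\<lambda>x. \<Sum>i\<in>UNIV. x $ i *\<^sub>R (sqrt (1 - \<Delta>\<^sup>2) *\<^sub>R unit3 i)) has_derivative (\<lambda>d. \<Sum>i\<in>UNIV. d $ i *\<^sub>R (sqrt (1 - \<Delta>\<^sup>2) *\<^sub>R unit3 i))) (at x)"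
    by (rule bounded_linear_imp_has_derivative[OF linear_combination_bounded])
  moreover have "((\<lambda>x. (\<Delta> * smooth_radius h x) *\<^sub>R (axis 3 1 :: real^3)) has_derivative (\<lambda>d. (\<Delta> * ((x \<bullet> d) / smooth_radius h x)) *\<^sub>R axis 3 1)) (at x)"
    by (intro has_derivative_scaleR_left has_derivative_mult_right smooth_radius_has_derivative[OF assms])
  ultimately have "(cone h \<Delta> has_derivative (\<lambda>d. (\<Sum>i\<in>UNIV. d $ i *\<^sub>R (sqrt (1 - \<Delta>\<^sup>2) *\<^sub>R unit3 i)) + (\<Delta> * ((x \<bullet> d) / smooth_radius h x)) *\<^sub>R axis 3 1)) (at x)"
    unfolding cone_def by (rule has_derivative_add)
  then show ?thesis
    by (rule has_derivative_eq_rhs) (simp add: fun_eq_iff cone_deriv_def sum_UNIV_2 inner2 algebra_simps add_divide_distrib)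
qed

lemma cone_deriv_derivative:
  assumes "h > 0"
  shows "(cone_deriv h \<Delta> i has_derivative (\<lambda>d. \<Sum>j\<in>UNIV. d $ j *\<^sub>R cone_deriv2 h \<Delta> i j x)) (at x)"
proof -
  have p: "smooth_radius h x > 0" by (rule smooth_radius_pos[OF assms])
  have "((\<lambda>x. x $ i / smooth_radius h x) has_derivative (\<lambda>d. (d $ i * smooth_radius h x - x $ i * ((x \<bullet> d) / smooth_radius h x)) / (smooth_radius h x * smooth_radius h x))) (at x)"
    by (rule has_derivative_divide'[OF bounded_linear_imp_has_derivative[OF bounded_linear_vec_nth] smooth_radius_has_derivative[OF assms]]) (use p in simp)
  then have "((\<lambda>x. (\<Delta> * (x $ i / smooth_radius h x)) *\<^sub>R (axis 3 1 :: real^3)) has_derivative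
     (\<lambda>d. (\<Delta> * ((d $ i * smooth_radius h x - x $ i * ((x \<bullet> d) / smooth_radius h x)) / (smooth_radius h x * smooth_radius h x))) *\<^sub>R axis 3 1)) (at x)"
    by (intro has_derivative_scaleR_left has_derivative_mult_right)
  then have "(cone_deriv h \<Delta> i has_derivative (\<lambda>d. 0 + (\<Delta> * ((d $ i * smooth_radius h x - x $ i * ((x \<bullet> d) / smooth_radius h x)) / (smooth_radius h x * smooth_radius h x))) *\<^sub>R axis 3 1)) (at x)"
    unfolding cone_deriv_def by (intro has_derivative_add has_derivative_const)
  then show ?thesis
  proof (rule has_derivative_eq_rhs)
    show "(\<lambda>d. 0 + (\<Delta> * ((d $ i * smooth_radius h x - x $ i * ((x \<bullet> d) / smooth_radius h x)) / (smooth_radius h x * smooth_radius h x))) *\<^sub>R axis 3 1) = (\<lambda>d. \<Sum>j\<in>UNIV. d $ j *\<^sub>R cone_deriv2 h \<Delta> i j x)"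
    proof
      fix d :: "real^2"
      have eq: "(d $ i * smooth_radius h x - x $ i * ((x \<bullet> d) / smooth_radius h x)) / (smooth_radius h x * smooth_radius h x)
         = d $ 1 * (kronecker i 1 / smooth_radius h x - x $ i * x $ 1 / (smooth_radius h x)^3) + d $ 2 * (kronecker i 2 / smooth_radius h x - x $ i * x $ 2 / (smooth_radius h x)^3)"
        using p exhaust_2[of i] by (auto simp: kronecker_def inner2 field_simps power3_eq_cube)
      have "\<Delta> * ((d $ i * smooth_radius h x - x $ i * ((x \<bullet> d) / smooth_radius h x)) / (smooth_radius h x * smooth_radius h x))
         = d $ 1 * (\<Delta> * (kronecker i 1 / smooth_radius h x - x $ i * x $ 1 / (smooth_radius h x)^3)) + d $ 2 * (\<Delta> * (kronecker i 2 / smooth_radius h x - x $ i * x $ 2 / (smooth_radius h x)^3))"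
        unfolding eq by (simp add: distrib_left mult.left_commute)
      then show "0 + (\<Delta> * ((d $ i * smooth_radius h x - x $ i * ((x \<bullet> d) / smooth_radius h x)) / (smooth_radius h x * smooth_radius h x))) *\<^sub>R axis 3 1 = (\<Sum>j\<in>UNIV. d $ j *\<^sub>R cone_deriv2 h \<Delta> i j x)"
        by (simp only: sum_UNIV_2 cone_deriv2_def scaleR_scaleR scaleR_add_left[symmetric] add_0_left)
    qed
  qed
qed

lemma cone_deriv2_continuous: "h > 0 \<Longrightarrow> continuous_on UNIV (cone_deriv2 h \<Delta> i j)"
  unfolding cone_deriv2_def using smooth_radius_continuous[of h] smooth_radius_pos[of h]
  by (auto intro!: continuous_intros simp: less_imp_neq[symmetric])

lemma cone_weak_jet:
  assumes "h > 0"
  shows "weak_jet (\<lambda>x. indicator B1 x *\<^sub>R cone h \<Delta> x) (\<lambda>i x. indicator B1 x *\<^sub>R cone_deriv h \<Delta> i x) (\<lambda>i j x. indicator B1 x *\<^sub>R cone_deriv2 h \<Delta> i j x)"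
proof -
  have c1: "continuous_on UNIV (cone_deriv h \<Delta> i)" for i by (rule has_derivative_continuous_on[OF cone_deriv_derivative[OF assms]])
  have c0: "continuous_on UNIV (cone h \<Delta>)" by (rule has_derivative_continuous_on[OF cone_derivative[OF assms]])
  show ?thesis unfolding weak_jet_def
    by (intro conjI allI L2B_restrict_continuous c0 c1 cone_deriv2_continuous[OF assms] classical_weak_deriv cone_derivative[OF assms] cone_deriv_derivative[OF assms])
qed

lemma unit3_inner: "unit3 i \<bullet> unit3 j = kronecker i j" "unit3 i \<bullet> axis 3 1 = 0"
  using exhaust_2[of i] exhaust_2[of j] by (auto simp: unit3_def kronecker_def inner_axis_axis)

lemma norm_matrix_sq: "(norm (A :: real^2^2))\<^sup>2 = (\<Sum>i\<in>UNIV. \<Sum>j\<in>UNIV. (A $ i $ j)\<^sup>2)"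
  by (simp add: norm_vec_def L2_set_def sum_nonneg)

text \<open>Uses \<open>x\<^sup>\<bottom> \<otimes> x\<^sup>\<bottom> + x \<otimes> x = |x|\<^sup>2 Id\<close> in the plane, so that the radial direction appears instead of the
  perpendicular one.\<close>
lemma ref_metric_entry:
  assumes "x \<noteq> 0"
  shows "ref_metric \<Delta> x $ i $ j = (1 - \<Delta>\<^sup>2) * kronecker i j + \<Delta>\<^sup>2 * (x $ i * x $ j) / (norm x)\<^sup>2"
proof -
  have n: "(norm x)\<^sup>2 \<noteq> 0" using assms by simp
  have "(norm x)\<^sup>2 * (perp_hat x $ i * perp_hat x $ j) = (vector [- x $ 2, x $ 1] :: real^2) $ i * (vector [- x $ 2, x $ 1] :: real^2) $ j"
    using assms by (simp add: perp_hat_def power2_eq_square)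
  also have "\<dots> = (norm x)\<^sup>2 * kronecker i j - x $ i * x $ j"
    unfolding norm_vec2_sq using exhaust_2[of i] exhaust_2[of j] by (auto simp: kronecker_def power2_eq_square)
  finally have "(norm x)\<^sup>2 * (perp_hat x $ i * perp_hat x $ j) = (norm x)\<^sup>2 * kronecker i j - x $ i * x $ j" .
  then have pp: "perp_hat x $ i * perp_hat x $ j = kronecker i j - x $ i * x $ j / (norm x)\<^sup>2" using n by (simp add: field_simps)
  have "ref_metric \<Delta> x $ i $ j = kronecker i j - \<Delta>\<^sup>2 * (perp_hat x $ i * perp_hat x $ j)"
    by (simp add: ref_metric_def outer_def mat_def kronecker_def)
  then show ?thesis unfolding pp by (simp add: algebra_simps)
qed

text \<open>The difference of the metrics is \<open>\<Delta>\<^sup>2 (1/(|x|\<^sup>2 + h\<^sup>2) - 1/|x|\<^sup>2) x \<otimes> x\<close>, a matrix of rank one.\<close>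
lemma cone_metric_error:
  assumes "h > 0" "x \<noteq> 0" "\<Delta>\<^sup>2 \<le> 1"
  shows "(norm (metric_of (cone_deriv h \<Delta>) x - ref_metric \<Delta> x))\<^sup>2 = \<Delta>^4 * h^4 * (1 / ((norm x)\<^sup>2 + h\<^sup>2)\<^sup>2)"
proof -
  define s where "s = (norm x)\<^sup>2"
  have s1: "s > 0" using assms(2) by (simp add: s_def)
  have s2: "s = (x $ 1)\<^sup>2 + (x $ 2)\<^sup>2" by (simp add: s_def norm_vec2_sq)
  note s = s1 s2
  define f where "f = s + h\<^sup>2"
  have f1: "f > 0" unfolding f_def using s1 by (intro add_pos_nonneg) auto
  have f2: "f = (smooth_radius h x)\<^sup>2" by (simp add: f_def s_def smooth_radius_sq)
  note f = f1 f2
  have p: "smooth_radius h x > 0" by (rule smooth_radius_pos[OF assms(1)])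
  have e: "(metric_of (cone_deriv h \<Delta>) x - ref_metric \<Delta> x) $ i $ j = (\<Delta>\<^sup>2 * (1 / f - 1 / s)) * (x $ i * x $ j)" for i j
  proof -
    have "metric_of (cone_deriv h \<Delta>) x $ i $ j = (sqrt (1 - \<Delta>\<^sup>2))\<^sup>2 * kronecker i j + \<Delta>\<^sup>2 * (x $ i * x $ j) / f"
      using p unfolding f(2)
      by (simp add: metric_of_def cone_deriv_def inner_add_left inner_add_right unit3_inner inner_commute[of "axis 3 1" "unit3 _"] inner_axis_axis power2_eq_square[of \<Delta>] power2_eq_square[of "smooth_radius h x"] power2_eq_square[of "sqrt _"] field_simps del: real_sqrt_mult_self)
    moreover have "(sqrt (1 - \<Delta>\<^sup>2))\<^sup>2 = 1 - \<Delta>\<^sup>2" using assms(3) by simp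
    ultimately show ?thesis
      unfolding vector_minus_component ref_metric_entry[OF assms(2)] s_def[symmetric] by (simp add: algebra_simps)
  qed
  define k where "k = \<Delta>\<^sup>2 * (1 / f - 1 / s)"
  have "(norm (metric_of (cone_deriv h \<Delta>) x - ref_metric \<Delta> x))\<^sup>2 = k\<^sup>2 * s\<^sup>2"
  proof -
    have e': "(metric_of (cone_deriv h \<Delta>) x - ref_metric \<Delta> x) $ i $ j = k * (x $ i * x $ j)" for i j unfolding e k_def ..
    have "k\<^sup>2 * s\<^sup>2 = k\<^sup>2 * ((x $ 1)\<^sup>2 + (x $ 2)\<^sup>2)\<^sup>2" unfolding s2 ..
    then show ?thesis unfolding norm_matrix_sq e' sum_UNIV_2 by (simp add: power2_eq_square algebra_simps)
  qed
  also have "\<dots> = (\<Delta>\<^sup>2)\<^sup>2 * ((1 / f - 1 / s) * s)\<^sup>2" by (simp add: k_def power_mult_distrib)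
  also have "(1 / f - 1 / s) * s = (s - f) / f" using f1 s1 by (simp add: left_diff_distrib diff_divide_distrib)
  also have "s - f = - h\<^sup>2" by (simp add: f_def)
  finally show ?thesis by (simp add: f_def s_def power_divide flip: power_mult)
qed

lemma cone_bending:
  assumes "h > 0"
  shows "(\<Sum>i\<in>UNIV. \<Sum>j\<in>UNIV. (norm (cone_deriv2 h \<Delta> i j x))\<^sup>2) \<le> \<Delta>\<^sup>2 * (1 / ((norm x)\<^sup>2 + h\<^sup>2) + h\<^sup>2 * (1 / ((norm x)\<^sup>2 + h\<^sup>2)\<^sup>2))"
proof -
  define s where "s = (norm x)\<^sup>2"
  have s: "s \<ge> 0" "s = (x $ 1)\<^sup>2 + (x $ 2)\<^sup>2" by (auto simp: s_def norm_vec2_sq)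
  define f where "f = s + h\<^sup>2"
  have h2: "h\<^sup>2 > 0" using assms by simp
  have f1: "f > 0" "h\<^sup>2 \<le> f" unfolding f_def using s(1) h2 by linarith+
  have f2: "f = (smooth_radius h x)\<^sup>2" by (simp add: f_def s_def smooth_radius_sq)
  note f = f1(1) f2 f1(2)
  have p: "smooth_radius h x > 0" by (rule smooth_radius_pos[OF assms])
  have n: "(norm (cone_deriv2 h \<Delta> i j x))\<^sup>2 = \<Delta>\<^sup>2 * (kronecker i j - x $ i * x $ j / f)\<^sup>2 / f" for i j
  proof -
    have "kronecker i j / smooth_radius h x - x $ i * x $ j / (smooth_radius h x)^3 = (kronecker i j - x $ i * x $ j / f) / smooth_radius h x"
      unfolding f(2) using p by (simp add: field_simps power2_eq_square power3_eq_cube)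
    moreover have "(norm (c *\<^sub>R (axis 3 1 :: real^3)))\<^sup>2 = c\<^sup>2" for c :: real by simp
    ultimately have "(norm (cone_deriv2 h \<Delta> i j x))\<^sup>2 = \<Delta>\<^sup>2 * ((kronecker i j - x $ i * x $ j / f) / smooth_radius h x)\<^sup>2"
      unfolding cone_deriv2_def by (simp only: power_mult_distrib)
    then show ?thesis by (simp add: power_divide f(2))
  qed
  have "(\<Sum>i\<in>UNIV. \<Sum>j\<in>UNIV. (norm (cone_deriv2 h \<Delta> i j x))\<^sup>2) = \<Delta>\<^sup>2 / f * (\<Sum>i\<in>UNIV. \<Sum>j\<in>UNIV. (kronecker i j - x $ i * x $ j / f)\<^sup>2)"
    unfolding n by (simp add: sum_UNIV_2 algebra_simps)
  also have "(\<Sum>i\<in>UNIV. \<Sum>j\<in>UNIV. (kronecker i j - x $ i * x $ j / f)\<^sup>2) = 1 + (1 - s / f)\<^sup>2"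
    unfolding s(2) by (simp add: sum_UNIV_2 kronecker_def power2_eq_square algebra_simps add_divide_distrib)
  also have "1 - s / f = h\<^sup>2 / f" using f(1) by (simp add: field_simps f_def)
  also have "\<Delta>\<^sup>2 / f * (1 + (h\<^sup>2 / f)\<^sup>2) \<le> \<Delta>\<^sup>2 / f * (1 + h\<^sup>2 / f)"
  proof (intro mult_left_mono add_left_mono)
    define q where "q = h\<^sup>2 / f"
    have "q \<le> 1" "q \<ge> 0" using f h2 by (auto simp: q_def)
    then have "q\<^sup>2 \<le> q" by (simp add: power2_eq_square mult_left_le)
    then show "(h\<^sup>2 / f)\<^sup>2 \<le> h\<^sup>2 / f" by (simp only: q_def)
  qed (use f in auto)
  also have "\<dots> = \<Delta>\<^sup>2 * (1 / f + h\<^sup>2 * (1 / f\<^sup>2))" by (simp add: algebra_simps power2_eq_square)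
  finally show ?thesis by (simp add: f_def s_def)
qed

text \<open>Only the term \<open>1/(s + h\<^sup>2)\<close> of the bending density contributes a logarithm, namely
  \<open>ln (1 + h\<^sup>2) - ln (h\<^sup>2) \<le> 2 |ln h| + 1\<close>; the terms \<open>1/(s + h\<^sup>2)\<^sup>2\<close> integrate to at most \<open>1/h\<^sup>2\<close> and are compensated by powers of \<open>h\<close>.\<close>
lemma cone_energy:
  assumes h: "0 < h" "h \<le> 1" and D: "0 < \<Delta>" "\<Delta> < 1"
  shows "field_energy h \<Delta> (\<lambda>i x. indicator B1 x *\<^sub>R cone_deriv h \<Delta> i x) (\<lambda>i j x. indicator B1 x *\<^sub>R cone_deriv2 h \<Delta> i j x)
     \<le> ennreal (2 * pi * \<Delta>\<^sup>2 * h\<^sup>2 * (\<bar>ln h\<bar> + 2))"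
proof -
  let ?V = "\<lambda>i x. indicator B1 x *\<^sub>R cone_deriv h \<Delta> i x" and ?W = "\<lambda>i j x. indicator B1 x *\<^sub>R cone_deriv2 h \<Delta> i j x"
  have Bm[measurable]: "B1 \<in> sets borel" by simp
  have D2: "\<Delta>\<^sup>2 \<le> 1" "\<Delta>\<^sup>2 > 0" using D by (auto simp: power_le_one)
  have h2: "h\<^sup>2 > 0" using h by simp
  have "AE x in lborel. x \<noteq> (0::real^2)" by (rule AE_lborel_singleton)
  then have "(\<integral>\<^sup>+x. indicator B1 x * ennreal ((norm (metric_of ?V x - ref_metric \<Delta> x))\<^sup>2) \<partial>lborel)
     = (\<integral>\<^sup>+x. ennreal (\<Delta>^4 * h^4) * (indicator B1 x * ennreal (1 / ((norm x)\<^sup>2 + h\<^sup>2)\<^sup>2)) \<partial>lborel)"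
  proof (intro nn_integral_cong_AE, eventually_elim)
    fix x :: "real^2" assume elim: "x \<noteq> 0"
    show "indicator B1 x * ennreal ((norm (metric_of ?V x - ref_metric \<Delta> x))\<^sup>2) = ennreal (\<Delta>^4 * h^4) * (indicator B1 x * ennreal (1 / ((norm x)\<^sup>2 + h\<^sup>2)\<^sup>2))"
    proof (cases "x \<in> B1")
      case True
      then have "metric_of ?V x = metric_of (cone_deriv h \<Delta>) x" by (simp add: metric_of_def)
      then show ?thesis using True cone_metric_error[OF h(1) elim D2(1)] by (simp add: ennreal_mult'[symmetric])
    qed simp
  qed
  also have "\<dots> = ennreal (\<Delta>^4 * h^4) * (ennreal pi * (\<integral>\<^sup>+s. indicator {0..1} s * ennreal (1 / (s + h\<^sup>2)\<^sup>2) \<partial>lborel))"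
    by (subst nn_integral_cmult) (simp_all add: radial_nn_integral[of "\<lambda>s. ennreal (1 / (s + h\<^sup>2)\<^sup>2)"])
  also have "\<dots> \<le> ennreal (\<Delta>^4 * h^4) * (ennreal pi * ennreal (1 / h\<^sup>2))"
    by (intro mult_left_mono nn_integral_inverse_square[OF h(1)]) auto
  also have "\<dots> = ennreal (\<Delta>^4 * h^4 * (pi * (1 / h\<^sup>2)))"
    by (subst ennreal_mult[symmetric], simp, simp, subst ennreal_mult[symmetric], simp, simp, rule refl)
  also have "\<Delta>^4 * h^4 * (pi * (1 / h\<^sup>2)) = pi * \<Delta>^4 * h\<^sup>2"
    using h by (simp add: power4_eq_xxxx power2_eq_square)
  finally have A: "(\<integral>\<^sup>+x. indicator B1 x * ennreal ((norm (metric_of ?V x - ref_metric \<Delta> x))\<^sup>2) \<partial>lborel) \<le> ennreal (pi * \<Delta>^4 * h\<^sup>2)" .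
  have L: "L2 (?W i j)" for i j by (rule L2B_L2[OF L2B_restrict_continuous[OF cone_deriv2_continuous[OF h(1)]]])
  have "ennreal (bending ?W) = (\<integral>\<^sup>+x. ennreal (\<Sum>i\<in>UNIV. \<Sum>j\<in>UNIV. (norm (?W i j x))\<^sup>2) \<partial>lborel)"
  proof -
    have "bending ?W = (\<integral>x. (\<Sum>i\<in>UNIV. \<Sum>j\<in>UNIV. (norm (?W i j x))\<^sup>2) \<partial>lborel)"
      unfolding bending_def n2_def using L2_integrable[OF L] by (simp del: norm_scaleR)
    then show ?thesis using L2_integrable[OF L]
      by (subst nn_integral_eq_integral) (auto intro!: sum_nonneg simp del: norm_scaleR)
  qed
  also have "\<dots> \<le> (\<integral>\<^sup>+x. ennreal (\<Delta>\<^sup>2) * (indicator B1 x * (ennreal (1 / ((norm x)\<^sup>2 + h\<^sup>2)) + ennreal (h\<^sup>2) * ennreal (1 / ((norm x)\<^sup>2 + h\<^sup>2)\<^sup>2))) \<partial>lborel)"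
  proof (rule nn_integral_mono)
    fix x :: "real^2"
    show "ennreal (\<Sum>i\<in>UNIV. \<Sum>j\<in>UNIV. (norm (?W i j x))\<^sup>2) \<le> ennreal (\<Delta>\<^sup>2) * (indicator B1 x * (ennreal (1 / ((norm x)\<^sup>2 + h\<^sup>2)) + ennreal (h\<^sup>2) * ennreal (1 / ((norm x)\<^sup>2 + h\<^sup>2)\<^sup>2)))"
    proof (cases "x \<in> B1")
      case True
      have "ennreal (\<Sum>i\<in>UNIV. \<Sum>j\<in>UNIV. (norm (?W i j x))\<^sup>2) \<le> ennreal (\<Delta>\<^sup>2 * (1 / ((norm x)\<^sup>2 + h\<^sup>2) + h\<^sup>2 * (1 / ((norm x)\<^sup>2 + h\<^sup>2)\<^sup>2)))"
        using True by (intro ennreal_leI) (simp, rule cone_bending[OF h(1), unfolded mult_1_right, simplified])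
      also have "\<dots> = ennreal (\<Delta>\<^sup>2) * (ennreal (1 / ((norm x)\<^sup>2 + h\<^sup>2)) + ennreal (h\<^sup>2) * ennreal (1 / ((norm x)\<^sup>2 + h\<^sup>2)\<^sup>2))"
        by (subst ennreal_mult[symmetric], simp, simp, subst ennreal_plus[symmetric], simp, simp, subst ennreal_mult[symmetric], simp_all)
      finally show ?thesis using True by simp
    qed simp
  qed
  also have "\<dots> = ennreal (\<Delta>\<^sup>2) * (ennreal pi * (\<integral>\<^sup>+s. indicator {0..1} s * (ennreal (1 / (s + h\<^sup>2)) + ennreal (h\<^sup>2) * ennreal (1 / (s + h\<^sup>2)\<^sup>2)) \<partial>lborel))"
    by (subst nn_integral_cmult) (simp_all add: radial_nn_integral[of "\<lambda>s. ennreal (1 / (s + h\<^sup>2)) + ennreal (h\<^sup>2) * ennreal (1 / (s + h\<^sup>2)\<^sup>2)"])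
  also have "(\<integral>\<^sup>+s. indicator {0..1} s * (ennreal (1 / (s + h\<^sup>2)) + ennreal (h\<^sup>2) * ennreal (1 / (s + h\<^sup>2)\<^sup>2)) \<partial>lborel)
     = (\<integral>\<^sup>+s. indicator {0..1} s * ennreal (1 / (s + h\<^sup>2)) \<partial>lborel) + ennreal (h\<^sup>2) * (\<integral>\<^sup>+s. indicator {0..1} s * ennreal (1 / (s + h\<^sup>2)\<^sup>2) \<partial>lborel)"
    by (subst nn_integral_cmult[symmetric], measurable, subst nn_integral_add[symmetric], measurable) (simp add: distrib_left mult.left_commute)
  also have "ennreal (\<Delta>\<^sup>2) * (ennreal pi * ((\<integral>\<^sup>+s. indicator {0..1} s * ennreal (1 / (s + h\<^sup>2)) \<partial>lborel) + ennreal (h\<^sup>2) * (\<integral>\<^sup>+s. indicator {0..1} s * ennreal (1 / (s + h\<^sup>2)\<^sup>2) \<partial>lborel)))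
     \<le> ennreal (\<Delta>\<^sup>2) * (ennreal pi * (ennreal (2 * \<bar>ln h\<bar> + 1) + ennreal (h\<^sup>2) * ennreal (1 / h\<^sup>2)))"
  proof (intro mult_left_mono add_mono nn_integral_inverse_square[OF h(1)])
    have "ln (1 + h\<^sup>2) \<le> h\<^sup>2" by (rule ln_add_one_self_le_self) simp
    also have "h\<^sup>2 \<le> 1" using h by (simp add: power_le_one)
    finally have "ln (1 + h\<^sup>2) - ln (h\<^sup>2) \<le> 2 * \<bar>ln h\<bar> + 1" using h by (simp add: ln_realpow)
    then show "(\<integral>\<^sup>+s. indicator {0..1} s * ennreal (1 / (s + h\<^sup>2)) \<partial>lborel) \<le> ennreal (2 * \<bar>ln h\<bar> + 1)"
      unfolding nn_integral_inverse[OF h(1)] by (rule ennreal_leI)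
  qed auto
  also have "ennreal (h\<^sup>2) * ennreal (1 / h\<^sup>2) = ennreal 1" using h2 by (simp add: ennreal_mult[symmetric])
  also have "ennreal (2 * \<bar>ln h\<bar> + 1) + ennreal 1 = ennreal (2 * \<bar>ln h\<bar> + 2)" by (subst ennreal_plus[symmetric]) auto
  also have "ennreal (\<Delta>\<^sup>2) * (ennreal pi * ennreal (2 * \<bar>ln h\<bar> + 2)) = ennreal (\<Delta>\<^sup>2 * (pi * (2 * \<bar>ln h\<bar> + 2)))"
    by (subst ennreal_mult[symmetric], simp, simp, subst ennreal_mult[symmetric], simp, simp, simp)
  finally have B: "bending ?W \<le> \<Delta>\<^sup>2 * (pi * (2 * \<bar>ln h\<bar> + 2))"
    by (subst (asm) ennreal_le_iff) (auto intro!: mult_nonneg_nonneg)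
  have "field_energy h \<Delta> ?V ?W \<le> ennreal (pi * \<Delta>^4 * h\<^sup>2) + ennreal (h\<^sup>2 * (\<Delta>\<^sup>2 * (pi * (2 * \<bar>ln h\<bar> + 2))))"
    unfolding field_energy_def by (intro add_mono A ennreal_leI mult_left_mono B) simp
  also have "\<dots> = ennreal (pi * \<Delta>^4 * h\<^sup>2 + h\<^sup>2 * (\<Delta>\<^sup>2 * (pi * (2 * \<bar>ln h\<bar> + 2))))"
    by (intro ennreal_plus[symmetric]) (auto intro!: mult_nonneg_nonneg)
  also have "\<dots> \<le> ennreal (2 * pi * \<Delta>\<^sup>2 * h\<^sup>2 * (\<bar>ln h\<bar> + 2))"
  proof (rule ennreal_leI)
    have "\<Delta>^4 = \<Delta>\<^sup>2 * \<Delta>\<^sup>2" by (simp add: power4_eq_xxxx power2_eq_square)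
    then have "\<Delta>^4 \<le> \<Delta>\<^sup>2 * 1" using mult_left_mono[OF D2(1), of "\<Delta>\<^sup>2"] by simp
    then have "\<Delta>^4 * h\<^sup>2 \<le> \<Delta>\<^sup>2 * h\<^sup>2" by (simp add: mult_right_mono)
    moreover have "0 \<le> \<Delta>\<^sup>2 * h\<^sup>2" by simp
    ultimately have "\<Delta>^4 * h\<^sup>2 \<le> 2 * (\<Delta>\<^sup>2 * h\<^sup>2)" by linarith
    then have "pi * (\<Delta>^4 * h\<^sup>2) \<le> pi * (2 * (\<Delta>\<^sup>2 * h\<^sup>2))" by (intro mult_left_mono) auto
    moreover have "pi * \<Delta>^4 * h\<^sup>2 + h\<^sup>2 * (\<Delta>\<^sup>2 * (pi * (2 * \<bar>ln h\<bar> + 2))) =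
        pi * (\<Delta>^4 * h\<^sup>2) + 2 * pi * \<Delta>\<^sup>2 * h\<^sup>2 * (\<bar>ln h\<bar> + 1)" by (simp add: algebra_simps)
    moreover have "2 * pi * \<Delta>\<^sup>2 * h\<^sup>2 * (\<bar>ln h\<bar> + 2) = pi * (2 * (\<Delta>\<^sup>2 * h\<^sup>2)) + 2 * pi * \<Delta>\<^sup>2 * h\<^sup>2 * (\<bar>ln h\<bar> + 1)"
      by (simp add: algebra_simps)
    ultimately show "pi * \<Delta>^4 * h\<^sup>2 + h\<^sup>2 * (\<Delta>\<^sup>2 * (pi * (2 * \<bar>ln h\<bar> + 2))) \<le> 2 * pi * \<Delta>\<^sup>2 * h\<^sup>2 * (\<bar>ln h\<bar> + 2)"
      by linarith
  qed
  finally show ?thesis .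
qed

section \<open>An isoperimetric inequality on circles\<close>

text \<open>Completing the square: \<open>(f')\<^sup>2 - \<mu>\<^sup>2 f\<^sup>2 + (g f\<^sup>2)' = (f' + g f)\<^sup>2\<close> whenever \<open>g' = \<mu>\<^sup>2 + g\<^sup>2\<close>.\<close>
lemma riccati_piece:
  fixes f f' g :: "real \<Rightarrow> real"
  assumes uv: "u \<le> v" and f: "\<And>t. (f has_real_derivative f' t) (at t)" and c: "continuous_on UNIV f'"
    and g: "\<And>t. t \<in> {u..v} \<Longrightarrow> (g has_real_derivative \<mu>\<^sup>2 + (g t)\<^sup>2) (at t)"
  shows "g u * (f u)\<^sup>2 - g v * (f v)\<^sup>2 \<le> integral {u..v} (\<lambda>t. (f' t)\<^sup>2 - \<mu>\<^sup>2 * (f t)\<^sup>2)"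
proof -
  have fc: "continuous_on UNIV f" using f by (intro continuous_at_imp_continuous_on ballI DERIV_isCont) auto
  have gc: "continuous_on {u..v} g" using g by (intro continuous_at_imp_continuous_on ballI DERIV_isCont) auto
  define k where "k t = (\<mu>\<^sup>2 + (g t)\<^sup>2) * (f t)\<^sup>2 + 2 * g t * f t * f' t" for t
  have k: "(k has_integral (g v * (f v)\<^sup>2 - g u * (f u)\<^sup>2)) {u..v}"
  proof (rule fundamental_theorem_of_calculus[OF uv])
    fix t assume "t \<in> {u..v}"
    then have "((\<lambda>t. g t * (f t)\<^sup>2) has_real_derivative k t) (at t)"
      unfolding k_def by (auto intro!: derivative_eq_intros g f simp: power2_eq_square algebra_simps)
    then show "((\<lambda>t. g t * (f t)\<^sup>2) has_vector_derivative k t) (at t within {u..v})"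
      using has_real_derivative_iff_has_vector_derivative has_field_derivative_at_within by blast
  qed
  have i: "(\<lambda>t. (f' t)\<^sup>2 - \<mu>\<^sup>2 * (f t)\<^sup>2) integrable_on {u..v}"
    by (intro integrable_continuous_real continuous_intros continuous_on_subset[OF c] continuous_on_subset[OF fc]) auto
  have "0 \<le> integral {u..v} (\<lambda>t. ((f' t)\<^sup>2 - \<mu>\<^sup>2 * (f t)\<^sup>2) + k t)"
  proof (rule integral_nonneg)
    show "(\<lambda>t. ((f' t)\<^sup>2 - \<mu>\<^sup>2 * (f t)\<^sup>2) + k t) integrable_on {u..v}" using i k by (intro integrable_add) auto
    show "0 \<le> ((f' t)\<^sup>2 - \<mu>\<^sup>2 * (f t)\<^sup>2) + k t" for t
    proof -
      have "((f' t)\<^sup>2 - \<mu>\<^sup>2 * (f t)\<^sup>2) + k t = (f' t + g t * f t)\<^sup>2"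
        by (simp add: k_def power2_eq_square algebra_simps)
      then show ?thesis by simp
    qed
  qed
  also have "\<dots> = integral {u..v} (\<lambda>t. (f' t)\<^sup>2 - \<mu>\<^sup>2 * (f t)\<^sup>2) + (g v * (f v)\<^sup>2 - g u * (f u)\<^sup>2)"
    using i k by (simp add: Henstock_Kurzweil_Integration.integral_add integral_unique has_integral_integrable)
  finally show ?thesis by linarith
qed

text \<open>The parameter \<open>\<mu> < 1\<close> keeps the tangent finite on a closed interval of length \<open>\<pi>\<close>.\<close>
lemma tan_riccati:
  assumes "0 < \<mu>" "\<mu> < 1" "\<bar>t - t0\<bar> \<le> pi / 2"
  shows "((\<lambda>t. \<mu> * tan (\<mu> * (t - t0))) has_real_derivative \<mu>\<^sup>2 + (\<mu> * tan (\<mu> * (t - t0)))\<^sup>2) (at t)"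
proof -
  have "\<bar>\<mu> * (t - t0)\<bar> = \<mu> * \<bar>t - t0\<bar>" using assms(1) by (simp add: abs_mult)
  also have "\<dots> \<le> \<mu> * (pi / 2)" using assms by (intro mult_left_mono) auto
  also have "\<dots> < 1 * (pi / 2)" using assms by (intro mult_strict_right_mono) auto
  finally have "- (pi / 2) < \<mu> * (t - t0)" "\<mu> * (t - t0) < pi / 2" by (auto simp: abs_less_iff)
  then have c: "cos (\<mu> * (t - t0)) > 0" by (rule cos_gt_zero_pi)
  have "((\<lambda>t. \<mu> * tan (\<mu> * (t - t0))) has_real_derivative \<mu> * (inverse ((cos (\<mu> * (t - t0)))\<^sup>2) * \<mu>)) (at t)"
    by (intro DERIV_cmult DERIV_chain2[OF DERIV_tan]) (use c in \<open>auto intro!: derivative_eq_intros\<close>)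
  moreover have "inverse ((cos (\<mu> * (t - t0)))\<^sup>2) = 1 + (tan (\<mu> * (t - t0)))\<^sup>2"
    using tan_sec[of "\<mu> * (t - t0)"] c by (simp add: power_inverse)
  ultimately show ?thesis by (simp add: power2_eq_square algebra_simps)
qed

text \<open>Two zeros at distance \<open>\<pi>\<close> replace the usual mean value condition. Between consecutive zeros the
  Riccati argument has no boundary terms for every \<open>\<mu> < 1\<close>, and then \<open>\<mu>\<close> tends to \<open>1\<close>.\<close>
lemma wirtinger:
  fixes f f' :: "real \<Rightarrow> real"
  assumes f: "\<And>t. (f has_real_derivative f' t) (at t)" and c: "continuous_on UNIV f'"
    and per: "f 0 = f (2 * pi)" and p: "0 \<le> p" "p \<le> pi" "f p = 0" "f (p + pi) = 0"
  shows "integral {0..2 * pi} (\<lambda>t. (f t)\<^sup>2) \<le> integral {0..2 * pi} (\<lambda>t. (f' t)\<^sup>2)"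
proof -
  have fc: "continuous_on UNIV f" using f by (intro continuous_at_imp_continuous_on ballI DERIV_isCont) auto
  have i: "(\<lambda>t. (f t)\<^sup>2) integrable_on {u..v}" "(\<lambda>t. (f' t)\<^sup>2) integrable_on {u..v}" for u v
    by (intro integrable_continuous_real continuous_intros continuous_on_subset[OF c] continuous_on_subset[OF fc]; simp)+
  have key: "\<mu>\<^sup>2 * integral {0..2 * pi} (\<lambda>t. (f t)\<^sup>2) \<le> integral {0..2 * pi} (\<lambda>t. (f' t)\<^sup>2)" if l: "0 < \<mu>" "\<mu> < 1" for \<mu>
  proof -
    define G where "G t = (f' t)\<^sup>2 - \<mu>\<^sup>2 * (f t)\<^sup>2" for t
    define g where "g t0 t = \<mu> * tan (\<mu> * (t - t0))" for t0 t
    have Gi: "G integrable_on {u..v}" for u v unfolding G_def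
      by (intro integrable_continuous_real continuous_intros continuous_on_subset[OF c] continuous_on_subset[OF fc]; simp)
    have piece: "g t0 u * (f u)\<^sup>2 - g t0 v * (f v)\<^sup>2 \<le> integral {u..v} G" if "u \<le> v" "t0 - pi/2 \<le> u" "v \<le> t0 + pi/2" for u v t0
      unfolding G_def
    proof (rule riccati_piece[OF that(1) f c])
      fix t assume "t \<in> {u..v}"
      then have "u \<le> t" "t \<le> v" by auto
      then have "\<bar>t - t0\<bar> \<le> pi / 2" using that by linarith
      then show "(g t0 has_real_derivative \<mu>\<^sup>2 + (g t0 t)\<^sup>2) (at t)"
        unfolding g_def by (rule tan_riccati[OF l])
    qed
    (* By periodicity the arcs before p and after p + pi form one interval of length pi between consecutive zeros; each tangent is centred at the midpoint of such an interval. *)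
    have 1: "g (p - pi/2) 0 * (f 0)\<^sup>2 \<le> integral {0..p} G"
      using piece[of 0 p "p - pi/2"] p by simp
    have 2: "0 \<le> integral {p..p + pi} G" using piece[of p "p + pi" "p + pi/2"] p by simp
    have 3: "- (g (p + 3 * pi / 2) (2 * pi) * (f (2 * pi))\<^sup>2) \<le> integral {p + pi..2 * pi} G"
      using piece[of "p + pi" "2 * pi" "p + 3 * pi / 2"] p by simp
    have "g (p - pi/2) 0 = g (p + 3 * pi / 2) (2 * pi)" by (simp add: g_def algebra_simps)
    then have "0 \<le> integral {0..p} G + (integral {p..p + pi} G + integral {p + pi..2 * pi} G)"
      using 1 2 3 unfolding per by simp
    also have "integral {p..p + pi} G + integral {p + pi..2 * pi} G = integral {p..2 * pi} G"
      by (rule Henstock_Kurzweil_Integration.integral_combine[OF _ _ Gi]) (use p in auto)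
    also have "integral {0..p} G + integral {p..2 * pi} G = integral {0..2 * pi} G"
      by (rule Henstock_Kurzweil_Integration.integral_combine[OF _ _ Gi]) (use p in auto)
    also have "\<dots> = integral {0..2 * pi} (\<lambda>t. (f' t)\<^sup>2) - \<mu>\<^sup>2 * integral {0..2 * pi} (\<lambda>t. (f t)\<^sup>2)"
      unfolding G_def using i by (subst Henstock_Kurzweil_Integration.integral_diff) (auto intro!: integrable_on_mult_right)
    finally show ?thesis by simp
  qed
  show ?thesis
  proof (rule LIMSEQ_le_const2)
    define l where "l n = 1 - 1 / real (Suc (Suc n))" for n
    have lim: "l \<longlonglongrightarrow> 1 - 0"
      unfolding l_def by (intro tendsto_intros LIMSEQ_Suc[OF LIMSEQ_Suc[OF lim_1_over_n]])
    have "(\<lambda>n. (l n)\<^sup>2 * integral {0..2 * pi} (\<lambda>t. (f t)\<^sup>2)) \<longlonglongrightarrow> (1 - 0)\<^sup>2 * integral {0..2 * pi} (\<lambda>t. (f t)\<^sup>2)"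
      by (intro tendsto_intros lim)
    then show "(\<lambda>n. (l n)\<^sup>2 * integral {0..2 * pi} (\<lambda>t. (f t)\<^sup>2)) \<longlonglongrightarrow> integral {0..2 * pi} (\<lambda>t. (f t)\<^sup>2)" by simp
    have "0 < l n" "l n < 1" for n by (auto simp: l_def)
    then show "\<exists>N. \<forall>n\<ge>N. (l n)\<^sup>2 * integral {0..2 * pi} (\<lambda>t. (f t)\<^sup>2) \<le> integral {0..2 * pi} (\<lambda>t. (f' t)\<^sup>2)"
      using key by blast
  qed
qed

text \<open>By the intermediate value theorem some constant \<open>c\<close> makes \<open>b - c\<close> vanish at two points at
  distance \<open>\<pi>\<close>; subtracting \<open>c\<close> does not change the integral of \<open>b a'\<close> since \<open>a\<close> is periodic. Then
  \<open>a'\<^sup>2 / 2 + (b - c) a' \<ge> - (b - c)\<^sup>2 / 2\<close>, and \<open>wirtinger\<close> compares this with \<open>b'\<^sup>2 / 2\<close>.\<close>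
lemma isoperimetric_scalar:
  fixes a a' b b' :: "real \<Rightarrow> real"
  assumes a: "\<And>t. (a has_real_derivative a' t) (at t)" "continuous_on UNIV a'" "a 0 = a (2 * pi)"
    and b: "\<And>t. (b has_real_derivative b' t) (at t)" "continuous_on UNIV b'" "b 0 = b (2 * pi)"
  shows "0 \<le> integral {0..2 * pi} (\<lambda>t. (a' t)\<^sup>2 / 2 + (b' t)\<^sup>2 / 2 + b t * a' t)"
proof -
  have bc: "continuous_on UNIV b" using b(1) by (intro continuous_at_imp_continuous_on ballI DERIV_isCont) auto
  define d where "d t = b t - b (t + pi)" for t
  have "continuous_on {0..pi} (\<lambda>t. b (t + pi))"
    by (rule continuous_on_compose2[OF bc]) (auto intro!: continuous_intros)
  then have dc: "continuous_on {0..pi} d" unfolding d_def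
    by (intro continuous_on_diff continuous_on_subset[OF bc]) auto
  have "pi + pi = 2 * pi" by simp
  then have "d pi = b pi - b (2 * pi)" unfolding d_def by (simp only:)
  moreover have "d 0 = b 0 - b pi" by (simp add: d_def)
  ultimately have dd: "d pi = - d 0" using b(3) by linarith
  obtain p where p: "0 \<le> p" "p \<le> pi" "d p = 0"
  proof (cases "d 0 \<le> 0")
    case True
    then obtain p where "0 \<le> p" "p \<le> pi" "d p = 0" using IVT'[of d 0 0 pi, OF _ _ _ dc] dd by auto
    then show ?thesis by (rule that)
  next
    case False
    then obtain p where "0 \<le> p" "p \<le> pi" "d p = 0" using IVT2'[of d pi 0 0, OF _ _ _ dc] dd by auto
    then show ?thesis by (rule that)
  qed
  define c where "c = b p"
  define f where "f t = b t - c" for t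
  have fd: "(f has_real_derivative b' t) (at t)" for t unfolding f_def by (auto intro!: derivative_eq_intros b(1))
  have fc: "continuous_on UNIV f" unfolding f_def by (intro continuous_intros bc)
  have W: "integral {0..2 * pi} (\<lambda>t. (f t)\<^sup>2) \<le> integral {0..2 * pi} (\<lambda>t. (b' t)\<^sup>2)"
    by (rule wirtinger[OF fd b(2) _ p(1,2)]) (use b(3) p(3) in \<open>simp_all add: f_def c_def d_def\<close>)
  have ia: "(a' has_integral (a (2 * pi) - a 0)) {0..2 * pi}"
    by (rule fundamental_theorem_of_calculus)
      (use a(1) in \<open>auto simp: has_real_derivative_iff_has_vector_derivative[symmetric] intro: has_field_derivative_at_within\<close>)
  have i: "(\<lambda>t. (a' t + f t)\<^sup>2 / 2) integrable_on {0..2 * pi}" "(\<lambda>t. (f t)\<^sup>2 / 2) integrable_on {0..2 * pi}"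
    "(\<lambda>t. (b' t)\<^sup>2 / 2) integrable_on {0..2 * pi}" "(\<lambda>t. c * a' t) integrable_on {0..2 * pi}"
    by (intro integrable_continuous_real continuous_intros continuous_on_subset[OF fc] continuous_on_subset[OF a(2)] continuous_on_subset[OF b(2)]; simp)+
  have "0 \<le> integral {0..2 * pi} (\<lambda>t. (a' t + f t)\<^sup>2 / 2)" by (rule integral_nonneg[OF i(1)]) simp
  moreover have "integral {0..2 * pi} (\<lambda>t. (a' t)\<^sup>2 / 2 + (b' t)\<^sup>2 / 2 + b t * a' t)
     = integral {0..2 * pi} (\<lambda>t. ((a' t + f t)\<^sup>2 / 2 - (f t)\<^sup>2 / 2) + ((b' t)\<^sup>2 / 2 + c * a' t))"
    by (intro integral_cong) (simp add: f_def power2_eq_square field_simps)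
  moreover have "\<dots> = (integral {0..2 * pi} (\<lambda>t. (a' t + f t)\<^sup>2 / 2) - integral {0..2 * pi} (\<lambda>t. (f t)\<^sup>2 / 2))
     + (integral {0..2 * pi} (\<lambda>t. (b' t)\<^sup>2 / 2) + integral {0..2 * pi} (\<lambda>t. c * a' t))"
    using i by (simp add: Henstock_Kurzweil_Integration.integral_add Henstock_Kurzweil_Integration.integral_diff integrable_add integrable_diff)
  moreover have "integral {0..2 * pi} (\<lambda>t. c * a' t) = 0" using integral_unique[OF ia] a(3) by simp
  moreover have "integral {0..2 * pi} (\<lambda>t. (f t)\<^sup>2 / 2) \<le> integral {0..2 * pi} (\<lambda>t. (b' t)\<^sup>2 / 2)"
    using W by simp
  ultimately show ?thesis by linarith
qed

text \<open>For a closed curve \<open>(a, b)\<close> in the plane this is a weak form of the isoperimetric inequality: area at most half of the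
  integral of the squared speed. Vectors are treated coordinate by coordinate.\<close>
lemma isoperimetric_vector:
  fixes a a' b b' :: "real \<Rightarrow> 'c::euclidean_space"
  assumes a: "\<And>t. (a has_vector_derivative a' t) (at t)" "continuous_on UNIV a'" "a 0 = a (2 * pi)"
    and b: "\<And>t. (b has_vector_derivative b' t) (at t)" "continuous_on UNIV b'" "b 0 = b (2 * pi)"
  shows "0 \<le> integral {0..2 * pi} (\<lambda>t. (norm (a' t))\<^sup>2 / 2 + (norm (b' t))\<^sup>2 / 2 + b t \<bullet> a' t)"
proof -
  have bc: "continuous_on UNIV b" using b(1)
    by (intro continuous_at_imp_continuous_on ballI has_vector_derivative_continuous) auto
  let ?G = "\<lambda>k t. (a' t \<bullet> k)\<^sup>2 / 2 + (b' t \<bullet> k)\<^sup>2 / 2 + (b t \<bullet> k) * (a' t \<bullet> k)"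
  have eq: "(norm (a' t))\<^sup>2 / 2 + (norm (b' t))\<^sup>2 / 2 + b t \<bullet> a' t = (\<Sum>k\<in>Basis. ?G k t)" for t
    unfolding power2_norm_eq_inner euclidean_inner[of "a' t" "a' t"] euclidean_inner[of "b' t" "b' t"] euclidean_inner[of "b t" "a' t"]
    by (simp add: sum.distrib sum_divide_distrib power2_eq_square)
  have int: "?G k integrable_on {0..2 * pi}" for k
    by (intro integrable_continuous_real continuous_intros continuous_on_subset[OF bc] continuous_on_subset[OF a(2)] continuous_on_subset[OF b(2)]; simp)
  have "0 \<le> (\<Sum>k\<in>Basis. integral {0..2 * pi} (?G k))"
  proof (rule sum_nonneg)
    fix k :: 'c
    have vd: "((\<lambda>t. f t \<bullet> k) has_real_derivative f' t \<bullet> k) (at t)" if "\<And>t. (f has_vector_derivative f' t) (at t)" for f f' :: "real \<Rightarrow> 'c" and t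
      unfolding has_real_derivative_iff_has_vector_derivative
      by (rule bounded_linear.has_vector_derivative[OF bounded_linear_inner_left that])
    show "0 \<le> integral {0..2 * pi} (?G k)"
      by (rule isoperimetric_scalar[OF vd[OF a(1)] _ _ vd[OF b(1)]])
        (use a(3) b(3) in \<open>auto intro!: continuous_intros a(2) b(2)\<close>)
  qed
  also have "\<dots> = integral {0..2 * pi} (\<lambda>t. \<Sum>k\<in>Basis. ?G k t)"
    by (rule Henstock_Kurzweil_Integration.integral_sum[symmetric]) (use int in auto)
  finally show ?thesis unfolding eq .
qed

section \<open>Averaging over rotations\<close>

definition rot :: "real \<Rightarrow> real^2 \<Rightarrow> real^2" where
  "rot \<theta> x = vector [cos \<theta> * x $ 1 - sin \<theta> * x $ 2, sin \<theta> * x $ 1 + cos \<theta> * x $ 2]"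

lemma rot_nth [simp]: "rot \<theta> x $ 1 = cos \<theta> * x $ 1 - sin \<theta> * x $ 2" "rot \<theta> x $ 2 = sin \<theta> * x $ 1 + cos \<theta> * x $ 2"
  by (auto simp: rot_def)

lemma norm_rot_sq: "(norm (rot \<theta> x))\<^sup>2 = (norm x)\<^sup>2"
proof -
  have alg: "(c * p - s * q)\<^sup>2 + (s * p + c * q)\<^sup>2 = (s\<^sup>2 + c\<^sup>2) * (p\<^sup>2 + q\<^sup>2)" for c s p q :: real
    by (simp add: power2_eq_square algebra_simps)
  show ?thesis unfolding norm_vec2_sq rot_nth alg by simp
qed

lemma norm_rot [simp]: "norm (rot \<theta> x) = norm x"
  using norm_rot_sq[of \<theta> x] by simp

lemma rot_inverse: "rot \<theta> (rot (- \<theta>) x) = x" "rot (- \<theta>) (rot \<theta> x) = x"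
proof -
  have s: "sin \<theta> * sin \<theta> + cos \<theta> * cos \<theta> = 1" using sin_cos_squared_add[of \<theta>] by (simp add: power2_eq_square)
  have e: "cos \<theta> * (cos \<theta> * t) + sin \<theta> * (sin \<theta> * t) = t" for t
  proof -
    have "cos \<theta> * (cos \<theta> * t) + sin \<theta> * (sin \<theta> * t) = (sin \<theta> * sin \<theta> + cos \<theta> * cos \<theta>) * t"
      by (simp only: distrib_right mult.assoc add.commute)
    then show ?thesis unfolding s by simp
  qed
  show "rot \<theta> (rot (- \<theta>) x) = x" "rot (- \<theta>) (rot \<theta> x) = x"
    by (auto simp: vec_eq_iff forall_2 algebra_simps e)
qed

lemma linear_rot: "linear (rot \<theta>)"
  by (rule linearI) (auto simp: vec_eq_iff forall_2 algebra_simps)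

lemma rot_measurable [measurable]: "rot \<theta> \<in> borel_measurable borel"
  using linear_continuous_on[OF linear_conv_bounded_linear[THEN iffD1, OF linear_rot]] by (intro borel_measurable_continuous_onI)

lemma rot_distr: "distr lborel borel (rot \<theta>) = lborel"
proof (rule lborel_eqI[symmetric])
  fix l u :: "real^2" assume le: "\<And>b. b \<in> Basis \<Longrightarrow> l \<bullet> b \<le> u \<bullet> b"
  have v: "rot \<theta> -` box l u = rot (- \<theta>) ` box l u"
  proof (intro equalityI subsetI)
    fix x assume "x \<in> rot \<theta> -` box l u"
    then have "rot \<theta> x \<in> box l u" by simp
    then show "x \<in> rot (- \<theta>) ` box l u" using rot_inverse(2)[of \<theta> x] by (metis imageI)
  qed (auto simp: rot_inverse)
  have ot: "orthogonal_transformation (rot (- \<theta>))"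
    unfolding orthogonal_transformation by (simp add: linear_rot)
  have lm: "box l u \<in> lmeasurable" by simp
  have vb: "rot (- \<theta>) ` box l u \<in> sets borel"
    unfolding v[symmetric] using measurable_sets[OF rot_measurable, of "box l u" \<theta>] by simp
  have "emeasure (distr lborel borel (rot \<theta>)) (box l u) = emeasure lborel (rot \<theta> -` box l u)"
    by (subst emeasure_distr) auto
  also have "\<dots> = emeasure lebesgue (rot (- \<theta>) ` box l u)" unfolding v using vb by simp
  also have "\<dots> = ennreal (measure lebesgue (rot (- \<theta>) ` box l u))"
    by (rule emeasure_eq_measure2[OF measurable_orthogonal_image[OF ot lm]])
  also have "\<dots> = ennreal (measure lebesgue (box l u))" unfolding measure_orthogonal_image[OF ot lm] ..
  also have "\<dots> = (\<Prod>b\<in>Basis. (u - l) \<bullet> b)" using le by (simp add: inner_diff_left)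
  finally show "emeasure (distr lborel borel (rot \<theta>)) (box l u) = (\<Prod>b\<in>Basis. (u - l) \<bullet> b)" .
qed simp

lemma integral_rot:
  fixes H :: "real^2 \<Rightarrow> real"
  assumes [measurable]: "H \<in> borel_measurable borel"
  shows "(\<integral>x. H (rot \<theta> x) \<partial>lborel) = (\<integral>x. H x \<partial>lborel)"
  using integral_distr[of "rot \<theta>" lborel borel H] by (simp add: rot_distr)

lemma rot_continuous: "continuous_on UNIV (\<lambda>p. rot (fst p) (snd p))"
proof -
  have "rot (fst p) (snd p) = (cos (fst p) * snd p $ 1 - sin (fst p) * snd p $ 2) *\<^sub>R axis 1 1
     + (sin (fst p) * snd p $ 1 + cos (fst p) * snd p $ 2) *\<^sub>R axis 2 1" for p
    by (auto simp: vec_eq_iff forall_2 axis_def)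
  then show ?thesis by (auto intro!: continuous_intros)
qed

text \<open>Replaces polar coordinates: the integral of \<open>H\<close> is unchanged when \<open>H\<close> is composed with a
  rotation, so by Fubini it is a mean of circle integrals.\<close>
lemma rotation_average_nonneg:
  fixes H :: "real^2 \<Rightarrow> real"
  assumes c: "continuous_on UNIV H" and z: "\<And>x. norm x > R \<Longrightarrow> H x = 0"
    and av: "\<And>x. 0 \<le> integral {0..2 * pi} (\<lambda>\<theta>. H (rot \<theta> x))"
  shows "0 \<le> (\<integral>x. H x \<partial>lborel)"
proof -
  have Hm[measurable]: "H \<in> borel_measurable borel" by (rule borel_measurable_continuous_onI[OF c])
  have Hrc: "continuous_on UNIV (\<lambda>p. H (rot (fst p) (snd p)))"
    by (rule continuous_on_compose2[OF c rot_continuous]) simp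
  define f where "f \<theta> x = indicator {0..2 * pi} \<theta> * H (rot \<theta> x)" for \<theta> x
  define S where "S = {0..2 * pi} \<times> cball (0::real^2) R"
  have Sb: "bounded S" "S \<in> sets borel" unfolding S_def
    by (auto intro!: bounded_Times borel_closed closed_Times)
  have int: "integrable (lborel \<Otimes>\<^sub>M lborel) (case_prod f)"
  proof -
    have "bounded ((\<lambda>p. H (rot (fst p) (snd p))) ` S)"
      unfolding S_def by (intro compact_imp_bounded compact_continuous_image continuous_on_subset[OF Hrc] compact_Times) auto
    then obtain B where "\<forall>y\<in>(\<lambda>p. H (rot (fst p) (snd p))) ` S. norm y \<le> B" unfolding bounded_iff ..
    then have B: "\<bar>H (rot (fst p) (snd p))\<bar> \<le> B" if "p \<in> S" for p using that by auto
    have out: "case_prod f p = 0" if "p \<notin> S" for p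
      using that z by (cases p) (auto simp: f_def S_def indicator_def)
    have m: "case_prod f \<in> borel_measurable borel"
    proof -
      have "(\<lambda>p. indicator ({0..2 * pi} \<times> (UNIV::(real^2) set)) p * H (rot (fst p) (snd p))) \<in> borel_measurable borel"
        by (intro borel_measurable_times borel_measurable_indicator borel_measurable_continuous_onI[OF Hrc] borel_closed closed_Times) auto
      moreover have "(\<lambda>p. indicator ({0..2 * pi} \<times> (UNIV::(real^2) set)) p * H (rot (fst p) (snd p))) = case_prod f"
        by (auto simp: f_def indicator_def fun_eq_iff)
      ultimately show ?thesis by simp
    qed
    have "L2 (case_prod f)"
    proof (rule L2_bound(1)[OF L2_indicator_bounded(1)[OF Sb] m])
      fix p show "norm (case_prod f p) \<le> \<bar>B\<bar> * norm (indicat_real S p)"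
        using out[of p] B[of p] by (cases "p \<in> S") (auto simp: f_def indicator_def split: prod.splits)
    qed simp
    then have "integrable lborel (case_prod f)" by (rule L2_integrable_bounded_support[OF _ Sb out])
    then show ?thesis by (simp add: lborel_prod)
  qed
  have "(\<integral>x. \<integral>\<theta>. f \<theta> x \<partial>lborel \<partial>lborel) = (\<integral>\<theta>. \<integral>x. f \<theta> x \<partial>lborel \<partial>lborel)"
    by (rule lborel_pair.Fubini_integral[OF int])
  also have "\<dots> = (\<integral>\<theta>. indicator {0..2 * pi} \<theta> * (\<integral>x. H x \<partial>lborel) \<partial>lborel)"
    unfolding f_def by (simp add: integral_rot)
  also have "\<dots> = (2 * pi) * (\<integral>x. H x \<partial>lborel)" by simp
  finally have eq: "(2 * pi) * (\<integral>x. H x \<partial>lborel) = (\<integral>x. \<integral>\<theta>. f \<theta> x \<partial>lborel \<partial>lborel)" ..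
  have "0 \<le> (\<integral>\<theta>. f \<theta> x \<partial>lborel)" for x
  proof -
    have "continuous_on {0..2 * pi} (\<lambda>\<theta>. H (rot \<theta> x))"
    proof -
      have "continuous_on {0..2 * pi} (\<lambda>\<theta>::real. (\<theta>, x))"
        by (intro continuous_on_Pair continuous_on_id continuous_on_const)
      from continuous_on_compose2[OF Hrc this] show ?thesis by simp
    qed
    then have "set_integrable lborel {0..2 * pi} (\<lambda>\<theta>. H (rot \<theta> x))" by (rule borel_integrable_atLeastAtMost')
    from set_borel_integral_eq_integral(2)[OF this]
    show ?thesis using av[of x] by (simp add: f_def set_lebesgue_integral_def)
  qed
  then have "0 \<le> (\<integral>x. \<integral>\<theta>. f \<theta> x \<partial>lborel \<partial>lborel)" by (intro integral_nonneg_AE) simp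
  then have "0 \<le> (2 * pi) * (\<integral>x. H x \<partial>lborel)" unfolding eq .
  then show ?thesis using pi_gt_zero by (auto simp: zero_le_mult_iff)
qed

section \<open>The radial test potential\<close>

text \<open>Vanishes for \<open>s \<ge> 1/4\<close>, that is \<open>|x| \<ge> 1/2\<close> when \<open>s = |x|\<^sup>2\<close>. Its square is continuously differentiable,
  which is enough regularity for the potential.\<close>
definition cutoff :: "real \<Rightarrow> real" where "cutoff s = max 0 (1 - 4 * s)"

text \<open>The potential \<open>\<psi>\<close> is never written down: \<open>test_grad\<close> is its gradient \<open>- weight(|x|\<^sup>2) x\<close> and \<open>test_hess\<close> its
  Hessian. Since \<open>\<psi>\<close> behaves like \<open>- ln |x|\<close> for small \<open>|x| > h\<close>, it is, up to a constant factor, a regularised and truncated fundamental solution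
  of the Laplacian.\<close>
definition weight :: "real \<Rightarrow> real \<Rightarrow> real" where "weight h s = (cutoff s)\<^sup>2 / (s + h\<^sup>2)"

definition weight' :: "real \<Rightarrow> real \<Rightarrow> real" where "weight' h s = - 8 * cutoff s / (s + h\<^sup>2) - (cutoff s)\<^sup>2 / (s + h\<^sup>2)\<^sup>2"

definition test_grad :: "real \<Rightarrow> 2 \<Rightarrow> real^2 \<Rightarrow> real" where "test_grad h j x = - weight h ((norm x)\<^sup>2) * x $ j"

definition test_hess :: "real \<Rightarrow> 2 \<Rightarrow> 2 \<Rightarrow> real^2 \<Rightarrow> real" where
  "test_hess h i j x = - weight h ((norm x)\<^sup>2) * kronecker i j - 2 * weight' h ((norm x)\<^sup>2) * (x $ i * x $ j)"

lemma cutoff_bounds: "0 \<le> cutoff s" "s \<ge> 0 \<Longrightarrow> cutoff s \<le> 1" "s \<ge> 1/4 \<Longrightarrow> cutoff s = 0"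
  by (auto simp: cutoff_def)

lemma pos_part_sq_deriv: "((\<lambda>t. (max 0 t)\<^sup>2) has_real_derivative 2 * max 0 t) (at (t::real))"
proof -
  consider "t > 0" | "t < 0" | "t = 0" by linarith
  then show ?thesis
  proof cases
    case 1
    have "((\<lambda>t. t\<^sup>2) has_real_derivative 2 * max 0 t) (at t)" using 1 by (auto intro!: derivative_eq_intros)
    then show ?thesis by (rule has_field_derivative_transform_within_open[of _ _ _ "{0<..}"]) (use 1 in auto)
  next
    case 2
    have "((\<lambda>t. 0) has_real_derivative 2 * max 0 t) (at t)" using 2 by simp
    then show ?thesis by (rule has_field_derivative_transform_within_open[of _ _ _ "{..<0}"]) (use 2 in auto)
  next
    case 3
    have "((\<lambda>h. (max 0 h)\<^sup>2 / h) \<longlongrightarrow> (0::real)) (at 0)"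
    proof (rule Lim_null_comparison)
      show "\<forall>\<^sub>F h in at 0. norm ((max 0 h)\<^sup>2 / h) \<le> \<bar>h::real\<bar>"
        by (auto simp: eventually_at_filter max_def power2_eq_square)
      show "((\<lambda>h. \<bar>h\<bar>) \<longlongrightarrow> (0::real)) (at 0)" by (auto intro!: tendsto_eq_intros)
    qed
    then show ?thesis using 3 by (simp add: DERIV_def)
  qed
qed

lemma cutoff_sq_deriv: "((\<lambda>s. (cutoff s)\<^sup>2) has_real_derivative - 8 * cutoff s) (at s)"
proof -
  have "((\<lambda>s. (max 0 (1 - 4 * s))\<^sup>2) has_real_derivative (2 * max 0 (1 - 4 * s)) * (- 4)) (at s)"
    by (rule DERIV_chain2[OF pos_part_sq_deriv]) (auto intro!: derivative_eq_intros)
  then show ?thesis by (simp add: cutoff_def[abs_def])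
qed

lemma weight_deriv:
  assumes "h > 0" "s \<ge> 0" shows "(weight h has_real_derivative weight' h s) (at s)"
proof -
  have p: "s + h\<^sup>2 > 0" using assms by (simp add: add_nonneg_pos)
  have "(weight h has_real_derivative (- 8 * cutoff s * (s + h\<^sup>2) - (cutoff s)\<^sup>2 * 1) / ((s + h\<^sup>2) * (s + h\<^sup>2))) (at s)"
    unfolding weight_def by (rule DERIV_divide[OF cutoff_sq_deriv]) (use p in \<open>auto intro!: derivative_eq_intros\<close>)
  also have "(- 8 * cutoff s * (s + h\<^sup>2) - (cutoff s)\<^sup>2 * 1) / ((s + h\<^sup>2) * (s + h\<^sup>2)) = weight' h s"
    using p by (simp add: weight'_def diff_divide_distrib power2_eq_square)
  finally show ?thesis .
qed

lemma cutoff_continuous: "continuous_on A cutoff" unfolding cutoff_def by (intro continuous_intros)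

text \<open>The bound \<open>s * weight h s \<le> 1\<close> is the sharp one: it determines the leading constant in the lower
  bound.\<close>
lemma weight_bounds:
  assumes "h > 0" "s \<ge> 0"
  shows "0 \<le> weight h s" "weight h s \<le> 1 / (s + h\<^sup>2)" "s * weight h s \<le> 1" "\<bar>weight' h s\<bar> \<le> 8 / (s + h\<^sup>2) + 1 / (s + h\<^sup>2)\<^sup>2"
proof -
  have p: "s + h\<^sup>2 > 0" using assms by (simp add: add_nonneg_pos)
  have c: "0 \<le> cutoff s" "cutoff s \<le> 1" using cutoff_bounds assms by auto
  then have c2: "(cutoff s)\<^sup>2 \<le> 1" "0 \<le> (cutoff s)\<^sup>2" by (auto simp: power_le_one)
  show "0 \<le> weight h s" unfolding weight_def using p by (intro divide_nonneg_pos) auto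
  show 2: "weight h s \<le> 1 / (s + h\<^sup>2)" unfolding weight_def using p c2 by (intro divide_right_mono) auto
  have "s * weight h s \<le> s * (1 / (s + h\<^sup>2))" using 2 assms by (intro mult_left_mono) auto
  also have "\<dots> \<le> 1" using p by simp
  finally show "s * weight h s \<le> 1" .
  have "\<bar>weight' h s\<bar> \<le> \<bar>- 8 * cutoff s / (s + h\<^sup>2)\<bar> + \<bar>(cutoff s)\<^sup>2 / (s + h\<^sup>2)\<^sup>2\<bar>" unfolding weight'_def by (rule abs_triangle_ineq4)
  also have "\<dots> = 8 * cutoff s / (s + h\<^sup>2) + (cutoff s)\<^sup>2 / (s + h\<^sup>2)\<^sup>2" using p c by (simp add: abs_mult)
  also have "\<dots> \<le> 8 / (s + h\<^sup>2) + 1 / (s + h\<^sup>2)\<^sup>2" using p c c2 by (intro add_mono divide_right_mono) auto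
  finally show "\<bar>weight' h s\<bar> \<le> 8 / (s + h\<^sup>2) + 1 / (s + h\<^sup>2)\<^sup>2" .
qed

lemma weight_support: "s \<ge> 1/4 \<Longrightarrow> weight h s = 0" "s \<ge> 1/4 \<Longrightarrow> weight' h s = 0"
  by (auto simp: weight_def weight'_def cutoff_bounds(3))

lemma weight_continuous:
  assumes "h > 0" shows "continuous_on {0..} (weight h)" "continuous_on {0..} (weight' h)"
  unfolding weight_def weight'_def using assms
  by (auto intro!: continuous_intros cutoff_continuous simp: add_nonneg_pos less_imp_neq[symmetric])

lemma test_grad_derivative:
  assumes "h > 0" shows "(test_grad h j has_derivative (\<lambda>d. \<Sum>i\<in>UNIV. d $ i *\<^sub>R test_hess h i j x)) (at x)"
proof -
  have "((\<lambda>x. x \<bullet> x) has_derivative (\<lambda>d. 2 * (x \<bullet> d))) (at x)" by (auto intro!: derivative_eq_intros simp: inner_commute)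
  from DERIV_compose_FDERIV[OF weight_deriv[OF assms inner_ge_zero[of x]] this]
  have "((\<lambda>x. weight h (x \<bullet> x)) has_derivative (\<lambda>d. 2 * (x \<bullet> d) * weight' h (x \<bullet> x))) (at x)" .
  from has_derivative_mult[OF has_derivative_minus[OF this] bounded_linear_imp_has_derivative[OF bounded_linear_vec_nth[of j]]]
  have "((\<lambda>x. - weight h (x \<bullet> x) * x $ j) has_derivative (\<lambda>d. - weight h (x \<bullet> x) * d $ j + - (2 * (x \<bullet> d) * weight' h (x \<bullet> x)) * x $ j)) (at x)" .
  then have "(test_grad h j has_derivative (\<lambda>d. - weight h (x \<bullet> x) * d $ j + - (2 * (x \<bullet> d) * weight' h (x \<bullet> x)) * x $ j)) (at x)"
    by (simp add: test_grad_def[abs_def] power2_norm_eq_inner)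
  then show ?thesis
  proof (rule has_derivative_eq_rhs)
    have "d $ j = d $ 1 * kronecker 1 j + d $ 2 * kronecker 2 j" for d :: "real^2" using exhaust_2[of j] by (auto simp: kronecker_def)
    then show "(\<lambda>d. - weight h (x \<bullet> x) * d $ j + - (2 * (x \<bullet> d) * weight' h (x \<bullet> x)) * x $ j) = (\<lambda>d. \<Sum>i\<in>UNIV. d $ i *\<^sub>R test_hess h i j x)"
      by (simp add: fun_eq_iff sum_UNIV_2 test_hess_def power2_norm_eq_inner inner2[of x] algebra_simps)
  qed
qed

lemma test_hess_continuous:
  assumes "h > 0" shows "continuous_on UNIV (test_hess h i j)"
proof -
  have 1: "continuous_on UNIV (\<lambda>x::real^2. weight h ((norm x)\<^sup>2))" "continuous_on UNIV (\<lambda>x::real^2. weight' h ((norm x)\<^sup>2))"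
    by (rule continuous_on_compose2[OF weight_continuous(1)[OF assms]], auto intro!: continuous_intros)
      (rule continuous_on_compose2[OF weight_continuous(2)[OF assms]], auto intro!: continuous_intros)
  show ?thesis unfolding test_hess_def by (intro continuous_intros 1)
qed

lemma radial_support:
  assumes "x \<notin> cball (0::real^2) (1/2)" shows "weight h ((norm x)\<^sup>2) = 0" "weight' h ((norm x)\<^sup>2) = 0"
proof -
  have "(1/2)\<^sup>2 \<le> (norm x)\<^sup>2" using assms by (intro power_mono) auto
  then have "1/4 \<le> (norm x)\<^sup>2" by (simp add: power2_eq_square)
  then show "weight h ((norm x)\<^sup>2) = 0" "weight' h ((norm x)\<^sup>2) = 0" by (auto intro: weight_support)
qed

lemma test_support:
  assumes "x \<notin> cball (0::real^2) (1/2)" shows "test_grad h j x = 0" "test_hess h i j x = 0"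
  unfolding test_grad_def test_hess_def radial_support[OF assms] by simp_all

lemma integrable_continuous_support:
  fixes f :: "real^2 \<Rightarrow> real"
  assumes "continuous_on UNIV f" "\<And>x. x \<notin> cball 0 R \<Longrightarrow> f x = 0"
  shows "integrable lborel f"
proof (rule L2_integrable_bounded_support[where A = "cball 0 R"])
  show "L2 f" by (rule test_L2[OF assms(1) compact_cball]) (rule assms(2))
qed (use assms(2) in auto)

section \<open>Bounding the curvature functional by the bending energy\<close>

text \<open>The curvature functional \<open>\<integral> \<psi>_12 g_12 - \<psi>_22 g_11 / 2 - \<psi>_11 g_22 / 2\<close> on the metric induced by \<open>V\<close>, as a quadratic form in \<open>V\<close>; in
  this form its continuity in mean square is immediate.\<close>
definition pairing_integral :: "real \<Rightarrow> (2 \<Rightarrow> real^2 \<Rightarrow> real^3) \<Rightarrow> real" where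
  "pairing_integral h V = ip (\<lambda>x. test_hess h 1 2 x *\<^sub>R V 1 x) (V 2) - ip (\<lambda>x. test_hess h 2 2 x *\<^sub>R V 1 x) (V 1) / 2 - ip (\<lambda>x. test_hess h 1 1 x *\<^sub>R V 2 x) (V 2) / 2"

text \<open>The derivative along the rotation field \<open>(- x_2, x_1)\<close> of a function with partial derivatives \<open>w\<close>.\<close>
definition angular :: "(2 \<Rightarrow> real^2 \<Rightarrow> real^3) \<Rightarrow> real^2 \<Rightarrow> real^3" where
  "angular w x = x $ 1 *\<^sub>R w 2 x - x $ 2 *\<^sub>R w 1 x"

lemma angular_sq_le: "(norm (angular w x))\<^sup>2 \<le> (norm x)\<^sup>2 * (\<Sum>j\<in>UNIV. (norm (w j x))\<^sup>2)"
proof -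
  define d :: "real^2" where "d = vector [- x $ 2, x $ 1]"
  have "angular w x = (\<Sum>j\<in>UNIV. d $ j *\<^sub>R w j x)" by (simp add: angular_def sum_UNIV_2 d_def)
  moreover have "(norm d)\<^sup>2 = (norm x)\<^sup>2" by (simp add: norm_vec2_sq d_def)
  ultimately show ?thesis using norm_directional_sq_le[of d "\<lambda>j. w j x"] by simp
qed

lemma rot_derivative:
  "((\<lambda>\<theta>. rot \<theta> x) has_derivative (\<lambda>s. s *\<^sub>R vector [- rot \<theta> x $ 2, rot \<theta> x $ 1])) (at \<theta>)"
proof -
  have e: "rot \<theta> x = (cos \<theta> * x $ 1 - sin \<theta> * x $ 2) *\<^sub>R axis 1 1 + (sin \<theta> * x $ 1 + cos \<theta> * x $ 2) *\<^sub>R axis 2 1" for \<theta>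
    by (auto simp: vec_eq_iff forall_2 axis_def)
  have "((\<lambda>\<theta>. rot \<theta> x) has_derivative (\<lambda>s. (- (sin \<theta> * s) * x $ 1 - cos \<theta> * s * x $ 2) *\<^sub>R axis 1 1 + (cos \<theta> * s * x $ 1 - sin \<theta> * s * x $ 2) *\<^sub>R axis 2 1)) (at \<theta>)"
    unfolding e by (auto intro!: derivative_eq_intros simp: fun_eq_iff algebra_simps)
  then show ?thesis
    by (rule has_derivative_eq_rhs) (auto simp: fun_eq_iff vec_eq_iff forall_2 axis_def algebra_simps)
qed

text \<open>Integration by parts in each of the three terms removes the Hessian of \<open>\<psi>\<close>. By the symmetry of \<open>w\<close> the
  remaining terms combine to \<open>- \<integral> m v_2 \<bullet> \<partial>_\<theta> v_1\<close>, where only angular derivatives occur. The radial weight \<open>m\<close> is constant on circles, so the isoperimetric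
  inequality applies to the curves \<open>\<theta> \<mapsto> (v_1, v_2)\<close> on each of them.\<close>
lemma smooth_estimate:
  fixes v :: "2 \<Rightarrow> real^2 \<Rightarrow> real^3" and w :: "2 \<Rightarrow> 2 \<Rightarrow> real^2 \<Rightarrow> real^3"
  assumes h: "h > 0"
    and vc: "\<And>i. continuous_on UNIV (v i)" and wc: "\<And>i j. continuous_on UNIV (w i j)"
    and der: "\<And>i x. x \<in> ball 0 (3/4) \<Longrightarrow> (v i has_derivative (\<lambda>d. \<Sum>j\<in>UNIV. d $ j *\<^sub>R w i j x)) (at x)"
    and sym: "\<And>x. x \<in> ball 0 (3/4) \<Longrightarrow> w 1 2 x = w 2 1 x"
    and wL: "\<And>i j. L2 (w i j)"
  shows "pairing_integral h v \<le> bending w / 2"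
proof -
  let ?K = "cball (0::real^2) (1/2)"
  have KU: "?K \<subseteq> ball 0 (3/4)" by auto
  define m where "m x = weight h ((norm x)\<^sup>2)" for x :: "real^2"
  have m0: "m x \<ge> 0" "m x * (norm x)\<^sup>2 \<le> 1" for x using weight_bounds[OF h zero_le_power2[of "norm x"]] by (auto simp: m_def mult.commute)
  have mc: "continuous_on UNIV m" unfolding m_def
    by (rule continuous_on_compose2[OF weight_continuous(1)[OF h]]) (auto intro!: continuous_intros)
  have mK: "x \<notin> ?K \<Longrightarrow> m x = 0" for x unfolding m_def by (rule radial_support(1))
  note Pc = test_hess_continuous[OF h] and pd = test_grad_derivative[OF h]
  have pc: "continuous_on UNIV (test_grad h j)" for j by (rule has_derivative_continuous_on[OF pd])
  define P where "P a b i x = w a i x \<bullet> v b x + v a x \<bullet> w b i x" for a b i x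
  define A where "A a b i j x = test_hess h i j x * (v a x \<bullet> v b x) + test_grad h j x * P a b i x" for a b i j x
  have ibp: "(\<integral>x. A a b i j x \<partial>lborel) = 0" for a b i j
  proof -
    have "(\<integral>x. test_hess h i j x *\<^sub>R (v a x \<bullet> v b x) + test_grad h j x *\<^sub>R P a b i x \<partial>lborel) = 0"
    proof (rule integration_by_parts[of "test_grad h j" "\<lambda>i. test_hess h i j" ?K "ball 0 (3/4)" "\<lambda>x. v a x \<bullet> v b x" "P a b"])
      show "((\<lambda>x. v a x \<bullet> v b x) has_derivative (\<lambda>d. \<Sum>i\<in>UNIV. d $ i *\<^sub>R P a b i x)) (at x)" if "x \<in> ball 0 (3/4)" for x
        by (rule has_derivative_eq_rhs[OF has_derivative_inner[OF der[OF that] der[OF that]]])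
          (simp add: fun_eq_iff P_def sum_UNIV_2 inner_add_left inner_add_right algebra_simps)
      show "continuous_on (ball 0 (3/4)) (P a b i)" for i
        unfolding P_def by (intro continuous_intros continuous_on_subset[OF vc] continuous_on_subset[OF wc]) auto
    qed (use pd Pc KU test_support in auto)
    then show ?thesis by (simp add: A_def)
  qed
  have Ai: "integrable lborel (A a b i j)" for a b i j
  proof (rule integrable_continuous_support[of _ "1/2"])
    show "continuous_on UNIV (A a b i j)" unfolding A_def P_def by (intro continuous_intros Pc pc vc wc)
  qed (simp add: A_def test_support)
  define th where "th i = angular (w i)" for i
  have thc: "continuous_on UNIV (th i)" for i unfolding th_def angular_def by (intro continuous_intros wc)
  define S where "S x = m x * (v 2 x \<bullet> th 1 x)" for x
  have Si: "integrable lborel S"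
    by (rule integrable_continuous_support[of _ "1/2"]) (auto simp: S_def mK intro!: continuous_intros mc vc thc)
  define t where "t x = test_hess h 1 2 x * (v 1 x \<bullet> v 2 x) - test_hess h 2 2 x * (v 1 x \<bullet> v 1 x) / 2 - test_hess h 1 1 x * (v 2 x \<bullet> v 2 x) / 2" for x
  (* The terms with w 2 1 and w 1 2 cancel by symmetry, which leaves the angular derivative in S. *)
  have te: "t x = A 1 2 1 2 x - A 1 1 2 2 x / 2 - A 2 2 1 1 x / 2 - S x" for x
  proof (cases "x \<in> ?K")
    case True
    then have s: "w 2 1 x = w 1 2 x" using sym[of x] KU by auto
    have p: "test_grad h j x = - m x * x $ j" for j by (simp add: test_grad_def m_def)
    show ?thesis unfolding t_def A_def P_def S_def th_def angular_def p s
      by (simp add: inner_diff_right inner_commute[of "w _ _ x"] algebra_simps add_divide_distrib diff_divide_distrib)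
  next
    case False
    then show ?thesis by (simp add: t_def A_def S_def test_support mK)
  qed
  have "(\<integral>x. t x \<partial>lborel) = - (\<integral>x. S x \<partial>lborel)"
    unfolding te using Ai Si ibp by simp
  moreover have "pairing_integral h v = (\<integral>x. t x \<partial>lborel)"
  proof -
    have i: "integrable lborel (\<lambda>x. test_hess h i j x * (v a x \<bullet> v b x))" for a b i j
      by (rule integrable_continuous_support[of _ "1/2"]) (auto simp: test_support intro!: continuous_intros Pc vc)
    show ?thesis unfolding pairing_integral_def ip_def t_def using i by simp
  qed
  ultimately have T: "pairing_integral h v = - (\<integral>x. S x \<partial>lborel)" by simp
  define Q where "Q x = m x * ((norm (th 1 x))\<^sup>2 / 2 + (norm (th 2 x))\<^sup>2 / 2)" for x
  have Qi: "integrable lborel Q"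
    by (rule integrable_continuous_support[of _ "1/2"]) (auto simp: Q_def mK intro!: continuous_intros mc thc)
  have "0 \<le> (\<integral>x. Q x + S x \<partial>lborel)"
  proof (rule rotation_average_nonneg[of _ "1/2"])
    show "continuous_on UNIV (\<lambda>x. Q x + S x)" unfolding Q_def S_def by (intro continuous_intros mc thc vc) auto
    show "Q x + S x = 0" if "norm x > 1/2" for x using that mK[of x] by (simp add: Q_def S_def)
    show "0 \<le> integral {0..2 * pi} (\<lambda>\<theta>. Q (rot \<theta> x) + S (rot \<theta> x))" for x
    proof (cases "x \<in> ?K")
      case False
      then have "m (rot \<theta> x) = 0" for \<theta> by (intro mK) simp
      then show ?thesis by (simp add: Q_def S_def)
    next
      case True
      have mr: "m (rot \<theta> x) = m x" for \<theta> by (simp add: m_def)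
      have ib: "rot \<theta> x \<in> ball 0 (3/4)" for \<theta> using True by simp
      have vd: "((\<lambda>\<theta>. v i (rot \<theta> x)) has_vector_derivative th i (rot \<theta> x)) (at \<theta>)" for i \<theta>
      proof -
        have "((\<lambda>\<theta>. v i (rot \<theta> x)) has_derivative (\<lambda>s. \<Sum>j\<in>UNIV. (s *\<^sub>R vector [- rot \<theta> x $ 2, rot \<theta> x $ 1] :: real^2) $ j *\<^sub>R w i j (rot \<theta> x))) (at \<theta>)"
          by (rule has_derivative_compose[of "\<lambda>\<theta>. rot \<theta> x" _ \<theta> UNIV "v i" "\<lambda>d. \<Sum>j\<in>UNIV. d $ j *\<^sub>R w i j (rot \<theta> x)", OF rot_derivative der[OF ib]])
        then show ?thesis unfolding has_vector_derivative_def
          by (rule has_derivative_eq_rhs) (simp add: fun_eq_iff th_def angular_def sum_UNIV_2 algebra_simps)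
      qed
      have rc: "continuous_on UNIV (\<lambda>\<theta>. rot \<theta> x)"
        by (rule has_derivative_continuous_on[of UNIV "\<lambda>\<theta>. rot \<theta> x"]) (rule rot_derivative)
      have tr: "continuous_on A (\<lambda>\<theta>. th i (rot \<theta> x))" for A i
        by (rule continuous_on_subset[OF continuous_on_compose2[OF thc rc]]) simp_all
      have per: "rot (2 * pi) x = rot 0 x" by (simp add: rot_def)
      have "0 \<le> integral {0..2 * pi} (\<lambda>\<theta>. (norm (th 1 (rot \<theta> x)))\<^sup>2 / 2 + (norm (th 2 (rot \<theta> x)))\<^sup>2 / 2 + v 2 (rot \<theta> x) \<bullet> th 1 (rot \<theta> x))"
        by (rule isoperimetric_vector[of "\<lambda>\<theta>. v 1 (rot \<theta> x)" _ "\<lambda>\<theta>. v 2 (rot \<theta> x)", OF vd _ _ vd])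
          (use tr per in simp_all)
      then have "0 \<le> m x * \<dots>" using m0(1)[of x] by (intro mult_nonneg_nonneg)
      also have "\<dots> = integral {0..2 * pi} (\<lambda>\<theta>. m x * ((norm (th 1 (rot \<theta> x)))\<^sup>2 / 2 + (norm (th 2 (rot \<theta> x)))\<^sup>2 / 2 + v 2 (rot \<theta> x) \<bullet> th 1 (rot \<theta> x)))"
        by (rule integral_mult_right[symmetric])
      also have "\<dots> = integral {0..2 * pi} (\<lambda>\<theta>. Q (rot \<theta> x) + S (rot \<theta> x))"
        by (simp add: Q_def S_def mr distrib_left)
      finally show ?thesis .
    qed
  qed
  also have "\<dots> = (\<integral>x. Q x \<partial>lborel) + (\<integral>x. S x \<partial>lborel)" by (rule Bochner_Integration.integral_add[OF Qi Si])
  finally have "pairing_integral h v \<le> (\<integral>x. Q x \<partial>lborel)" unfolding T by linarith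
  also have "\<dots> \<le> (\<integral>x. (\<Sum>i\<in>UNIV. \<Sum>j\<in>UNIV. (norm (w i j x))\<^sup>2) / 2 \<partial>lborel)"
  proof (rule integral_mono[OF Qi])
    show "integrable lborel (\<lambda>x. (\<Sum>i\<in>UNIV. \<Sum>j\<in>UNIV. (norm (w i j x))\<^sup>2) / 2)" using L2_integrable[OF wL] by simp
    show "Q x \<le> (\<Sum>i\<in>UNIV. \<Sum>j\<in>UNIV. (norm (w i j x))\<^sup>2) / 2" for x
    proof -
      have one: "m x * (norm (th i x))\<^sup>2 \<le> (\<Sum>j\<in>UNIV. (norm (w i j x))\<^sup>2)" for i
      proof -
        have "m x * (norm (th i x))\<^sup>2 \<le> m x * ((norm x)\<^sup>2 * (\<Sum>j\<in>UNIV. (norm (w i j x))\<^sup>2))"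
          unfolding th_def by (intro mult_left_mono angular_sq_le m0)
        also have "\<dots> = (m x * (norm x)\<^sup>2) * (\<Sum>j\<in>UNIV. (norm (w i j x))\<^sup>2)" by simp
        also have "\<dots> \<le> 1 * (\<Sum>j\<in>UNIV. (norm (w i j x))\<^sup>2)" by (intro mult_right_mono m0 sum_nonneg) auto
        finally show ?thesis by simp
      qed
      have "Q x = (m x * (norm (th 1 x))\<^sup>2 + m x * (norm (th 2 x))\<^sup>2) / 2" by (simp add: Q_def algebra_simps add_divide_distrib)
      also have "\<dots> \<le> ((\<Sum>j\<in>UNIV. (norm (w 1 j x))\<^sup>2) + (\<Sum>j\<in>UNIV. (norm (w 2 j x))\<^sup>2)) / 2"
        by (intro divide_right_mono add_mono one) simp
      finally show ?thesis by (simp only: sum_UNIV_2[of "\<lambda>i. \<Sum>j\<in>UNIV. (norm (w i j x))\<^sup>2"])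
    qed
  qed
  also have "\<dots> = bending w / 2" unfolding bending_def n2_def using L2_integrable[OF wL] by simp
  finally show ?thesis .
qed

lemma test_hess_bounded:
  assumes "h > 0" "L2 f"
  obtains B where "B \<ge> 0" "\<And>x. \<bar>test_hess h i j x\<bar> \<le> B"
  using continuous_compact_support_bounded[OF test_hess_continuous[OF assms(1)] compact_cball test_support(2)] by (metis abs_ge_zero order_trans)

lemma L2_test_hess_scale:
  fixes f :: "real^2 \<Rightarrow> real^3"
  assumes "h > 0" "L2 f" shows "L2 (\<lambda>x. test_hess h i j x *\<^sub>R f x)"
proof -
  obtain B where B: "B \<ge> 0" "\<And>x. \<bar>test_hess h i j x\<bar> \<le> B" using test_hess_bounded[OF assms, of i j] by blast
  show ?thesis
    by (rule L2_bound(1)[OF assms(2), of _ B])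
      (use B assms(2) borel_measurable_continuous_onI[OF test_hess_continuous[OF assms(1)]] in \<open>auto simp: L2_def intro!: mult_right_mono\<close>)
qed

lemma test_hess_tendsto:
  fixes f :: "nat \<Rightarrow> real^2 \<Rightarrow> real^3"
  assumes h: "h > 0" and f: "\<And>n. L2 (f n)" "L2 g" "(\<lambda>n. n2 (\<lambda>x. f n x - g x)) \<longlonglongrightarrow> 0"
  shows "(\<lambda>n. n2 (\<lambda>x. test_hess h i j x *\<^sub>R f n x - test_hess h i j x *\<^sub>R g x)) \<longlonglongrightarrow> 0"
proof -
  obtain B where B: "B \<ge> 0" "\<And>x. \<bar>test_hess h i j x\<bar> \<le> B" using test_hess_bounded[OF h f(2), of i j] by blast
  have "n2 (\<lambda>x. test_hess h i j x *\<^sub>R f n x - test_hess h i j x *\<^sub>R g x) \<le> B\<^sup>2 * n2 (\<lambda>x. f n x - g x)" for n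
  proof (rule L2_bound(2)[OF L2_diff(1)[OF f(1,2)] _ _ B(1)])
    show "(\<lambda>x. test_hess h i j x *\<^sub>R f n x - test_hess h i j x *\<^sub>R g x) \<in> borel_measurable borel"
      using L2_diff(1)[OF L2_test_hess_scale[OF h f(1)[of n]] L2_test_hess_scale[OF h f(2)]] by (simp add: L2_def)
    show "norm (test_hess h i j x *\<^sub>R f n x - test_hess h i j x *\<^sub>R g x) \<le> B * norm (f n x - g x)" for x
      unfolding scaleR_diff_right[symmetric] norm_scaleR using B(2) by (intro mult_right_mono) auto
  qed
  then have le: "\<forall>\<^sub>F n in sequentially. n2 (\<lambda>x. test_hess h i j x *\<^sub>R f n x - test_hess h i j x *\<^sub>R g x) \<le> B\<^sup>2 * n2 (\<lambda>x. f n x - g x)"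
    by (intro always_eventually allI)
  have "(\<lambda>n. B\<^sup>2 * n2 (\<lambda>x. f n x - g x)) \<longlonglongrightarrow> B\<^sup>2 * 0" by (intro tendsto_intros f(3))
  then show ?thesis by (intro tendsto_sandwich[OF _ le tendsto_const]) auto
qed

text \<open>Mollified gradients satisfy the hypotheses of \<open>smooth_estimate\<close> on the disc of radius \<open>3/4\<close> once the
  kernel is small, and both sides are continuous in mean square.\<close>
lemma weak_estimate:
  assumes h: "h > 0" and a: "weak_jet Y V W"
  shows "pairing_integral h V \<le> bending W / 2"
proof -
  have L: "L2B Y" "L2B (V i)" "L2B (W i j)" for i j using a by (auto simp: weak_jet_def)
  have Wd: "weak_deriv i Y (V i)" "weak_deriv j (V i) (W i j)" for i j using a by (auto simp: weak_jet_def)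
  note vL = L2B_L2[OF L(2)] and wL = L2B_L2[OF L(3)]
  define v where "v n i = mollify (eta n) (V i)" for n i
  define w where "w n i j = mollify (eta n) (W i j)" for n i j
  have lv: "L2 (v n i)" "(\<lambda>n. n2 (\<lambda>x. v n i x - V i x)) \<longlonglongrightarrow> 0" for n i unfolding v_def by (rule eta_tendsto[OF vL])+
  have lw: "L2 (w n i j)" "(\<lambda>n. n2 (\<lambda>x. w n i j x - W i j x)) \<longlonglongrightarrow> 0" for n i j unfolding w_def by (rule eta_tendsto[OF wL])+
  have est: "pairing_integral h (v n) \<le> bending (w n) / 2" if n: "n \<ge> 8" for n
  proof (rule smooth_estimate[OF h])
    have s: "norm x + 2 / real (Suc n) < 1" if "x \<in> ball 0 (3/4)" for x :: "real^2"
    proof -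
      have "2 / real (Suc n) \<le> 2 / 8" using n by (intro divide_left_mono) auto
      moreover have "norm x < 3 / 4" using that by simp
      ultimately show ?thesis by linarith
    qed
    show "continuous_on UNIV (v n i)" "continuous_on UNIV (w n i j)" for i j
      unfolding v_def w_def by (auto intro: mollify_eta_continuous L)
    show "(v n i has_derivative (\<lambda>d. \<Sum>j\<in>UNIV. d $ j *\<^sub>R w n i j x)) (at x)" if "x \<in> ball 0 (3/4)" for i x
      unfolding v_def w_def by (rule mollify_weak_deriv_has_derivative[OF L(2) Wd(2) s[OF that]])
    show "w n 1 2 x = w n 2 1 x" if "x \<in> ball 0 (3/4)" for x
      unfolding w_def by (rule mollify_weak_deriv_symmetric[OF Wd s[OF that]])
  qed (rule lw)
  have l: "(\<lambda>n. ip (\<lambda>x. test_hess h i j x *\<^sub>R v n p x) (v n q)) \<longlonglongrightarrow> ip (\<lambda>x. test_hess h i j x *\<^sub>R V p x) (V q)" for i j p q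
    by (rule ip_tendsto[OF L2_test_hess_scale[OF h lv(1)] L2_test_hess_scale[OF h vL] test_hess_tendsto[OF h lv(1) vL lv(2)] lv(1) vL lv(2)])
  have "(\<lambda>n. pairing_integral h (v n)) \<longlonglongrightarrow> pairing_integral h V" unfolding pairing_integral_def by (intro tendsto_intros l) auto
  moreover have "(\<lambda>n. bending (w n) / 2) \<longlonglongrightarrow> bending W / 2"
    unfolding bending_def by (intro tendsto_intros n2_tendsto lw wL) auto
  ultimately show ?thesis by (rule LIMSEQ_le) (use est in blast)
qed

section \<open>The lower bound\<close>

text \<open>The integrand of the curvature functional at a symmetric matrix \<open>M\<close>.\<close>
definition pairing :: "real \<Rightarrow> real^2 \<Rightarrow> real^2^2 \<Rightarrow> real" where
  "pairing h x M = test_hess h 1 2 x * M $ 1 $ 2 - test_hess h 2 2 x * M $ 1 $ 1 / 2 - test_hess h 1 1 x * M $ 2 $ 2 / 2"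

lemma pairing_diff: "pairing h x (M - N) = pairing h x M - pairing h x N"
  by (simp add: pairing_def algebra_simps diff_divide_distrib)

lemma weight_isCont:
  assumes "h > 0" "s \<ge> 0" shows "isCont (weight h) s" "isCont (weight' h) s"
proof -
  have p: "s + h\<^sup>2 \<noteq> 0" using assms by (smt (verit) zero_less_power)
  have c: "isCont cutoff s" using cutoff_continuous[of UNIV] by (simp add: continuous_on_eq_continuous_at)
  show "isCont (weight h) s" "isCont (weight' h) s" unfolding weight_def weight'_def using p
    by (auto intro!: continuous_intros c)
qed

lemma weight_measurable [measurable]: "weight h \<in> borel_measurable borel" "weight' h \<in> borel_measurable borel"
proof -
  have [measurable]: "cutoff \<in> borel_measurable borel" by (intro borel_measurable_continuous_onI cutoff_continuous)
  show "weight h \<in> borel_measurable borel" "weight' h \<in> borel_measurable borel"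
    unfolding weight_def[abs_def] weight'_def[abs_def] by measurable
qed

text \<open>The integrand is the derivative of \<open>s * weight h s\<close>, which vanishes at both ends. This
  is the flat part of \<open>g_\<Delta>\<close>, which carries no curvature.\<close>
lemma integral_weight_total_derivative:
  assumes "h > 0"
  shows "integrable lborel (\<lambda>s. (weight h s + s * weight' h s) * indicator {0..1} s)"
    "(\<integral>s. (weight h s + s * weight' h s) * indicator {0..1} s \<partial>lborel) = 0"
proof -
  have c: "isCont (\<lambda>s. weight h s + s * weight' h s) s" if "0 \<le> s" for s
    by (intro continuous_intros weight_isCont assms that)
  then show "integrable lborel (\<lambda>s. (weight h s + s * weight' h s) * indicator {0..1} s)"
    by (intro borel_integrable_atLeastAtMost) auto
  have d: "((\<lambda>s. s * weight h s) has_real_derivative (weight h s + s * weight' h s)) (at s)" if "0 \<le> s" for s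
    using DERIV_mult[OF DERIV_ident weight_deriv[OF assms that]] by (simp add: algebra_simps)
  have "(\<integral>s. (weight h s + s * weight' h s) * indicator {0..1} s \<partial>lborel) = 1 * weight h 1 - 0 * weight h 0"
    by (rule integral_FTC_Icc_real) (use c d in auto)
  then show "(\<integral>s. (weight h s + s * weight' h s) * indicator {0..1} s \<partial>lborel) = 0" by (simp add: weight_support)
qed

text \<open>The cutoff satisfies \<open>(cutoff s)\<^sup>2 \<ge> 1 - 8 s\<close>, so removing it costs at most a constant.\<close>
lemma integral_weight_lower:
  assumes "0 < h" "h < 1"
  shows "integrable lborel (\<lambda>s. weight h s * indicator {0..1} s)"
    "2 * \<bar>ln h\<bar> - 8 \<le> (\<integral>s. weight h s * indicator {0..1} s \<partial>lborel)"
proof -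
  have p: "s + h\<^sup>2 > 0" if "0 \<le> s" for s using that assms by (simp add: add_nonneg_pos)
  show i: "integrable lborel (\<lambda>s. weight h s * indicator {0..1} s)"
    by (intro borel_integrable_atLeastAtMost weight_isCont assms) auto
  have c: "isCont (\<lambda>s. 1 / (s + h\<^sup>2) - 8) s" if "0 \<le> s" for s
    using p[OF that] by (intro continuous_intros) auto
  have d: "((\<lambda>s. ln (s + h\<^sup>2) - 8 * s) has_real_derivative (1 / (s + h\<^sup>2) - 8)) (at s)" if "0 \<le> s" for s
    using p[OF that] by (auto intro!: derivative_eq_intros)
  have "(\<integral>s. (1 / (s + h\<^sup>2) - 8) * indicator {0..1} s \<partial>lborel) = (ln (1 + h\<^sup>2) - 8 * 1) - (ln (0 + h\<^sup>2) - 8 * 0)"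
    by (rule integral_FTC_Icc_real) (use c d in auto)
  moreover have "(\<integral>s. (1 / (s + h\<^sup>2) - 8) * indicator {0..1} s \<partial>lborel) \<le> (\<integral>s. weight h s * indicator {0..1} s \<partial>lborel)"
  proof (rule integral_mono[OF _ i])
    show "integrable lborel (\<lambda>s. (1 / (s + h\<^sup>2) - 8) * indicator {0..1} s)"
      by (intro borel_integrable_atLeastAtMost c)
    show "(1 / (s + h\<^sup>2) - 8) * indicator {0..1} s \<le> weight h s * indicator {0..1} s" for s
    proof (cases "s \<in> {0..1}")
      case True
      have "1 - 8 * s \<le> (cutoff s)\<^sup>2"
      proof (cases "4 * s \<le> 1")
        case True
        then have "(cutoff s)\<^sup>2 = 1 - 8 * s + 16 * s\<^sup>2" by (simp add: cutoff_def power2_eq_square algebra_simps)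
        then show ?thesis by simp
      next
        case False
        then show ?thesis using zero_le_power2[of "cutoff s"] by linarith
      qed
      then have "(1 - 8 * s) / (s + h\<^sup>2) \<le> weight h s" unfolding weight_def using p True by (intro divide_right_mono) (auto simp: less_imp_le)
      moreover have "s / (s + h\<^sup>2) \<le> 1" using p[of s] True by simp
      moreover have "(1 - 8 * s) / (s + h\<^sup>2) = 1 / (s + h\<^sup>2) - 8 * (s / (s + h\<^sup>2))" by (simp add: diff_divide_distrib)
      ultimately show ?thesis using True by simp
    qed simp
  qed
  moreover have "ln (h\<^sup>2) = - 2 * \<bar>ln h\<bar>" using assms by (simp add: ln_realpow)
  moreover have "ln (1 + h\<^sup>2) \<ge> 0" by simp
  ultimately show "2 * \<bar>ln h\<bar> - 8 \<le> (\<integral>s. weight h s * indicator {0..1} s \<partial>lborel)" unfolding add_0 by linarith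
qed

lemma borel_measurable_matrix_entry:
  fixes f :: "'a \<Rightarrow> real^2^2"
  assumes "f \<in> borel_measurable M" shows "(\<lambda>x. f x $ i $ j) \<in> borel_measurable M"
proof -
  have "(\<lambda>x. f x \<bullet> axis i (axis j 1)) \<in> borel_measurable M" using assms by simp
  then show ?thesis by (simp add: inner_axis)
qed

text \<open>Only the multiple \<open>(1 - \<Delta>\<^sup>2)\<close> of the identity sees \<open>weight'\<close>; in the part \<open>x \<otimes> x / |x|\<^sup>2\<close> the second-order terms
  of the Hessian cancel.\<close>
lemma pairing_ref_metric:
  assumes "x \<noteq> 0"
  shows "pairing h x (ref_metric \<Delta> x) = indicator B1 x *
    ((\<lambda>s. (1 - \<Delta>\<^sup>2) * (weight h s + s * weight' h s) + \<Delta>\<^sup>2 / 2 * weight h s) ((norm x)\<^sup>2))"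
proof -
  define s a b m m' D where "s = (norm x)\<^sup>2" and "a = x $ 1" and "b = x $ 2" and "m = weight h s" and "m' = weight' h s" and "D = \<Delta>\<^sup>2"
  have s: "s \<noteq> 0" "s = a\<^sup>2 + b\<^sup>2" using assms by (simp add: s_def) (simp add: s_def a_def b_def norm_vec2_sq)
  have "pairing h x (ref_metric \<Delta> x) = (- 2 * m' * (a * b)) * (D * (a * b) / s)
     - (- m - 2 * m' * (b * b)) * ((1 - D) + D * (a * a) / s) / 2
     - (- m - 2 * m' * (a * a)) * ((1 - D) + D * (b * b) / s) / 2"
    unfolding pairing_def ref_metric_entry[OF assms] test_hess_def s_def[symmetric] a_def[symmetric] b_def[symmetric]
      m_def[symmetric] m'_def[symmetric] D_def[symmetric]
    by (simp add: kronecker_def)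
  also have "\<dots> = (1 - D) * (m + m' * (a\<^sup>2 + b\<^sup>2)) + D * m * ((a\<^sup>2 + b\<^sup>2) / s) / 2"
    using s(1) by (simp add: field_simps power2_eq_square)
  also have "\<dots> = (1 - D) * (m + s * m') + D / 2 * m" unfolding s(2)[symmetric] using s(1) by simp
  finally have e: "pairing h x (ref_metric \<Delta> x) = (1 - D) * (m + s * m') + D / 2 * m" .
  show ?thesis
  proof (cases "x \<in> B1")
    case True
    then show ?thesis using e by (simp add: s_def m_def m'_def D_def)
  next
    case False
    then show ?thesis by (simp add: pairing_def test_support)
  qed
qed

text \<open>The contribution of the curvature at the apex, with the logarithm coming from
  \<open>integral_weight_lower\<close>.\<close>
lemma pairing_ref_metric_integral:
  assumes h: "0 < h" "h < 1"
  shows "pi * \<Delta>\<^sup>2 * (\<bar>ln h\<bar> - 4) \<le> (\<integral>x. pairing h x (ref_metric \<Delta> x) \<partial>lborel)"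
proof -
  define G where "G s = (1 - \<Delta>\<^sup>2) * (weight h s + s * weight' h s) + \<Delta>\<^sup>2 / 2 * weight h s" for s
  have Gm[measurable]: "G \<in> borel_measurable borel" unfolding G_def[abs_def] by measurable
  have [measurable]: "B1 \<in> sets borel" by simp
  have [measurable]: "test_hess h i j \<in> borel_measurable borel" for i j
    by (intro borel_measurable_continuous_onI test_hess_continuous h)
  have [measurable]: "(\<lambda>x. ref_metric \<Delta> x $ i $ j) \<in> borel_measurable borel" for i j
    by (rule borel_measurable_matrix_entry[OF ref_metric_measurable])
  have "AE x in lborel. x \<noteq> (0::real^2)" by (rule AE_lborel_singleton)
  moreover have "pairing h x (ref_metric \<Delta> x) = indicator B1 x * G ((norm x)\<^sup>2)" if "x \<noteq> 0" for x
    unfolding G_def by (rule pairing_ref_metric[OF that])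
  ultimately have "AE x in lborel. pairing h x (ref_metric \<Delta> x) = indicator B1 x * G ((norm x)\<^sup>2)" by auto
  then have "(\<integral>x. pairing h x (ref_metric \<Delta> x) \<partial>lborel) = (\<integral>x. indicator B1 x * G ((norm (x::real^2))\<^sup>2) \<partial>lborel)"
    by (intro integral_cong_AE) (auto simp: pairing_def)
  also have "\<dots> = pi * (\<integral>s. indicator {0..1} s * G s \<partial>lborel)" by (rule radial_integral[OF Gm])
  also have "(\<lambda>s. indicator {0..1} s * G s) = (\<lambda>s. (1 - \<Delta>\<^sup>2) * ((weight h s + s * weight' h s) * indicator {0..1} s) + \<Delta>\<^sup>2 / 2 * (weight h s * indicator {0..1} s))"
    by (simp add: G_def fun_eq_iff indicator_def)
  also have "(\<integral>s. (1 - \<Delta>\<^sup>2) * ((weight h s + s * weight' h s) * indicator {0..1} s) + \<Delta>\<^sup>2 / 2 * (weight h s * indicator {0..1} s) \<partial>lborel)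
    = (1 - \<Delta>\<^sup>2) * 0 + \<Delta>\<^sup>2 / 2 * (\<integral>s. weight h s * indicator {0..1} s \<partial>lborel)"
    using integral_weight_total_derivative[OF h(1)] integral_weight_lower(1)[OF h]
    by (subst Bochner_Integration.integral_add) (auto simp only: integral_mult_right_zero intro!: integrable_mult_right)
  finally have e: "(\<integral>x. pairing h x (ref_metric \<Delta> x) \<partial>lborel) = pi * (\<Delta>\<^sup>2 / 2 * (\<integral>s. weight h s * indicator {0..1} s \<partial>lborel))" by simp
  have "pi * (\<Delta>\<^sup>2 / 2 * (2 * \<bar>ln h\<bar> - 8)) \<le> pi * (\<Delta>\<^sup>2 / 2 * (\<integral>s. weight h s * indicator {0..1} s \<partial>lborel))"
    by (intro mult_left_mono integral_weight_lower h) auto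
  then show ?thesis unfolding e by (simp add: algebra_simps)
qed

lemma test_hess_bound:
  assumes "h > 0" "norm x < 1" shows "\<bar>test_hess h i j x\<bar> \<le> 19 / ((norm x)\<^sup>2 + h\<^sup>2)"
proof -
  define s where "s = (norm x)\<^sup>2"
  define p where "p = s + h\<^sup>2"
  have s: "s \<ge> 0" "s \<le> 1" using assms by (auto simp: s_def power_le_one)
  have p: "p > 0" "s \<le> p" using assms s by (auto simp: p_def add_nonneg_pos)
  have "\<bar>x $ i * x $ j\<bar> \<le> norm x * norm x" unfolding abs_mult by (intro mult_mono component_le_norm_cart) auto
  then have ij: "\<bar>x $ i * x $ j\<bar> \<le> s" by (simp add: s_def power2_eq_square)
  have m: "\<bar>weight h s * kronecker i j\<bar> \<le> 1 / p"
    using weight_bounds(1,2)[OF assms(1) s(1)] p by (auto simp: kronecker_def p_def)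
  have "\<bar>2 * weight' h s * (x $ i * x $ j)\<bar> = 2 * (\<bar>weight' h s\<bar> * \<bar>x $ i * x $ j\<bar>)" by (simp add: abs_mult)
  also have "\<dots> \<le> 2 * ((8 / p + 1 / p\<^sup>2) * s)"
    using weight_bounds(4)[OF assms(1) s(1)] ij p by (intro mult_left_mono mult_mono) (auto simp: p_def)
  also have "\<dots> = 16 * s / p + 2 * (s / p) / p" by (simp add: algebra_simps power2_eq_square)
  also have "\<dots> \<le> 16 * 1 / p + 2 * 1 / p"
    using s p by (intro add_mono divide_right_mono mult_left_mono) auto
  finally have "\<bar>2 * weight' h s * (x $ i * x $ j)\<bar> \<le> 18 / p" by simp
  then have "\<bar>test_hess h i j x\<bar> \<le> 1 / p + 18 / p"
    unfolding test_hess_def s_def[symmetric] using m by linarith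
  then show ?thesis by (simp add: p_def s_def)
qed

text \<open>Dominates the operator norm of \<open>pairing h x\<close>; the constant is twice that of \<open>test_hess_bound\<close>, since the coefficients
  \<open>1, 1/2, 1/2\<close> add up to \<open>2\<close>.\<close>
definition dual_weight :: "real \<Rightarrow> real^2 \<Rightarrow> real" where
  "dual_weight h x = indicator B1 x * (38 / ((norm x)\<^sup>2 + h\<^sup>2))"

lemma pairing_bound:
  assumes "h > 0" shows "\<bar>pairing h x M\<bar> \<le> dual_weight h x * norm M"
proof (cases "x \<in> B1")
  case False
  then show ?thesis by (simp add: pairing_def test_support dual_weight_def)
next
  case True
  define b where "b = 19 / ((norm x)\<^sup>2 + h\<^sup>2)"
  have P: "\<bar>test_hess h i j x\<bar> \<le> b" for i j unfolding b_def using True by (intro test_hess_bound assms) simp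
  have M: "\<bar>M $ i $ j\<bar> \<le> norm M" for i j
    using component_le_norm_cart[of "M $ i" j] Finite_Cartesian_Product.norm_nth_le[of M i] by linarith
  have PM: "\<bar>test_hess h i j x * M $ k $ l\<bar> \<le> b * norm M" for i j k l
    unfolding abs_mult by (intro mult_mono P M) (use P[of i j] in auto)
  have "\<bar>pairing h x M\<bar> \<le> 2 * (b * norm M)"
    unfolding pairing_def using PM[of 1 2 1 2] PM[of 2 2 1 1] PM[of 1 1 2 2] by linarith
  then show ?thesis using True by (simp add: dual_weight_def b_def)
qed

lemma dual_weight_L2:
  assumes "h > 0" shows "L2 (dual_weight h)" "n2 (dual_weight h) \<le> 38\<^sup>2 * pi / h\<^sup>2"
proof -
  have [measurable]: "B1 \<in> sets borel" by simp
  have m: "dual_weight h \<in> borel_measurable borel" unfolding dual_weight_def[abs_def] by measurable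
  have metric_of: "(\<lambda>s. ennreal (38\<^sup>2 * (1 / (s + h\<^sup>2)\<^sup>2))) \<in> borel_measurable borel" by measurable
  have "(\<integral>\<^sup>+x. ennreal ((norm (dual_weight h x))\<^sup>2) \<partial>lborel)
      = (\<integral>\<^sup>+x. indicator B1 x * (\<lambda>s. ennreal (38\<^sup>2 * (1 / (s + h\<^sup>2)\<^sup>2))) ((norm (x::real^2))\<^sup>2) \<partial>lborel)"
    by (intro nn_integral_cong) (auto simp: dual_weight_def indicator_def power_divide)
  also have "\<dots> = ennreal pi * (\<integral>\<^sup>+s. indicator {0..1} s * ennreal (38\<^sup>2 * (1 / (s + h\<^sup>2)\<^sup>2)) \<partial>lborel)"
    by (rule radial_nn_integral[OF metric_of])
  also have "(\<integral>\<^sup>+s. indicator {0..1} s * ennreal (38\<^sup>2 * (1 / (s + h\<^sup>2)\<^sup>2)) \<partial>lborel)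
      = (\<integral>\<^sup>+s. ennreal (38\<^sup>2) * (indicator {0..1} s * ennreal (1 / (s + h\<^sup>2)\<^sup>2)) \<partial>lborel)"
    by (intro nn_integral_cong, subst ennreal_mult) (simp_all add: mult.left_commute)
  also have "\<dots> = ennreal (38\<^sup>2) * (\<integral>\<^sup>+s. indicator {0..1} s * ennreal (1 / (s + h\<^sup>2)\<^sup>2) \<partial>lborel)"
    by (rule nn_integral_cmult) measurable
  also have "ennreal pi * \<dots> \<le> ennreal pi * (ennreal (38\<^sup>2) * ennreal (1 / h\<^sup>2))"
    by (intro mult_left_mono nn_integral_inverse_square assms) auto
  also have "ennreal pi * (ennreal (38\<^sup>2) * ennreal (1 / h\<^sup>2)) = ennreal (pi * (38\<^sup>2 * (1 / h\<^sup>2)))"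
    by (subst ennreal_mult, simp, simp, subst ennreal_mult) (simp_all del: ennreal_numeral)
  also have "pi * (38\<^sup>2 * (1 / h\<^sup>2)) = 38\<^sup>2 * pi / h\<^sup>2" by simp
  finally have le: "(\<integral>\<^sup>+x. ennreal ((norm (dual_weight h x))\<^sup>2) \<partial>lborel) \<le> ennreal (38\<^sup>2 * pi / h\<^sup>2)" .
  show "L2 (dual_weight h)" "n2 (dual_weight h) \<le> 38\<^sup>2 * pi / h\<^sup>2"
    by (rule L2_if_nn_integral_le[OF m le], simp)+
qed

lemma pairing_induced_metric:
  assumes "h > 0" "\<And>i. L2 (V i)"
  shows "integrable lborel (\<lambda>x. pairing h x (metric_of V x))" "(\<integral>x. pairing h x (metric_of V x) \<partial>lborel) = pairing_integral h V"
proof -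
  have i: "integrable lborel (\<lambda>x. test_hess h i j x * (V p x \<bullet> V q x))" for i j p q
    using L2_inner_integrable[OF L2_test_hess_scale[OF assms(1) assms(2)[of p], of i j] assms(2)[of q]] by simp
  show "integrable lborel (\<lambda>x. pairing h x (metric_of V x))" unfolding pairing_def metric_of_def using i by simp
  show "(\<integral>x. pairing h x (metric_of V x) \<partial>lborel) = pairing_integral h V" unfolding pairing_def metric_of_def pairing_integral_def ip_def using i by simp
qed

text \<open>With \<open>q\<close> the \<open>L\<^sup>2\<close> distance of the metrics, duality gives
  \<open>\<pi> \<Delta>\<^sup>2 (|ln h| - 4) \<le> 38 sqrt \<pi> q / h + bending W / 2\<close>; after multiplication by \<open>2 h\<^sup>2\<close> the mixed term is absorbed by \<open>q\<^sup>2\<close>.\<close>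
lemma energy_lower_bound:
  assumes h: "0 < h" "h < 1" and a: "weak_jet Y V W"
  shows "ennreal (2 * pi * \<Delta>\<^sup>2 * h\<^sup>2 * (\<bar>ln h\<bar> - 4) - 38\<^sup>2 * pi * h\<^sup>2) \<le> field_energy h \<Delta> V W"
proof (cases "(\<integral>\<^sup>+x. indicator B1 x * ennreal ((norm (metric_of V x - ref_metric \<Delta> x))\<^sup>2) \<partial>lborel) = \<infinity>")
  case True
  then show ?thesis by (simp add: field_energy_def)
next
  case False
  have vL: "L2 (V i)" for i using a L2B_L2 by (auto simp: weak_jet_def)
  define Dn where "Dn x = indicator B1 x * norm (metric_of V x - ref_metric \<Delta> x)" for x
  have Vm[measurable]: "V i \<in> borel_measurable borel" for i using vL by (rule L2_measurable)
  have gmm[measurable]: "metric_of V \<in> borel_measurable borel" by (rule metric_of_measurable[OF Vm])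
  have [measurable]: "B1 \<in> sets borel" by simp
  have Dm: "Dn \<in> borel_measurable borel" unfolding Dn_def[abs_def] by measurable
  have nnD: "(\<integral>\<^sup>+x. ennreal ((norm (Dn x))\<^sup>2) \<partial>lborel) = (\<integral>\<^sup>+x. indicator B1 x * ennreal ((norm (metric_of V x - ref_metric \<Delta> x))\<^sup>2) \<partial>lborel)"
    by (intro nn_integral_cong) (auto simp: Dn_def indicator_def)
  obtain c where c: "(\<integral>\<^sup>+x. ennreal ((norm (Dn x))\<^sup>2) \<partial>lborel) = ennreal c" "c \<ge> 0"
    using False unfolding nnD[symmetric] by (cases "\<integral>\<^sup>+x. ennreal ((norm (Dn x))\<^sup>2) \<partial>lborel") auto
  have DL: "L2 Dn" by (rule L2_if_nn_integral_le(1)[OF Dm eq_refl[OF c(1)] c(2)])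
  note KL = dual_weight_L2[OF h(1)]
  let ?r = "\<lambda>x. pairing h x (ref_metric \<Delta> x)" and ?g = "\<lambda>x. pairing h x (metric_of V x)"
  let ?d = "\<lambda>x. pairing h x (ref_metric \<Delta> x - metric_of V x)"
  have [measurable]: "test_hess h i j \<in> borel_measurable borel" for i j
    by (intro borel_measurable_continuous_onI test_hess_continuous h)
  have DKi: "integrable lborel (\<lambda>x. Dn x \<bullet> dual_weight h x)" by (rule L2_inner_integrable[OF DL KL(1)])
  have db: "\<bar>?d x\<bar> \<le> Dn x \<bullet> dual_weight h x" for x
    using pairing_bound[OF h(1), of x "ref_metric \<Delta> x - metric_of V x"]
    by (auto simp: Dn_def dual_weight_def norm_minus_commute mult.commute split: split_indicator)
  have mm1: "(\<lambda>x. (ref_metric \<Delta> x - metric_of V x)) \<in> borel_measurable borel" by measurable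
  have dm: "?d \<in> borel_measurable borel"
    unfolding pairing_def using borel_measurable_matrix_entry[OF mm1] by measurable
  have di: "integrable lborel ?d"
  proof (rule Bochner_Integration.integrable_bound[OF DKi])
    show "AE x in lborel. norm (?d x) \<le> norm (Dn x \<bullet> dual_weight h x)"
      using db by (intro AE_I2) (simp only: real_norm_def, meson abs_ge_self order_trans)
  qed (use dm in simp)
  note gi = pairing_induced_metric[OF h(1) vL]
  have "(\<integral>x. ?r x \<partial>lborel) = (\<integral>x. ?d x + ?g x \<partial>lborel)" by (simp add: pairing_diff)
  also have "\<dots> = (\<integral>x. ?d x \<partial>lborel) + pairing_integral h V" using di gi by simp
  also have "(\<integral>x. ?d x \<partial>lborel) \<le> ip Dn (dual_weight h)"
    unfolding ip_def by (rule integral_mono[OF di DKi]) (use db abs_le_D1 in blast)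
  also have "\<dots> \<le> sqrt (n2 Dn) * sqrt (n2 (dual_weight h))"
    using ip_CS_abs[OF DL KL(1)] by linarith
  also have "\<dots> \<le> sqrt (n2 Dn) * sqrt (38\<^sup>2 * pi / h\<^sup>2)"
    using KL(2) by (intro mult_left_mono real_sqrt_le_mono) auto
  finally have R: "(\<integral>x. ?r x \<partial>lborel) \<le> sqrt (n2 Dn) * sqrt (38\<^sup>2 * pi / h\<^sup>2) + pairing_integral h V" by simp
  define q where "q = sqrt (n2 Dn)"
  have q: "q\<^sup>2 = n2 Dn" by (simp add: q_def)
  have sq: "sqrt (38\<^sup>2 * pi / h\<^sup>2) = 38 * sqrt pi / h"
    using h by (simp add: real_sqrt_divide real_sqrt_mult)
  have "pi * \<Delta>\<^sup>2 * (\<bar>ln h\<bar> - 4) \<le> q * (38 * sqrt pi / h) + bending W / 2"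
    using pairing_ref_metric_integral[OF h, of \<Delta>] R weak_estimate[OF h(1) a] unfolding sq q_def by linarith
  then have "2 * h\<^sup>2 * (pi * \<Delta>\<^sup>2 * (\<bar>ln h\<bar> - 4)) \<le> 2 * h\<^sup>2 * (q * (38 * sqrt pi / h) + bending W / 2)"
    by (intro mult_left_mono) auto
  also have "\<dots> = 2 * q * (38 * sqrt pi * h) + h\<^sup>2 * bending W" using h by (simp add: field_simps power2_eq_square)
  (* Young's inequality. *)
  also have "2 * q * (38 * sqrt pi * h) \<le> q\<^sup>2 + (38 * sqrt pi * h)\<^sup>2"
    using zero_le_power2[of "q - 38 * sqrt pi * h"] by (simp add: power2_diff)
  also have "(38 * sqrt pi * h)\<^sup>2 = 38\<^sup>2 * pi * h\<^sup>2" by (simp add: power_mult_distrib)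
  finally have main: "2 * pi * \<Delta>\<^sup>2 * h\<^sup>2 * (\<bar>ln h\<bar> - 4) - 38\<^sup>2 * pi * h\<^sup>2 \<le> n2 Dn + h\<^sup>2 * bending W"
    unfolding q by (simp add: algebra_simps)
  have "bending W \<ge> 0" unfolding bending_def by (intro sum_nonneg) simp
  then have "field_energy h \<Delta> V W = ennreal (n2 Dn + h\<^sup>2 * bending W)"
    unfolding field_energy_def nnD[symmetric] nn_integral_norm_sq[OF DL] by (subst ennreal_plus) auto
  then show ?thesis using ennreal_leI[OF main] by (simp only:)
qed

section \<open>Energy scaling of the minimisers\<close>

theorem theorem1:
  fixes \<Delta> :: real
  assumes "0 < \<Delta>" and "\<Delta> < 1"
  shows "\<exists>C::real. \<forall>\<^sub>F h in at_right (0::real). \<exists>y.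
    is_arg_min (energy h \<Delta>) (\<lambda>z. z \<in> W22 B1) y \<and>
    ennreal (2 * pi * \<Delta>\<^sup>2 * h\<^sup>2 * (\<bar>ln h\<bar> - 3/2 * ln \<bar>ln h\<bar> - C)) \<le> energy h \<Delta> y \<and>
    energy h \<Delta> y \<le> ennreal (2 * pi * \<Delta>\<^sup>2 * h\<^sup>2 * (\<bar>ln h\<bar> + C))"
proof -
  (* The term 38^2 / (2 Delta^2) is the Young remainder 38^2 pi h^2 in units of 2 pi Delta^2 h^2. *)
  define C where "C = 4 + 38\<^sup>2 / (2 * \<Delta>\<^sup>2)"
  have C2: "2 \<le> C" using assms by (simp add: C_def add_increasing2)
  have "\<exists>y. is_arg_min (energy h \<Delta>) (\<lambda>z. z \<in> W22 B1) y \<and>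
    ennreal (2 * pi * \<Delta>\<^sup>2 * h\<^sup>2 * (\<bar>ln h\<bar> - 3/2 * ln \<bar>ln h\<bar> - C)) \<le> energy h \<Delta> y \<and>
    energy h \<Delta> y \<le> ennreal (2 * pi * \<Delta>\<^sup>2 * h\<^sup>2 * (\<bar>ln h\<bar> + C))" if h: "0 < h" "h < exp (- 1)" for h
  proof -
    have h1: "h < 1" using h(2) by (smt (verit) exp_less_one_iff)
    have "ln h < - 1" using ln_less_cancel_iff[of h "exp (- 1)"] h by simp
    then have ll: "ln \<bar>ln h\<bar> \<ge> 0" by simp
    note ca = cone_weak_jet[OF h(1), of \<Delta>] and ce = cone_energy[OF h(1) less_imp_le[OF h1] assms]
    have fin: "field_energy h \<Delta> (\<lambda>i x. indicator B1 x *\<^sub>R cone_deriv h \<Delta> i x) (\<lambda>i j x. indicator B1 x *\<^sub>R cone_deriv2 h \<Delta> i j x) < \<infinity>"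
      using ce by (simp add: order_le_less_trans)
    obtain Y V W where YVW: "weak_jet Y V W" and min: "\<forall>Y' V' W'. weak_jet Y' V' W' \<longrightarrow> field_energy h \<Delta> V W \<le> field_energy h \<Delta> V' W'"
      using minimizer_exists[OF h(1) ca fin] by blast
    note Y = weak_jet_imp_W22[OF YVW]
    have "energy h \<Delta> Y \<le> energy h \<Delta> z" if z: "z \<in> W22 B1" for z
    proof -
      obtain Y' V' W' where "weak_jet Y' V' W'" "energy h \<Delta> z = field_energy h \<Delta> V' W'" using W22_imp_weak_jet[OF z] by metis
      then show ?thesis using min Y(2)[of h \<Delta>] by simp
    qed
    then have "is_arg_min (energy h \<Delta>) (\<lambda>z. z \<in> W22 B1) Y"
      using Y(1) by (simp add: is_arg_min_linorder)
    moreover have "ennreal (2 * pi * \<Delta>\<^sup>2 * h\<^sup>2 * (\<bar>ln h\<bar> - 3/2 * ln \<bar>ln h\<bar> - C)) \<le> energy h \<Delta> Y"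
    proof -
      have "2 * pi * \<Delta>\<^sup>2 * h\<^sup>2 * (\<bar>ln h\<bar> - 3/2 * ln \<bar>ln h\<bar> - C) \<le> 2 * pi * \<Delta>\<^sup>2 * h\<^sup>2 * (\<bar>ln h\<bar> - C)"
        using ll by (intro mult_left_mono) auto
      also have "\<dots> = 2 * pi * \<Delta>\<^sup>2 * h\<^sup>2 * (\<bar>ln h\<bar> - 4) - 38\<^sup>2 * pi * h\<^sup>2"
        using assms by (simp add: C_def field_simps)
      finally have "ennreal (2 * pi * \<Delta>\<^sup>2 * h\<^sup>2 * (\<bar>ln h\<bar> - 3/2 * ln \<bar>ln h\<bar> - C))
        \<le> ennreal (2 * pi * \<Delta>\<^sup>2 * h\<^sup>2 * (\<bar>ln h\<bar> - 4) - 38\<^sup>2 * pi * h\<^sup>2)" by (rule ennreal_leI)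
      also have "\<dots> \<le> energy h \<Delta> Y" unfolding Y(2) by (rule energy_lower_bound[OF h(1) h1 YVW])
      finally show ?thesis .
    qed
    moreover have "energy h \<Delta> Y \<le> ennreal (2 * pi * \<Delta>\<^sup>2 * h\<^sup>2 * (\<bar>ln h\<bar> + C))"
    proof -
      have "field_energy h \<Delta> V W \<le> ennreal (2 * pi * \<Delta>\<^sup>2 * h\<^sup>2 * (\<bar>ln h\<bar> + 2))"
        using min ca ce order_trans by blast
      also have "\<dots> \<le> ennreal (2 * pi * \<Delta>\<^sup>2 * h\<^sup>2 * (\<bar>ln h\<bar> + C))"
        using C2 by (intro ennreal_leI mult_left_mono) auto
      finally show ?thesis unfolding Y(2) .
    qed
    ultimately show ?thesis by blast
  qed
  then show ?thesis
    by (intro exI[of _ C] eventually_at_rightI[of 0 "exp (- 1)"]) auto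
qed

end
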